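(* Let $\mu>0$ satisfy $2+2\mu(\mu+\sqrt{1+\mu^2})>2m+1$ and let $\alpha_0,\beta,\gamma$ satisfy $\frac1{1+\mu(\mu+\sqrt{1+\mu^2})}\le\alpha_0\le\frac2{2m+1}$, $\beta>0$, $\frac{\alpha_0+\beta}2<\gamma<\frac1{2m+1}$. Let $\lambda>0$, $\underline Z\in\mathcal L$, $u_0\in\mathcal C^{-\alpha_0}$ and let $v$ be the global mild solution of $\partial_tv=[(\mathrm i+\mu)\Delta-1]v+\Psi(v,\underline Z)$, $v(0)=u_0$. Then for every $u_1\in\mathcal C^{-\alpha_0}$ there exists a unique $\tilde v\in C((0,\infty);\mathcal C^\beta)$, with $\sup_{0<t\le T}t^\gamma\|\tilde v_t\|_{\mathcal C^\beta}<\infty$ for all $T>0$, which is a mild solution of $$\partial_t\tilde v=[(\mathrm i+\mu)\Delta-1]\tilde v+\lambda(v-\tilde v)+\Psi(\tilde v,\underline Z),\qquad\tilde v(0)=u_1,$$ i.e. $\tilde v_t=P_tu_1+\int_0^tP_{t-s}\big(\lambda(v_s-\tilde v_s)+\Psi(\tilde v_s,\underline Z_s)\big)ds$ for all $t>0$.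
   Context: $\mathbb T^2=\mathbb R^2/\mathbb Z^2$; $\nu,\tau\in\mathbb C$ with $\mathrm{Re}\,\nu>0$, $m\ge1$ integer. $\mathcal C^\alpha=\mathcal B^\alpha_{\infty,\infty}$ is the complex-valued Besov–Hölder space on $\mathbb T^2$. $A=(\mathrm i+\mu)\Delta-1$, $P_t=e^{tA}$. Let $L=\{(i,j)\in\mathbb N^2:0\le i\le m+1,\ 0\le j\le m,\ i\ge j,\ i+j>1\}$. For $\alpha,\alpha'\in(0,1)$, $T>0$ and $\underline Z=(Z_t,Z^{(i,j)}_t)_{(i,j)\in L}$ with $Z\in C([0,T];\mathcal C^{-\alpha})$, $Z^{(i,j)}\in C((0,T];\mathcal C^{-\alpha})$, set $\|\underline Z\|_{\alpha,\alpha',T}=\sup_{0\le t\le T}\big(\|Z_t\|_{\mathcal C^{-\alpha}}\vee\sup_{(i,j)\in L}t^{(i+j-1)\alpha'}\|Z^{(i,j)}_t\|_{\mathcal C^{-\alpha}}\big)$. $\mathcal L$ is the set of such families on $(0,\infty)$ with all these norms finite. Notation: $Z^{:1,0:}_t=Z_t$, $Z^{:0,1:}_t=\overline{Z_t}$, $Z^{:0,0:}_t=1$, $Z^{:i,j:}_t=Z^{(i,j)}_t$ and $Z^{:j,i:}_t=\overline{Z^{(i,j)}_t}$ for $(i,j)\in L$. $\Psi(v_t,\underline Z_t)=-\nu\sum_{i=0}^{m+1}\sum_{j=0}^m\binom{m+1}i\binom mj v_t^i\overline{v_t}^{\,j}Z^{:m+1-i,m-j:}_t+(\tau+1)(v_t+Z_t)$.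 A (global) mild solution of $\partial_tv=[(\mathrm i+\mu)\Delta-1]v+\Psi(v,\underline Z)$, $v(0)=u_0$, is $v\in C((0,\infty);\mathcal C^\beta)$ with $\sup_{0<t\le T}t^\gamma\|v_t\|_{\mathcal C^\beta}<\infty$ for all $T$ and $v_t=P_tu_0+\int_0^tP_{t-s}\Psi(v_s,\underline Z_s)ds$; it exists uniquely under the stated conditions. *)

theory Defs
  imports "HOL-Analysis.Analysis"
begin

text \<open>Distributions on the torus T^2 are represented by their Fourier coefficients,
  i.e. functions from Z^2 to C (with respect to e_k(x) = exp(2 pi i k.x)).\<close>

type_synonym dist = "int \<times> int \<Rightarrow> complex"

definition freq :: "int \<times> int \<Rightarrow> real \<times> real" where
  "freq k = (real_of_int (fst k), real_of_int (snd k))"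

definition ekx :: "int \<times> int \<Rightarrow> real \<times> real \<Rightarrow> complex" where
  "ekx k x = exp (2 * pi * \<i> * complex_of_real (real_of_int (fst k) * fst x + real_of_int (snd k) * snd x))"

coinductive smooth2 :: "(real \<times> real \<Rightarrow> real) \<Rightarrow> bool" where
  "(\<forall>x. f differentiable (at x)) \<Longrightarrow>
   smooth2 (\<lambda>x. frechet_derivative f (at x) (1, 0)) \<Longrightarrow>
   smooth2 (\<lambda>x. frechet_derivative f (at x) (0, 1)) \<Longrightarrow> smooth2 f"

definition dyadic_partition :: "(real \<times> real \<Rightarrow> real) \<Rightarrow> (real \<times> real \<Rightarrow> real) \<Rightarrow> bool" where
  "dyadic_partition chi rho \<longleftrightarrow> smooth2 chi \<and> smooth2 rho \<and>
     (\<forall>\<xi>. 0 \<le> chi \<xi> \<and> 0 \<le> rho \<xi>) \<and>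
     (\<exists>R>0. \<forall>\<xi>. norm \<xi> > R \<longrightarrow> chi \<xi> = 0) \<and>
     (\<exists>r R. 0 < r \<and> r < R \<and> (\<forall>\<xi>. (norm \<xi> < r \<or> norm \<xi> > R) \<longrightarrow> rho \<xi> = 0)) \<and>
     (\<forall>\<xi>. chi \<xi> + (\<Sum>j. rho ((1/2) ^ j *\<^sub>R \<xi>)) = 1)"

text \<open>Weight of the n-th Littlewood-Paley block; block n corresponds to j = n - 1 (n = 0 is j = -1).\<close>
definition lp_weight :: "(real \<times> real \<Rightarrow> real) \<Rightarrow> (real \<times> real \<Rightarrow> real) \<Rightarrow> nat \<Rightarrow> int \<times> int \<Rightarrow> real" where
  "lp_weight chi rho n k = (if n = 0 then chi (freq k) else rho ((1/2) ^ (n - 1) *\<^sub>R freq k))"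

definition LP_block :: "(real \<times> real \<Rightarrow> real) \<Rightarrow> (real \<times> real \<Rightarrow> real) \<Rightarrow> nat \<Rightarrow> dist \<Rightarrow> real \<times> real \<Rightarrow> complex" where
  "LP_block chi rho n f x = (\<Sum>k\<in>{k. lp_weight chi rho n k \<noteq> 0}. complex_of_real (lp_weight chi rho n k) * f k * ekx k x)"

definition in_besov :: "(real \<times> real \<Rightarrow> real) \<Rightarrow> (real \<times> real \<Rightarrow> real) \<Rightarrow> real \<Rightarrow> dist \<Rightarrow> bool" where
  "in_besov chi rho a f \<longleftrightarrow> (\<exists>C. \<forall>n x. 2 powr (a * (real n - 1)) * cmod (LP_block chi rho n f x) \<le> C)"

definition besov_norm :: "(real \<times> real \<Rightarrow> real) \<Rightarrow> (real \<times> real \<Rightarrow> real) \<Rightarrow> real \<Rightarrow> dist \<Rightarrow> real" where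
  "besov_norm chi rho a f = Sup {2 powr (a * (real n - 1)) * cmod (LP_block chi rho n f x) | n x. True}"

definition besov_cont_on :: "(real \<times> real \<Rightarrow> real) \<Rightarrow> (real \<times> real \<Rightarrow> real) \<Rightarrow> real \<Rightarrow> real set \<Rightarrow> (real \<Rightarrow> dist) \<Rightarrow> bool" where
  "besov_cont_on chi rho a S w \<longleftrightarrow>
     (\<forall>t\<in>S. ((\<lambda>s. besov_norm chi rho a (\<lambda>k. w s k - w t k)) \<longlongrightarrow> 0) (at t within S))"

text \<open>Product of distributions: limit of the products of the smooth low-frequency truncations
  S_N f = sum_{n<N} Delta_n f (Bony product, well-defined when the regularities sum to a positive number).\<close>
definition low_pass :: "(real \<times> real \<Rightarrow> real) \<Rightarrow> (real \<times> real \<Rightarrow> real) \<Rightarrow> nat \<Rightarrow> dist \<Rightarrow> dist" where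
  "low_pass chi rho N f k = complex_of_real (\<Sum>n<N. lp_weight chi rho n k) * f k"

definition conv_fin :: "dist \<Rightarrow> dist \<Rightarrow> dist" where
  "conv_fin f g k = (\<Sum>l\<in>{l. f (k - l) \<noteq> 0 \<and> g l \<noteq> 0}. f (k - l) * g l)"

definition dprod :: "(real \<times> real \<Rightarrow> real) \<Rightarrow> (real \<times> real \<Rightarrow> real) \<Rightarrow> dist \<Rightarrow> dist \<Rightarrow> dist" where
  "dprod chi rho f g k = lim (\<lambda>N. conv_fin (low_pass chi rho N f) (low_pass chi rho N g) k)"

definition dconj :: "dist \<Rightarrow> dist" where
  "dconj f k = cnj (f (- k))"

definition dunit :: dist where
  "dunit k = (if k = (0, 0) then 1 else 0)"

definition dpow :: "(real \<times> real \<Rightarrow> real) \<Rightarrow> (real \<times> real \<Rightarrow> real) \<Rightarrow> dist \<Rightarrow> nat \<Rightarrow> dist" where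
  "dpow chi rho f n = (dprod chi rho f ^^ n) dunit"

definition Lset :: "nat \<Rightarrow> (nat \<times> nat) set" where
  "Lset m = {(i, j). i \<le> m + 1 \<and> j \<le> m \<and> j \<le> i \<and> 1 < i + j}"

definition Zc :: "(real \<Rightarrow> dist) \<Rightarrow> (nat \<Rightarrow> nat \<Rightarrow> real \<Rightarrow> dist) \<Rightarrow> nat \<Rightarrow> nat \<Rightarrow> real \<Rightarrow> dist" where
  "Zc Z Zij a b t =
     (if (a, b) = (0, 0) then dunit
      else if (a, b) = (1, 0) then Z t
      else if (a, b) = (0, 1) then dconj (Z t)
      else if b \<le> a then Zij a b t
      else dconj (Zij b a t))"

definition Psi :: "(real \<times> real \<Rightarrow> real) \<Rightarrow> (real \<times> real \<Rightarrow> real) \<Rightarrow> nat \<Rightarrow> complex \<Rightarrow> complex \<Rightarrow>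
    (real \<Rightarrow> dist) \<Rightarrow> (nat \<Rightarrow> nat \<Rightarrow> real \<Rightarrow> dist) \<Rightarrow> real \<Rightarrow> dist \<Rightarrow> dist" where
  "Psi chi rho m \<nu> \<tau> Z Zij t w = (\<lambda>k.
     - \<nu> * (\<Sum>i\<le>m + 1. \<Sum>j\<le>m. of_nat ((m + 1) choose i) * of_nat (m choose j) *
          dprod chi rho (dprod chi rho (dpow chi rho w i) (dpow chi rho (dconj w) j))
                 (Zc Z Zij (m + 1 - i) (m - j) t) k)
     + (\<tau> + 1) * (w k + Z t k))"

text \<open>Fourier symbol of A = (i + mu) Laplacian - 1, and P_t = e^{tA}.\<close>
definition symA :: "real \<Rightarrow> int \<times> int \<Rightarrow> complex" where
  "symA \<mu> k = - (\<i> + complex_of_real \<mu>) * complex_of_real (4 * pi ^ 2 * (real_of_int (fst k) ^ 2 + real_of_int (snd k) ^ 2)) - 1"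

definition Pt :: "real \<Rightarrow> real \<Rightarrow> dist \<Rightarrow> dist" where
  "Pt \<mu> t f k = exp (complex_of_real t * symA \<mu> k) * f k"

definition mild_eq :: "real \<Rightarrow> dist \<Rightarrow> (real \<Rightarrow> dist \<Rightarrow> dist) \<Rightarrow> (real \<Rightarrow> dist) \<Rightarrow> bool" where
  "mild_eq \<mu> u F w \<longleftrightarrow> (\<forall>t>0. \<forall>k.
     set_integrable lborel {0..t} (\<lambda>s. Pt \<mu> (t - s) (F s (w s)) k) \<and>
     w t k = Pt \<mu> t u k + (LINT s:{0..t}|lborel. Pt \<mu> (t - s) (F s (w s)) k))"

definition sol_class :: "(real \<times> real \<Rightarrow> real) \<Rightarrow> (real \<times> real \<Rightarrow> real) \<Rightarrow> real \<Rightarrow> real \<Rightarrow> (real \<Rightarrow> dist) \<Rightarrow> bool" where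
  "sol_class chi rho \<beta> \<gamma> w \<longleftrightarrow>
     (\<forall>t>0. in_besov chi rho \<beta> (w t)) \<and> besov_cont_on chi rho \<beta> {0<..} w \<and>
     (\<forall>T>0. \<exists>C. \<forall>t\<in>{0<..T}. t powr \<gamma> * besov_norm chi rho \<beta> (w t) \<le> C)"

definition in_L :: "(real \<times> real \<Rightarrow> real) \<Rightarrow> (real \<times> real \<Rightarrow> real) \<Rightarrow> nat \<Rightarrow> (real \<Rightarrow> dist) \<Rightarrow> (nat \<Rightarrow> nat \<Rightarrow> real \<Rightarrow> dist) \<Rightarrow> bool" where
  "in_L chi rho m Z Zij \<longleftrightarrow> (\<forall>\<alpha>\<in>{0<..<1}.
     (\<forall>t\<ge>0. in_besov chi rho (- \<alpha>) (Z t)) \<and> besov_cont_on chi rho (- \<alpha>) {0..} Z \<and>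
     (\<forall>(i, j)\<in>Lset m. (\<forall>t>0. in_besov chi rho (- \<alpha>) (Zij i j t)) \<and>
         besov_cont_on chi rho (- \<alpha>) {0<..} (Zij i j)) \<and>
     (\<forall>\<alpha>'\<in>{0<..<1}. \<forall>T>0. \<exists>C.
        (\<forall>t\<in>{0..T}. besov_norm chi rho (- \<alpha>) (Z t) \<le> C) \<and>
        (\<forall>(i, j)\<in>Lset m. \<forall>t\<in>{0<..T}.
            t powr ((real (i + j) - 1) * \<alpha>') * besov_norm chi rho (- \<alpha>) (Zij i j t) \<le> C)))"

end

(*
Distributions are handled through their Fourier coefficients. Local existence and uniqueness in the
weighted space come from a contraction with weight exp (Lambda t), so it remains to bound a solution
in C^{-a1}, where a1 is slightly larger than alpha0, on every interval [t0, T] with t0 > 0.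

For p = 2 / a1 the condition on mu gives (p - 2)^2 < 4 mu^2 (p - 1). Testing the frequency-truncated
equation with |w|^(p-2) conj w therefore produces the good terms - c D - Re nu * E, where D is the
mean of |w|^(p-2) |grad w|^2 and E the mean of |w|^(p+2m). All other terms pair
|w|^(p-2) conj w * w^i (conj w)^j, i + j <= 2 m, with distributions of regularity just below 0.
The n-th Littlewood-Paley block of such a pairing is bounded by 2^(-n/(8m)) (1 + D + E): cut w off
smoothly at height 2^(n/(4m)), integrate the truncated part by parts, and bound the rest by E. Hence
these terms are absorbed, the L^p norm stays bounded uniformly in the truncation, and L^p embeds into
C^{-2/p} = C^{-a1}.
*)
theory Submission
  imports Defs
begin

text \<open>Truncation does not commute with the products. The truncated nonlinearity and the
  nonlinearity of the truncated data differ by an error that tends to 0 in regularity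
  \<open>- 2 * \<alpha>\<close>, uniformly in time on [t0, b]. Its rate depends on the solution, but
  once it is at most 1 it is merely one more rough forcing, paired like all others. Hence the bound
  depends only on t0, T and the size of the solution at t0, and this is what continuation requires.
  The reason for \<alpha>1 > \<alpha>0: the hypothesis admits equality for \<alpha>0, where the
  quadratic form behind the dissipation is only nonnegative. A strictly larger exponent lowers p and
  makes the form coercive; the strict inequality (\<alpha>0 + \<beta>) / 2 < \<gamma> leaves room
  for it. The noise has regularity \<open>- \<alpha>\<close> for every small \<alpha>, so \<alpha>
  can be adapted to m, \<beta> and \<gamma>. In the relaxation term, v is a given input in C^\<beta>
  with singularity t powr (- \<gamma>); it is of lower order both in the fixed point and in the
  energy.\<close>

declare split_paired_All [simp del] split_paired_Ex [simp del]

section \<open>Symbols on the lattice\<close>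

definition fdiff :: "int \<times> int => dist => dist" where
 "fdiff d a k = a (k + d) - a k"

text \<open>Mikhlin-type condition at scale \<open>N\<close>: every iterated difference of \<open>a\<close> along a sublist of
 \<open>ds\<close> of length \<open>l\<close> is at most \<open>B / N ^ l\<close>.\<close>

primrec symbol_bd :: "real => (int \<times> int) list => real => dist => bool" where
 "symbol_bd N [] B a \<longleftrightarrow> (\<forall>k. cmod (a k) \<le> B)"
| "symbol_bd N (d # ds) B a \<longleftrightarrow> symbol_bd N ds B a \<and> symbol_bd N ds (B / N) (fdiff d a)"

lemma symbol_bd_cmod: "symbol_bd N ds B a ==> cmod (a k) \<le> B"
 by (induction ds arbitrary: a B) auto

lemma symbol_bd_nonneg: "symbol_bd N ds B a ==> 0 \<le> B"
 using symbol_bd_cmod[of N ds B a 0] by (meson norm_ge_zero order_trans)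

lemma symbol_bd_mono: "symbol_bd N ds B a ==> B \<le> B' ==> 0 < N ==> symbol_bd N ds B' a"
proof (induction ds arbitrary: a B B')
 case Nil
 then show ?case by (auto intro: order_trans)
next
 case (Cons d ds)
 have "B / N \<le> B' / N" using Cons.prems by (simp add: divide_right_mono)
 then show ?case using Cons by auto
qed

lemma symbol_bd_shift: "symbol_bd N ds B a ==> symbol_bd N ds B (%k. a (k + d))"
proof (induction ds arbitrary: a B)
 case (Cons e ds)
 have "fdiff e (%k. a (k + d)) = (%k. fdiff e a (k + d))"
  by (auto simp: fdiff_def ac_simps)
 then show ?case using Cons by auto
qed auto

text \<open>The unimodular factor \<open>c\<close> closes the induction: a difference of the
  reflected symbol is minus the reflection of a shifted difference, and the sign is moved into
  \<open>c\<close>.\<close>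

lemma symbol_bd_reflect: "symbol_bd N ds B a ==> symbol_bd N ds B (%k. c * a (- k))" if "cmod c = 1"
 using that
proof (induction ds arbitrary: a B c)
 case (Cons e ds)
 have eq: "fdiff e (%k. c * a (- k)) = (%k. (- c) * (%j. fdiff e a (j + (- e))) (- k))"
  by (auto simp: fdiff_def algebra_simps)
 have "symbol_bd N ds (B / N) (%j. fdiff e a (j + (- e)))"
  using Cons.prems by (intro symbol_bd_shift) auto
 then have "symbol_bd N ds (B / N) (fdiff e (%k. c * a (- k)))"
  unfolding eq by (intro Cons.IH) (use Cons.prems in auto)
 then show ?case using Cons by auto
qed (auto simp: norm_mult)

lemma symbol_bd_add:
 "symbol_bd N ds A a ==> symbol_bd N ds B b ==> symbol_bd N ds (A + B) (%k. a k + b k)"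
proof (induction ds arbitrary: a b A B)
 case Nil
 then show ?case by (auto intro: norm_triangle_mono)
next
 case (Cons d ds)
 have "fdiff d (%k. a k + b k) = (%k. fdiff d a k + fdiff d b k)"
  by (auto simp: fdiff_def)
 then show ?case using Cons by (auto simp: add_divide_distrib)
qed

lemma symbol_bd_cmult: "symbol_bd N ds B a ==> symbol_bd N ds (cmod c * B) (%k. c * a k)"
proof (induction ds arbitrary: a B)
 case Nil
 then show ?case by (auto simp: norm_mult mult_left_mono)
next
 case (Cons d ds)
 have "fdiff d (%k. c * a k) = (%k. c * fdiff d a k)"
  by (auto simp: fdiff_def algebra_simps)
 then show ?case using Cons.IH[of "B / N" "fdiff d a"] Cons by auto
qed

lemma symbol_bd_zero: "0 < N ==> 0 \<le> B ==> symbol_bd N ds B (%k. 0)"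
 by (induction ds arbitrary: B) (simp_all add: fdiff_def[abs_def])

lemma symbol_bd_const: "0 < N ==> symbol_bd N ds (cmod c) (%k. c)"
 by (induction ds) (simp_all add: fdiff_def[abs_def] symbol_bd_zero)

lemma symbol_bd_sum:
 assumes "finite I" "!!i. i \<in> I ==> symbol_bd N ds (B i) (a i)" "0 < N"
 shows "symbol_bd N ds (\<Sum>i\<in>I. B i) (%k. \<Sum>i\<in>I. a i k)"
 using assms(1,2)
 by (induction I rule: finite_induct) (auto intro: symbol_bd_zero symbol_bd_add assms(3))

text \<open>Discrete Leibniz rule with one factor shifted: every difference produces two products,
  hence the power of 2.\<close>

lemma symbol_bd_mult:
 assumes "0 < N"
 shows "symbol_bd N ds A a ==> symbol_bd N ds B b ==>
  symbol_bd N ds (2 ^ length ds * A * B) (%k. a k * b k)"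
proof (induction ds arbitrary: a b A B)
 case Nil
 then show ?case by (auto simp: norm_mult intro!: mult_mono intro: order_trans[OF norm_ge_zero])
next
 case (Cons d ds)
 have nn: "0 \<le> A" "0 \<le> B" using Cons.prems symbol_bd_nonneg by blast+
 have eq: "fdiff d (%k. a k * b k) = (%k. fdiff d a k * b (k + d) + a k * fdiff d b k)"
  by (auto simp: fdiff_def algebra_simps)
 have "symbol_bd N ds (2 ^ length ds * (A / N) * B + 2 ^ length ds * A * (B / N))
   (fdiff d (%k. a k * b k))"
  unfolding eq by (intro symbol_bd_add Cons.IH symbol_bd_shift) (use Cons.prems in auto)
 also have "2 ^ length ds * (A / N) * B + 2 ^ length ds * A * (B / N) = 2 ^ length (d # ds) * A * B / N"
  by (simp add: field_simps)
 finally have 1: "symbol_bd N ds (2 ^ length (d # ds) * A * B / N) (fdiff d (%k. a k * b k))" .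
 have "symbol_bd N ds (2 ^ length ds * A * B) (%k. a k * b k)"
  using Cons by auto
 then have "symbol_bd N ds (2 ^ length (d # ds) * A * B) (%k. a k * b k)"
  using nn assms by (elim symbol_bd_mono) (auto intro!: mult_right_mono)
 with 1 show ?case by auto
qed

text \<open>Each difference is worth one inverse power of the scale, so moving to a comparable or
  smaller scale costs one factor \<open>K\<close> per difference.\<close>

lemma symbol_bd_rescale:
 "symbol_bd N ds B a ==> 0 < M ==> M \<le> K * N ==> 1 \<le> K ==> 0 < N ==> symbol_bd M ds (K ^ length ds * B) a"
proof (induction ds arbitrary: a B)
 case (Cons d ds)
 have B: "0 \<le> B" using Cons.prems symbol_bd_nonneg by blast
 have 1: "symbol_bd M ds (K ^ length (d # ds) * B) a"
  by (rule symbol_bd_mono[of _ _ "K ^ length ds * B"])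
   (use Cons B in \<open>auto intro!: mult_right_mono simp: mult_le_cancel_right1\<close>)
 have "K ^ length ds * (B / N) \<le> K ^ length (d # ds) * B / M"
 proof -
  have "1 / N \<le> K / M" using Cons.prems by (simp add: field_simps)
  then have "K ^ length ds * B * (1 / N) \<le> K ^ length ds * B * (K / M)"
   using B Cons.prems by (intro mult_left_mono) auto
  then show ?thesis by (simp add: ac_simps)
 qed
 then have "symbol_bd M ds (K ^ length (d # ds) * B / M) (fdiff d a)"
  by (intro symbol_bd_mono[OF Cons.IH[of "B / N" "fdiff d a"]]) (use Cons.prems in auto)
 with 1 show ?case by auto
qed auto

text \<open>Differences of exponentials and of sampled smooth functions are expressed below as
  averages along a segment.\<close>

lemma symbol_bd_average:
 assumes "0 < N"
 shows "(!!\<sigma>. \<sigma> \<in> {0..1} ==> symbol_bd N ds B (a \<sigma>)) ==>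
  (!!k. continuous_on {0..1} (%\<sigma>::real. a \<sigma> k)) ==>
  symbol_bd N ds B (%k. integral {0..1} (%\<sigma>. a \<sigma> k))"
proof (induction ds arbitrary: a B)
 case Nil
 then have "cmod (integral {0..1} (%\<sigma>. a \<sigma> k)) \<le> B * (1 - 0)" for k
  by (intro integral_bound) auto
 then show ?case by auto
next
 case (Cons d ds)
 have int: "(%\<sigma>. a \<sigma> k) integrable_on {0..1}" for k
  using Cons.prems(2) by (rule integrable_continuous_real)
 have eq: "fdiff d (%k. integral {0..1} (%\<sigma>. a \<sigma> k)) = (%k. integral {0..1} (%\<sigma>. fdiff d (a \<sigma>) k))"
  by (auto simp: fdiff_def integral_diff int)
 have "symbol_bd N ds (B / N) (fdiff d (%k. integral {0..1} (%\<sigma>. a \<sigma> k)))"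
  unfolding eq
 proof (rule Cons.IH)
  show "continuous_on {0..1} (%\<sigma>. fdiff d (a \<sigma>) k)" for k
   unfolding fdiff_def by (intro continuous_intros Cons.prems)
 qed (use Cons.prems in auto)
 then show ?case using Cons by auto
qed

text \<open>The fundamental theorem along the segment from z k to z (k + d) writes a difference as
  \<open>- \<tau> * fdiff d z\<close> times the exponential of an interpolated symbol. Interpolation
  preserves both the lower bound on the real part and the symbol bound, so the induction hypothesis
  applies to it. The bound \<open>L\<close> on the length keeps the base of the power fixed during
  the induction.\<close>

lemma symbol_bd_exp:
 assumes "0 < N" "0 \<le> \<tau>" "0 \<le> B"
 shows "(!!k. c \<le> Re (z k)) ==> symbol_bd N ds B z ==> length ds \<le> L ==>
  symbol_bd N ds ((1 + 2 ^ L * \<tau> * B) ^ length ds * exp (- \<tau> * c)) (%k. exp (- of_real \<tau> * z k))"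
proof (induction ds arbitrary: z)
 case Nil
 then show ?case using assms by (auto intro!: mult_left_mono)
next
 case (Cons d ds)
 let ?E = "%z k. exp (- of_real \<tau> * z k)"
 let ?X = "1 + 2 ^ L * \<tau> * B"
 have X: "1 \<le> ?X" using assms by simp
 define w where "w \<sigma> k = (1 - complex_of_real \<sigma>) * z k + of_real \<sigma> * z (k + d)" for \<sigma> k
 have ftc: "fdiff d (?E z) k = integral {0..1} (%\<sigma>. (- of_real \<tau> * fdiff d z k) * ?E (w \<sigma>) k)" for k
 proof -
  have "((%\<sigma>. (- of_real \<tau> * fdiff d z k) * ?E (w \<sigma>) k) has_integral ?E (w 1) k - ?E (w 0) k) {0..1}"
   by (rule fundamental_theorem_of_calculus)
    (auto simp: w_def fdiff_def algebra_simps intro!: derivative_eq_intros has_vector_derivative_real_field)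
  then show ?thesis
   by (auto simp: w_def fdiff_def dest!: integral_unique)
 qed
 have wRe: "c \<le> Re (w \<sigma> k)" if "\<sigma> \<in> {0..1}" for \<sigma> k
 proof -
  have "(1 - \<sigma>) * c + \<sigma> * c \<le> (1 - \<sigma>) * Re (z k) + \<sigma> * Re (z (k + d))"
   using that Cons.prems(1) by (intro add_mono mult_left_mono) auto
  then show ?thesis by (simp add: w_def algebra_simps)
 qed
 have wB: "symbol_bd N ds B (w \<sigma>)" if "\<sigma> \<in> {0..1}" for \<sigma>
 proof -
  have "symbol_bd N ds (cmod (1 - of_real \<sigma>) * B + cmod (of_real \<sigma>) * B) (w \<sigma>)"
   unfolding w_def using Cons.prems by (intro symbol_bd_add symbol_bd_cmult symbol_bd_shift) auto
  moreover have "cmod (1 - complex_of_real \<sigma>) = 1 - \<sigma>"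
   using that by (metis abs_of_nonneg atLeastAtMost_iff diff_ge_0_iff_ge norm_of_real of_real_1 of_real_diff)
  ultimately show ?thesis using that by (simp add: algebra_simps)
 qed
 have "symbol_bd N ds (2 ^ length ds * (\<tau> * (B / N)) * (?X ^ length ds * exp (- \<tau> * c)))
   (%k. (- of_real \<tau> * fdiff d z k) * ?E (w \<sigma>) k)" if "\<sigma> \<in> {0..1}" for \<sigma>
 proof (rule symbol_bd_mult[OF assms(1)])
  have "symbol_bd N ds (cmod (- of_real \<tau>) * (B / N)) (%k. - of_real \<tau> * fdiff d z k)"
   using Cons.prems by (intro symbol_bd_cmult) auto
  then show "symbol_bd N ds (\<tau> * (B / N)) (%k. - of_real \<tau> * fdiff d z k)"
   using assms by simp
 qed (use that wRe wB Cons.IH[of "w \<sigma>"] Cons.prems in auto)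
 then have *: "symbol_bd N ds (2 ^ length ds * (\<tau> * (B / N)) * (?X ^ length ds * exp (- \<tau> * c))) (fdiff d (?E z))"
  unfolding ftc[abs_def]
  by (intro symbol_bd_average assms) (auto simp: w_def intro!: continuous_intros)
 have "(2::real) ^ length ds \<le> 2 ^ L" using Cons.prems by (intro power_increasing) auto
 then have "2 ^ length ds * (\<tau> * B) \<le> 2 ^ L * (\<tau> * B)"
  using assms by (intro mult_right_mono) auto
 also have "\<dots> \<le> ?X" by simp
 finally have "(2 ^ length ds * (\<tau> * B)) * (?X ^ length ds * exp (- \<tau> * c) / N) \<le> ?X * (?X ^ length ds * exp (- \<tau> * c) / N)"
  using X assms(1) by (intro mult_right_mono) auto
 then have 1: "symbol_bd N ds (?X ^ length (d # ds) * exp (- \<tau> * c) / N) (fdiff d (?E z))"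
  by (intro symbol_bd_mono[OF *]) (use assms in \<open>auto simp: ac_simps\<close>)
 have "?X ^ length ds \<le> ?X ^ length (d # ds)" using X by (intro power_increasing) auto
 then have "symbol_bd N ds (?X ^ length (d # ds) * exp (- \<tau> * c)) (?E z)"
  using Cons by (intro symbol_bd_mono[OF Cons.IH[of z]]) (auto simp: assms intro!: mult_right_mono)
 with 1 show ?case by auto
qed

text \<open>The increment comes from the resolvent identity: a difference of 1 / z is minus the
  difference of z times 1 / z times a shifted 1 / z, and the two products cost 2 ^ l each.\<close>

primrec inverse_bd :: "real => real => nat => real" where
 "inverse_bd c B 0 = 1 / c"
| "inverse_bd c B (Suc l) = inverse_bd c B l + 4 ^ l * B * (inverse_bd c B l)\<^sup>2"

lemma symbol_bd_inverse:
 assumes "0 < N" "0 < c"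
 shows "(!!k. c \<le> cmod (z k)) ==> symbol_bd N ds B z ==>
  symbol_bd N ds (inverse_bd c B (length ds)) (%k. 1 / z k)"
proof (induction ds)
 case Nil
 show ?case
  using Nil(1) assms(2) by (auto simp: norm_divide intro!: divide_left_mono) (metis assms(2) less_le_trans mult_pos_pos)
next
 case (Cons d ds)
 let ?K = "inverse_bd c B (length ds)"
 have IH: "symbol_bd N ds ?K (%k. 1 / z k)" using Cons by auto
 have B: "0 \<le> B" using Cons.prems symbol_bd_nonneg by blast
 have pow4: "(4::real) ^ l = 2 ^ l * 2 ^ l" for l by (simp flip: power_mult_distrib)
 have nz: "z k \<noteq> 0" for k using Cons.prems(1)[of k] assms by auto
 have eq: "fdiff d (%k. 1 / z k) = (%k. (- 1) * (fdiff d z k * (1 / z k * (1 / z (k + d)))))"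
  by (rule ext) (simp add: fdiff_def field_simps nz)
 have "symbol_bd N ds (cmod (- 1) * (2 ^ length ds * (B / N) * (2 ^ length ds * ?K * ?K))) (fdiff d (%k. 1 / z k))"
  unfolding eq
  by (intro symbol_bd_cmult symbol_bd_mult symbol_bd_shift[of N ds ?K "%k. 1 / z k" d])
   (use Cons.prems IH assms in auto)
 moreover have "cmod (- 1) * (2 ^ length ds * (B / N) * (2 ^ length ds * ?K * ?K)) = 4 ^ length ds * B * ?K\<^sup>2 / N"
  by (simp add: power2_eq_square pow4)
 ultimately have "symbol_bd N ds (4 ^ length ds * B * ?K\<^sup>2 / N) (fdiff d (%k. 1 / z k))" by (simp only:)
 then have "symbol_bd N ds (inverse_bd c B (length (d # ds)) / N) (fdiff d (%k. 1 / z k))"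
  by (rule symbol_bd_mono) (use symbol_bd_nonneg[OF IH] assms in \<open>auto simp: divide_right_mono\<close>)
 moreover have "symbol_bd N ds (inverse_bd c B (length (d # ds))) (%k. 1 / z k)"
  by (rule symbol_bd_mono[OF IH]) (use B assms in auto)
 ultimately show ?case by simp
qed

text \<open>A coordinate is unbounded on the lattice, so the support of b must be tracked. Each
  difference enlarges that support by one lattice step, which is at most N, and adds 1 / N times a
  shift of b; these are the two units per direction in the constant.\<close>

lemma symbol_bd_coordinate:
 assumes N: "1 \<le> N"
 shows "symbol_bd N ds B b ==> set ds \<subseteq> {(1, 0), (0, 1)} ==> (!!k. b k \<noteq> 0 ==> \<bar>of_int (p k)\<bar> \<le> R * N) ==>
  p = fst \<or> p = snd ==> 0 \<le> R ==>
  symbol_bd N ds (B * (R + 2 * length ds)) (%k. of_real (of_int (p k) / N) * b k)"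
proof (induction ds arbitrary: b B R)
 case Nil
 have "cmod (of_real (of_int (p k) / N) * b k) \<le> B * R" for k
 proof (cases "b k = 0")
  case True
  then show ?thesis using symbol_bd_nonneg[OF Nil(1)] Nil(5) by simp
 next
  case False
  have "\<bar>of_int (p k)\<bar> / N \<le> R" using Nil(3)[OF False] N by (simp add: field_simps)
  then have "\<bar>of_int (p k)\<bar> / N * cmod (b k) \<le> R * B"
   using Nil(1,5) by (intro mult_mono) auto
  then show ?thesis using N by (simp add: norm_mult norm_divide mult.commute[of B])
 qed
 then show ?case by simp
next
 case (Cons d ds)
 have B: "0 \<le> B" using symbol_bd_nonneg[OF Cons.prems(1)] .
 let ?q = "%b k. complex_of_real (of_int (p k) / N) * b k"
 have pd: "p (k + d) = p k + p d" for k using Cons.prems(4) by auto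
 have pd1: "\<bar>real_of_int (p d)\<bar> \<le> 1" using Cons.prems(2,4) by auto
 have eq: "fdiff d (?q b) = (%k. ?q (fdiff d b) k + of_real (of_int (p d) / N) * b (k + d))"
  using N by (intro ext) (simp add: fdiff_def pd field_simps)
 have supp: "\<bar>of_int (p k)\<bar> \<le> (R + 1) * N" if "fdiff d b k \<noteq> 0" for k
 proof -
  have "b k \<noteq> 0 \<or> b (k + d) \<noteq> 0" using that by (auto simp: fdiff_def)
  then have "\<bar>of_int (p k)\<bar> \<le> R * N \<or> \<bar>of_int (p (k + d))\<bar> \<le> R * N" using Cons.prems(3) by blast
  moreover have "\<bar>real_of_int (p k)\<bar> \<le> \<bar>of_int (p (k + d))\<bar> + \<bar>of_int (p d)\<bar>" by (simp add: pd)
  moreover have "(R + 1) * N = R * N + N" by (simp add: algebra_simps)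
  ultimately show ?thesis using pd1 N by linarith
 qed
 have "symbol_bd N ds (B / N * (R + 1 + 2 * length ds) + cmod (of_real (of_int (p d) / N)) * B) (fdiff d (?q b))"
  unfolding eq
  using Cons.prems(1,2,5)
  by (intro symbol_bd_add Cons.IH symbol_bd_cmult symbol_bd_shift supp Cons.prems(4)) auto
 moreover have "B / N * (R + 1 + 2 * length ds) + cmod (of_real (of_int (p d) / N)) * B \<le> B * (R + 2 * length (d # ds)) / N"
 proof -
  have "cmod (of_real (of_int (p d) / N)) * B \<le> 1 / N * B"
   using pd1 N B by (intro mult_right_mono) (auto simp: norm_divide divide_right_mono)
  then have "B / N * (R + 1 + 2 * length ds) + cmod (of_real (of_int (p d) / N)) * B \<le> B / N * (R + 1 + 2 * length ds) + 1 / N * B"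
   by simp
  also have "\<dots> = B * (R + 2 * length (d # ds)) / N" by (simp add: algebra_simps add_divide_distrib)
  finally show ?thesis .
 qed
 ultimately have "symbol_bd N ds (B * (R + 2 * length (d # ds)) / N) (fdiff d (?q b))"
  using N by (elim symbol_bd_mono) auto
 moreover have "symbol_bd N ds (B * (R + 2 * length (d # ds))) (?q b)"
 proof (rule symbol_bd_mono)
  show "symbol_bd N ds (B * (R + 2 * length ds)) (?q b)"
   using Cons.prems(1,2) by (intro Cons.IH Cons.prems(3-5)) auto
 qed (use B N in \<open>auto intro!: mult_left_mono\<close>)
 ultimately show ?case by simp
qed

section \<open>Symbols sampled from smooth functions of compact support\<close>

lemma freq_add: "freq (k + l) = freq k + freq l"
 by (simp add: freq_def)

lemma freq_uminus: "freq (- k) = - freq k"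
 by (simp add: freq_def)

lemma frechet_derivative_outside_support:
 fixes f :: "'a::real_normed_vector => real"
 assumes "!!x. R < norm x ==> f x = 0" "R < norm x"
 shows "frechet_derivative f (at x) v = 0"
proof -
 have "open {x::'a. R < norm x}" by (intro open_Collect_less continuous_intros)
 then have "eventually (%y. y \<in> {x. R < norm x}) (nhds x)"
  using assms(2) by (intro eventually_nhds_in_open) auto
 then have "\<forall>\<^sub>F y in nhds x. f y = 0" by eventually_elim (use assms in auto)
 then have "(f has_derivative (%_. 0)) (at x)"
  using assms by (intro has_derivative_transform_eventually[of "%_. 0" "%_. 0" x UNIV f])
   (auto simp: eventually_at_filter elim: eventually_mono)
 then show ?thesis by (simp add: frechet_derivative_at[symmetric])
qed

lemma smooth2_differentiable: "smooth2 f ==> f differentiable (at x)"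
 by (cases rule: smooth2.cases) auto

lemma smooth2_continuous: "smooth2 f ==> continuous_on A f"
 by (meson smooth2_differentiable continuous_at_imp_continuous_on differentiable_imp_continuous_within)

lemma smooth2_frechet:
 "smooth2 f ==> d \<in> {(1, 0), (0, 1)} ==> smooth2 (%x. frechet_derivative f (at x) d)"
 by (erule smooth2.cases) auto

text \<open>A lattice difference is 1 / N times the average of a partial derivative over a segment,
  and \<open>smooth2\<close> passes to partial derivatives. The base point y is arbitrary because
  the derivative is sampled from base points that move along this segment.\<close>

lemma symbol_bd_smooth:
 assumes "set ds \<subseteq> {(1, 0), (0, 1)}"
 shows "smooth2 f ==> (!!\<xi>. R < norm \<xi> ==> f \<xi> = 0) ==>
  \<exists>B. \<forall>N>0. \<forall>y. symbol_bd N ds B (%k. of_real (f (y + (1 / N) *\<^sub>R freq k)))"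
 using assms
proof (induction ds arbitrary: f)
 case Nil
 have cont: "continuous_on UNIV f"
  using Nil(1) by (rule smooth2_continuous)
 have "compact (cball 0 R :: (real \<times> real) set)" by simp
 then have "bounded (f ` cball 0 R)"
  by (intro compact_imp_bounded compact_continuous_image continuous_on_subset[OF cont]) auto
 then obtain B where B: "!!\<xi>. \<xi> \<in> cball 0 R ==> \<bar>f \<xi>\<bar> \<le> B" unfolding bounded_iff real_norm_def by blast
 have "\<bar>f \<xi>\<bar> \<le> \<bar>B\<bar>" for \<xi>
  using B[of \<xi>] Nil(2)[of \<xi>] by (cases "norm \<xi> \<le> R") auto
 then show ?case by (intro exI[of _ "\<bar>B\<bar>"]) simp
next
 case (Cons d ds)
 define g where "g x = frechet_derivative f (at x) (of_int (fst d), of_int (snd d))" for x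
 have "smooth2 g" using Cons.prems unfolding g_def by (intro smooth2_frechet) auto
 moreover have "!!\<xi>. R < norm \<xi> ==> g \<xi> = 0"
  unfolding g_def using Cons.prems(2) frechet_derivative_outside_support by blast
 moreover have sub: "set ds \<subseteq> {(1, 0), (0, 1)}" using Cons.prems(3) by simp
 ultimately obtain B1 where "\<forall>N>0. \<forall>y. symbol_bd N ds B1 (%k. of_real (g (y + (1 / N) *\<^sub>R freq k)))"
  using Cons.IH[of g] by blast
 note B1 = this[rule_format]
 obtain B0 where "\<forall>N>0. \<forall>y. symbol_bd N ds B0 (%k. of_real (f (y + (1 / N) *\<^sub>R freq k)))"
  using Cons.IH[of f] Cons.prems(1,2) sub by blast
 note B0 = this[rule_format]
 have gcont: "continuous_on UNIV g"
  using \<open>smooth2 g\<close> by (rule smooth2_continuous)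
 have df: "(f has_derivative frechet_derivative f (at x)) (at x)" for x
  using smooth2_differentiable[OF Cons.prems(1)] by (simp add: frechet_derivative_works)
 have "symbol_bd N (d # ds) (max B0 B1) (%k. of_real (f (y + (1 / N) *\<^sub>R freq k)))" if N: "0 < N" for N y
 proof -
  define pt where "pt \<sigma> k = y + (\<sigma> / N) *\<^sub>R freq d + (1 / N) *\<^sub>R freq k" for \<sigma> k
  have ftc: "fdiff d (%k. of_real (f (y + (1 / N) *\<^sub>R freq k))) k
   = integral {0..1} (%\<sigma>. of_real (1 / N) * complex_of_real (g (pt \<sigma> k)))" for k
  proof -
   have "((%\<sigma>. f (pt \<sigma> k)) has_real_derivative (1 / N) * g (pt \<sigma> k)) (at \<sigma>)" for \<sigma>
   proof -
    have "((%\<sigma>. pt \<sigma> k) has_derivative (%h. (h / N) *\<^sub>R freq d)) (at \<sigma>)"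
     using has_derivative_add[OF has_derivative_const[of "y + (1 / N) *\<^sub>R freq k"]
       has_derivative_scaleR_left[OF has_derivative_ident, of "(1 / N) *\<^sub>R freq d" "at \<sigma>"]]
     by (simp add: pt_def ac_simps)
    then have "((%\<sigma>. f (pt \<sigma> k)) has_derivative (%h. frechet_derivative f (at (pt \<sigma> k)) ((h / N) *\<^sub>R freq d))) (at \<sigma>)"
     by (rule has_derivative_compose[OF _ df])
    moreover have "frechet_derivative f (at (pt \<sigma> k)) ((h / N) *\<^sub>R freq d) = h / N * g (pt \<sigma> k)" for h
     using linear_scale[OF has_derivative_linear[OF df], of "pt \<sigma> k" "h / N" "freq d"]
     by (simp add: g_def freq_def)
    ultimately have "((%\<sigma>. f (pt \<sigma> k)) has_derivative (%h. h / N * g (pt \<sigma> k))) (at \<sigma>)"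
     by simp
    moreover have "(%h. h / N * g (pt \<sigma> k)) = (*) (1 / N * g (pt \<sigma> k))"
     by (rule ext) simp
    ultimately show ?thesis by (simp only: has_field_derivative_def)
   qed
   then have "((%\<sigma>. complex_of_real (f (pt \<sigma> k))) has_vector_derivative of_real ((1 / N) * g (pt \<sigma> k))) (at \<sigma> within {0..1})" for \<sigma>
    by (intro has_vector_derivative_of_real)
     (auto simp: has_real_derivative_iff_has_vector_derivative[symmetric] intro: has_field_derivative_at_within)
   then have "((%\<sigma>. complex_of_real ((1 / N) * g (pt \<sigma> k))) has_integral of_real (f (pt 1 k)) - of_real (f (pt 0 k))) {0..1}"
    by (intro fundamental_theorem_of_calculus) auto
   then show ?thesis
    by (auto simp: fdiff_def pt_def freq_add scaleR_add_right ac_simps dest!: integral_unique)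
  qed
  have "symbol_bd N ds (cmod (of_real (1 / N)) * B1) (%k. of_real (1 / N) * complex_of_real (g (pt \<sigma> k)))" for \<sigma>
   unfolding pt_def by (intro symbol_bd_cmult B1 N)
  then have "symbol_bd N ds (cmod (of_real (1 / N)) * B1) (fdiff d (%k. of_real (f (y + (1 / N) *\<^sub>R freq k))))"
   unfolding ftc[abs_def] pt_def
   by (intro symbol_bd_average N)
    (use N in \<open>auto intro!: continuous_intros continuous_on_compose2[OF gcont]\<close>)
  then have "symbol_bd N ds (max B0 B1 / N) (fdiff d (%k. of_real (f (y + (1 / N) *\<^sub>R freq k))))"
   by (rule symbol_bd_mono) (use N in \<open>auto simp: norm_divide divide_right_mono\<close>)
  moreover have "symbol_bd N ds (max B0 B1) (%k. of_real (f (y + (1 / N) *\<^sub>R freq k)))"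
   by (rule symbol_bd_mono[OF B0]) (use N in auto)
  ultimately show ?thesis by simp
 qed
 then show ?case by blast
qed

section \<open>Trigonometric polynomials on the torus\<close>

abbreviation trig :: "dist => bool" where "trig f \<equiv> finite {k. f k \<noteq> 0}"

definition ev :: "dist => real \<times> real => complex" where
 "ev f x = (\<Sum>k | f k \<noteq> 0. f k * ekx k x)"

lemma ev_eq: "finite A ==> (!!k. k \<notin> A ==> f k = 0) ==> ev f x = (\<Sum>k\<in>A. f k * ekx k x)"
 unfolding ev_def by (rule sum.mono_neutral_left) auto

lemma trigI: "finite A ==> (!!k. k \<notin> A ==> f k = 0) ==> trig f"
 by (erule rev_finite_subset) auto

lemma trig_mult1: "trig a ==> trig (%k. a k * f k)"
 by (erule rev_finite_subset) auto

lemma trig_mult2: "trig f ==> trig (%k. a k * f k)"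
 by (erule rev_finite_subset) auto

lemma trig_add: "trig f ==> trig g ==> trig (%k. f k + g k)"
 by (rule finite_subset[of _ "{k. f k \<noteq> 0} \<union> {k. g k \<noteq> 0}"]) auto

lemma trig_diff: "trig f ==> trig g ==> trig (%k. f k - g k)"
 by (rule finite_subset[of _ "{k. f k \<noteq> 0} \<union> {k. g k \<noteq> 0}"]) auto

lemma trig_sum: "finite I ==> (!!i. i \<in> I ==> trig (f i)) ==> trig (%k. \<Sum>i\<in>I. f i k)"
 by (induction I rule: finite_induct) (simp_all add: trig_add)

lemma ev_add:
 assumes "trig f" "trig g" shows "ev (%k. f k + g k) x = ev f x + ev g x"
proof -
 let ?A = "{k. f k \<noteq> 0} \<union> {k. g k \<noteq> 0}"
 have A: "finite ?A" using assms by auto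
 show ?thesis
  by (subst (1 2 3) ev_eq[OF A]) (auto simp: sum.distrib algebra_simps)
qed

lemma ev_cmult: "trig f ==> ev (%k. c * f k) x = c * ev f x"
 using ev_eq[of "{k. f k \<noteq> 0}" "%k. c * f k" x] by (simp add: ev_def sum_distrib_left mult.assoc)

lemma ev_diff: "trig f ==> trig g ==> ev (%k. f k - g k) x = ev f x - ev g x"
 using ev_add[of f "%k. (- 1) * g k" x] ev_cmult[of g "- 1" x] trig_mult2[of g "%_. - 1"] by simp

lemma ev_zero: "ev (%k. 0) x = 0"
 by (simp add: ev_def)

lemma ev_sum: "finite I ==> (!!i. i \<in> I ==> trig (f i)) ==> ev (%k. \<Sum>i\<in>I. f i k) x = (\<Sum>i\<in>I. ev (f i) x)"
 by (induction I rule: finite_induct) (simp_all add: ev_zero ev_add trig_sum)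

lemma ekx_cis: "ekx k x = cis (2 * pi * (real_of_int (fst k) * fst x + real_of_int (snd k) * snd x))"
 by (simp add: ekx_def cis_conv_exp mult.assoc mult.commute mult.left_commute)

lemma norm_ekx [simp]: "cmod (ekx k x) = 1"
 by (simp add: ekx_cis)

lemma ekx_add: "ekx (k + l) x = ekx k x * ekx l x"
 by (simp add: ekx_cis cis_mult algebra_simps)

lemma ekx_add2: "ekx k (x + y) = ekx k x * ekx k y"
 by (simp add: ekx_cis cis_mult algebra_simps)

lemma ekx_uminus: "ekx (- k) x = cnj (ekx k x)"
 by (simp add: ekx_cis cis_cnj algebra_simps)

lemma ekx_uminus2: "ekx k (- x) = cnj (ekx k x)"
 by (simp add: ekx_cis cis_cnj algebra_simps)

lemma ekx_zero [simp]: "ekx 0 x = 1" "ekx (0, 0) x = 1"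
 by (simp_all add: ekx_cis)

lemma ekx_continuous [continuous_intros]: "continuous_on A f ==> continuous_on A (%x. ekx k (f x))"
 unfolding ekx_def by (intro continuous_intros)

lemma ev_continuous [continuous_intros]: "continuous_on A f ==> continuous_on A (%x. ev g (f x))"
 unfolding ev_def by (intro continuous_intros)

lemma ekx_periodic: "ekx k (x + (of_int a, of_int b)) = ekx k x"
proof -
 have "ekx k (of_int a, of_int b) = cis (2 * pi * of_int (fst k * a + snd k * b))"
  by (simp add: ekx_cis)
 also have "\<dots> = 1" by (rule cis_multiple_2pi) simp
 finally show ?thesis by (simp add: ekx_add2)
qed

lemma ev_periodic: "ev f (x + (of_int a, of_int b)) = ev f x"
 by (simp add: ev_def ekx_periodic)

text \<open>The unit box is centred at 0, where the convolution kernels concentrate.\<close>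

definition tmean :: "(real \<times> real => 'a::euclidean_space) => 'a" where
 "tmean g = integral (cbox (- 1/2, - 1/2) (1/2, 1/2)) g"

lemma tmean_iterated:
 assumes "continuous_on UNIV g"
 shows "tmean g = integral {-1/2..1/2} (%x. integral {-1/2..1/2} (%y. g (x, y)))"
 unfolding tmean_def by (subst integral_prod_continuous) (use assms in \<open>auto intro: continuous_on_subset\<close>)

lemma tmean_iterated_swap:
 assumes "continuous_on UNIV g"
 shows "tmean g = integral {-1/2..1/2} (%y. integral {-1/2..1/2} (%x. g (x, y)))"
 unfolding tmean_iterated[OF assms]
 using integral_swap_continuous[of "-1/2::real" "-1/2::real" "1/2::real" "1/2::real" "%x y. g (x, y)"] assms
 by (simp add: continuous_on_subset)

lemma tmean_integrable: "continuous_on UNIV g ==> g integrable_on cbox (- 1/2, - 1/2) (1/2, 1/2 :: real)"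
 for g :: "real \<times> real => 'a::euclidean_space"
 by (rule integrable_continuous) (auto intro: continuous_on_subset)

lemma tmean_add: "continuous_on UNIV f ==> continuous_on UNIV g ==> tmean (%x. f x + g x) = tmean f + tmean g"
 unfolding tmean_def by (intro integral_add tmean_integrable)

lemma tmean_cmult: "tmean (%x. c * f x) = c * tmean f" for c :: "'a::{euclidean_space, real_normed_field}"
 unfolding tmean_def by (rule integral_mult_right)

lemma tmean_sum: "finite I ==> (!!i. i \<in> I ==> continuous_on UNIV (f i)) ==> tmean (%x. \<Sum>i\<in>I. f i x) = (\<Sum>i\<in>I. tmean (f i))"
 unfolding tmean_def by (intro integral_sum tmean_integrable)

lemma tmean_const [simp]: "tmean (%x. c) = c"
 unfolding tmean_def by (subst integral_const) (simp add: content_Pair)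

lemma tmean_mono: "continuous_on UNIV f ==> continuous_on UNIV g ==>
  (!!x. x \<in> cbox (- 1/2, - 1/2) (1/2, 1/2) ==> f x \<le> g x) ==> tmean f \<le> tmean (g :: _ => real)"
 unfolding tmean_def by (intro integral_le tmean_integrable)

lemma tmean_norm: "continuous_on UNIV f ==> norm (tmean f) \<le> tmean (%x. norm (f x))"
 unfolding tmean_def
 by (intro integral_norm_bound_integral tmean_integrable continuous_on_norm) auto

lemma tmean_nonneg: "continuous_on UNIV f ==> (!!x. 0 \<le> f x) ==> 0 \<le> tmean (f :: _ => real)"
 unfolding tmean_def by (intro integral_nonneg tmean_integrable) auto

lemma tmean_Re: "continuous_on UNIV f ==> tmean (%x. Re (f x)) = Re (tmean f)"
 unfolding tmean_def using integral_linear[OF tmean_integrable bounded_linear_Re, of f] by (simp add: o_def)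

lemma tmean_split:
 fixes f g :: "real => 'a::{euclidean_space, real_normed_field}"
 assumes "continuous_on UNIV f" "continuous_on UNIV g"
 shows "tmean (%x. f (fst x) * g (snd x)) = integral {-1/2..1/2} f * integral {-1/2..1/2} g"
proof -
 have "continuous_on UNIV (%x. f (fst x) * g (snd x))"
  by (intro continuous_intros continuous_on_compose2[OF assms(1)] continuous_on_compose2[OF assms(2)]) auto
 then show ?thesis by (simp add: tmean_iterated)
qed

lemma tmean_ekx: "tmean (ekx k) = (if k = 0 then 1 else 0)"
proof -
 define E where "E n y = cis (2 * pi * real_of_int n * y)" for n y
 have cont: "continuous_on UNIV (E n)" for n unfolding E_def by (intro continuous_intros)
 have int: "integral {-1/2..1/2} (E n) = (if n = 0 then 1 else 0)" for n
 proof (cases "n = 0")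
  case False
  let ?c = "2 * pi * real_of_int n"
  have "((%y. exp (\<i> * of_real (?c * y)) / (\<i> * of_real ?c)) has_vector_derivative E n y) (at y within {-1/2..1/2})" for y
  proof -
   have "((%z. exp (\<i> * of_real ?c * z) / (\<i> * of_real ?c)) has_field_derivative exp (\<i> * of_real ?c * of_real y)) (at (of_real y))"
    using False by (auto intro!: derivative_eq_intros)
   then have "((%y. exp (\<i> * of_real ?c * of_real y) / (\<i> * of_real ?c)) has_vector_derivative exp (\<i> * of_real ?c * of_real y)) (at y within {-1/2..1/2})"
    by (rule has_vector_derivative_real_field)
   then show ?thesis by (simp add: E_def cis_conv_exp mult.assoc)
  qed
  then have "(E n has_integral exp (\<i> * of_real (?c * (1/2))) / (\<i> * of_real ?c) - exp (\<i> * of_real (?c * (- 1/2))) / (\<i> * of_real ?c)) {-1/2..1/2}"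
   by (intro fundamental_theorem_of_calculus) auto
  moreover have "exp (\<i> * of_real (?c * (1/2))) = exp (\<i> * of_real (?c * (- 1/2)))"
  proof -
   have "cis (?c * (1/2)) = cis (?c * (- 1/2)) * cis ?c" by (simp only: cis_mult) simp
   also have "cis ?c = 1" by (rule cis_multiple_2pi) simp
   finally show ?thesis by (simp only: cis_conv_exp mult_1_right)
  qed
  ultimately show ?thesis using False by (simp add: integral_unique)
 qed (simp add: E_def[abs_def])
 have "ekx k = (%x. E (fst k) (fst x) * E (snd k) (snd x))"
  by (auto simp: ekx_cis E_def cis_mult algebra_simps)
 then have "tmean (ekx k) = integral {-1/2..1/2} (E (fst k)) * integral {-1/2..1/2} (E (snd k))"
  using tmean_split[OF cont cont] by simp
 then show ?thesis using int[of "fst k"] int[of "snd k"] by (auto simp: prod_eq_iff)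
qed

text \<open>Orthogonality of the characters: the convolution kernel of a multiplier is its own
  trigonometric polynomial.\<close>

lemma ev_multiplier:
 assumes "trig a" "trig f"
 shows "ev (%k. a k * f k) x = tmean (%y. ev a y * ev f (x - y))"
proof -
 define A where "A = {k. a k \<noteq> 0} \<union> {k. f k \<noteq> 0}"
 have A: "finite A" using assms by (simp add: A_def)
 have e: "ev a y = (\<Sum>k\<in>A. a k * ekx k y)" "ev f y = (\<Sum>k\<in>A. f k * ekx k y)"
  "ev (%k. a k * f k) y = (\<Sum>k\<in>A. a k * f k * ekx k y)" for y
  using A by (auto intro!: ev_eq simp: A_def)
 have "tmean (%y. ev a y * ev f (x - y)) = tmean (%y. \<Sum>k\<in>A. \<Sum>l\<in>A. (a k * f l * ekx l x) * ekx (k - l) y)"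
 proof -
  have "ekx k y * ekx l (x - y) = ekx l x * ekx (k - l) y" for k l y
   using ekx_add2[of l x "- y"] ekx_add[of k "- l" y] by (simp add: ekx_uminus ekx_uminus2)
  then have "a k * ekx k y * (f l * ekx l (x - y)) = (a k * f l * ekx l x) * ekx (k - l) y" for k l y
   by (metis (no_types, lifting) mult.assoc mult.left_commute)
  then show ?thesis by (simp only: e sum_product)
 qed
 also have "\<dots> = (\<Sum>k\<in>A. \<Sum>l\<in>A. (a k * f l * ekx l x) * tmean (ekx (k - l)))"
  by (subst tmean_sum, use A in \<open>auto intro!: continuous_intros\<close>)
   (subst tmean_sum, use A in \<open>auto intro!: continuous_intros simp: tmean_cmult[symmetric]\<close>)
 also have "\<dots> = (\<Sum>k\<in>A. \<Sum>l\<in>A. if k = l then a k * f l * ekx l x else 0)"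
  by (intro sum.cong refl) (auto simp: tmean_ekx)
 also have "\<dots> = ev (%k. a k * f k) x"
  using A by (simp add: e)
 finally show ?thesis ..
qed

text \<open>Fourier inversion, read off from the convolution formula at the point 0 with the
  multiplier concentrated at -k and f reflected.\<close>

lemma coeff_tmean: "trig f ==> f k = tmean (%y. ev f y * ekx (- k) y)"
proof -
 assume f: "trig f"
 define a where "a l = (if l = - k then 1 else 0 :: complex)" for l
 have a: "trig a" by (rule trigI[of "{- k}"]) (auto simp: a_def)
 have 1: "ev a y = ekx (- k) y" for y
  using ev_eq[of "{- k}" a y] by (simp add: a_def)
 define g where "g l = f (- l)" for l
 have g: "trig g"
  using finite_imageI[OF f, of uminus] by (rule rev_finite_subset) (force simp: g_def)
 have "ev g y = ev f (- y)" for y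
 proof -
  have "ev g y = (\<Sum>l\<in>uminus ` {k. f k \<noteq> 0}. g l * ekx l y)"
   using f by (intro ev_eq) (force simp: g_def)+
  also have "\<dots> = (\<Sum>l | f l \<noteq> 0. f l * ekx l (- y))"
   by (subst sum.reindex) (auto simp: g_def ekx_uminus ekx_uminus2 inj_on_def)
  finally show ?thesis by (simp add: ev_def)
 qed
 then have "ev (%l. a l * g l) 0 = tmean (%y. ev f y * ekx (- k) y)"
  using ev_multiplier[OF a g, of 0] by (simp add: 1 mult.commute)
 moreover have "ev (%l. a l * g l) 0 = f k"
  using ev_eq[of "{- k}" "%l. a l * g l" 0] by (simp add: a_def g_def ekx_cis)
 ultimately show ?thesis by simp
qed

lemma coeff_bound: "trig f ==> (!!x. cmod (ev f x) \<le> M) ==> cmod (f k) \<le> M"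
proof -
 assume f: "trig f" "!!x. cmod (ev f x) \<le> M"
 have "cmod (f k) \<le> tmean (%y. cmod (ev f y * ekx (- k) y))"
  by (subst coeff_tmean[OF f(1)], intro tmean_norm continuous_intros)
 also have "\<dots> \<le> tmean (%y. M)"
  by (intro tmean_mono continuous_intros) (auto simp: norm_mult f)
 finally show ?thesis by simp
qed

section \<open>Summation by parts and integrable kernels\<close>

lemma one_minus_cis_lower:
 assumes "\<bar>y\<bar> \<le> 1/2"
 shows "2 * \<bar>y\<bar> \<le> cmod (cis (2 * pi * y) - 1)"
proof -
 have aux: "u / 3 \<le> sin u" if "0 \<le> u" "u \<le> 2" for u :: real
 proof -
  have "u - sin u \<le> \<bar>sin u - (\<Sum>m<3. sin_coeff m * u ^ m)\<bar>"
   by (simp add: sin_coeff_def numeral_3_eq_3)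
  also have "\<dots> \<le> inverse (fact 3) * \<bar>u\<bar> ^ 3" by (rule Maclaurin_sin_bound)
  also have "\<dots> = u * (u * u) / 6" using that by (simp add: fact_numeral power3_eq_cube)
  also have "\<dots> \<le> u * (2 * 2) / 6" using that by (intro divide_right_mono mult_left_mono mult_mono) auto
  finally show ?thesis by simp
 qed
 have "2 * \<bar>y\<bar> \<le> 2 * (pi * \<bar>y\<bar> / 3)"
  using pi_gt3 mult_right_mono[of 3 pi "\<bar>y\<bar>"] by simp
 also have "\<dots> \<le> 2 * sin (pi * \<bar>y\<bar>)"
 proof -
  have "pi * \<bar>y\<bar> \<le> 4 * (1/2)" using assms pi_less_4 by (intro mult_mono) auto
  then show ?thesis using aux[of "pi * \<bar>y\<bar>"] by simp
 qed
 also have "\<dots> \<le> 2 * \<bar>sin (pi * y)\<bar>" by (cases "0 \<le> y") (auto simp: abs_if)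
 also have "\<dots> = cmod (cis (2 * pi * y) - 1)"
  using dist_exp_i_1[of "2 * pi * y"] by (simp add: cis_conv_exp mult.assoc)
 finally show ?thesis .
qed

lemma ev_shift:
 assumes "trig a"
 shows "trig (%k. a (k + d))" "ev (%k. a (k + d)) x = ekx (- d) x * ev a x"
proof -
 let ?A = "(%k. k - d) ` {k. a k \<noteq> 0}"
 have A: "finite ?A" using assms by simp
 have z: "a (k + d) = 0" if "k \<notin> ?A" for k using that by (force simp: image_iff)
 show "trig (%k. a (k + d))" by (rule trigI[OF A z])
 have "ev (%k. a (k + d)) x = (\<Sum>k\<in>?A. a (k + d) * ekx k x)" by (rule ev_eq[OF A z])
 also have "\<dots> = (\<Sum>k | a k \<noteq> 0. a k * ekx (k - d) x)"
  by (subst sum.reindex) (auto simp: inj_on_def)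
 also have "\<dots> = ekx (- d) x * ev a x"
  using ekx_add[of _ "- d" x] by (simp add: ev_def sum_distrib_left ac_simps)
 finally show "ev (%k. a (k + d)) x = ekx (- d) x * ev a x" .
qed

lemma trig_fdiff: "trig a ==> trig (fdiff d a)"
 unfolding fdiff_def[abs_def] by (intro trig_diff ev_shift)

text \<open>Since the factor in front of the kernel is at least of order |x| on the unit box
  (\<open>one_minus_cis_lower\<close>), bounds on differences of the coefficients become decay of
  the kernel.\<close>

lemma ev_fdiff: "trig a ==> ev (fdiff d a) x = (ekx (- d) x - 1) * ev a x"
 unfolding fdiff_def[abs_def] by (simp add: ev_diff ev_shift algebra_simps)

lemma box_card:
 assumes "0 \<le> r"
 defines "bx \<equiv> {k :: int \<times> int. \<bar>of_int (fst k)\<bar> \<le> r \<and> \<bar>of_int (snd k)\<bar> \<le> r}"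
 shows "finite bx" "real (card bx) \<le> (2 * r + 1)\<^sup>2"
proof -
 have sub: "bx \<subseteq> {- \<lfloor>r\<rfloor>..\<lfloor>r\<rfloor>} \<times> {- \<lfloor>r\<rfloor>..\<lfloor>r\<rfloor>}"
  unfolding bx_def by (auto simp: le_floor_iff abs_le_iff) linarith+
 then show "finite bx" by (rule finite_subset) auto
 have "card bx \<le> card ({- \<lfloor>r\<rfloor>..\<lfloor>r\<rfloor>} \<times> {- \<lfloor>r\<rfloor>..\<lfloor>r\<rfloor>})" by (rule card_mono[OF _ sub]) auto
 then have "card bx \<le> nat (2 * \<lfloor>r\<rfloor> + 1) ^ 2"
  by (simp add: card_cartesian_product power2_eq_square)
 then have "real (card bx) \<le> real (nat (2 * \<lfloor>r\<rfloor> + 1)) ^ 2" by (metis of_nat_le_iff of_nat_power)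
 also have "\<dots> \<le> (2 * r + 1)\<^sup>2" using assms by (intro power_mono) auto
 finally show "real (card bx) \<le> (2 * r + 1)\<^sup>2" .
qed

lemma ev_box_bound:
 assumes "0 \<le> r" "!!k. a k \<noteq> 0 ==> \<bar>of_int (fst k)\<bar> \<le> r \<and> \<bar>of_int (snd k)\<bar> \<le> r"
  and "!!k. cmod (a k) \<le> b"
 shows "trig a" "cmod (ev a x) \<le> (2 * r + 1)\<^sup>2 * b"
proof -
 note box = box_card[OF assms(1)]
 let ?B = "{k :: int \<times> int. \<bar>of_int (fst k)\<bar> \<le> r \<and> \<bar>of_int (snd k)\<bar> \<le> r}"
 have b: "0 \<le> b" using assms(3)[of 0] by (meson norm_ge_zero order_trans)
 have z: "a k = 0" if "k \<notin> ?B" for k using assms(2)[of k] that by blast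
 show "trig a" by (rule trigI[OF box(1) z])
 have "cmod (ev a x) \<le> (\<Sum>k\<in>?B. b)"
  by (subst ev_eq[OF box(1) z], assumption, rule sum_norm_le) (auto simp: norm_mult assms(3))
 also have "\<dots> \<le> (2 * r + 1)\<^sup>2 * b" using box(2) b by (simp add: mult_right_mono)
 finally show "cmod (ev a x) \<le> (2 * r + 1)\<^sup>2 * b" .
qed

text \<open>Two differences per coordinate yield inverse-square decay in each variable, which is
  integrable uniformly in the scale.\<close>

abbreviation dirs :: "(int \<times> int) list" where "dirs \<equiv> [(1, 0), (1, 0), (0, 1), (0, 1)]"

text \<open>Up to the factor N^2 this bounds the number of lattice points in the box of radius
  (\<rho> + 4) N, which contains the supports of a symbol and of its four iterated
  differences.\<close>

definition ksize :: "real => real" where "ksize \<rho> = (2 * \<rho> + 9)\<^sup>2"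

text \<open>Summation by parts, twice in each variable, gives the kernel its decay.\<close>

lemma kernel_pointwise:
 assumes N: "1 \<le> N" and \<rho>: "0 \<le> \<rho>" and B: "symbol_bd N dirs B a"
  and supp: "!!k. a k \<noteq> 0 ==> \<bar>of_int (fst k)\<bar> \<le> \<rho> * N \<and> \<bar>of_int (snd k)\<bar> \<le> \<rho> * N"
 shows "trig a" "cmod (ev a x) \<le> ksize \<rho> * N\<^sup>2 * B"
  "x \<in> cbox (- 1/2, - 1/2) (1/2, 1/2) ==>
   cmod (ev a x) \<le> 4 * ksize \<rho> * B * (N / (1 + (2 * N * fst x)\<^sup>2) * (N / (1 + (2 * N * snd x)\<^sup>2)))"
proof -
 let ?C = "ksize \<rho>"
 let ?in = "%r a. \<forall>k. a k \<noteq> 0 --> \<bar>of_int (fst k)\<bar> \<le> r \<and> \<bar>of_int (snd k)\<bar> \<le> (r :: real)"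
 have in_fdiff: "?in (r + N) (fdiff d a)" if "?in r a" "d \<in> {(1, 0), (0, 1)}" for r d a
 proof (intro allI impI)
  fix k assume "fdiff d a k \<noteq> 0"
  then have "a k \<noteq> 0 \<or> a (k + d) \<noteq> 0" by (auto simp: fdiff_def)
  with that(1) have "(\<bar>of_int (fst k)\<bar> \<le> r \<and> \<bar>of_int (snd k)\<bar> \<le> r) \<or>
    (\<bar>of_int (fst (k + d))\<bar> \<le> r \<and> \<bar>of_int (snd (k + d))\<bar> \<le> r)" by blast
  then show "\<bar>of_int (fst k)\<bar> \<le> r + N \<and> \<bar>of_int (snd k)\<bar> \<le> r + N"
   using that(2) N by (elim insertE emptyE; simp; linarith)
 qed
 have in_mono: "?in r' a" if "?in r a" "r \<le> r'" for r r' a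
  using that by (meson order_trans)
 have est: "cmod (ev f x) \<le> ?C * N\<^sup>2 * b" if "?in ((\<rho> + 4) * N) f" "\<forall>k. cmod (f k) \<le> b" for f b
 proof -
  have b: "0 \<le> b" using that(2) by (meson norm_ge_zero order_trans)
  have "cmod (ev f x) \<le> (2 * ((\<rho> + 4) * N) + 1)\<^sup>2 * b"
   by (rule ev_box_bound) (use that N \<rho> in auto)
  also have "\<dots> \<le> ((2 * \<rho> + 9) * N)\<^sup>2 * b"
   using N \<rho> b by (intro mult_right_mono power_mono) (auto simp: algebra_simps)
  finally show ?thesis by (simp add: ksize_def power_mult_distrib)
 qed
 show tr: "trig a" by (rule ev_box_bound(1)[of "\<rho> * N" _ B]) (use N \<rho> B supp in auto)
 define s1 where "s1 = cmod (ekx (- (1, 0)) x - 1)"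
 define s2 where "s2 = cmod (ekx (- (0, 1)) x - 1)"
 have B0: "0 \<le> B" using symbol_bd_nonneg[OF B] .
 have i0: "?in (\<rho> * N) a" using supp by blast
 note i1 = in_fdiff[OF i0] note i2 = in_fdiff[OF i1] note i3 = in_fdiff[OF i2] note i4 = in_fdiff[OF i3]
 have le: "\<rho> * N + N + N \<le> (\<rho> + 4) * N" "\<rho> * N + N + N + N + N \<le> (\<rho> + 4) * N" "\<rho> * N \<le> (\<rho> + 4) * N"
  using N by (auto simp: algebra_simps)
 show e0: "cmod (ev a x) \<le> ?C * N\<^sup>2 * B"
  by (rule est[OF in_mono[OF i0 le(3)]]) (use B in auto)
 have e1: "s1\<^sup>2 * cmod (ev a x) \<le> ?C * N\<^sup>2 * (B / N / N)"
 proof -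
  have "cmod (ev (fdiff (1, 0) (fdiff (1, 0) a)) x) \<le> ?C * N\<^sup>2 * (B / N / N)"
   by (rule est[OF in_mono[OF i2 le(1)]]) (use B in auto)
  then show ?thesis by (simp add: ev_fdiff trig_fdiff tr norm_mult s1_def power2_eq_square)
 qed
 have e2: "s2\<^sup>2 * cmod (ev a x) \<le> ?C * N\<^sup>2 * (B / N / N)"
 proof -
  have "cmod (ev (fdiff (0, 1) (fdiff (0, 1) a)) x) \<le> ?C * N\<^sup>2 * (B / N / N)"
   by (rule est[OF in_mono[OF i2 le(1)]]) (use B in auto)
  then show ?thesis by (simp add: ev_fdiff trig_fdiff tr norm_mult s2_def power2_eq_square)
 qed
 have e3: "s1\<^sup>2 * s2\<^sup>2 * cmod (ev a x) \<le> ?C * N\<^sup>2 * (B / N / N / N / N)"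
 proof -
  have "cmod (ev (fdiff (0, 1) (fdiff (0, 1) (fdiff (1, 0) (fdiff (1, 0) a)))) x) \<le> ?C * N\<^sup>2 * (B / N / N / N / N)"
   by (rule est[OF in_mono[OF i4 le(2)]]) (use B in auto)
  then show ?thesis by (simp add: ev_fdiff trig_fdiff tr norm_mult s1_def s2_def power2_eq_square mult.assoc mult.left_commute)
 qed
 assume x: "x \<in> cbox (- 1/2, - 1/2) (1/2, 1/2)"
 obtain x1 x2 where xx: "x = (x1, x2)" by force
 have x12: "\<bar>x1\<bar> \<le> 1/2" "\<bar>x2\<bar> \<le> 1/2" using x by (auto simp: xx cbox_Pair_eq)
 have s: "2 * \<bar>x1\<bar> \<le> s1" "2 * \<bar>x2\<bar> \<le> s2"
  using one_minus_cis_lower[of "- x1"] one_minus_cis_lower[of "- x2"] x12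
  by (auto simp: s1_def s2_def ekx_cis xx)
 have sq: "(2 * N * x1)\<^sup>2 \<le> N\<^sup>2 * s1\<^sup>2" "(2 * N * x2)\<^sup>2 \<le> N\<^sup>2 * s2\<^sup>2"
  using power_mono[OF s(1), of 2] power_mono[OF s(2), of 2] N
  by (simp_all add: power_mult_distrib mult_left_mono)
 \<comment> \<open>Expanding the product gives four terms, controlled by zero, two, two and four
   differences; all four have the same bound.\<close>
 have "(1 + (2 * N * x1)\<^sup>2) * (1 + (2 * N * x2)\<^sup>2) * cmod (ev a x) \<le> (1 + N\<^sup>2 * s1\<^sup>2) * (1 + N\<^sup>2 * s2\<^sup>2) * cmod (ev a x)"
  using sq by (intro mult_right_mono mult_mono) auto
 also have "\<dots> = cmod (ev a x) + N\<^sup>2 * (s1\<^sup>2 * cmod (ev a x)) + N\<^sup>2 * (s2\<^sup>2 * cmod (ev a x)) + N ^ 4 * (s1\<^sup>2 * s2\<^sup>2 * cmod (ev a x))"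
  by (simp add: algebra_simps power2_eq_square power4_eq_xxxx)
 also have "\<dots> \<le> ?C * N\<^sup>2 * B + N\<^sup>2 * (?C * N\<^sup>2 * (B / N / N)) + N\<^sup>2 * (?C * N\<^sup>2 * (B / N / N)) + N ^ 4 * (?C * N\<^sup>2 * (B / N / N / N / N))"
  using e0 e1 e2 e3 N by (intro add_mono mult_left_mono) auto
 also have "\<dots> = 4 * ?C * B * N\<^sup>2"
  using N by (simp add: power2_eq_square power4_eq_xxxx)
 finally have "cmod (ev a x) \<le> 4 * ?C * B * N\<^sup>2 / ((1 + (2 * N * x1)\<^sup>2) * (1 + (2 * N * x2)\<^sup>2))"
  by (subst pos_le_divide_eq) (auto intro!: mult_pos_pos add_pos_nonneg simp: mult.commute)
 also have "\<dots> = 4 * ?C * B * (N / (1 + (2 * N * fst x)\<^sup>2) * (N / (1 + (2 * N * snd x)\<^sup>2)))"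
  by (simp add: xx power2_eq_square)
 finally show "cmod (ev a x) \<le> 4 * ksize \<rho> * B * (N / (1 + (2 * N * fst x)\<^sup>2) * (N / (1 + (2 * N * snd x)\<^sup>2)))" .
qed

text \<open>The majorant is a product of functions of one variable whose integrals are arctan N, so
  the scale disappears; arctan N \<le> 2 in each variable turns the constant 4 into 16.\<close>

lemma kernel_L1:
 assumes N: "1 \<le> N" and \<rho>: "0 \<le> \<rho>" and B: "symbol_bd N dirs B a"
  and supp: "!!k. a k \<noteq> 0 ==> \<bar>of_int (fst k)\<bar> \<le> \<rho> * N \<and> \<bar>of_int (snd k)\<bar> \<le> \<rho> * N"
 shows "tmean (%x. cmod (ev a x)) \<le> 16 * ksize \<rho> * B"
proof -
 define g where "g y = N / (1 + (2 * N * y)\<^sup>2)" for y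
 have den: "0 < 1 + (2 * N * y)\<^sup>2" for y by (intro add_pos_nonneg) auto
 have gc: "continuous_on UNIV g"
  unfolding g_def using den by (intro continuous_intros) (auto simp: less_le)
 have gint: "(g has_integral arctan (2 * N * (1/2)) / 2 - arctan (2 * N * (- 1/2)) / 2) {-1/2..1/2}"
 proof (rule fundamental_theorem_of_calculus)
  fix y :: real
  have "((%y. arctan (2 * N * y) / 2) has_real_derivative g y) (at y)"
  proof -
   have lin: "((%y. 2 * N * y) has_real_derivative 2 * N) (at y)"
    using DERIV_cmult_Id[of "2 * N" y UNIV] by simp
   have "((%y. arctan (2 * N * y) / 2) has_real_derivative inverse (1 + (2 * N * y)\<^sup>2) * (2 * N) / 2) (at y)"
    by (rule DERIV_cdivide[OF DERIV_chain2[OF DERIV_arctan lin]])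
   moreover have "inverse X * (2 * N) / 2 = N / X" for X by (cases "X = 0") (simp_all add: field_simps)
   ultimately show ?thesis by (simp only: g_def)
  qed
  then show "((%y. arctan (2 * N * y) / 2) has_vector_derivative g y) (at y within {-1/2..1/2})"
   by (simp add: has_real_derivative_iff_has_vector_derivative has_vector_derivative_at_within)
 qed simp
 have "integral {-1/2..1/2} g = arctan N"
  using integral_unique[OF gint] by (simp add: arctan_minus)
 moreover have "0 \<le> arctan N" "arctan N \<le> 2" using N arctan_ubound[of N] pi_less_4 by auto
 ultimately have gI: "integral {-1/2..1/2} g * integral {-1/2..1/2} g \<le> 2 * 2"
  by (intro mult_mono) auto
 have "tmean (%x. cmod (ev a x)) \<le> tmean (%x. 4 * ksize \<rho> * B * (g (fst x) * g (snd x)))"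
 proof (rule tmean_mono)
  show "continuous_on UNIV (%x. 4 * ksize \<rho> * B * (g (fst x) * g (snd x)))"
   by (intro continuous_intros continuous_on_compose2[OF gc]) auto
 qed (use kernel_pointwise(3)[OF N \<rho> B supp] in \<open>auto simp: g_def intro!: continuous_intros\<close>)
 also have "\<dots> = 4 * ksize \<rho> * B * (integral {-1/2..1/2} g * integral {-1/2..1/2} g)"
  by (simp only: tmean_cmult tmean_split[OF gc gc])
 also have "\<dots> \<le> 4 * ksize \<rho> * B * (2 * 2)"
  using gI symbol_bd_nonneg[OF B] by (intro mult_left_mono) (auto simp: ksize_def)
 finally show ?thesis by simp
qed

text \<open>Testing on trigonometric polynomials suffices because every block of a distribution is
  one.\<close>

definition mult_bd :: "dist => real => bool" where
 "mult_bd a M \<longleftrightarrow> trig a \<and> 0 \<le> M \<and> (\<forall>f S. trig f --> (\<forall>x. cmod (ev f x) \<le> S) --> (\<forall>x. cmod (ev (%k. a k * f k) x) \<le> M * S))"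

lemma mult_bdD: "mult_bd a M ==> trig f ==> (!!x. cmod (ev f x) \<le> S) ==> cmod (ev (%k. a k * f k) x) \<le> M * S"
 by (auto simp: mult_bd_def)

text \<open>Young's inequality: the operator norm on bounded functions is at most the L^1 norm of
  the kernel.\<close>

lemma mult_bd_symbol:
 assumes N: "1 \<le> N" and \<rho>: "0 \<le> \<rho>" and B: "symbol_bd N dirs B a"
  and supp: "!!k. a k \<noteq> 0 ==> \<bar>of_int (fst k)\<bar> \<le> \<rho> * N \<and> \<bar>of_int (snd k)\<bar> \<le> \<rho> * N"
 shows "mult_bd a (16 * ksize \<rho> * B)"
 unfolding mult_bd_def
proof (intro conjI allI impI)
 show a: "trig a" using kernel_pointwise(1)[OF N \<rho> B supp] .
 show "0 \<le> 16 * ksize \<rho> * B" using symbol_bd_nonneg[OF B] by (simp add: ksize_def)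
 fix f S x assume f: "trig f" and S: "\<forall>x. cmod (ev f x) \<le> S"
 have S0: "0 \<le> S" using S by (meson norm_ge_zero order_trans)
 have c: "continuous_on UNIV (%y. ev a y * ev f (x - y))" by (intro continuous_intros)
 have "cmod (ev (%k. a k * f k) x) \<le> tmean (%y. cmod (ev a y * ev f (x - y)))"
  by (subst ev_multiplier[OF a f], rule tmean_norm[OF c])
 also have "\<dots> \<le> tmean (%y. S * cmod (ev a y))"
  using S by (intro tmean_mono continuous_intros) (auto simp: norm_mult mult.commute[of S] intro!: mult_left_mono)
 also have "\<dots> \<le> S * (16 * ksize \<rho> * B)"
  unfolding tmean_cmult by (intro mult_left_mono kernel_L1[OF N \<rho> B supp] S0)
 finally show "cmod (ev (%k. a k * f k) x) \<le> 16 * ksize \<rho> * B * S" by (simp add: mult.commute)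
qed

section \<open>Littlewood-Paley blocks\<close>

text \<open>A single integer \<open>J\<close> replaces all radii of the partition, so that questions
  of overlapping supports become comparisons of powers of 2.\<close>

locale littlewood_paley =
 fixes chi rho :: "real \<times> real => real" and J :: nat
 assumes partition: "dyadic_partition chi rho"
  and chi_supp: "chi \<xi> \<noteq> 0 ==> norm \<xi> \<le> 2 ^ J"
  and rho_supp: "rho \<xi> \<noteq> 0 ==> 1 \<le> 2 ^ J * norm \<xi> \<and> norm \<xi> \<le> 2 ^ J"

lemma littlewood_paley_exists:
 assumes "dyadic_partition chi rho"
 obtains J where "littlewood_paley chi rho J"
proof -
 obtain R0 where R0: "!!\<xi>. R0 < norm \<xi> ==> chi \<xi> = 0"
  using assms by (auto simp: dyadic_partition_def)
 obtain r R where r: "0 < r" "!!\<xi>. norm \<xi> < r \<or> R < norm \<xi> ==> rho \<xi> = 0"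
  using assms unfolding dyadic_partition_def by blast
 obtain J where J: "max (max R0 R) (1 / r) < 2 ^ J"
  using real_arch_pow[of 2 "max (max R0 R) (1 / r)"] by auto
 have "littlewood_paley chi rho J"
 proof
  show "dyadic_partition chi rho" by fact
  show "norm \<xi> \<le> 2 ^ J" if "chi \<xi> \<noteq> 0" for \<xi>
   using R0[of \<xi>] that J by (cases "R0 < norm \<xi>") auto
  show "1 \<le> 2 ^ J * norm \<xi> \<and> norm \<xi> \<le> 2 ^ J" if "rho \<xi> \<noteq> 0" for \<xi>
  proof
   have n: "r \<le> norm \<xi>" "norm \<xi> \<le> R" using r(2)[of \<xi>] that by (auto simp: not_less[symmetric])
   then show "norm \<xi> \<le> 2 ^ J" using J by auto
   have "1 = 1 / r * r" using r(1) by simp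
   also have "\<dots> \<le> 2 ^ J * norm \<xi>" using J n r(1) by (intro mult_mono) auto
   finally show "1 \<le> 2 ^ J * norm \<xi>" .
  qed
 qed
 then show ?thesis by (rule that)
qed

context littlewood_paley
begin

abbreviation wt :: "nat => dist" where "wt n k \<equiv> complex_of_real (lp_weight chi rho n k)"

text \<open>Block n \<ge> 1 is \<open>rho\<close> at scale 2 ^ (n - 1); this offset is the source of
  the exponent \<open>J + 1\<close>. Block 0 contains the frequency 0 and has no lower
  bound.\<close>

definition freq_in :: "nat => int \<times> int => bool" where
 "freq_in n k \<longleftrightarrow> norm (freq k) \<le> 2 ^ (J + n) \<and> (n \<noteq> 0 --> 2 ^ n \<le> 2 ^ (J + 1) * norm (freq k))"

lemma lp_weight_freq_in: "lp_weight chi rho n k \<noteq> 0 ==> freq_in n k"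
proof (cases n)
 case 0
 then show "lp_weight chi rho n k \<noteq> 0 ==> freq_in n k"
  using chi_supp[of "freq k"] by (simp add: freq_in_def lp_weight_def)
next
 case (Suc i)
 assume "lp_weight chi rho n k \<noteq> 0"
 then have "rho ((1/2) ^ i *\<^sub>R freq k) \<noteq> 0" using Suc by (simp add: lp_weight_def)
 from rho_supp[OF this] have "1 \<le> 2 ^ J * ((1/2) ^ i * norm (freq k))" "(1/2) ^ i * norm (freq k) \<le> 2 ^ J"
  by auto
 then have "2 ^ i \<le> 2 ^ J * norm (freq k)" "norm (freq k) \<le> 2 ^ J * 2 ^ i"
  by (simp_all add: power_one_over field_simps)
 moreover have "(2::real) ^ J * 2 ^ i \<le> 2 ^ (J + n)" using Suc by (simp add: power_add)
 ultimately show "freq_in n k" using Suc by (simp add: freq_in_def)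
qed

lemma lp_weight_nonneg: "0 \<le> lp_weight chi rho n k"
 using partition by (auto simp: lp_weight_def dyadic_partition_def)

text \<open>Overlap of two blocks alone would give 2 * J + 1; the additional unit is spent in the
  product estimate, where sums of two frequencies are localised.\<close>

abbreviation gap :: nat where "gap \<equiv> 2 * J + 2"

lemma freq_in_near:
 assumes "freq_in n k" "freq_in j k"
 shows "n \<le> j + gap"
proof (cases "n = 0")
 case False
 have "(2::real) ^ n \<le> 2 ^ (J + 1) * norm (freq k)" using assms(1) False by (simp add: freq_in_def)
 also have "\<dots> \<le> 2 ^ (J + 1) * 2 ^ (J + j)" using assms(2) by (intro mult_left_mono) (auto simp: freq_in_def)
 also have "\<dots> = 2 ^ (2 * J + 1 + j)" by (simp add: power_add power_mult power2_eq_square algebra_simps flip: power_mult_distrib)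
 finally have "n \<le> 2 * J + 1 + j" by (rule power_le_imp_le_exp[rotated]) simp
 then show ?thesis by simp
qed simp

lemma abs_coord_le_norm_freq: "\<bar>of_int (fst k)\<bar> \<le> norm (freq k)" "\<bar>of_int (snd k)\<bar> \<le> norm (freq k)"
 using norm_fst_le[of "real_of_int (fst k)" "real_of_int (snd k)"]
  norm_snd_le[of "real_of_int (snd k)" "real_of_int (fst k)"] by (simp_all add: freq_def)

lemma finite_freq_le: "finite {k. norm (freq k) \<le> r}"
proof (rule finite_subset)
 show "{k. norm (freq k) \<le> r} \<subseteq> {k. \<bar>of_int (fst k)\<bar> \<le> max r 0 \<and> \<bar>of_int (snd k)\<bar> \<le> max r 0}"
 proof (rule subsetI, clarify)
  fix a b :: int assume "norm (freq (a, b)) \<le> r"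
  then show "\<bar>real_of_int (fst (a, b))\<bar> \<le> max r 0 \<and> \<bar>real_of_int (snd (a, b))\<bar> \<le> max r 0"
   using abs_coord_le_norm_freq[of "(a, b)"] by linarith
 qed
qed (rule box_card, simp)

lemma trig_wt: "trig (wt n)"
 by (rule trigI[OF finite_freq_le[of "2 ^ (J + n)"]]) (use lp_weight_freq_in in \<open>auto simp: freq_in_def\<close>)

lemma LP_block_ev: "LP_block chi rho n f x = ev (%k. wt n k * f k) x"
proof -
 have "{k. lp_weight chi rho n k \<noteq> 0} = {k. wt n k \<noteq> 0}" by simp
 then show ?thesis unfolding LP_block_def
  using trig_wt[of n] by (subst ev_eq[of "{k. wt n k \<noteq> 0}"]) auto
qed

text \<open>The partition of unity at \<open>2 ^ M \<cdot> \<xi>\<close> and at \<open>\<xi>\<close> differ by a finite sum, which telescopes the blocks.\<close>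

lemma sum_lp_weight: "(\<Sum>n<Suc M. lp_weight chi rho n k) = chi ((1/2) ^ M *\<^sub>R freq k)"
proof -
 have part: "chi \<xi> + (\<Sum>j. rho ((1/2) ^ j *\<^sub>R \<xi>)) = 1" for \<xi>
  using partition by (auto simp: dyadic_partition_def)
 have summ: "summable (%j. rho ((1/2) ^ j *\<^sub>R \<xi>))" for \<xi>
 proof -
  obtain N where N: "2 ^ J * norm \<xi> < 2 ^ N" using real_arch_pow[of 2] by auto
  have fin: "finite {..N}" by simp
  have "rho ((1/2) ^ j *\<^sub>R \<xi>) = 0" if "j \<notin> {..N}" for j
  proof (rule ccontr)
   assume "rho ((1/2) ^ j *\<^sub>R \<xi>) \<noteq> 0"
   from rho_supp[OF this] have "1 \<le> 2 ^ J * ((1/2) ^ j * norm \<xi>)" by simp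
   then have "2 ^ j \<le> 2 ^ J * norm \<xi>" by (simp add: power_one_over field_simps)
   moreover have "(2::real) ^ N \<le> 2 ^ j" using that by (intro power_increasing) auto
   ultimately show False using N by linarith
  qed
  then show ?thesis by (rule summable_finite[OF fin])
 qed
 let ?a = "%j. rho ((1/2) ^ j *\<^sub>R freq k)"
 have "(\<Sum>j. rho ((1/2) ^ j *\<^sub>R ((1/2) ^ M *\<^sub>R freq k))) = (\<Sum>j. ?a (j + M))"
  by (simp add: power_add)
 also have "\<dots> = (\<Sum>j. ?a j) - (\<Sum>j<M. ?a j)"
  using suminf_minus_initial_segment[OF summ] .
 finally have "chi ((1/2) ^ M *\<^sub>R freq k) = chi (freq k) + (\<Sum>j<M. ?a j)"
  using part[of "freq k"] part[of "(1/2) ^ M *\<^sub>R freq k"] by simp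
 also have "(\<Sum>j<M. ?a j) = (\<Sum>n=Suc 0..<Suc M. lp_weight chi rho n k)"
  by (subst sum.atLeast_Suc_lessThan_Suc_shift) (simp add: lp_weight_def lessThan_atLeast0 o_def)
 also have "chi (freq k) + \<dots> = (\<Sum>n<Suc M. lp_weight chi rho n k)"
  by (simp add: lessThan_atLeast0 sum.atLeast_Suc_lessThan lp_weight_def)
 finally show ?thesis ..
qed

lemma sum_lp_weight_eq_1:
 assumes "!!j. M \<le> j ==> \<not> freq_in j k"
 shows "(\<Sum>n<M. lp_weight chi rho n k) = 1"
proof -
 have conv: "(%m. \<Sum>n<Suc m. lp_weight chi rho n k) \<longlonglongrightarrow> 1"
 proof -
  have part: "chi (freq k) + (\<Sum>j. rho ((1/2) ^ j *\<^sub>R freq k)) = 1"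
   using partition by (auto simp: dyadic_partition_def)
  have "summable (%j. rho ((1/2) ^ j *\<^sub>R freq k))"
  proof (rule summable_finite[of "{..M}"])
   show "rho ((1/2) ^ j *\<^sub>R freq k) = 0" if "j \<notin> {..M}" for j
    using assms[of "Suc j"] lp_weight_freq_in[of "Suc j" k] that by (auto simp: lp_weight_def)
  qed simp
  then have "(%m. chi (freq k) + (\<Sum>j<m. rho ((1/2) ^ j *\<^sub>R freq k))) \<longlonglongrightarrow> 1"
   using tendsto_add[OF tendsto_const summable_LIMSEQ] part by metis
  moreover have "chi (freq k) + (\<Sum>j<m. rho ((1/2) ^ j *\<^sub>R freq k)) = (\<Sum>n<Suc m. lp_weight chi rho n k)" for m
  proof -
   have "(\<Sum>j<m. rho ((1/2) ^ j *\<^sub>R freq k)) = (\<Sum>n=Suc 0..<Suc m. lp_weight chi rho n k)"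
    by (subst sum.atLeast_Suc_lessThan_Suc_shift) (simp add: lp_weight_def lessThan_atLeast0 o_def)
   then show ?thesis
    by (simp add: lessThan_atLeast0 sum.atLeast_Suc_lessThan lp_weight_def)
  qed
  ultimately show ?thesis by simp
 qed
 have const: "(\<Sum>n<m. lp_weight chi rho n k) = (\<Sum>n<M. lp_weight chi rho n k)" if "M \<le> m" for m
 proof (rule sum.mono_neutral_right)
  show "\<forall>i\<in>{..<m} - {..<M}. lp_weight chi rho i k = 0"
   using assms lp_weight_freq_in by (metis DiffD2 lessThan_iff not_less)
 qed (use that in auto)
 have "eventually (%m. (\<Sum>n<Suc m. lp_weight chi rho n k) = (\<Sum>n<M. lp_weight chi rho n k)) sequentially"
  using eventually_ge_at_top[of M] by eventually_elim (rule const, simp)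
 then have "(%m. \<Sum>n<Suc m. lp_weight chi rho n k) \<longlonglongrightarrow> (\<Sum>n<M. lp_weight chi rho n k)"
  by (rule tendsto_eventually)
 then show ?thesis using LIMSEQ_unique conv by blast
qed

lemma freq_in_finite: "\<exists>M. \<forall>j\<ge>M. \<not> freq_in j k"
proof -
 obtain M where M: "2 ^ (J + 1) * norm (freq k) < 2 ^ M" using real_arch_pow[of 2] by auto
 have "\<not> freq_in j k" if "Suc M \<le> j" for j
 proof
  assume "freq_in j k"
  then have "2 ^ j \<le> 2 ^ (J + 1) * norm (freq k)" using that by (simp add: freq_in_def)
  moreover have "(2::real) ^ M \<le> 2 ^ j" using that by (intro power_increasing) auto
  ultimately show False using M by linarith
 qed
 then show ?thesis by blast
qed

abbreviation near :: "nat => nat set" where "near n \<equiv> {j. j \<le> n + gap \<and> n \<le> j + gap}"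

lemma finite_near [simp]: "finite (near n)"
 by (rule finite_subset[of _ "{..n + gap}"]) auto

lemma sum_near_eq_1:
 assumes "freq_in n k"
 shows "(\<Sum>j\<in>near n. wt j k) = 1"
proof -
 have "(\<Sum>j\<in>near n. lp_weight chi rho j k) = (\<Sum>j<Suc (n + gap). lp_weight chi rho j k)"
 proof (rule sum.mono_neutral_left)
  show "\<forall>i\<in>{..<Suc (n + gap)} - near n. lp_weight chi rho i k = 0"
  proof
   fix i assume i: "i \<in> {..<Suc (n + gap)} - near n"
   show "lp_weight chi rho i k = 0"
   proof (rule ccontr)
    assume "lp_weight chi rho i k \<noteq> 0"
    then have "freq_in i k" by (rule lp_weight_freq_in)
    then show False using i freq_in_near[OF assms, of i] by auto
   qed
  qed
 qed auto
 also have "\<dots> = 1"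
 proof (rule sum_lp_weight_eq_1)
  show "\<not> freq_in j k" if "Suc (n + gap) \<le> j" for j
   using freq_in_near[of j k n] assms that by auto
 qed
 finally show ?thesis by (simp flip: of_real_sum)
qed

lemma set_dirs: "set dirs \<subseteq> {(1, 0), (0, 1)}"
 by auto

lemma wt_symbol: "\<exists>B. \<forall>n. symbol_bd (2 ^ n) dirs B (wt n)"
proof -
 have sm: "smooth2 chi" "smooth2 rho" using partition by (auto simp: dyadic_partition_def)
 obtain B0 where B0: "\<forall>N>0. \<forall>y. symbol_bd N dirs B0 (%k. of_real (chi (y + (1 / N) *\<^sub>R freq k)))"
  using symbol_bd_smooth[OF set_dirs sm(1), of "2 ^ J"] chi_supp by (meson not_le)
 obtain B1 where B1: "\<forall>N>0. \<forall>y. symbol_bd N dirs B1 (%k. of_real (rho (y + (1 / N) *\<^sub>R freq k)))"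
  using symbol_bd_smooth[OF set_dirs sm(2), of "2 ^ J"] rho_supp by (meson not_le)
 have nn: "0 \<le> B0" "0 \<le> B1" using B0[rule_format, of 1 0] B1[rule_format, of 1 0] symbol_bd_nonneg by auto
 have "symbol_bd (2 ^ n) dirs (B0 + 2 ^ length dirs * B1) (wt n)" for n
 proof (cases n)
  case 0
  then have "symbol_bd (2 ^ n) dirs B0 (wt n)" using B0[rule_format, of 1 0] by (simp add: lp_weight_def)
  then show ?thesis by (rule symbol_bd_mono) (use nn in auto)
 next
  case (Suc i)
  have "symbol_bd (2 ^ i) dirs B1 (wt n)"
   using B1[rule_format, of "2 ^ i" 0] Suc by (simp add: lp_weight_def power_one_over)
  then have "symbol_bd (2 ^ n) dirs (2 ^ length dirs * B1) (wt n)"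
   by (rule symbol_bd_rescale) (use Suc in auto)
  then show ?thesis by (rule symbol_bd_mono) (use nn in auto)
 qed
 then show ?thesis by blast
qed

definition wtB :: real where "wtB = (SOME B. \<forall>n. symbol_bd (2 ^ n) dirs B (wt n))"

lemma symbol_bd_wt: "symbol_bd (2 ^ n) dirs wtB (wt n)"
 using someI_ex[OF wt_symbol] unfolding wtB_def by blast

lemma wtB_nonneg: "0 \<le> wtB"
 using symbol_bd_nonneg[OF symbol_bd_wt] .

definition annB :: "real => real" where "annB B = 16 * ksize (2 ^ J) * B"

lemma mult_bd_annulus:
 assumes "symbol_bd (2 ^ n) dirs B a" "!!k. a k \<noteq> 0 ==> freq_in n k"
 shows "mult_bd a (annB B)"
 unfolding annB_def
proof (rule mult_bd_symbol[OF _ _ assms(1)])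
 fix k assume "a k \<noteq> 0"
 then have "norm (freq k) \<le> 2 ^ J * 2 ^ n" using assms(2) by (auto simp: freq_in_def power_add)
 then show "\<bar>real_of_int (fst k)\<bar> \<le> 2 ^ J * 2 ^ n \<and> \<bar>of_int (snd k)\<bar> \<le> (2 ^ J * 2 ^ n :: real)"
  using abs_coord_le_norm_freq[of k] by (intro conjI) linarith+
qed auto

lemma mult_bd_wt: "mult_bd (wt n) (annB wtB)"
 by (rule mult_bd_annulus[OF symbol_bd_wt]) (use lp_weight_freq_in in auto)

definition Schi :: "nat => dist" where "Schi M k = (\<Sum>n<M. wt n k)"

lemma Schi_0 [simp]: "Schi 0 = (%k. 0)"
 by (simp add: Schi_def[abs_def])

lemma Schi_Suc_eq: "Schi (Suc M) k = of_real (chi ((1/2) ^ M *\<^sub>R freq k))"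
 unfolding Schi_def by (subst of_real_sum[symmetric]) (simp only: sum_lp_weight)

lemma low_pass_eq: "low_pass chi rho N f = (%k. Schi N k * f k)"
 by (simp add: low_pass_def Schi_def fun_eq_iff)

lemma Schi_freq: "Schi M k \<noteq> 0 ==> norm (freq k) \<le> 2 ^ (J + M)"
proof (cases M)
 case (Suc m)
 assume "Schi M k \<noteq> 0"
 then have "chi ((1/2) ^ m *\<^sub>R freq k) \<noteq> 0" using Suc by (simp add: Schi_Suc_eq)
 from chi_supp[OF this] have "(1/2) ^ m * norm (freq k) \<le> 2 ^ J" by simp
 then have "norm (freq k) \<le> 2 ^ (J + m)" by (simp add: power_one_over power_add field_simps)
 also have "(2::real) ^ (J + m) \<le> 2 ^ (J + M)" using Suc by (intro power_increasing) auto
 finally show ?thesis .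
qed simp

lemma Schi_freq': "Schi (Suc M) k \<noteq> 0 ==> norm (freq k) \<le> 2 ^ (J + M)"
proof -
 assume "Schi (Suc M) k \<noteq> 0"
 then have "chi ((1/2) ^ M *\<^sub>R freq k) \<noteq> 0" by (simp add: Schi_Suc_eq)
 from chi_supp[OF this] have "(1/2) ^ M * norm (freq k) \<le> 2 ^ J" by simp
 then show "norm (freq k) \<le> 2 ^ (J + M)" by (simp add: power_one_over power_add field_simps)
qed

lemma trig_Schi: "trig (Schi M)"
 by (rule trigI[OF finite_freq_le[of "2 ^ (J + M)"]]) (use Schi_freq in auto)

text \<open>The blocks telescope to one dilate of \<open>chi\<close>, so the bound is uniform in M,
  whereas adding block bounds would give a factor M.\<close>

lemma mult_bd_Schi: "\<exists>C. \<forall>M. mult_bd (Schi M) C"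
proof -
 have sm: "smooth2 chi" using partition by (auto simp: dyadic_partition_def)
 obtain B where B: "\<forall>N>0. \<forall>y. symbol_bd N dirs B (%k. of_real (chi (y + (1 / N) *\<^sub>R freq k)))"
  using symbol_bd_smooth[OF set_dirs sm, of "2 ^ J"] chi_supp by (meson not_le)
 have "mult_bd (Schi M) (16 * ksize (2 ^ J) * B)" for M
 proof (cases M)
  case 0
  have "0 \<le> B" using B symbol_bd_nonneg by (metis zero_less_one)
  then show ?thesis using 0 by (simp add: mult_bd_def ev_zero ksize_def) (meson norm_ge_zero order_trans mult_nonneg_nonneg zero_le_power2 zero_le_numeral)
 next
  case (Suc m)
  have "symbol_bd (2 ^ m) dirs B (Schi M)"
   using B[rule_format, of "2 ^ m" 0] by (simp add: Suc Schi_Suc_eq[abs_def] power_one_over)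
  then show ?thesis
  proof (rule mult_bd_symbol[rotated 2])
   fix k assume "Schi M k \<noteq> 0"
   then have "norm (freq k) \<le> 2 ^ J * 2 ^ m" using Schi_freq' Suc by (auto simp: power_add)
   then show "\<bar>real_of_int (fst k)\<bar> \<le> 2 ^ J * 2 ^ m \<and> \<bar>of_int (snd k)\<bar> \<le> (2 ^ J * 2 ^ m :: real)"
    using abs_coord_le_norm_freq[of k] by (intro conjI) linarith+
  qed auto
 qed
 then show ?thesis by blast
qed

definition SchiC :: real where "SchiC = (SOME C. \<forall>M. mult_bd (Schi M) C)"

lemma mult_bd_SchiC: "mult_bd (Schi M) SchiC"
 using someI_ex[OF mult_bd_Schi] unfolding SchiC_def by blast

end

section \<open>Besov bounds\<close>

context littlewood_paley
begin

text \<open>Explicit-constant form of the Besov norm, which avoids suprema.\<close>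

definition bb :: "real => dist => real => bool" where
 "bb a f C \<longleftrightarrow> (\<forall>n x. 2 powr (a * (real n - 1)) * cmod (LP_block chi rho n f x) \<le> C)"

definition dy :: "real => nat => real" where "dy a n = 2 powr (- a * (real n - 1))"

lemma dy_pos [simp]: "0 < dy a n" "0 \<le> dy a n"
 by (simp_all add: dy_def)

lemma dy_add: "dy (a + b) n = dy a n * dy b n"
 by (simp add: dy_def powr_add[symmetric] algebra_simps)

lemma bb_iff: "bb a f C \<longleftrightarrow> (\<forall>n x. cmod (ev (%k. wt n k * f k) x) \<le> C * dy a n)"
proof -
 have "2 powr (a * (real n - 1)) * y \<le> C \<longleftrightarrow> y \<le> C * dy a n" for n y
 proof -
  have "2 powr (a * (real n - 1)) = inverse (dy a n)" by (simp add: dy_def flip: powr_minus)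
  then show ?thesis by (simp add: field_simps)
 qed
 then show ?thesis by (simp add: bb_def LP_block_ev)
qed

lemma bbI: "(!!n x. cmod (ev (%k. wt n k * f k) x) \<le> C * dy a n) ==> bb a f C"
 by (simp add: bb_iff)

lemma bbD: "bb a f C ==> cmod (ev (%k. wt n k * f k) x) \<le> C * dy a n"
 by (simp add: bb_iff)

lemma trig_wt_mult: "trig (%k. wt n k * f k)"
 by (rule trig_mult1[OF trig_wt])

lemma bb_nonneg: "bb a f C ==> 0 \<le> C"
 using bbD[of a f C 0 0] dy_pos(1)[of a 0] by (smt (verit) mult_neg_pos norm_ge_zero)

lemma bb_mono: "bb a f C ==> C \<le> C' ==> bb a f C'"
 unfolding bb_def by (meson order_trans)

lemma bb_add: "bb a f A ==> bb a g B ==> bb a (%k. f k + g k) (A + B)"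
 unfolding bb_iff
 by (simp add: distrib_left ev_add[OF trig_wt_mult trig_wt_mult] distrib_right norm_triangle_mono)

lemma bb_cmult: "bb a f A ==> bb a (%k. c * f k) (cmod c * A)"
proof (rule bbI)
 fix n x assume "bb a f A"
 then have "cmod c * cmod (ev (%k. wt n k * f k) x) \<le> cmod c * (A * dy a n)"
  by (intro mult_left_mono bbD) auto
 moreover have "(%k. wt n k * (c * f k)) = (%k. c * (wt n k * f k))" by (simp add: fun_eq_iff)
 ultimately show "cmod (ev (%k. wt n k * (c * f k)) x) \<le> cmod c * A * dy a n"
  by (simp add: ev_cmult[OF trig_wt_mult] norm_mult mult.assoc)
qed

lemma bb_zero: "0 \<le> C ==> bb a (%k. 0) C"
 by (simp add: bb_iff ev_zero)

lemma bb_uminus: "bb a f A ==> bb a (%k. - f k) A"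
 using bb_cmult[of a f A "- 1"] by simp

lemma bb_diff: "bb a f A ==> bb a g B ==> bb a (%k. f k - g k) (A + B)"
 using bb_add[OF _ bb_uminus, of a f A g B] by simp

lemma bb_diff_swap: "bb a (%k. f k - g k) A ==> bb a (%k. g k - f k) A"
 using bb_uminus[of a "%k. f k - g k" A] by simp

lemma bb_sum: "finite I ==> (!!i. i \<in> I ==> bb a (f i) (A i)) ==> bb a (%k. \<Sum>i\<in>I. f i k) (\<Sum>i\<in>I. A i)"
 by (induction I rule: finite_induct) (auto intro: bb_zero bb_add)

text \<open>Index n = 0 stands for j = -1, where the weights are ordered the other way round; this
  is where the constant comes from.\<close>

lemma dy_le: "a' \<le> a ==> dy a n \<le> 2 powr (a - a') * dy a' n"
proof -
 assume "a' \<le> a"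
 then have "- a * (real n - 1) \<le> (a - a') + - a' * (real n - 1)"
  using mult_nonneg_nonneg[of "a - a'" "real n"] by (simp add: algebra_simps)
 then show ?thesis unfolding dy_def by (subst powr_add[symmetric]) simp
qed

lemma bb_le_exponent: "bb a f C ==> a' \<le> a ==> bb a' f (2 powr (a - a') * C)"
proof (rule bbI)
 fix n x assume *: "bb a f C" "a' \<le> a"
 have "cmod (ev (%k. wt n k * f k) x) \<le> C * dy a n" using * by (simp add: bbD)
 also have "\<dots> \<le> C * (2 powr (a - a') * dy a' n)"
  using * by (intro mult_left_mono dy_le bb_nonneg)
 finally show "cmod (ev (%k. wt n k * f k) x) \<le> 2 powr (a - a') * C * dy a' n" by (simp add: ac_simps)
qed

lemma dy_near: "j \<in> near n ==> dy s j \<le> 2 powr (\<bar>s\<bar> * gap) * dy s n"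
proof -
 assume j: "j \<in> near n"
 have "s * (real n - real j) \<le> \<bar>s\<bar> * \<bar>real n - real j\<bar>" by (simp add: abs_mult[symmetric])
 also have "\<dots> \<le> \<bar>s\<bar> * gap" using j by (intro mult_left_mono) auto
 finally have "- s * (real j - 1) \<le> \<bar>s\<bar> * gap + - s * (real n - 1)" by (simp add: algebra_simps)
 then show ?thesis unfolding dy_def by (subst powr_add[symmetric]) simp
qed

definition nearC :: "real => real" where "nearC s = real (2 * gap + 1) * 2 powr (\<bar>s\<bar> * gap)"

lemma nearC_nonneg: "0 \<le> nearC s" by (simp add: nearC_def)

lemma sum_dy_near: "(\<Sum>j\<in>near n. dy s j) \<le> nearC s * dy s n"
proof -
 have "card (near n) \<le> card {n - gap..n + gap}" by (rule card_mono) auto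
 then have c: "real (card (near n)) \<le> real (2 * gap + 1)" by simp
 have "(\<Sum>j\<in>near n. dy s j) \<le> (\<Sum>j\<in>near n. 2 powr (\<bar>s\<bar> * gap) * dy s n)"
  by (intro sum_mono dy_near)
 also have "\<dots> = real (card (near n)) * (2 powr (\<bar>s\<bar> * gap) * dy s n)" by simp
 also have "\<dots> \<le> real (2 * gap + 1) * (2 powr (\<bar>s\<bar> * gap) * dy s n)"
  using c by (intro mult_right_mono) auto
 finally show ?thesis by (simp add: nearC_def mult.assoc)
qed

text \<open>On the frequencies of the multiplier the nearby blocks sum to 1, so they can be
  inserted; each of them is bounded by hypothesis and their number is bounded. All multiplier
  estimates on distributions pass through this.\<close>

lemma block_annulus:
 assumes a: "mult_bd a M" "!!k. a k \<noteq> 0 ==> freq_in n k" and f: "bb s f C"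
 shows "cmod (ev (%k. a k * f k) x) \<le> M * C * nearC s * dy s n"
proof -
 have M: "0 \<le> M" using a by (simp add: mult_bd_def)
 have eq: "(%k. a k * f k) = (%k. \<Sum>j\<in>near n. a k * (wt j k * f k))"
 proof
  fix k show "a k * f k = (\<Sum>j\<in>near n. a k * (wt j k * f k))"
  proof (cases "a k = 0")
   case False
   then have "(\<Sum>j\<in>near n. wt j k) = 1" using a(2) sum_near_eq_1 by blast
   then have "a k * f k = a k * ((\<Sum>j\<in>near n. wt j k) * f k)" by simp
   then show ?thesis by (simp only: sum_distrib_left sum_distrib_right)
  qed simp
 qed
 have "cmod (ev (%k. a k * f k) x) \<le> (\<Sum>j\<in>near n. cmod (ev (%k. a k * (wt j k * f k)) x))"
  unfolding eq by (subst ev_sum, simp, rule trig_mult2[OF trig_wt_mult], rule norm_sum)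
 also have "\<dots> \<le> (\<Sum>j\<in>near n. M * (C * dy s j))"
  by (intro sum_mono mult_bdD[OF a(1)] trig_wt_mult bbD f)
 also have "\<dots> = M * C * (\<Sum>j\<in>near n. dy s j)" by (simp add: sum_distrib_left mult.assoc)
 also have "\<dots> \<le> M * C * (nearC s * dy s n)"
  using M bb_nonneg[OF f] by (intro mult_left_mono sum_dy_near) auto
 finally show ?thesis by (simp add: mult.assoc)
qed

definition coeffC :: "real => int \<times> int => real" where
 "coeffC s k = (\<Sum>j<(SOME M. \<forall>j\<ge>M. \<not> freq_in j k). dy s j)"

lemma coeffC_nonneg: "0 \<le> coeffC s k"
 by (simp add: coeffC_def sum_nonneg)

text \<open>A frequency lies in finitely many blocks, so its coefficient is a finite sum of block
  coefficients. Limits in Besov norms are thereby identified coefficient by coefficient.\<close>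

lemma bb_coeff: assumes "bb s f C" shows "cmod (f k) \<le> C * coeffC s k"
proof -
 define M where "M = (SOME M. \<forall>j\<ge>M. \<not> freq_in j k)"
 have M: "!!j. M \<le> j ==> \<not> freq_in j k"
  using someI_ex[OF freq_in_finite[of k]] unfolding M_def by blast
 have "(\<Sum>j<M. wt j k) = 1" using sum_lp_weight_eq_1[OF M] by (simp flip: of_real_sum)
 then have "f k = (\<Sum>j<M. wt j k * f k)" by (simp flip: sum_distrib_right)
 then have "cmod (f k) \<le> (\<Sum>j<M. cmod (wt j k * f k))" by (metis norm_sum)
 also have "\<dots> \<le> (\<Sum>j<M. C * dy s j)"
  by (intro sum_mono coeff_bound[of "%k. wt _ k * f k"] trig_wt_mult bbD assms)
 finally show ?thesis by (simp add: coeffC_def M_def sum_distrib_left)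
qed

lemma bb_0_imp_zero: "bb s f 0 ==> f k = 0"
 using bb_coeff[of s f 0 k] by simp

text \<open>Lower semicontinuity: each block depends on finitely many coefficients, so
  coefficientwise convergence is enough.\<close>

lemma bb_limit:
 assumes "F \<noteq> bot" "!!k. ((%i. h i k) \<longlongrightarrow> h' k) F" "eventually (%i. bb a (h i) (C i)) F" "(C \<longlongrightarrow> C') F"
 shows "bb a h' C'"
proof (rule bbI)
 fix n x
 have e: "ev (%k. wt n k * f k) x = (\<Sum>k | wt n k \<noteq> 0. wt n k * f k * ekx k x)" for f
  by (rule ev_eq) (use trig_wt in auto)
 have "((%i. cmod (ev (%k. wt n k * h i k) x)) \<longlongrightarrow> cmod (ev (%k. wt n k * h' k) x)) F"
  unfolding e by (intro tendsto_intros assms(2))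
 moreover have "((%i. C i * dy a n) \<longlongrightarrow> C' * dy a n) F" by (intro tendsto_intros assms(4))
 moreover have "eventually (%i. cmod (ev (%k. wt n k * h i k) x) \<le> C i * dy a n) F"
  using assms(3) by eventually_elim (rule bbD)
 ultimately show "cmod (ev (%k. wt n k * h' k) x) \<le> C' * dy a n"
  using assms(1) by (rule_tac tendsto_le)
qed

definition conjC :: "real => real" where "conjC s = annB wtB * nearC s"

lemma annB_nonneg: "0 \<le> annB wtB"
 using wtB_nonneg by (simp add: annB_def ksize_def)

lemma conjC_nonneg: "0 \<le> conjC s"
 by (simp add: conjC_def annB_nonneg nearC_nonneg)

text \<open>Conjugation reflects frequencies and the partition is not assumed even. The reflected
  weight is another annulus multiplier, which explains the constant.\<close>

lemma bb_dconj: assumes "bb s f C" shows "bb s (dconj f) (conjC s * C)"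
proof (rule bbI)
 fix n x
 define a where "a k = wt n (- k)" for k
 have "symbol_bd (2 ^ n) dirs wtB a"
  using symbol_bd_reflect[of 1, OF _ symbol_bd_wt[of n]] by (simp add: a_def[abs_def])
 moreover have supp: "freq_in n k" if "a k \<noteq> 0" for k
  using lp_weight_freq_in[of n "- k"] that by (simp add: a_def freq_in_def freq_uminus)
 ultimately have "mult_bd a (annB wtB)" by (rule mult_bd_annulus)
 then have "cmod (ev (%k. a k * f k) x) \<le> annB wtB * C * nearC s * dy s n"
  using supp assms by (rule block_annulus)
 moreover have "ev (%k. wt n k * dconj f k) x = cnj (ev (%k. a k * f k) x)"
 proof -
  let ?A = "{k. wt n k \<noteq> 0}"
  have "ev (%k. a k * f k) x = (\<Sum>k\<in>uminus ` ?A. a k * f k * ekx k x)"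
   using trig_wt[of n] by (intro ev_eq) (force simp: a_def)+
  also have "\<dots> = (\<Sum>k\<in>?A. wt n k * f (- k) * ekx (- k) x)"
   by (subst sum.reindex) (auto simp: inj_on_def a_def)
  finally have "cnj (ev (%k. a k * f k) x) = (\<Sum>k\<in>?A. wt n k * dconj f k * ekx k x)"
   by (simp add: dconj_def ekx_uminus)
  also have "\<dots> = ev (%k. wt n k * dconj f k) x"
   by (rule ev_eq[symmetric]) (use trig_wt in auto)
  finally show ?thesis ..
 qed
 ultimately show "cmod (ev (%k. wt n k * dconj f k) x) \<le> conjC s * C * dy s n"
  by (simp add: conjC_def ac_simps)
qed

lemma dconj_diff: "dconj (%k. f k - g k) = (%k. dconj f k - dconj g k)"
 by (simp add: dconj_def fun_eq_iff)

lemma SchiC_nonneg: "0 \<le> SchiC"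
 using mult_bd_SchiC[of 0] by (simp add: mult_bd_def)

lemma bb_Schi: assumes "bb s f C" shows "bb s (%k. Schi M k * f k) (SchiC * C)"
proof (rule bbI)
 fix n x
 have "cmod (ev (%k. Schi M k * (wt n k * f k)) x) \<le> SchiC * (C * dy s n)"
  by (intro mult_bdD[OF mult_bd_SchiC] trig_wt_mult bbD assms)
 then show "cmod (ev (%k. wt n k * (Schi M k * f k)) x) \<le> SchiC * C * dy s n"
  by (simp add: ac_simps)
qed

lemma Schi_eq_1: "freq_in n k ==> n + gap < M ==> Schi M k = 1"
proof -
 assume *: "freq_in n k" "n + gap < M"
 have "\<not> freq_in j k" if "M \<le> j" for j using freq_in_near[of j k n] * that by auto
 then have "(\<Sum>n<M. lp_weight chi rho n k) = 1" by (rule sum_lp_weight_eq_1)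
 then show ?thesis by (simp add: Schi_def flip: of_real_sum)
qed

lemma Schi_eventually_1: "eventually (%M. Schi M k = 1) sequentially"
proof -
 obtain M0 where M0: "\<forall>j\<ge>M0. \<not> freq_in j k" using freq_in_finite by blast
 have "Schi M k = 1" if "M0 \<le> M" for M
 proof -
  have "(\<Sum>n<M. lp_weight chi rho n k) = 1" by (rule sum_lp_weight_eq_1) (use that M0 in auto)
  then show ?thesis by (simp add: Schi_def flip: of_real_sum)
 qed
 then show ?thesis by (auto simp: eventually_sequentially)
qed

definition tailC :: "real => real" where "tailC d = (1 + SchiC) * 2 powr (d * (gap + 1))"

lemma tailC_nonneg: "0 \<le> tailC d"
 using SchiC_nonneg by (simp add: tailC_def)

text \<open>Blocks well below M are reproduced exactly, and in the others the surplus of regularity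
  gives the power of 2 ^ (-M). This is the rate of all mollification limits.\<close>

lemma bb_Schi_tail:
 assumes "bb s f C" "s' \<le> s"
 shows "bb s' (%k. f k - Schi M k * f k) (tailC (s - s') * C * 2 powr (- (s - s') * M))"
proof (rule bbI)
 fix n x
 have C: "0 \<le> C" using bb_nonneg[OF assms(1)] .
 show "cmod (ev (%k. wt n k * (f k - Schi M k * f k)) x) \<le> tailC (s - s') * C * 2 powr (- (s - s') * M) * dy s' n"
 proof (cases "n + gap < M")
  case True
  then have "(%k. wt n k * (f k - Schi M k * f k)) = (%k. 0)"
   using Schi_eq_1 lp_weight_freq_in by (fastforce simp: fun_eq_iff)
  then show ?thesis using C tailC_nonneg by (simp add: ev_zero)
 next
  case False
  have "(%k. wt n k * (f k - Schi M k * f k)) = (%k. wt n k * f k - Schi M k * (wt n k * f k))"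
   by (simp add: fun_eq_iff algebra_simps)
  then have "cmod (ev (%k. wt n k * (f k - Schi M k * f k)) x) \<le>
    cmod (ev (%k. wt n k * f k) x) + cmod (ev (%k. Schi M k * (wt n k * f k)) x)"
   by (simp add: ev_diff[OF trig_wt_mult trig_mult2[OF trig_wt_mult]] norm_triangle_ineq4)
  also have "\<dots> \<le> C * dy s n + SchiC * (C * dy s n)"
   by (intro add_mono mult_bdD[OF mult_bd_SchiC] trig_wt_mult bbD assms)
  also have "\<dots> = (1 + SchiC) * C * (dy (s - s') n * dy s' n)"
   using dy_add[of "s - s'" s' n] by (simp add: algebra_simps)
  also have "\<dots> \<le> (1 + SchiC) * C * (2 powr ((s - s') * (gap + 1)) * 2 powr (- (s - s') * M) * dy s' n)"
  proof (intro mult_left_mono mult_right_mono)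
   have "(s - s') * (real M - (gap + 1)) \<le> (s - s') * (real n - 1 + gap - gap)"
    using False assms(2) by (intro mult_left_mono) auto
   then show "dy (s - s') n \<le> 2 powr ((s - s') * (gap + 1)) * 2 powr (- (s - s') * M)"
    unfolding dy_def by (subst powr_add[symmetric]) (simp add: algebra_simps)
  qed (use C SchiC_nonneg in auto)
  finally show ?thesis by (simp add: tailC_def ac_simps)
 qed
qed

text \<open>Only the neighbours of block N see it, and there the surplus \<open>s - s'\<close>
  becomes a factor decaying geometrically in N.\<close>

lemma bb_wt_block:
 assumes "bb s f C" "s' \<le> s"
 shows "bb s' (%k. wt N k * f k) (annB wtB * 2 powr (\<bar>s'\<bar> * gap) * C * dy (s - s') N)"
proof (rule bbI)
 fix n x
 have C: "0 \<le> C" using bb_nonneg[OF assms(1)] .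
 show "cmod (ev (%k. wt n k * (wt N k * f k)) x) \<le> annB wtB * 2 powr (\<bar>s'\<bar> * gap) * C * dy (s - s') N * dy s' n"
 proof (cases "N \<in> near n")
  case False
  have "wt n k * wt N k = 0" for k
   using freq_in_near[of n k N] freq_in_near[of N k n] lp_weight_freq_in[of n k] lp_weight_freq_in[of N k] False by auto
  then have "(%k. wt n k * (wt N k * f k)) = (%k. 0)" by (simp add: fun_eq_iff flip: mult.assoc)
  then show ?thesis using C annB_nonneg by (simp add: ev_zero)
 next
  case True
  have "cmod (ev (%k. wt n k * (wt N k * f k)) x) \<le> annB wtB * (C * dy s N)"
   by (intro mult_bdD[OF mult_bd_wt] trig_wt_mult bbD assms)
  also have "\<dots> = annB wtB * C * dy (s - s') N * dy s' N"
   using dy_add[of "s - s'" s' N] by simp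
  also have "\<dots> \<le> annB wtB * C * dy (s - s') N * (2 powr (\<bar>s'\<bar> * gap) * dy s' n)"
   using C annB_nonneg True by (intro mult_left_mono dy_near) auto
  finally show ?thesis by (simp add: ac_simps)
 qed
qed

lemma bb_finite_support:
 assumes "trig f" shows "\<exists>C. bb s f C"
proof -
 obtain M where M: "!!k. f k \<noteq> 0 ==> norm (freq k) \<le> M"
 proof -
  have "bdd_above ((%k. norm (freq k)) ` {k. f k \<noteq> 0})" using assms by (intro bdd_above_finite) auto
  then show ?thesis using that by (auto simp: bdd_above_def)
 qed
 obtain m where m: "2 ^ (J + 1) * M < 2 ^ m" using real_arch_pow[of 2] by auto
 define S where "S = (\<Sum>k | f k \<noteq> 0. cmod (f k))"
 have S: "cmod (ev f x) \<le> S" for x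
  unfolding ev_def S_def by (rule order_trans[OF norm_sum]) (simp add: norm_mult)
 define C where "C = (\<Sum>n\<le>m. annB wtB * S / dy s n)"
 have S0: "0 \<le> S" by (simp add: S_def sum_nonneg)
 have C0: "0 \<le> C" unfolding C_def by (intro sum_nonneg) (simp add: S0 annB_nonneg less_imp_le)
 have "bb s f C"
 proof (rule bbI)
  fix n x
  show "cmod (ev (%k. wt n k * f k) x) \<le> C * dy s n"
  proof (cases "n \<le> m")
   case True
   have "cmod (ev (%k. wt n k * f k) x) \<le> annB wtB * S"
    by (rule mult_bdD[OF mult_bd_wt assms S])
   also have "\<dots> = annB wtB * S / dy s n * dy s n" using dy_pos(1)[of s n] by (simp add: less_imp_neq[symmetric])
   also have "\<dots> \<le> C * dy s n"
    unfolding C_def using True S0 annB_nonneg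
    by (intro mult_right_mono member_le_sum) (auto simp: less_imp_le)
   finally show ?thesis .
  next
   case False
   have "wt n k * f k = 0" for k
   proof (rule ccontr)
    assume nz: "wt n k * f k \<noteq> 0"
    then have "freq_in n k" using lp_weight_freq_in by auto
    then have "2 ^ n \<le> 2 ^ (J + 1) * norm (freq k)" using False by (auto simp: freq_in_def)
    also have "\<dots> \<le> 2 ^ (J + 1) * M" using nz M by (intro mult_left_mono) auto
    also have "\<dots> < 2 ^ m" by (rule m)
    finally show False using False by (auto dest: power_less_imp_less_exp[rotated])
   qed
   then have "(%k. wt n k * f k) = (%k. 0)" by (simp add: fun_eq_iff)
   then show ?thesis using C0 by (simp add: ev_zero)
  qed
 qed
 then show ?thesis ..
qed

end

section \<open>Products of distributions\<close>

lemma conv_fin_eq: "finite A ==> (!!l. l \<notin> A ==> g l = 0) ==> conv_fin f g k = (\<Sum>l\<in>A. f (k - l) * g l)"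
 unfolding conv_fin_def by (rule sum.mono_neutral_left) auto

lemma conv_fin_trig_eq: "trig g ==> conv_fin f g k = (\<Sum>l | g l \<noteq> 0. f (k - l) * g l)"
 by (rule conv_fin_eq) auto

lemma conv_fin_nonzero: "conv_fin f g k \<noteq> 0 ==> \<exists>l. f (k - l) \<noteq> 0 \<and> g l \<noteq> 0"
 unfolding conv_fin_def by (metis (mono_tags, lifting) empty_Collect_eq sum.empty)

lemma trig_conv_fin:
 assumes "trig f" "trig g" shows "trig (conv_fin f g)"
proof (rule trigI)
 let ?A = "(%(a, b). a + b) ` ({k. f k \<noteq> 0} \<times> {k. g k \<noteq> 0})"
 show "finite ?A" using assms by auto
 show "conv_fin f g k = 0" if "k \<notin> ?A" for k
 proof (rule ccontr)
  assume "conv_fin f g k \<noteq> 0"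
  then obtain l where "f (k - l) \<noteq> 0" "g l \<noteq> 0" using conv_fin_nonzero by blast
  then have "(k - l, l) \<in> {k. f k \<noteq> 0} \<times> {k. g k \<noteq> 0}" by auto
  then have "(%(a, b). a + b) (k - l, l) \<in> ?A" by (rule imageI)
  then show False using that by simp
 qed
qed

lemma ev_conv_fin:
 assumes f: "trig f" and g: "trig g" shows "ev (conv_fin f g) x = ev f x * ev g x"
proof -
 have "conv_fin f g = (%k. \<Sum>l | g l \<noteq> 0. g l * f (k + (- l)))"
  by (simp add: conv_fin_trig_eq[OF g] fun_eq_iff mult.commute)
 then have "ev (conv_fin f g) x = (\<Sum>l | g l \<noteq> 0. g l * (ekx (- (- l)) x * ev f x))"
  using g f by (simp only:, subst ev_sum)
   (simp_all only: ev_cmult ev_shift trig_mult2)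
 then show ?thesis by (simp add: ev_def[of g] sum_distrib_left sum_distrib_right ac_simps)
qed

lemma conv_fin_sum_left: "trig g ==> conv_fin (%k. \<Sum>i\<in>I. f i k) g k = (\<Sum>i\<in>I. conv_fin (f i) g k)"
 by (simp add: conv_fin_trig_eq sum_distrib_right) (rule sum.swap)

lemma conv_fin_sum_right:
 assumes "finite I" "!!i. i \<in> I ==> trig (g i)"
 shows "conv_fin f (%k. \<Sum>i\<in>I. g i k) k = (\<Sum>i\<in>I. conv_fin f (g i) k)"
proof -
 define A where "A = (\<Union>i\<in>I. {k. g i k \<noteq> 0})"
 have A: "finite A" using assms by (auto simp: A_def)
 have z: "g i l = 0" if "i \<in> I" "l \<notin> A" for i l using that by (auto simp: A_def)
 have "conv_fin f (%k. \<Sum>i\<in>I. g i k) k = (\<Sum>l\<in>A. f (k - l) * (\<Sum>i\<in>I. g i l))"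
  by (rule conv_fin_eq[OF A]) (simp add: z)
 also have "\<dots> = (\<Sum>i\<in>I. \<Sum>l\<in>A. f (k - l) * g i l)"
  by (simp add: sum_distrib_left) (rule sum.swap)
 also have "\<dots> = (\<Sum>i\<in>I. conv_fin f (g i) k)"
  by (intro sum.cong refl conv_fin_eq[symmetric] A z)
 finally show ?thesis .
qed

lemma conv_fin_diff_left: "trig g ==> conv_fin (%k. f k - f' k) g k = conv_fin f g k - conv_fin f' g k"
 by (simp add: conv_fin_trig_eq sum_subtractf left_diff_distrib)

lemma conv_fin_diff_right:
 assumes "trig g" "trig g'" shows "conv_fin f (%k. g k - g' k) k = conv_fin f g k - conv_fin f g' k"
proof -
 let ?A = "{k. g k \<noteq> 0} \<union> {k. g' k \<noteq> 0}"
 have A: "finite ?A" using assms by auto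
 show ?thesis
  by (subst (1 2 3) conv_fin_eq[OF A]) (auto simp: sum_subtractf right_diff_distrib)
qed

lemma sum_geometric_upper:
 fixes q :: real
 assumes "0 < q" "q < 1" "finite S" "!!i. i \<in> S ==> m \<le> i"
 shows "(\<Sum>i\<in>S. q ^ i) \<le> q ^ m / (1 - q)"
proof -
 have inj: "inj_on (%i. i - m) S" using assms(4) by (auto simp: inj_on_def) (metis le_add_diff_inverse2)
 have "(\<Sum>i\<in>S. q ^ i) = (\<Sum>i\<in>S. q ^ m * q ^ (i - m))"
  using assms(4) by (intro sum.cong) (auto simp flip: power_add)
 also have "\<dots> = q ^ m * (\<Sum>j\<in>(%i. i - m) ` S. q ^ j)" by (simp add: sum.reindex[OF inj] sum_distrib_left)
 also have "\<dots> \<le> q ^ m * (1 / (1 - q))"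
 proof (intro mult_left_mono)
  have "(\<Sum>j\<in>(%i. i - m) ` S. q ^ j) \<le> suminf (%j. q ^ j)"
   using assms by (intro sum_le_suminf summable_geometric) auto
  then show "(\<Sum>j\<in>(%i. i - m) ` S. q ^ j) \<le> 1 / (1 - q)"
   using assms by (simp add: suminf_geometric)
 qed (use assms in auto)
 finally show ?thesis by simp
qed

context littlewood_paley
begin

text \<open>With the absolute value, one constant serves both decaying tails (d > 0) and growing
  heads (d < 0) of the dyadic weights.\<close>

definition geoC :: "real => real" where "geoC d = 2 powr \<bar>d\<bar> / (1 - 2 powr (- \<bar>d\<bar>))"

lemma geoC_nonneg: "d \<noteq> 0 ==> 0 \<le> geoC d"
 unfolding geoC_def using powr_mono[of "- \<bar>d\<bar>" 0 2] by (intro divide_nonneg_nonneg) auto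

lemma dy_power: "dy d i = 2 powr d * (2 powr (- d)) ^ i"
 by (simp add: dy_def powr_realpow[symmetric] powr_powr powr_add[symmetric] algebra_simps)

lemma sum_dy_tail:
 assumes "0 < d" "finite S" "!!i. i \<in> S ==> n \<le> i + c"
 shows "(\<Sum>i\<in>S. dy d i) \<le> geoC d * 2 powr (d * c) * 2 powr (- d * n)"
proof -
 have q: "0 < 2 powr (- d)" "2 powr (- d) < (1::real)" using assms by (auto simp: powr_less_one)
 have "(\<Sum>i\<in>S. dy d i) = 2 powr d * (\<Sum>i\<in>S. (2 powr (- d)) ^ i)"
  by (simp add: dy_power sum_distrib_left)
 also have "\<dots> \<le> 2 powr d * ((2 powr (- d)) ^ (n - c) / (1 - 2 powr (- d)))"
  using assms(3) by (intro mult_left_mono sum_geometric_upper q assms(2)) (auto simp: le_diff_conv)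
 also have "\<dots> \<le> 2 powr d * (2 powr (d * c + - d * n) / (1 - 2 powr (- d)))"
 proof -
  have "(2 powr (- d)) ^ (n - c) = 2 powr (- d * real (n - c))"
   by (simp add: powr_powr flip: powr_realpow)
  moreover have "d * (real n - real c) \<le> d * real (n - c)" using assms(1) by (intro mult_left_mono) auto
  ultimately have "(2 powr (- d)) ^ (n - c) \<le> 2 powr (d * c + - d * n)" by (simp add: algebra_simps)
  then show ?thesis using q by (intro mult_left_mono divide_right_mono) auto
 qed
 also have "\<dots> = geoC d * 2 powr (d * c) * 2 powr (- d * n)"
  using assms(1) by (simp only: geoC_def powr_add abs_of_pos times_divide_eq_left times_divide_eq_right mult.assoc)
 finally show ?thesis .
qed

lemma sum_dy_all: "0 < d ==> finite S ==> (\<Sum>i\<in>S. dy d i) \<le> geoC d"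
 using sum_dy_tail[of d S 0 0] by simp

lemma sum_dy_head:
 assumes "b < 0" shows "(\<Sum>j\<le>m. dy b j) \<le> geoC b * 2 powr (- b * m)"
proof -
 have q: "0 < 2 powr b" "2 powr b < (1::real)" using assms by (auto simp: powr_less_one)
 have "(\<Sum>j\<le>m. dy b j) = (\<Sum>j\<le>m. dy b (m - j))"
  by (rule sum.reindex_bij_witness[of _ "%j. m - j" "%j. m - j"]) auto
 also have "\<dots> = (\<Sum>j\<le>m. 2 powr (- b * m) * (2 powr b * (2 powr b) ^ j))"
  by (intro sum.cong refl) (simp add: dy_def powr_realpow[symmetric] powr_powr powr_add[symmetric] algebra_simps of_nat_diff)
 also have "\<dots> = 2 powr (- b * m) * (2 powr b * (\<Sum>j\<le>m. (2 powr b) ^ j))" by (simp add: sum_distrib_left)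
 also have "\<dots> \<le> 2 powr (- b * m) * (2 powr b * (1 / (1 - 2 powr b)))"
  using sum_geometric_upper[OF q, of "{..m}" 0] by (intro mult_left_mono) auto
 also have "\<dots> \<le> 2 powr (- b * m) * geoC b"
 proof -
  have "2 powr b \<le> 2 powr \<bar>b\<bar>" by simp
  then show ?thesis using q assms by (auto simp: geoC_def divide_right_mono)
 qed
 finally show ?thesis by (simp add: mult.commute)
qed

text \<open>The regularities for which a product with a C^\<beta> function stays in C^b. Excluding b
  = 0 avoids the logarithm in the sum of the low blocks.\<close>

definition adm :: "real => real => bool" where
 "adm \<beta> b \<longleftrightarrow> 0 < \<beta> \<and> b \<le> \<beta> \<and> 0 < \<beta> + b \<and> b \<noteq> 0"

lemma bb_sup_partial:
 assumes "0 < \<beta>" "bb \<beta> f A" "finite I"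
 shows "cmod (ev (%k. \<Sum>i\<in>I. wt i k * f k) x) \<le> A * geoC \<beta>"
proof -
 have "cmod (ev (%k. \<Sum>i\<in>I. wt i k * f k) x) \<le> (\<Sum>i\<in>I. A * dy \<beta> i)"
  by (subst ev_sum[OF assms(3) trig_wt_mult], rule sum_norm_le, rule bbD, rule assms)
 also have "\<dots> \<le> A * geoC \<beta>"
  using sum_dy_all[OF assms(1,3)] bb_nonneg[OF assms(2)] by (simp add: mult_left_mono flip: sum_distrib_left)
 finally show ?thesis .
qed

lemma bb_head_partial:
 assumes "b \<noteq> 0" "bb b g B" "I \<subseteq> {..m}"
 shows "cmod (ev (%k. \<Sum>j\<in>I. wt j k * g k) x) \<le> B * geoC b * 2 powr (max 0 (- b) * m)"
proof -
 have fin: "finite I" using assms(3) finite_subset by blast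
 have B: "0 \<le> B" using bb_nonneg[OF assms(2)] .
 show ?thesis
 proof (cases "b < 0")
  case True
  have "cmod (ev (%k. \<Sum>j\<in>I. wt j k * g k) x) \<le> (\<Sum>j\<in>I. B * dy b j)"
   by (subst ev_sum[OF fin trig_wt_mult], rule sum_norm_le, rule bbD, rule assms)
  also have "\<dots> \<le> (\<Sum>j\<le>m. B * dy b j)" using assms(3) B by (intro sum_mono2) auto
  also have "\<dots> \<le> B * (geoC b * 2 powr (- b * m))"
   using sum_dy_head[OF True, of m] B by (simp add: mult_left_mono flip: sum_distrib_left)
  finally show ?thesis using True by (simp add: mult.assoc)
 next
  case False
  then show ?thesis using bb_sup_partial[OF _ assms(2) fin, of x] assms(1) by simp
 qed
qed

text \<open>Bony decomposition: the pairs \<open>i + gap < j\<close> of blocks produce frequencies comparable to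
 \<open>2 ^ j\<close>, the others frequencies bounded by \<open>2 ^ i\<close> up to a constant.\<close>

definition bonyC :: "real => real => real" where
 "bonyC \<beta> b = annB wtB * geoC \<beta> * nearC b +
  annB wtB * geoC b * 2 powr (max 0 (- b) * (gap + 1)) * (geoC (\<beta> - max 0 (- b)) * 2 powr ((\<beta> - max 0 (- b)) * (2 * gap)) * 2 powr \<bar>b\<bar>)"

lemma bilinear_trig:
 assumes adm: "adm \<beta> b" and f: "trig f" "bb \<beta> f A" and g: "trig g" "bb b g B"
 shows "bb b (conv_fin f g) (bonyC \<beta> b * A * B)"
proof (rule bbI)
 fix n x
 let ?c = "max 0 (- b)" let ?d = "\<beta> - max 0 (- b)"
 have A: "0 \<le> A" and B: "0 \<le> B" using f g bb_nonneg by blast+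
 have ab: "0 < \<beta>" "b \<noteq> 0" "0 < ?d" "b \<le> ?d" using adm by (auto simp: adm_def)
 have aw: "0 \<le> annB wtB" by (rule annB_nonneg)
 obtain M where M: "f k = (\<Sum>i<M. wt i k * f k)" "g k = (\<Sum>i<M. wt i k * g k)" for k
 proof -
  have fin: "finite ({k. f k \<noteq> 0} \<union> {k. g k \<noteq> 0})" using f g by simp
  have "eventually (%M. \<forall>k\<in>{k. f k \<noteq> 0} \<union> {k. g k \<noteq> 0}. Schi M k = 1) sequentially"
   using Schi_eventually_1 by (intro eventually_ball_finite[OF fin]) blast
  then obtain M where "\<forall>k\<in>{k. f k \<noteq> 0} \<union> {k. g k \<noteq> 0}. Schi M k = 1"
   by (auto simp: eventually_sequentially)
  then have "(f k \<noteq> 0 --> Schi M k = 1) \<and> (g k \<noteq> 0 --> Schi M k = 1)" for k by blast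
  then have S: "f k = Schi M k * f k" "g k = Schi M k * g k" for k by (cases "f k = 0"; cases "g k = 0"; simp)+
  have "(\<Sum>i<M. wt i k * h k) = Schi M k * h k" for h :: dist and k
   unfolding Schi_def by (rule sum_distrib_right[symmetric])
  with S show ?thesis by (intro that[of M]) metis+
 qed
 define fi where "fi i k = wt i k * f k" for i k
 define gj where "gj j k = wt j k * g k" for j k
 have trf: "trig (fi i)" and trg: "trig (gj i)" for i unfolding fi_def[abs_def] gj_def[abs_def] by (rule trig_wt_mult)+
 define F where "F j k = (\<Sum>i\<in>{i. i < M \<and> i + gap < j}. fi i k)" for j k
 define G where "G i k = (\<Sum>j\<in>{j. j < M \<and> j \<le> i + gap}. gj j k)" for i k
 have trF: "trig (F j)" and trG: "trig (G j)" for j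
  unfolding F_def[abs_def] G_def[abs_def] by (intro trig_sum trf trg; simp)+
 have decomp: "conv_fin f g k = (\<Sum>j<M. conv_fin (F j) (gj j) k) + (\<Sum>i<M. conv_fin (fi i) (G i) k)" for k
 proof -
  have fs: "f = (%k. \<Sum>i<M. fi i k)" and gs: "g = (%k. \<Sum>j<M. gj j k)"
   unfolding fi_def gj_def by (rule ext, rule M)+
  have "conv_fin f g k = (\<Sum>i<M. conv_fin (fi i) g k)"
   by (subst fs) (rule conv_fin_sum_left[OF g(1)])
  also have "\<dots> = (\<Sum>i<M. \<Sum>j<M. conv_fin (fi i) (gj j) k)"
   by (intro sum.cong refl, subst gs, rule conv_fin_sum_right) (auto simp: trg)
  also have "\<dots> = (\<Sum>i<M. \<Sum>j<M. (if i + gap < j then conv_fin (fi i) (gj j) k else 0) + (if j \<le> i + gap then conv_fin (fi i) (gj j) k else 0))"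
   by (intro sum.cong refl) auto
  also have "\<dots> = (\<Sum>i<M. \<Sum>j<M. if i + gap < j then conv_fin (fi i) (gj j) k else 0) + (\<Sum>i<M. \<Sum>j<M. if j \<le> i + gap then conv_fin (fi i) (gj j) k else 0)"
   by (simp only: sum.distrib)
  also have "(\<Sum>i<M. \<Sum>j<M. if i + gap < j then conv_fin (fi i) (gj j) k else 0) = (\<Sum>j<M. \<Sum>i<M. if i + gap < j then conv_fin (fi i) (gj j) k else 0)"
   by (rule sum.swap)
  also have "\<dots> = (\<Sum>j<M. conv_fin (F j) (gj j) k)"
   unfolding F_def by (intro sum.cong refl, subst conv_fin_sum_left[OF trg], rule sum.mono_neutral_cong_right) auto
  also have "(\<Sum>i<M. \<Sum>j<M. if j \<le> i + gap then conv_fin (fi i) (gj j) k else 0) = (\<Sum>i<M. conv_fin (fi i) (G i) k)"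
   unfolding G_def by (intro sum.cong refl, subst conv_fin_sum_right, simp, rule trg, rule sum.mono_neutral_cong_right) auto
  finally show ?thesis .
 qed
 \<comment> \<open>The low factor has frequency at most 2 ^ (j - J - 3), block j has frequency at
   least 2 ^ (j - J - 1); their sum therefore remains comparable to 2 ^ j.\<close>
 have freqF: "norm (freq k) * 2 ^ (J + 3) \<le> 2 ^ j" if "F j k \<noteq> 0" for j k
 proof -
  from that obtain i where i: "i + gap < j" "fi i k \<noteq> 0"
   unfolding F_def by (metis (mono_tags, lifting) mem_Collect_eq sum.neutral)
  then have "norm (freq k) \<le> 2 ^ (J + i)" using lp_weight_freq_in[of i k] by (auto simp: fi_def freq_in_def)
  then have "norm (freq k) * 2 ^ (J + 3) \<le> 2 ^ (J + i) * 2 ^ (J + 3)" by (intro mult_right_mono) auto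
  also have "\<dots> = 2 ^ (J + i + (J + 3))" by (simp only: power_add)
  also have "\<dots> \<le> (2::real) ^ j" using i by (intro power_increasing) auto
  finally show ?thesis .
 qed
 have freqG: "norm (freq k) \<le> 2 ^ (J + (i + gap))" if "G i k \<noteq> 0" for i k
 proof -
  from that obtain j where j: "j \<le> i + gap" "gj j k \<noteq> 0"
   unfolding G_def by (metis (mono_tags, lifting) mem_Collect_eq sum.neutral)
  then have "norm (freq k) \<le> 2 ^ (J + j)" using lp_weight_freq_in[of j k] by (auto simp: gj_def freq_in_def)
  also have "\<dots> \<le> 2 ^ (J + (i + gap))" using j by (intro power_increasing) auto
  finally show ?thesis .
 qed
 have norm_split: "norm (freq k) \<le> norm (freq (k - l)) + norm (freq l)" "norm (freq l) \<le> norm (freq k) + norm (freq (k - l))" for k l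
 proof -
  have e: "freq k = freq (k - l) + freq l" by (simp flip: freq_add)
  show "norm (freq k) \<le> norm (freq (k - l)) + norm (freq l)" unfolding e by (rule norm_triangle_ineq)
  show "norm (freq l) \<le> norm (freq k) + norm (freq (k - l))" unfolding e using norm_triangle_ineq4[of "freq (k-l) + freq l" "freq (k - l)"] by simp
 qed
 have zero1: "wt n k * conv_fin (F j) (gj j) k = 0" if "j \<notin> near n" for j k
 proof (rule ccontr)
  assume "wt n k * conv_fin (F j) (gj j) k \<noteq> 0"
  then have w: "wt n k \<noteq> 0" and c: "conv_fin (F j) (gj j) k \<noteq> 0" by auto
  from c obtain l where l: "F j (k - l) \<noteq> 0" "gj j l \<noteq> 0" using conv_fin_nonzero by blast
  have "j \<noteq> 0"
  proof
   assume "j = 0"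
   then have "F j (k - l) = 0" unfolding F_def by (intro sum.neutral) auto
   then show False using l(1) by simp
  qed
  have n: "norm (freq k) \<le> 2 ^ (J + n)" "n \<noteq> 0 ==> 2 ^ n \<le> 2 ^ (J + 1) * norm (freq k)"
   using w lp_weight_freq_in[of n k] by (auto simp: freq_in_def)
  have jl: "norm (freq l) \<le> 2 ^ (J + j)" "2 ^ j \<le> 2 ^ (J + 1) * norm (freq l)"
   using l(2) lp_weight_freq_in[of j l] \<open>j \<noteq> 0\<close> by (auto simp: gj_def freq_in_def)
  note fF = freqF[OF l(1)]
  have "2 ^ (J + 1) * norm (freq l) \<le> 2 ^ (J + 1) * (norm (freq k) + norm (freq (k - l)))"
   using norm_split(2)[of l k] by (intro mult_left_mono) auto
  with jl(2) have "(2::real) ^ j \<le> 2 ^ (J + 1) * (norm (freq k) + norm (freq (k - l)))" by (rule order_trans)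
  then have "4 * 2 ^ j \<le> 2 ^ (J + 3) * norm (freq k) + norm (freq (k - l)) * 2 ^ (J + 3)"
   by (simp add: power_add algebra_simps)
  then have "2 ^ j \<le> 2 ^ (J + 3) * norm (freq k)" using fF zero_le_power[of "2::real" j] by linarith
  then have "3 * 2 ^ j \<le> 2 ^ (J + 3) * norm (freq k)"
   using fF \<open>4 * 2 ^ j \<le> _\<close> by linarith
  then have "2 * 2 ^ j \<le> 2 ^ (J + 3) * norm (freq k)" using zero_le_power[of "2::real" j] by linarith
  then have "2 ^ j \<le> 2 ^ (J + 2) * norm (freq k)" by (simp add: power_add ac_simps)
  also have "\<dots> \<le> 2 ^ (J + 2) * 2 ^ (J + n)" using n(1) by (intro mult_left_mono) auto
  also have "\<dots> = 2 ^ (J + 2 + (J + n))" by (simp only: power_add)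
  finally have "j \<le> J + 2 + (J + n)" by (rule power_le_imp_le_exp[rotated]) simp
  moreover have "n \<le> j + gap"
  proof (cases "n = 0")
   case False
   have "norm (freq (k - l)) \<le> norm (freq (k - l)) * 2 ^ (J + 3)"
    using mult_left_mono[of 1 "2 ^ (J + 3)" "norm (freq (k - l))"] by simp
   then have "norm (freq (k - l)) \<le> 2 ^ (J + j)"
    using fF power_increasing[of j "J + j" "2::real"] by linarith
   then have "norm (freq k) \<le> 2 * 2 ^ (J + j)" using jl(1) norm_split(1)[of k l] by linarith
   then have "2 ^ (J + 1) * norm (freq k) \<le> 2 ^ (J + 1) * (2 * 2 ^ (J + j))"
    by (intro mult_left_mono) auto
   with n(2)[OF False] have "2 ^ n \<le> 2 ^ (J + 1) * (2 * 2 ^ (J + j) :: real)" by (rule order_trans)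
   also have "\<dots> = 2 ^ (J + 1 + (1 + (J + j)))" by (simp only: power_add power_one_right)
   finally have "n \<le> J + 1 + (1 + (J + j))" by (rule power_le_imp_le_exp[rotated]) simp
   then show ?thesis by simp
  qed simp
  ultimately show False using that by auto
 qed
 have zero2: "wt n k * conv_fin (fi i) (G i) k = 0" if "\<not> n \<le> i + 2 * gap" for i k
 proof (rule ccontr)
  assume "wt n k * conv_fin (fi i) (G i) k \<noteq> 0"
  then have w: "wt n k \<noteq> 0" and c: "conv_fin (fi i) (G i) k \<noteq> 0" by auto
  from c obtain l where l: "fi i (k - l) \<noteq> 0" "G i l \<noteq> 0" using conv_fin_nonzero by blast
  have n: "2 ^ n \<le> 2 ^ (J + 1) * norm (freq k)"
   using w lp_weight_freq_in[of n k] that by (auto simp: freq_in_def)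
  have "norm (freq (k - l)) \<le> 2 ^ (J + i)"
   using l(1) lp_weight_freq_in[of i "k - l"] by (auto simp: fi_def freq_in_def)
  also have "\<dots> \<le> 2 ^ (J + (i + gap))" by (intro power_increasing) auto
  finally have "norm (freq k) \<le> 2 * 2 ^ (J + (i + gap))"
   using freqG[OF l(2)] norm_split(1)[of k l] by linarith
  then have "2 ^ (J + 1) * norm (freq k) \<le> 2 ^ (J + 1) * (2 * 2 ^ (J + (i + gap)))"
   by (intro mult_left_mono) auto
  with n have "2 ^ n \<le> 2 ^ (J + 1) * (2 * 2 ^ (J + (i + gap)) :: real)" by (rule order_trans)
  also have "\<dots> = 2 ^ (J + 1 + (1 + (J + (i + gap))))" by (simp only: power_add power_one_right)
  finally have "n \<le> J + 1 + (1 + (J + (i + gap)))" by (rule power_le_imp_le_exp[rotated]) simp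
  then show False using that by simp
 qed
 have block: "cmod (ev (%k. wt n k * conv_fin p q k) x) \<le> annB wtB * (P * Q)"
  if "trig p" "trig q" "!!x. cmod (ev p x) \<le> P" "!!x. cmod (ev q x) \<le> Q" for p q P Q
 proof (rule mult_bdD[OF mult_bd_wt trig_conv_fin[OF that(1,2)]])
  fix y show "cmod (ev (conv_fin p q) y) \<le> P * Q"
   using that(3,4)[of y] by (auto simp: ev_conv_fin[OF that(1,2)] norm_mult intro!: mult_mono intro: order_trans[OF norm_ge_zero])
 qed
 \<comment> \<open>Paraproduct with f at low frequency: only j near n survive, the partial sums of f
   are bounded because \<beta> > 0, and the regularity b comes from the block of g.\<close>
 have T1: "cmod (ev (%k. wt n k * conv_fin (F j) (gj j) k) x) \<le> (if j \<in> near n then annB wtB * (A * geoC \<beta> * (B * dy b j)) else 0)" for j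
 proof (cases "j \<in> near n")
  case True
  have "cmod (ev (F j) x) \<le> A * geoC \<beta>" for x
   unfolding F_def[abs_def] fi_def by (rule bb_sup_partial[OF ab(1) f(2)]) simp
  moreover have "cmod (ev (gj j) x) \<le> B * dy b j" for x
   unfolding gj_def[abs_def] by (rule bbD[OF g(2)])
  ultimately show ?thesis using True block[OF trF trg] by simp
 next
  case False
  have "(%k. wt n k * conv_fin (F j) (gj j) k) = (%k. 0)" using zero1[OF False] by (rule ext)
  then show ?thesis using False by (simp only: ev_zero norm_zero if_False order_refl)
 qed
 \<comment> \<open>Here f sits at the higher or a comparable frequency. The head of g costs 2 ^ (max
   0 (- b) i) and the block of f gains 2 ^ (- \<beta> i). Since \<open>?d\<close> is positive the
   sum over i \<ge> n - 2 gap is geometric, and \<open>?d\<close> \<ge> b restores the weight of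
   block n.\<close>
 have T2: "cmod (ev (%k. wt n k * conv_fin (fi i) (G i) k) x) \<le> (if n \<le> i + 2 * gap then annB wtB * (A * dy \<beta> i * (B * geoC b * 2 powr (?c * real (i + gap)))) else 0)" for i
 proof (cases "n \<le> i + 2 * gap")
  case True
  have "cmod (ev (G i) x) \<le> B * geoC b * 2 powr (?c * real (i + gap))" for x
   unfolding G_def[abs_def] gj_def by (rule bb_head_partial[OF ab(2) g(2)]) auto
  moreover have "cmod (ev (fi i) x) \<le> A * dy \<beta> i" for x
   unfolding fi_def[abs_def] by (rule bbD[OF f(2)])
  ultimately show ?thesis using True block[OF trf trG] by simp
 next
  case False
  have "(%k. wt n k * conv_fin (fi i) (G i) k) = (%k. 0)" using zero2[OF False] by (rule ext)
  then show ?thesis using False by (simp only: ev_zero norm_zero if_False order_refl)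
 qed
 have "ev (%k. wt n k * conv_fin f g k) x = (\<Sum>j<M. ev (%k. wt n k * conv_fin (F j) (gj j) k) x) + (\<Sum>i<M. ev (%k. wt n k * conv_fin (fi i) (G i) k) x)"
 proof -
  have "(%k. wt n k * conv_fin f g k) = (%k. (\<Sum>j<M. wt n k * conv_fin (F j) (gj j) k) + (\<Sum>i<M. wt n k * conv_fin (fi i) (G i) k))"
   by (simp only: decomp distrib_left sum_distrib_left)
  then show ?thesis
   by (simp only: ev_add[OF trig_sum[OF finite_lessThan trig_wt_mult] trig_sum[OF finite_lessThan trig_wt_mult]]
     ev_sum[OF finite_lessThan trig_wt_mult])
 qed
 then have "cmod (ev (%k. wt n k * conv_fin f g k) x) \<le> (\<Sum>j<M. cmod (ev (%k. wt n k * conv_fin (F j) (gj j) k) x)) + (\<Sum>i<M. cmod (ev (%k. wt n k * conv_fin (fi i) (G i) k) x))"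
  by (simp only:) (intro norm_triangle_mono norm_sum)
 also have "\<dots> \<le> (\<Sum>j<M. if j \<in> near n then annB wtB * (A * geoC \<beta> * (B * dy b j)) else 0) +
   (\<Sum>i<M. if n \<le> i + 2 * gap then annB wtB * (A * dy \<beta> i * (B * geoC b * 2 powr (?c * real (i + gap)))) else 0)"
  by (intro add_mono sum_mono T1 T2)
 also have "(\<Sum>j<M. if j \<in> near n then annB wtB * (A * geoC \<beta> * (B * dy b j)) else 0) \<le> annB wtB * (A * geoC \<beta> * B) * (nearC b * dy b n)"
 proof -
  have "(\<Sum>j<M. if j \<in> near n then annB wtB * (A * geoC \<beta> * (B * dy b j)) else 0) = (\<Sum>j\<in>{..<M} \<inter> near n. annB wtB * (A * geoC \<beta> * (B * dy b j)))"
   by (rule sum.inter_restrict[symmetric]) simp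
  also have "\<dots> \<le> (\<Sum>j\<in>near n. annB wtB * (A * geoC \<beta> * (B * dy b j)))"
   using A B aw geoC_nonneg[of \<beta>] ab by (intro sum_mono2) auto
  also have "\<dots> = annB wtB * (A * geoC \<beta> * B) * (\<Sum>j\<in>near n. dy b j)" by (simp add: sum_distrib_left ac_simps)
  also have "\<dots> \<le> annB wtB * (A * geoC \<beta> * B) * (nearC b * dy b n)"
   using A B aw geoC_nonneg[of \<beta>] ab by (intro mult_left_mono sum_dy_near) auto
  finally show ?thesis .
 qed
 also have "(\<Sum>i<M. if n \<le> i + 2 * gap then annB wtB * (A * dy \<beta> i * (B * geoC b * 2 powr (?c * real (i + gap)))) else 0)
   \<le> annB wtB * (A * B * geoC b * 2 powr (?c * (gap + 1))) * (geoC ?d * 2 powr (?d * (2 * gap)) * (2 powr \<bar>b\<bar> * dy b n))"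
 proof -
  have h: "dy \<beta> i * 2 powr (?c * real (i + gap)) = 2 powr (?c * (gap + 1)) * dy ?d i" for i
   by (simp add: dy_def powr_add[symmetric] algebra_simps)
  have e: "annB wtB * (A * dy \<beta> i * (B * geoC b * 2 powr (?c * real (i + gap)))) = annB wtB * (A * B * geoC b * 2 powr (?c * (gap + 1))) * dy ?d i" for i
  proof -
   have "annB wtB * (A * dy \<beta> i * (B * geoC b * 2 powr (?c * real (i + gap)))) = annB wtB * (A * B * geoC b) * (dy \<beta> i * 2 powr (?c * real (i + gap)))"
    by (simp only: ac_simps)
   then show ?thesis by (simp only: h mult.assoc)
  qed
  have "(\<Sum>i<M. if n \<le> i + 2 * gap then annB wtB * (A * dy \<beta> i * (B * geoC b * 2 powr (?c * real (i + gap)))) else 0) =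
   (\<Sum>i\<in>{..<M} \<inter> {i. n \<le> i + 2 * gap}. annB wtB * (A * B * geoC b * 2 powr (?c * (gap + 1))) * dy ?d i)"
  proof -
   have "(\<Sum>i<M. if n \<le> i + 2 * gap then annB wtB * (A * dy \<beta> i * (B * geoC b * 2 powr (?c * real (i + gap)))) else 0) =
    (\<Sum>i<M. if i \<in> {i. n \<le> i + 2 * gap} then annB wtB * (A * B * geoC b * 2 powr (?c * (gap + 1))) * dy ?d i else 0)"
    by (simp only: e mem_Collect_eq)
   also have "\<dots> = (\<Sum>i\<in>{..<M} \<inter> {i. n \<le> i + 2 * gap}. annB wtB * (A * B * geoC b * 2 powr (?c * (gap + 1))) * dy ?d i)"
    by (rule sum.inter_restrict[symmetric]) simp
   finally show ?thesis .
  qed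
  also have "\<dots> = annB wtB * (A * B * geoC b * 2 powr (?c * (gap + 1))) * (\<Sum>i\<in>{..<M} \<inter> {i. n \<le> i + 2 * gap}. dy ?d i)"
   by (simp only: sum_distrib_left)
  also have "\<dots> \<le> annB wtB * (A * B * geoC b * 2 powr (?c * (gap + 1))) * (geoC ?d * 2 powr (?d * (2 * gap)) * 2 powr (- ?d * n))"
   using A B aw geoC_nonneg[of b] ab sum_dy_tail[of ?d "{..<M} \<inter> {i. n \<le> i + 2 * gap}" n "2 * gap"]
   by (intro mult_left_mono) auto
  also have "\<dots> \<le> annB wtB * (A * B * geoC b * 2 powr (?c * (gap + 1))) * (geoC ?d * 2 powr (?d * (2 * gap)) * (2 powr \<bar>b\<bar> * dy b n))"
  proof (intro mult_left_mono)
   have "- ?d * real n \<le> \<bar>b\<bar> + - b * (real n - 1)"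
    using mult_right_mono[of b ?d "real n"] ab adm by (auto simp: algebra_simps adm_def)
   then show "2 powr (- ?d * real n) \<le> 2 powr \<bar>b\<bar> * dy b n"
    unfolding dy_def by (subst powr_add[symmetric]) simp
  qed (use A B aw geoC_nonneg[of b] geoC_nonneg[of ?d] ab in auto)
  finally show ?thesis .
 qed
 finally show "cmod (ev (%k. wt n k * conv_fin f g k) x) \<le> bonyC \<beta> b * A * B * dy b n"
  by (simp add: bonyC_def algebra_simps)
qed

end

section \<open>Products as limits of truncations; powers and their Lipschitz bounds\<close>

context littlewood_paley
begin

text \<open>Admissibility is an open condition. The two choices of \<epsilon> keep the second
  exponent on its side of 0 and the sum of the exponents positive.\<close>

lemma adm_relax:
 assumes "adm \<beta> b" obtains \<epsilon> where "0 < \<epsilon>" "adm (\<beta> - \<epsilon>) (b - \<epsilon>)"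
proof (cases "0 < b")
 case True
 then show ?thesis using assms by (intro that[of "b / 2"]) (auto simp: adm_def)
next
 case False
 then show ?thesis using assms by (intro that[of "(\<beta> + b) / 4"]) (auto simp: adm_def field_simps)
qed

lemma low_pass_Suc: "low_pass chi rho (Suc N) f k = low_pass chi rho N f k + wt N k * f k"
 by (simp add: low_pass_eq Schi_def algebra_simps)

lemma trig_low_pass: "trig (low_pass chi rho N f)"
 unfolding low_pass_eq by (rule trig_mult1[OF trig_Schi])

lemma bb_low_pass: "bb s f C ==> bb s (low_pass chi rho N f) (SchiC * C)"
 unfolding low_pass_eq by (rule bb_Schi)

lemma low_pass_diff: "low_pass chi rho N (%k. f k - g k) = (%k. low_pass chi rho N f k - low_pass chi rho N g k)"
 by (simp add: low_pass_eq algebra_simps fun_eq_iff)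

lemma low_pass_trig: "trig f ==> eventually (%N. low_pass chi rho N f = f) sequentially"
proof -
 assume fin: "trig f"
 have "eventually (%M. \<forall>k\<in>{k. f k \<noteq> 0}. Schi M k = 1) sequentially"
  using Schi_eventually_1 by (intro eventually_ball_finite[OF fin]) blast
 then show ?thesis
  by eventually_elim (auto simp: low_pass_eq fun_eq_iff)
qed

text \<open>The product is defined by \<open>lim\<close>, so its convergence has to be proved before
  anything else. Consecutive truncated products differ by two products, each with a single block N
  as one factor; after giving up \<epsilon> of regularity that block has size 2 ^ (- \<epsilon> N),
  so the increments of each coefficient are summable.\<close>

lemma dprod_conv:
 assumes "adm \<beta> b" "bb \<beta> f A" "bb b g B"
 shows "(%N. conv_fin (low_pass chi rho N f) (low_pass chi rho N g) k) \<longlonglongrightarrow> dprod chi rho f g k"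
proof -
 obtain \<epsilon> where e: "0 < \<epsilon>" and adm': "adm (\<beta> - \<epsilon>) (b - \<epsilon>)" by (rule adm_relax[OF assms(1)])
 define h where "h N = conv_fin (low_pass chi rho N f) (low_pass chi rho N g) k" for N
 let ?K = "bonyC (\<beta> - \<epsilon>) (b - \<epsilon>)"
 define K1 where "K1 = ?K * (annB wtB * 2 powr (\<bar>\<beta> - \<epsilon>\<bar> * gap) * A) * (2 powr \<epsilon> * (SchiC * B)) * coeffC (b - \<epsilon>) k"
 define K2 where "K2 = ?K * (2 powr \<epsilon> * (SchiC * A)) * (annB wtB * 2 powr (\<bar>b - \<epsilon>\<bar> * gap) * B) * coeffC (b - \<epsilon>) k"
 have step: "cmod (h (Suc N) - h N) \<le> (K1 + K2) * 2 powr \<epsilon> * (2 powr (- \<epsilon>)) ^ N" for N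
 proof -
  define u where "u = conv_fin (%k. wt N k * f k) (low_pass chi rho (Suc N) g)"
  define v where "v = conv_fin (low_pass chi rho N f) (%k. wt N k * g k)"
  have dist_l: "(%k. low_pass chi rho (Suc N) f' k - low_pass chi rho N f' k) = (%k. wt N k * f' k)" for f'
   by (simp add: low_pass_Suc)
  have "h (Suc N) - h N = u k + v k"
   using conv_fin_diff_left[OF trig_low_pass, of "low_pass chi rho (Suc N) f" "low_pass chi rho N f" "Suc N" g k]
    conv_fin_diff_right[OF trig_low_pass trig_low_pass, of "low_pass chi rho N f" "Suc N" g N g k]
   by (simp add: h_def u_def v_def dist_l)
  moreover have "bb (b - \<epsilon>) u (?K * (annB wtB * 2 powr (\<bar>\<beta> - \<epsilon>\<bar> * gap) * A * dy \<epsilon> N) * (2 powr \<epsilon> * (SchiC * B)))"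
   unfolding u_def
  proof (rule bilinear_trig[OF adm' trig_wt_mult _ trig_low_pass])
   show "bb (\<beta> - \<epsilon>) (%k. wt N k * f k) (annB wtB * 2 powr (\<bar>\<beta> - \<epsilon>\<bar> * gap) * A * dy \<epsilon> N)"
    using bb_wt_block[OF assms(2), of "\<beta> - \<epsilon>" N] e by simp
   show "bb (b - \<epsilon>) (low_pass chi rho (Suc N) g) (2 powr \<epsilon> * (SchiC * B))"
    using bb_le_exponent[OF bb_low_pass[OF assms(3)], of "b - \<epsilon>" "Suc N"] e by simp
  qed
  from bb_coeff[OF this, of k] have "cmod (u k) \<le> K1 * dy \<epsilon> N" by (simp add: K1_def ac_simps)
  moreover have "bb (b - \<epsilon>) v (?K * (2 powr \<epsilon> * (SchiC * A)) * (annB wtB * 2 powr (\<bar>b - \<epsilon>\<bar> * gap) * B * dy \<epsilon> N))"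
   unfolding v_def
  proof (rule bilinear_trig[OF adm' trig_low_pass _ trig_wt_mult])
   show "bb (b - \<epsilon>) (%k. wt N k * g k) (annB wtB * 2 powr (\<bar>b - \<epsilon>\<bar> * gap) * B * dy \<epsilon> N)"
    using bb_wt_block[OF assms(3), of "b - \<epsilon>" N] e by simp
   show "bb (\<beta> - \<epsilon>) (low_pass chi rho N f) (2 powr \<epsilon> * (SchiC * A))"
    using bb_le_exponent[OF bb_low_pass[OF assms(2)], of "\<beta> - \<epsilon>" N] e by simp
  qed
  from bb_coeff[OF this, of k] have "cmod (v k) \<le> K2 * dy \<epsilon> N" by (simp add: K2_def ac_simps)
  ultimately have "cmod (h (Suc N) - h N) \<le> K1 * dy \<epsilon> N + K2 * dy \<epsilon> N"
   by (metis norm_triangle_mono)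
  then show ?thesis by (simp add: dy_power algebra_simps)
 qed
 have q: "2 powr (- \<epsilon>) < (1::real)" using e by (auto simp: powr_less_one)
 have "summable (%N. h (Suc N) - h N)"
  by (rule summable_comparison_test'[where N=0, OF summable_mult[OF summable_geometric]])
   (use step q in auto)
 then have "convergent (%N. \<Sum>n<N. h (Suc n) - h n)"
  by (simp add: summable_iff_convergent)
 then have "convergent (%N. h 0 + (\<Sum>n<N. h (Suc n) - h n))"
  by (intro convergent_add convergent_const)
 then have "convergent h" by (simp add: sum_lessThan_telescope)
 then show ?thesis
  unfolding dprod_def convergent_LIMSEQ_iff h_def[abs_def] .
qed

definition prodC :: "real => real => real" where "prodC \<beta> b = bonyC \<beta> b * SchiC * SchiC"

lemma bb_dprod:
 assumes "adm \<beta> b" "bb \<beta> f A" "bb b g B"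
 shows "bb b (dprod chi rho f g) (prodC \<beta> b * A * B)"
proof (rule bb_limit[OF _ dprod_conv[OF assms]])
 have "bb b (conv_fin (low_pass chi rho N f) (low_pass chi rho N g)) (prodC \<beta> b * A * B)" for N
  using bilinear_trig[OF assms(1) trig_low_pass bb_low_pass[OF assms(2)] trig_low_pass bb_low_pass[OF assms(3)], of N N]
  by (simp add: prodC_def ac_simps)
 then show "eventually (%N. bb b (conv_fin (low_pass chi rho N f) (low_pass chi rho N g)) (prodC \<beta> b * A * B)) sequentially"
  by simp
qed auto

lemma dprod_diff_left:
 assumes "adm \<beta> b" "bb \<beta> f A" "bb \<beta> f' A'" "bb b g B"
 shows "dprod chi rho (%k. f k - f' k) g = (%k. dprod chi rho f g k - dprod chi rho f' g k)"
proof
 fix k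
 have "(%N. conv_fin (low_pass chi rho N (%k. f k - f' k)) (low_pass chi rho N g) k) \<longlonglongrightarrow> dprod chi rho f g k - dprod chi rho f' g k"
  unfolding low_pass_diff conv_fin_diff_left[OF trig_low_pass]
  by (intro tendsto_diff dprod_conv[OF assms(1,2,4)] dprod_conv[OF assms(1,3,4)])
 then show "dprod chi rho (%k. f k - f' k) g k = dprod chi rho f g k - dprod chi rho f' g k"
  using dprod_conv[OF assms(1) bb_diff[OF assms(2,3)] assms(4)] LIMSEQ_unique by blast
qed

lemma dprod_diff_right:
 assumes "adm \<beta> b" "bb \<beta> f A" "bb b g B" "bb b g' B'"
 shows "dprod chi rho f (%k. g k - g' k) = (%k. dprod chi rho f g k - dprod chi rho f g' k)"
proof
 fix k
 have "(%N. conv_fin (low_pass chi rho N f) (low_pass chi rho N (%k. g k - g' k)) k) \<longlonglongrightarrow> dprod chi rho f g k - dprod chi rho f g' k"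
  unfolding low_pass_diff conv_fin_diff_right[OF trig_low_pass trig_low_pass]
  by (intro tendsto_diff dprod_conv[OF assms(1,2,3)] dprod_conv[OF assms(1,2,4)])
 then show "dprod chi rho f (%k. g k - g' k) k = dprod chi rho f g k - dprod chi rho f g' k"
  using dprod_conv[OF assms(1,2) bb_diff[OF assms(3,4)]] LIMSEQ_unique by blast
qed

lemma dprod_diff:
 assumes "adm \<beta> b" "bb \<beta> f A" "bb \<beta> f' A'" "bb b g B" "bb b g' B'"
 shows "(%k. dprod chi rho f g k - dprod chi rho f' g' k) =
  (%k. dprod chi rho (%k. f k - f' k) g k + dprod chi rho f' (%k. g k - g' k) k)"
 unfolding dprod_diff_left[OF assms(1-4)] dprod_diff_right[OF assms(1,3,4,5)] by simp

text \<open>Truncation eventually does nothing. On trigonometric polynomials the abstract product is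
  thus the pointwise one, and the energy method can compute pointwise.\<close>

lemma dprod_trig:
 assumes "trig f" "trig g" shows "dprod chi rho f g = conv_fin f g"
proof
 fix k
 have "eventually (%N. conv_fin (low_pass chi rho N f) (low_pass chi rho N g) k = conv_fin f g k) sequentially"
  using low_pass_trig[OF assms(1)] low_pass_trig[OF assms(2)] by eventually_elim simp
 then have "(%N. conv_fin (low_pass chi rho N f) (low_pass chi rho N g) k) \<longlonglongrightarrow> conv_fin f g k"
  by (rule tendsto_eventually)
 then show "dprod chi rho f g k = conv_fin f g k" unfolding dprod_def by (rule limI)
qed

lemma trig_dprod: "trig f ==> trig g ==> trig (dprod chi rho f g)"
 by (simp add: dprod_trig trig_conv_fin)

lemma ev_dprod: "trig f ==> trig g ==> ev (dprod chi rho f g) x = ev f x * ev g x"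
 by (simp add: dprod_trig ev_conv_fin)

lemma trig_dunit: "trig dunit"
 by (rule trigI[of "{(0, 0)}"]) (auto simp: dunit_def)

lemma ev_dunit: "ev dunit x = 1"
 using ev_eq[of "{(0, 0)}" dunit x] by (simp add: dunit_def)

lemma trig_dconj: assumes "trig f" shows "trig (dconj f)"
 using finite_imageI[OF assms, of uminus] by (rule rev_finite_subset) (force simp: dconj_def)

lemma ev_dconj: assumes "trig f" shows "ev (dconj f) x = cnj (ev f x)"
proof -
 have "ev (dconj f) x = (\<Sum>k\<in>uminus ` {k. f k \<noteq> 0}. dconj f k * ekx k x)"
  using assms by (intro ev_eq) (force simp: dconj_def)+
 also have "\<dots> = (\<Sum>k | f k \<noteq> 0. cnj (f k) * ekx (- k) x)"
  by (subst sum.reindex) (auto simp: inj_on_def dconj_def)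
 finally show ?thesis by (simp add: ev_def ekx_uminus)
qed

lemma dpow_0: "dpow chi rho f 0 = dunit" by (simp add: dpow_def)

lemma dpow_Suc: "dpow chi rho f (Suc n) = dprod chi rho f (dpow chi rho f n)"
 by (simp add: dpow_def)

lemma trig_dpow: "trig f ==> trig (dpow chi rho f n)"
 by (induction n) (simp_all add: dpow_0 dpow_Suc trig_dunit trig_dprod)

lemma ev_dpow: "trig f ==> ev (dpow chi rho f n) x = ev f x ^ n"
 by (induction n) (simp_all add: dpow_0 dpow_Suc ev_dunit ev_dprod trig_dpow)

definition unitC :: "real => real" where "unitC s = (SOME C. bb s dunit C)"

lemma bb_dunit: "bb s dunit (unitC s)"
 unfolding unitC_def using bb_finite_support[OF trig_dunit] by (rule someI_ex)

primrec powC :: "real => nat => real" where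
 "powC \<beta> 0 = unitC \<beta>"
| "powC \<beta> (Suc i) = prodC \<beta> \<beta> * powC \<beta> i"

lemma adm_self: "0 < \<beta> ==> adm \<beta> \<beta>" by (simp add: adm_def)

lemma bb_dpow: "0 < \<beta> ==> bb \<beta> f A ==> bb \<beta> (dpow chi rho f i) (powC \<beta> i * A ^ i)"
proof (induction i)
 case (Suc i)
 then show ?case
  using bb_dprod[OF adm_self Suc.prems(2) Suc.IH] by (simp add: dpow_Suc ac_simps)
qed (simp add: dpow_0 bb_dunit)

primrec powdC :: "real => nat => real" where
 "powdC \<beta> 0 = 0"
| "powdC \<beta> (Suc i) = prodC \<beta> \<beta> * powC \<beta> i + prodC \<beta> \<beta> * powdC \<beta> i"

text \<open>In the Lipschitz estimates the distance of the arguments is measured as a multiple \<open>\<epsilon>\<close> of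
 their common size \<open>A\<close>; this keeps the estimates homogeneous in \<open>A\<close>, including the power \<open>0\<close>.\<close>

lemma bb_dpow_diff:
 assumes "0 < \<beta>" "bb \<beta> f A" "bb \<beta> f' A" "bb \<beta> (%k. f k - f' k) (A * \<epsilon>)"
 shows "bb \<beta> (%k. dpow chi rho f i k - dpow chi rho f' i k) (powdC \<beta> i * A ^ i * \<epsilon>)"
proof (induction i)
 case (Suc i)
 have p: "bb \<beta> (dpow chi rho g i) (powC \<beta> i * A ^ i)" if "bb \<beta> g A" for g by (rule bb_dpow[OF assms(1) that])
 have "bb \<beta> (%k. dprod chi rho f (dpow chi rho f i) k - dprod chi rho f' (dpow chi rho f' i) k)
  (prodC \<beta> \<beta> * (A * \<epsilon>) * (powC \<beta> i * A ^ i) + prodC \<beta> \<beta> * A * (powdC \<beta> i * A ^ i * \<epsilon>))"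
  unfolding dprod_diff[OF adm_self[OF assms(1)] assms(2,3) p[OF assms(2)] p[OF assms(3)]]
  by (intro bb_add bb_dprod adm_self assms p Suc.IH)
 then show ?case by (simp add: dpow_Suc algebra_simps)
qed (simp add: dpow_0 bb_zero)

definition monom_term :: "nat => nat => dist => dist => dist" where
 "monom_term i j w \<zeta> = dprod chi rho (dprod chi rho (dpow chi rho w i) (dpow chi rho (dconj w) j)) \<zeta>"

lemma trig_monom_term: "trig w ==> trig \<zeta> ==> trig (monom_term i j w \<zeta>)"
 by (simp add: monom_term_def trig_dprod trig_dpow trig_dconj)

lemma ev_monom_term: "trig w ==> trig \<zeta> ==> ev (monom_term i j w \<zeta>) x = ev w x ^ i * cnj (ev w x) ^ j * ev \<zeta> x"
 by (simp add: monom_term_def ev_dprod trig_dprod ev_dpow trig_dpow trig_dconj ev_dconj)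

lemma bb_power_pair:
 assumes "0 < \<beta>" "bb \<beta> w A"
 shows "bb \<beta> (dprod chi rho (dpow chi rho w i) (dpow chi rho (dconj w) j))
  (prodC \<beta> \<beta> * powC \<beta> i * (powC \<beta> j * conjC \<beta> ^ j) * A ^ (i + j))"
 using bb_dprod[OF adm_self[OF assms(1)] bb_dpow[OF assms, of i] bb_dpow[OF assms(1) bb_dconj[OF assms(2)], of j]]
 by (simp add: power_add power_mult_distrib ac_simps)

definition pairdC :: "real => nat => nat => real" where
 "pairdC \<beta> i j = prodC \<beta> \<beta> * powdC \<beta> i * (powC \<beta> j * conjC \<beta> ^ j) + prodC \<beta> \<beta> * powC \<beta> i * (powdC \<beta> j * conjC \<beta> ^ j)"

lemma bb_power_pair_diff:
 assumes "0 < \<beta>" "bb \<beta> w A" "bb \<beta> w' A" "bb \<beta> (%k. w k - w' k) (A * \<epsilon>)"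
 shows "bb \<beta> (%k. dprod chi rho (dpow chi rho w i) (dpow chi rho (dconj w) j) k - dprod chi rho (dpow chi rho w' i) (dpow chi rho (dconj w') j) k)
  (pairdC \<beta> i j * A ^ (i + j) * \<epsilon>)"
proof -
 have c: "bb \<beta> (%k. dconj w k - dconj w' k) (conjC \<beta> * A * \<epsilon>)"
  using bb_dconj[OF assms(4)] by (simp add: dconj_diff mult.assoc)
 note p = bb_dpow[OF assms(1,2), of i] bb_dpow[OF assms(1,3), of i]
  bb_dpow[OF assms(1) bb_dconj[OF assms(2)], of j] bb_dpow[OF assms(1) bb_dconj[OF assms(3)], of j]
 have "bb \<beta> (%k. dprod chi rho (dpow chi rho w i) (dpow chi rho (dconj w) j) k - dprod chi rho (dpow chi rho w' i) (dpow chi rho (dconj w') j) k)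
  (prodC \<beta> \<beta> * (powdC \<beta> i * A ^ i * \<epsilon>) * (powC \<beta> j * (conjC \<beta> * A) ^ j) + prodC \<beta> \<beta> * (powC \<beta> i * A ^ i) * (powdC \<beta> j * (conjC \<beta> * A) ^ j * \<epsilon>))"
  unfolding dprod_diff[OF adm_self[OF assms(1)] p]
  by (intro bb_add bb_dprod adm_self assms p bb_dpow_diff c bb_dconj)
 then show ?thesis by (simp add: pairdC_def power_add power_mult_distrib algebra_simps)
qed

definition termC :: "real => real => nat => nat => real" where
 "termC \<beta> \<alpha> i j = prodC \<beta> (- \<alpha>) * (prodC \<beta> \<beta> * powC \<beta> i * (powC \<beta> j * conjC \<beta> ^ j))"

definition termdC :: "real => real => nat => nat => real" where
 "termdC \<beta> \<alpha> i j = prodC \<beta> (- \<alpha>) * pairdC \<beta> i j"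

lemma adm_neg: "0 < \<alpha> ==> \<alpha> < \<beta> ==> adm \<beta> (- \<alpha>)" by (simp add: adm_def)

lemma bb_monom_term:
 assumes "0 < \<alpha>" "\<alpha> < \<beta>" "bb \<beta> w A" "bb (- \<alpha>) \<zeta> B"
 shows "bb (- \<alpha>) (monom_term i j w \<zeta>) (termC \<beta> \<alpha> i j * A ^ (i + j) * B)"
 using bb_dprod[OF adm_neg[OF assms(1,2)] bb_power_pair[OF _ assms(3)] assms(4), of i j] assms(1,2)
 by (simp add: monom_term_def termC_def ac_simps)

lemma bb_monom_term_diff:
 assumes "0 < \<alpha>" "\<alpha> < \<beta>" "bb \<beta> w A" "bb \<beta> w' A" "bb \<beta> (%k. w k - w' k) (A * \<epsilon>)" "bb (- \<alpha>) \<zeta> B"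
 shows "bb (- \<alpha>) (%k. monom_term i j w \<zeta> k - monom_term i j w' \<zeta> k) (termdC \<beta> \<alpha> i j * A ^ (i + j) * \<epsilon> * B)"
proof -
 have b: "0 < \<beta>" using assms by simp
 have "bb (- \<alpha>) (%k. monom_term i j w \<zeta> k - monom_term i j w' \<zeta> k) (prodC \<beta> (- \<alpha>) * (pairdC \<beta> i j * A ^ (i + j) * \<epsilon>) * B)"
  unfolding monom_term_def
   dprod_diff_left[OF adm_neg[OF assms(1,2)] bb_power_pair[OF b assms(3)] bb_power_pair[OF b assms(4)] assms(6), symmetric]
  by (intro bb_dprod adm_neg assms bb_power_pair_diff b)
 then show ?thesis by (simp add: termdC_def ac_simps)
qed

text \<open>Convergence to \<open>0\<close> along a filter. Continuity in time uses the filter \<^term>\<open>at t within S\<close>; the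
 convergence of mollifications, uniformly in time, uses \<^term>\<open>sequentially \<times>\<^sub>F principal S\<close>.\<close>

definition bdd_along :: "'i filter => real => ('i => dist) => bool" where
 "bdd_along F s h \<longleftrightarrow> (\<exists>C. eventually (%i. bb s (h i) C) F)"

definition null_along :: "'i filter => real => ('i => dist) => bool" where
 "null_along F s h \<longleftrightarrow> (\<exists>e. (e \<longlongrightarrow> 0) F \<and> eventually (%i. bb s (h i) (e i)) F)"

lemma null_along_map:
 assumes "null_along F s f" "!!i e. bb s (f i) e ==> bb s' (g i) (K * e)"
 shows "null_along F s' g"
proof -
 obtain e where e: "(e \<longlongrightarrow> 0) F" "eventually (%i. bb s (f i) (e i)) F"
  using assms(1) unfolding null_along_def by blast
 have "((%i. K * e i) \<longlongrightarrow> 0) F" using e(1) by (rule tendsto_mult_right_zero)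
 moreover have "eventually (%i. bb s' (g i) (K * e i)) F"
  using e(2) by eventually_elim (rule assms(2))
 ultimately show ?thesis unfolding null_along_def by blast
qed

lemma bdd_along_map:
 assumes "bdd_along F s f" "!!i e. bb s (f i) e ==> bb s' (g i) (K e)"
 shows "bdd_along F s' g"
proof -
 obtain e where e: "eventually (%i. bb s (f i) e) F"
  using assms(1) unfolding bdd_along_def by blast
 have "eventually (%i. bb s' (g i) (K e)) F"
  using e by eventually_elim (rule assms(2))
 then show ?thesis unfolding bdd_along_def by blast
qed

lemma bdd_along_map2:
 assumes "bdd_along F s f" "bdd_along F r h" "!!i d e. bb s (f i) d ==> bb r (h i) e ==> bb s' (g i) (K d e)"
 shows "bdd_along F s' g"
proof -
 obtain d e where e: "eventually (%i. bb s (f i) d) F" "eventually (%i. bb r (h i) e) F"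
  using assms(1,2) unfolding bdd_along_def by blast
 have "eventually (%i. bb s' (g i) (K d e)) F"
  using e by eventually_elim (rule assms(3))
 then show ?thesis unfolding bdd_along_def by blast
qed

lemma null_along_add: "null_along F s f ==> null_along F s g ==> null_along F s (%i k. f i k + g i k)"
proof -
 assume "null_along F s f" "null_along F s g"
 then obtain a b where "(a \<longlongrightarrow> 0) F" "eventually (%i. bb s (f i) (a i)) F"
  "(b \<longlongrightarrow> 0) F" "eventually (%i. bb s (g i) (b i)) F" by (auto simp: null_along_def)
 then show ?thesis
  unfolding null_along_def
  by (intro exI[of _ "%i. a i + b i"]) (auto intro: tendsto_add_zero bb_add elim: eventually_elim2)
qed

lemma null_along_cmult: "null_along F s f ==> null_along F s (%i k. c * f i k)"
 by (erule null_along_map) (rule bb_cmult)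

lemma null_along_diff: "null_along F s f ==> null_along F s g ==> null_along F s (%i k. f i k - g i k)"
 using null_along_add[of F s f "%i k. (- 1) * g i k"] null_along_cmult[of F s g "- 1"] by simp

lemma null_along_zero: "null_along F s (%i k. 0)"
 unfolding null_along_def by (intro exI[of _ "%_. 0"]) (simp add: bb_zero)

lemma null_along_sum: "finite I ==> (!!a. a \<in> I ==> null_along F s (f a)) ==> null_along F s (%i k. \<Sum>a\<in>I. f a i k)"
 by (induction I rule: finite_induct) (simp_all add: null_along_zero null_along_add)

lemma null_along_bdd: "null_along F s f ==> bdd_along F s f"
proof -
 assume "null_along F s f"
 then obtain a where a: "(a \<longlongrightarrow> 0) F" "eventually (%i. bb s (f i) (a i)) F" by (auto simp: null_along_def)
 from a(1) have "eventually (%i. a i < 1) F" by (rule order_tendstoD) simp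
 with a(2) have "eventually (%i. bb s (f i) 1) F" by eventually_elim (auto intro: bb_mono)
 then show ?thesis by (auto simp: bdd_along_def)
qed

lemma bdd_along_add: "bdd_along F s f ==> bdd_along F s g ==> bdd_along F s (%i k. f i k + g i k)"
 by (erule bdd_along_map2, assumption) (rule bb_add)

lemma bdd_along_transfer: "bdd_along F s f' ==> null_along F s (%i k. f i k - f' i k) ==> bdd_along F s f"
 using bdd_along_add[OF null_along_bdd, of F s "%i k. f i k - f' i k" f'] by simp

lemma bdd_along_const: "bb s f C ==> bdd_along F s (%_. f)"
 unfolding bdd_along_def by (intro exI[of _ C]) simp

lemma bdd_along_dprod: "adm \<beta> b ==> bdd_along F \<beta> f ==> bdd_along F b g ==> bdd_along F b (%i. dprod chi rho (f i) (g i))"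
 by (erule bdd_along_map2, assumption) (rule bb_dprod)

lemma bdd_along_dconj: "bdd_along F s f ==> bdd_along F s (%i. dconj (f i))"
 by (erule bdd_along_map) (rule bb_dconj)

lemma null_along_dconj: "null_along F s (%i k. f i k - g i k) ==> null_along F s (%i k. dconj (f i) k - dconj (g i) k)"
 unfolding dconj_diff[symmetric] by (erule null_along_map) (rule bb_dconj)

lemma null_along_dprod:
 assumes adm: "adm \<beta> b" and "null_along F \<beta> (%i k. f i k - f' i k)" "bdd_along F \<beta> f'"
  and "null_along F b (%i k. g i k - g' i k)" "bdd_along F b g'"
 shows "null_along F b (%i k. dprod chi rho (f i) (g i) k - dprod chi rho (f' i) (g' i) k)"
proof -
 obtain a where a: "(a \<longlongrightarrow> 0) F" "eventually (%i. bb \<beta> (%k. f i k - f' i k) (a i)) F"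
  using assms(2) by (auto simp: null_along_def)
 obtain c where c: "(c \<longlongrightarrow> 0) F" "eventually (%i. bb b (%k. g i k - g' i k) (c i)) F"
  using assms(4) by (auto simp: null_along_def)
 obtain A where A: "eventually (%i. bb \<beta> (f' i) A) F" using assms(3) by (auto simp: bdd_along_def)
 obtain A' where A': "eventually (%i. bb \<beta> (f i) A') F"
  using bdd_along_transfer[OF assms(3,2)] by (auto simp: bdd_along_def)
 obtain B where B: "eventually (%i. bb b (g' i) B) F" using assms(5) by (auto simp: bdd_along_def)
 obtain B' where B': "eventually (%i. bb b (g i) B') F"
  using bdd_along_transfer[OF assms(5,4)] by (auto simp: bdd_along_def)
 have "eventually (%i. bb b (%k. dprod chi rho (f i) (g i) k - dprod chi rho (f' i) (g' i) k)
   (prodC \<beta> b * a i * B' + prodC \<beta> b * A * c i)) F"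
  using a(2) c(2) A A' B B'
 proof eventually_elim
  case (elim i)
  show ?case
   unfolding dprod_diff[OF adm elim(4,3,6,5)]
   by (intro bb_add bb_dprod adm elim)
 qed
 moreover have "((%i. prodC \<beta> b * a i * B' + prodC \<beta> b * A * c i) \<longlongrightarrow> 0) F"
  using a(1) c(1) by (intro tendsto_add_zero tendsto_mult_left_zero tendsto_mult_right_zero)
 ultimately show ?thesis by (auto simp: null_along_def)
qed

lemma bdd_along_dpow: "0 < \<beta> ==> bdd_along F \<beta> f ==> bdd_along F \<beta> (%i. dpow chi rho (f i) n)"
 by (induction n) (auto simp: dpow_0 dpow_Suc intro: bdd_along_const[OF bb_dunit] bdd_along_dprod adm_self)

lemma null_along_dpow:
 assumes "0 < \<beta>" "null_along F \<beta> (%i k. f i k - f' i k)" "bdd_along F \<beta> f'"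
 shows "null_along F \<beta> (%i k. dpow chi rho (f i) n k - dpow chi rho (f' i) n k)"
proof (induction n)
 case (Suc n)
 then show ?case unfolding dpow_Suc
  by (intro null_along_dprod[OF adm_self[OF assms(1)]] bdd_along_dpow assms)
qed (simp add: dpow_0 null_along_zero)

lemma null_along_monom_term:
 assumes "0 < \<alpha>" "\<alpha> < \<beta>" "null_along F \<beta> (%i k. w i k - w' i k)" "bdd_along F \<beta> w'"
  and "null_along F (- \<alpha>) (%i k. \<zeta> i k - \<zeta>' i k)" "bdd_along F (- \<alpha>) \<zeta>'"
 shows "null_along F (- \<alpha>) (%i k. monom_term p q (w i) (\<zeta> i) k - monom_term p q (w' i) (\<zeta>' i) k)"
proof -
 have b: "0 < \<beta>" using assms by simp
 show ?thesis
  unfolding monom_term_def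
  by (intro null_along_dprod[of \<beta>] null_along_dprod[of \<beta> \<beta>] bdd_along_dprod[of \<beta> \<beta>] adm_neg adm_self
    null_along_dpow bdd_along_dpow null_along_dconj bdd_along_dconj assms b)
qed

lemma null_along_exponent: "null_along F s f ==> s' \<le> s ==> null_along F s' f"
 by (erule null_along_map) (rule bb_le_exponent)

lemma bdd_along_exponent: "bdd_along F s f ==> s' \<le> s ==> bdd_along F s' f"
 by (erule bdd_along_map) (rule bb_le_exponent)

lemma null_along_coeff: "null_along F s h ==> ((%i. h i k) \<longlongrightarrow> 0) F"
proof -
 assume "null_along F s h"
 then obtain a where a: "(a \<longlongrightarrow> 0) F" "eventually (%i. bb s (h i) (a i)) F" by (auto simp: null_along_def)
 have "((%i. a i * coeffC s k) \<longlongrightarrow> 0) F" using a(1) by (rule tendsto_mult_left_zero)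
 moreover have "eventually (%i. norm (h i k) \<le> a i * coeffC s k) F"
  using a(2) by eventually_elim (rule bb_coeff)
 ultimately show ?thesis by (rule Lim_null_comparison[rotated])
qed

end

section \<open>Heat semigroup and Riesz-type multipliers\<close>

lemma norm_freq_sq: "(norm (freq k))\<^sup>2 = (of_int (fst k))\<^sup>2 + (of_int (snd k))\<^sup>2"
 by (simp add: freq_def norm_Pair)

text \<open>Four differences of the heat symbol cost the fourth power of 1 + \<tau>; the fifth power
  leaves one factor 1 / (1 + \<tau>).\<close>

lemma power5_exp_bound:
 fixes c x :: real assumes "0 < c" "0 \<le> x"
 shows "x ^ 5 * exp (- c * x) \<le> (5 / c) ^ 5"
proof -
 have "(c * x / 5) ^ 5 \<le> exp (c * x / 5) ^ 5"
 proof (intro power_mono)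
  show "c * x / 5 \<le> exp (c * x / 5)" using exp_ge_add_one_self[of "c * x / 5"] by linarith
 qed (use assms in auto)
 also have "\<dots> = exp (c * x)" by (simp flip: exp_of_nat_mult)
 finally have "x ^ 5 * (c / 5) ^ 5 \<le> exp (c * x)" by (simp add: power_mult_distrib power_divide mult.commute)
 then have "x ^ 5 * (c / 5) ^ 5 * exp (- c * x) \<le> exp (c * x) * exp (- c * x)"
  by (rule mult_right_mono) simp
 also have "\<dots> = 1" by (simp flip: exp_add)
 finally have "x ^ 5 * exp (- c * x) * (c / 5) ^ 5 \<le> 1" by (simp only: ac_simps)
 then have "x ^ 5 * exp (- c * x) \<le> 1 / (c / 5) ^ 5" using assms by (simp add: pos_le_divide_eq)
 then show ?thesis by (simp add: power_divide)
qed

context littlewood_paley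
begin

text \<open>A fattened weight, equal to 1 on the frequencies of block n and supported near them. It
  allows an unbounded symbol to be altered off the block.\<close>

definition psi :: "nat => int \<times> int => real" where
 "psi n k = (\<Sum>j\<in>near n. lp_weight chi rho j k)"

lemma psi_range: "0 \<le> psi n k" "psi n k \<le> 1"
proof -
 show "0 \<le> psi n k" unfolding psi_def by (intro sum_nonneg lp_weight_nonneg)
 obtain M where M: "\<forall>j\<ge>M. \<not> freq_in j k" using freq_in_finite by blast
 have "psi n k \<le> (\<Sum>j<max M (Suc (n + gap)). lp_weight chi rho j k)"
  unfolding psi_def by (intro sum_mono2 lp_weight_nonneg) auto
 also have "\<dots> = 1" by (rule sum_lp_weight_eq_1) (use M in auto)
 finally show "psi n k \<le> 1" .
qed

lemma wt_freq_in: "wt n k \<noteq> 0 ==> freq_in n k"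
 by (rule lp_weight_freq_in) (simp only: of_real_eq_0_iff not_False_eq_True)

lemma psi_eq_1: assumes "wt n k \<noteq> 0" shows "psi n k = 1"
proof -
 have "complex_of_real (psi n k) = 1" unfolding psi_def of_real_sum
  using assms by (intro sum_near_eq_1 wt_freq_in)
 then show ?thesis by (simp only: of_real_eq_1_iff)
qed

lemma psi_freq: assumes "psi n k \<noteq> 0"
 shows "norm (freq k) \<le> 2 ^ (J + gap) * 2 ^ n" "gap < n ==> 2 ^ n \<le> 2 ^ (J + 1 + gap) * norm (freq k)"
proof -
 obtain j where j: "j \<in> near n" "lp_weight chi rho j k \<noteq> 0"
  using sum.not_neutral_contains_not_neutral[OF assms[unfolded psi_def]] by blast
 have f: "freq_in j k" by (rule lp_weight_freq_in[OF j(2)])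
 have "norm (freq k) \<le> 2 ^ (J + j)" using f by (simp add: freq_in_def)
 also have "\<dots> \<le> 2 ^ (J + gap + n)" using j by (intro power_increasing) auto
 finally show "norm (freq k) \<le> 2 ^ (J + gap) * 2 ^ n" by (simp add: power_add)
 assume n: "gap < n"
 have "(2::real) ^ n \<le> 2 ^ (gap + j)" using j by (intro power_increasing) auto
 also have "\<dots> = 2 ^ gap * 2 ^ j" by (simp only: power_add)
 also have "\<dots> \<le> 2 ^ gap * (2 ^ (J + 1) * norm (freq k))"
  using f j n by (intro mult_left_mono) (auto simp: freq_in_def)
 finally show "2 ^ n \<le> 2 ^ (J + 1 + gap) * norm (freq k)" by (simp only: power_add ac_simps)
qed

lemma psi_symbol: "\<exists>B. \<forall>n. symbol_bd (2 ^ n) dirs B (%k. of_real (psi n k))"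
proof -
 let ?B = "(2 ^ gap) ^ length dirs * wtB"
 have "symbol_bd (2 ^ n) dirs (real (2 * gap + 1) * ?B) (%k. of_real (psi n k))" for n
 proof -
  have "symbol_bd (2 ^ n) dirs ?B (wt j)" if "j \<in> near n" for j
  proof (rule symbol_bd_rescale[OF symbol_bd_wt])
   have "(2::real) ^ n \<le> 2 ^ (gap + j)" using that by (intro power_increasing) auto
   then show "(2::real) ^ n \<le> 2 ^ gap * 2 ^ j" by (simp only: power_add)
   show "1 \<le> (2::real) ^ gap" by (rule one_le_power) simp
  qed auto
  then have "symbol_bd (2 ^ n) dirs (\<Sum>j\<in>near n. ?B) (%k. \<Sum>j\<in>near n. wt j k)"
   by (intro symbol_bd_sum) auto
  then have "symbol_bd (2 ^ n) dirs (\<Sum>j\<in>near n. ?B) (%k. of_real (psi n k))"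
   by (simp add: psi_def)
  moreover have "(\<Sum>j\<in>near n. ?B) \<le> real (2 * gap + 1) * ?B"
  proof -
   have "card (near n) \<le> card {n - gap..n + gap}" by (rule card_mono) auto
   then have "real (card (near n)) \<le> real (2 * gap + 1)" by simp
   then have "real (card (near n)) * ?B \<le> real (2 * gap + 1) * ?B"
    using wtB_nonneg by (intro mult_right_mono) auto
   then show ?thesis by simp
  qed
  ultimately show ?thesis by (rule symbol_bd_mono) simp
 qed
 then show ?thesis by blast
qed

lemma coord_psi_symbol:
 assumes B: "symbol_bd (2 ^ n) dirs B b" and b: "!!k. b k \<noteq> 0 ==> psi n k \<noteq> 0" and p: "p = fst \<or> p = snd"
 shows "symbol_bd (2 ^ n) dirs (B * ((2 ^ (J + gap) :: real) + 2 * length dirs)) (%k. of_real (of_int (p k) / 2 ^ n) * b k)"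
proof (rule symbol_bd_coordinate[OF _ B set_dirs _ p])
 fix k assume "b k \<noteq> 0"
 then have "norm (freq k) \<le> 2 ^ (J + gap) * 2 ^ n" using b psi_freq(1) by blast
 then show "\<bar>of_int (p k)\<bar> \<le> (2 ^ (J + gap) * 2 ^ n :: real)"
  using abs_coord_le_norm_freq[of k] p by (elim disjE) auto
qed auto

text \<open>The rescaled Laplace symbol, replaced by 1 away from block n. It satisfies a symbol
  bound uniform in n and, for n > \<open>gap\<close>, is bounded below everywhere, while on the
  block it is the original symbol.\<close>

definition zeta :: "complex => nat => dist" where
 "zeta c n k = c * of_real ((norm (freq k) / 2 ^ n)\<^sup>2) * of_real (psi n k) + (1 - of_real (psi n k))"

lemma zeta_symbol: "\<exists>B\<ge>0. \<forall>n. symbol_bd (2 ^ n) dirs B (zeta c n)"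
proof -
 obtain B where B: "!!n. symbol_bd (2 ^ n) dirs B (%k. of_real (psi n k))" using psi_symbol by blast
 let ?R = "(2 ^ (J + gap) :: real) + 2 * length dirs"
 let ?q = "%p n k. complex_of_real (of_int (p k) / 2 ^ n) * (of_real (of_int (p k) / 2 ^ n) * of_real (psi n k))"
 let ?B = "cmod c * (B * ?R * ?R + B * ?R * ?R) + (cmod 1 + cmod (- 1) * B)"
 have sq: "symbol_bd (2 ^ n) dirs (B * ?R * ?R) (?q p n)" if "p = fst \<or> p = snd" for p n
  by (intro coord_psi_symbol B that) auto
 have "symbol_bd (2 ^ n) dirs ?B (zeta c n)" for n
 proof -
  have e: "(norm (freq k) / 2 ^ n)\<^sup>2 * psi n k =
    of_int (fst k) / 2 ^ n * (of_int (fst k) / 2 ^ n * psi n k) + of_int (snd k) / 2 ^ n * (of_int (snd k) / 2 ^ n * psi n k)" for k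
   unfolding power_divide norm_freq_sq by (simp add: power2_eq_square algebra_simps add_divide_distrib)
  have "zeta c n k = c * of_real ((norm (freq k) / 2 ^ n)\<^sup>2 * psi n k) + (1 - of_real (psi n k))" for k
   by (simp add: zeta_def)
  then have "zeta c n = (%k. c * (?q fst n k + ?q snd n k) + (1 + (- 1) * of_real (psi n k)))"
   unfolding e by (intro ext) simp
  then show ?thesis
   by (simp only:) (intro symbol_bd_add symbol_bd_cmult sq B symbol_bd_const; simp)
 qed
 moreover have "0 \<le> ?B" using symbol_bd_nonneg[OF calculation] .
 ultimately show ?thesis by blast
qed

text \<open>A convex combination of the Laplace symbol and 1. For n \<le> \<open>gap\<close> the
  fattened block may contain the frequency 0, where the first of them vanishes, so only
  nonnegativity is left.\<close>

lemma zeta_Re: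
 assumes "0 \<le> Re c"
 shows "0 \<le> Re (zeta c n k)" "gap < n ==> min 1 (Re c / (2 ^ (J + 1 + gap))\<^sup>2) \<le> Re (zeta c n k)"
proof -
 note ps = psi_range[of n k]
 have R: "Re (zeta c n k) = Re c * (norm (freq k) / 2 ^ n)\<^sup>2 * psi n k + (1 - psi n k)"
 proof -
  have "zeta c n k = of_real ((norm (freq k) / 2 ^ n)\<^sup>2 * psi n k) * c + of_real (1 - psi n k)" by (simp add: zeta_def)
  then show ?thesis by (simp only: plus_complex.sel Re_complex_of_real times_complex.sel Im_complex_of_real) simp
 qed
 show "0 \<le> Re (zeta c n k)" unfolding R using ps assms by simp
 assume n: "gap < n"
 let ?c = "min 1 (Re c / (2 ^ (J + 1 + gap))\<^sup>2)"
 show "?c \<le> Re (zeta c n k)"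
 proof (cases "psi n k = 0")
  case False
  have "2 ^ n \<le> 2 ^ (J + 1 + gap) * norm (freq k)" by (rule psi_freq(2)[OF False n])
  then have "1 / 2 ^ (J + 1 + gap) \<le> norm (freq k) / 2 ^ n" by (simp add: field_simps)
  then have "(1 / 2 ^ (J + 1 + gap))\<^sup>2 \<le> (norm (freq k) / 2 ^ n)\<^sup>2" by (intro power_mono) auto
  then have "Re c * (1 / 2 ^ (J + 1 + gap))\<^sup>2 \<le> Re c * (norm (freq k) / 2 ^ n)\<^sup>2" using assms by (rule mult_left_mono)
  then have "?c \<le> Re c * (norm (freq k) / 2 ^ n)\<^sup>2" by (simp add: power_divide min.coboundedI2)
  then have "?c * psi n k + ?c * (1 - psi n k) \<le> Re c * (norm (freq k) / 2 ^ n)\<^sup>2 * psi n k + 1 * (1 - psi n k)"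
   using ps by (intro add_mono mult_right_mono) auto
  then show ?thesis unfolding R by (simp add: algebra_simps)
 qed (simp add: R)
qed

text \<open>With \<tau> = t * 4 ^ n the heat factor on block n is exp (- \<tau> *
  \<open>zeta\<close>), times exp (- t) from the zeroth-order term. For n > \<open>gap\<close>
  exponential decay beats the polynomial loss of the four differences; for the finitely many other
  n, \<tau> is bounded because t \<le> T.\<close>

lemma mult_bd_heat:
 assumes mu: "0 < \<mu>" and T: "0 < T"
 shows "\<exists>K\<ge>0. \<forall>n t. 0 < t --> t \<le> T --> mult_bd (%k. exp (of_real t * symA \<mu> k) * wt n k) (K / (1 + t * 4 ^ n))"
proof -
 define c where "c = (\<i> + of_real \<mu>) * of_real (4 * pi\<^sup>2)"
 have Rc: "Re c = \<mu> * (4 * pi\<^sup>2)" unfolding c_def by (simp only: times_complex.sel Re_complex_of_real Im_complex_of_real) simp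
 then have Rc0: "0 < Re c" using mu by simp
 obtain B where B: "0 \<le> B" "!!n. symbol_bd (2 ^ n) dirs B (zeta c n)" using zeta_symbol by blast
 define c0 where "c0 = min 1 (Re c / (2 ^ (J + 1 + gap))\<^sup>2)"
 have c0: "0 < c0" using Rc0 by (simp add: c0_def)
 define K1 where "K1 = (1 + 16 * B) ^ 4 * (exp c0 * (5 / c0) ^ 5)"
 define K2 where "K2 = (1 + 16 * (T * 4 ^ gap) * B) ^ 4 * (1 + T * 4 ^ gap)"
 have K12: "0 \<le> K1" "0 \<le> K2" using B c0 T by (auto simp: K1_def K2_def)
 define K where "K = annB (16 * (K1 + K2) * wtB)"
 have K0: "0 \<le> K" using wtB_nonneg K12 by (simp add: K_def annB_def ksize_def)
 have "mult_bd (%k. exp (of_real t * symA \<mu> k) * wt n k) (K / (1 + t * 4 ^ n))" if t: "0 < t" "t \<le> T" for n t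
 proof -
  define \<tau> where "\<tau> = t * 4 ^ n"
  have \<tau>: "0 < \<tau>" using t by (simp add: \<tau>_def)
  define e where "e = (if gap < n then c0 else 0)"
  have zR: "e \<le> Re (zeta c n k)" for k using zeta_Re[of c n k] Rc0 by (auto simp: e_def c0_def)
  have S: "symbol_bd (2 ^ n) dirs ((1 + 2 ^ 4 * \<tau> * B) ^ length dirs * exp (- \<tau> * e)) (%k. exp (- of_real \<tau> * zeta c n k))"
   by (rule symbol_bd_exp) (use \<tau> B zR in auto)
  have ld: "length dirs = 4" "(2::real) ^ 4 = 16" by simp_all
  have bound: "(1 + 16 * \<tau> * B) ^ 4 * exp (- \<tau> * e) \<le> (K1 + K2) / (1 + \<tau>)"
  proof (cases "gap < n")
   case True
   have "(1 + 16 * \<tau> * B) ^ 4 \<le> ((1 + 16 * B) * (1 + \<tau>)) ^ 4"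
    using \<tau> B(1) by (intro power_mono) (auto simp: algebra_simps)
   then have "(1 + 16 * \<tau> * B) ^ 4 * exp (- \<tau> * c0) * (1 + \<tau>) \<le> ((1 + 16 * B) * (1 + \<tau>)) ^ 4 * exp (- \<tau> * c0) * (1 + \<tau>)"
    using \<tau> by (intro mult_right_mono) auto
   also have "\<dots> = (1 + 16 * B) ^ 4 * exp c0 * ((1 + \<tau>) ^ 5 * exp (- c0 * (1 + \<tau>)))"
   proof -
    have ex: "exp (- \<tau> * c0) = exp c0 * exp (- c0 * (1 + \<tau>))" by (simp add: algebra_simps flip: exp_add)
    have p5: "(1 + \<tau>) ^ 5 = (1 + \<tau>) ^ 4 * (1 + \<tau>)" using power_add[of "1 + \<tau>" 4 1] by simp
    show ?thesis unfolding ex p5 power_mult_distrib by (simp only: ac_simps)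
   qed
   also have "\<dots> \<le> (1 + 16 * B) ^ 4 * exp c0 * (5 / c0) ^ 5"
    using \<tau> B(1) by (intro mult_left_mono power5_exp_bound c0) auto
   finally have "(1 + 16 * \<tau> * B) ^ 4 * exp (- \<tau> * c0) * (1 + \<tau>) \<le> K1 + K2"
    using K12 by (simp add: K1_def)
   then show ?thesis using True \<tau> by (simp add: e_def pos_le_divide_eq)
  next
   case False
   then have "(4::real) ^ n \<le> 4 ^ gap" by (intro power_increasing) auto
   then have le: "\<tau> \<le> T * 4 ^ gap" unfolding \<tau>_def using t by (intro mult_mono) auto
   have "(1 + 16 * \<tau> * B) ^ 4 * (1 + \<tau>) \<le> K2"
    unfolding K2_def using le \<tau> B(1) by (intro mult_mono power_mono add_left_mono mult_right_mono mult_left_mono) auto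
   then have "(1 + 16 * \<tau> * B) ^ 4 * (1 + \<tau>) \<le> K1 + K2" using K12 by simp
   then show ?thesis using False \<tau> by (simp add: e_def pos_le_divide_eq)
  qed
  have "symbol_bd (2 ^ n) dirs ((K1 + K2) / (1 + \<tau>)) (%k. exp (- of_real \<tau> * zeta c n k))"
   by (rule symbol_bd_mono[OF S[unfolded ld]]) (use bound in auto)
  then have "symbol_bd (2 ^ n) dirs (2 ^ length dirs * ((K1 + K2) / (1 + \<tau>)) * wtB) (%k. exp (- of_real \<tau> * zeta c n k) * wt n k)"
   by (intro symbol_bd_mult symbol_bd_wt) auto
  then have S2: "symbol_bd (2 ^ n) dirs (cmod (of_real (exp (- t))) * (2 ^ length dirs * ((K1 + K2) / (1 + \<tau>)) * wtB))
   (%k. of_real (exp (- t)) * (exp (- of_real \<tau> * zeta c n k) * wt n k))"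
   by (rule symbol_bd_cmult)
  have eqf: "(%k. of_real (exp (- t)) * (exp (- of_real \<tau> * zeta c n k) * wt n k)) = (%k. exp (of_real t * symA \<mu> k) * wt n k)"
  proof
   fix k show "of_real (exp (- t)) * (exp (- of_real \<tau> * zeta c n k) * wt n k) = exp (of_real t * symA \<mu> k) * wt n k"
   proof (cases "wt n k = 0")
    case False
    have p1: "psi n k = 1" using psi_eq_1[OF False] .
    have "\<tau> * (norm (freq k) / 2 ^ n)\<^sup>2 = t * (norm (freq k))\<^sup>2"
     by (simp add: \<tau>_def power_divide power2_eq_square flip: power_mult_distrib)
    then have "of_real \<tau> * zeta c n k = c * of_real (t * (norm (freq k))\<^sup>2)"
     unfolding zeta_def p1 by (simp only: of_real_mult[symmetric] of_real_1 mult_1_right mult.left_commute diff_self add_0_right)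
    then have h: "- of_real t + - of_real \<tau> * zeta c n k = of_real t * symA \<mu> k"
     by (simp add: symA_def c_def norm_freq_sq algebra_simps)
    show ?thesis unfolding h[symmetric] exp_add of_real_minus[symmetric] exp_of_real by (simp only: mult.assoc)
   qed simp
  qed
  have "symbol_bd (2 ^ n) dirs (16 * (K1 + K2) * wtB / (1 + \<tau>)) (%k. exp (of_real t * symA \<mu> k) * wt n k)"
  proof (rule symbol_bd_mono[OF S2[unfolded eqf]])
   have Y: "2 ^ length dirs * ((K1 + K2) / (1 + \<tau>)) * wtB = 16 * (K1 + K2) * wtB / (1 + \<tau>)"
    unfolding ld by simp
   have "exp (- t) * (16 * (K1 + K2) * wtB / (1 + \<tau>)) \<le> 1 * (16 * (K1 + K2) * wtB / (1 + \<tau>))"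
    using t wtB_nonneg K12 \<tau> by (intro mult_right_mono) auto
   then show "cmod (complex_of_real (exp (- t))) * (2 ^ length dirs * ((K1 + K2) / (1 + \<tau>)) * wtB) \<le> 16 * (K1 + K2) * wtB / (1 + \<tau>)"
    unfolding Y by (simp only: norm_of_real abs_exp_cancel mult_1_left)
  qed simp
  then have "mult_bd (%k. exp (of_real t * symA \<mu> k) * wt n k) (annB (16 * (K1 + K2) * wtB / (1 + \<tau>)))"
   by (rule mult_bd_annulus) (auto intro!: wt_freq_in)
  then show ?thesis by (simp add: K_def annB_def \<tau>_def)
 qed
 with K0 show ?thesis by blast
qed

lemma powr_le_one_plus: "0 < \<tau> ==> 0 \<le> \<kappa> ==> \<kappa> \<le> 1 ==> 1 / (1 + \<tau>) \<le> \<tau> powr (- \<kappa>)" for \<tau> \<kappa> :: real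
proof -
 assume a: "0 < \<tau>" "0 \<le> \<kappa>" "\<kappa> \<le> 1"
 have "\<tau> powr \<kappa> \<le> 1 + \<tau>"
 proof (cases "\<tau> \<le> 1")
  case True
  then have "\<tau> powr \<kappa> \<le> 1" using a by (intro powr_le1) auto
  then show ?thesis using a by simp
 next
  case False
  then have "\<tau> powr \<kappa> \<le> \<tau> powr 1" using a by (intro powr_mono) auto
  then show ?thesis using a by simp
 qed
 then show ?thesis using a by (simp add: powr_minus field_simps)
qed

text \<open>Block n gains 1 / (1 + t * 4 ^ n), which is at most any power of (t * 4 ^ n) with
  exponent between -1 and 0. That range is why at most two derivatives are gained.\<close>

lemma bb_Pt:
 assumes mu: "0 < \<mu>" and T: "0 < T"
 shows "\<exists>K\<ge>0. \<forall>t f C s b. 0 < t --> t \<le> T --> s \<le> b --> b \<le> s + 2 --> bb s f C -->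
  bb b (Pt \<mu> t f) (K * nearC s * C * t powr (- ((b - s) / 2)))"
proof -
 obtain K where K: "0 \<le> K" "!!n t. 0 < t ==> t \<le> T ==> mult_bd (%k. exp (of_real t * symA \<mu> k) * wt n k) (K / (1 + t * 4 ^ n))"
  using mult_bd_heat[OF mu T] by blast
 have "bb b (Pt \<mu> t f) (K * nearC s * C * t powr (- ((b - s) / 2)))"
  if t: "0 < t" "t \<le> T" and sb: "s \<le> b" "b \<le> s + 2" and f: "bb s f C" for t f C s b
 proof (rule bbI)
  fix n x
  have C: "0 \<le> C" using bb_nonneg[OF f] .
  have "cmod (ev (%k. exp (of_real t * symA \<mu> k) * wt n k * f k) x) \<le> K / (1 + t * 4 ^ n) * C * nearC s * dy s n"
   by (rule block_annulus[OF K(2)[OF t] _ f]) (auto intro!: wt_freq_in)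
  also have "\<dots> = K * nearC s * C * (1 / (1 + t * 4 ^ n) * dy s n)" by simp
  also have "\<dots> \<le> K * nearC s * C * (t powr (- ((b - s) / 2)) * dy b n)"
  proof (intro mult_left_mono)
   have "1 / (1 + t * 4 ^ n) \<le> (t * 4 ^ n) powr (- ((b - s) / 2))"
    using t sb by (intro powr_le_one_plus) auto
   also have "\<dots> = t powr (- ((b - s) / 2)) * 2 powr (- (b - s) * n)"
   proof -
    have "(4::real) ^ n = 2 powr (2 * n)" by (simp add: powr_realpow[symmetric] flip: powr_powr)
    then show ?thesis using t by (simp add: powr_mult powr_powr algebra_simps diff_divide_distrib)
   qed
   also have "\<dots> \<le> t powr (- ((b - s) / 2)) * dy (b - s) n"
    using sb by (intro mult_left_mono) (auto simp: dy_def algebra_simps)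
   finally have "1 / (1 + t * 4 ^ n) * dy s n \<le> t powr (- ((b - s) / 2)) * dy (b - s) n * dy s n"
    by (intro mult_right_mono) auto
   then show "1 / (1 + t * 4 ^ n) * dy s n \<le> t powr (- ((b - s) / 2)) * dy b n"
    using dy_add[of "b - s" s n] by simp
  qed (use K C nearC_nonneg in auto)
  finally show "cmod (ev (%k. wt n k * Pt \<mu> t f k) x) \<le> K * nearC s * C * t powr (- ((b - s) / 2)) * dy b n"
   by (simp add: Pt_def ac_simps)
 qed
 with K(1) show ?thesis by blast
qed

text \<open>Up to constants the multiplier is a component of the gradient of the inverse Laplacian,
  normalised by 2 ^ n. On block n it equals a rescaled coordinate divided by
  \<open>zeta 1 n\<close>, whose inverse is a good symbol because n > \<open>gap\<close>.\<close>

lemma mult_bd_riesz: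
 "\<exists>H\<ge>0. \<forall>n p. gap < n --> p = fst \<or> p = snd -->
  mult_bd (%k. of_real (2 ^ n * of_int (p k) / (norm (freq k))\<^sup>2) * wt n k) H"
proof -
 obtain B where B: "0 \<le> B" "!!n. symbol_bd (2 ^ n) dirs B (zeta 1 n)" using zeta_symbol by blast
 define c0 where "c0 = min 1 (Re 1 / (2 ^ (J + 1 + gap))\<^sup>2)"
 have c0: "0 < c0" by (simp add: c0_def)
 define K where "K = inverse_bd c0 B (length dirs)"
 let ?R = "(2 ^ (J + gap) :: real) + 2 * length dirs"
 have main: "mult_bd (%k. of_real (2 ^ n * of_int (p k) / (norm (freq k))\<^sup>2) * wt n k) (annB (2 ^ length dirs * K * (wtB * ?R)))"
  if n: "gap < n" and p: "p = fst \<or> p = snd" for n p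
 proof (rule mult_bd_annulus)
  have "c0 \<le> cmod (zeta 1 n k)" for k
   using zeta_Re(2)[of 1 n k] n complex_Re_le_cmod[of "zeta 1 n k"] unfolding c0_def by simp
  then have "symbol_bd (2 ^ n) dirs K (%k. 1 / zeta 1 n k)"
   unfolding K_def by (intro symbol_bd_inverse c0 B) auto
  moreover have "symbol_bd (2 ^ n) dirs (wtB * ?R) (%k. of_real (of_int (p k) / 2 ^ n) * wt n k)"
   by (intro coord_psi_symbol symbol_bd_wt p) (simp add: psi_eq_1)
  ultimately have S: "symbol_bd (2 ^ n) dirs (2 ^ length dirs * K * (wtB * ?R)) (%k. 1 / zeta 1 n k * (of_real (of_int (p k) / 2 ^ n) * wt n k))"
   by (intro symbol_bd_mult) auto
  have eq: "1 / zeta 1 n k * (of_real (of_int (p k) / 2 ^ n) * wt n k) = of_real (2 ^ n * of_int (p k) / (norm (freq k))\<^sup>2) * wt n k" for k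
  proof (cases "wt n k = 0")
   case False
   have z: "zeta 1 n k = of_real ((norm (freq k) / 2 ^ n)\<^sup>2)" using psi_eq_1[OF False] by (simp add: zeta_def)
   have "1 / (norm (freq k) / 2 ^ n)\<^sup>2 * (of_int (p k) / 2 ^ n) = 2 ^ n * of_int (p k) / (norm (freq k))\<^sup>2"
    by (simp add: power_divide power2_eq_square)
   then have "1 / zeta 1 n k * of_real (of_int (p k) / 2 ^ n) = of_real (2 ^ n * of_int (p k) / (norm (freq k))\<^sup>2)"
    unfolding z by (metis of_real_1 of_real_divide of_real_mult)
   then show ?thesis by (simp only: mult.assoc[symmetric])
  qed simp
  show "symbol_bd (2 ^ n) dirs (2 ^ length dirs * K * (wtB * ?R)) (%k. of_real (2 ^ n * of_int (p k) / (norm (freq k))\<^sup>2) * wt n k)"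
   using S unfolding eq .
 qed (auto intro!: wt_freq_in)
 define H where "H = annB (2 ^ length dirs * K * (wtB * ?R))"
 have H: "mult_bd (%k. of_real (2 ^ n * of_int (p k) / (norm (freq k))\<^sup>2) * wt n k) H"
  if "gap < n" "p = fst \<or> p = snd" for n p
  unfolding H_def by (rule main[OF that])
 have "0 \<le> H" using H[of "Suc gap" fst] by (simp add: mult_bd_def)
 show ?thesis
 proof (rule exI[of _ H], rule conjI)
  show "0 \<le> H" by fact
 qed (intro allI impI, rule H)
qed

end

section \<open>The nonlinearity\<close>

context littlewood_paley
begin

lemma in_besov_iff: "in_besov chi rho a f \<longleftrightarrow> (\<exists>C. bb a f C)"
 by (simp add: in_besov_def bb_def)

lemma bb_besov_norm: "in_besov chi rho a f ==> bb a f (besov_norm chi rho a f)"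
proof -
 let ?S = "{2 powr (a * (real n - 1)) * cmod (LP_block chi rho n f x) |n x. True}"
 assume "in_besov chi rho a f"
 then obtain C where "\<forall>n x. 2 powr (a * (real n - 1)) * cmod (LP_block chi rho n f x) \<le> C"
  unfolding in_besov_def by blast
 then have "bdd_above ?S" by (intro bdd_aboveI[of _ C]) blast
 then show ?thesis unfolding bb_def besov_norm_def by (intro allI cSup_upper) blast+
qed

lemma besov_norm_le: "bb a f C ==> besov_norm chi rho a f \<le> C"
 unfolding besov_norm_def bb_def by (rule cSup_least) auto

lemma besov_norm_nonneg: "in_besov chi rho a f ==> 0 \<le> besov_norm chi rho a f"
 by (rule bb_nonneg[OF bb_besov_norm])

lemma bb_imp_in_besov: "bb a f C ==> in_besov chi rho a f"
 unfolding in_besov_iff by blast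

lemma null_alongI:
 assumes "!!e. 0 < e ==> eventually (%i. bb s (h i) e) F"
 shows "null_along F s h"
proof -
 have ev: "eventually (%i. in_besov chi rho s (h i)) F"
  using assms[of 1] by (auto elim!: eventually_mono intro: bb_imp_in_besov)
 have "((%i. besov_norm chi rho s (h i)) \<longlongrightarrow> 0) F"
 proof (rule tendstoI)
  fix e :: real assume "0 < e"
  then have "eventually (%i. bb s (h i) (e / 2)) F" by (intro assms) simp
  with ev show "eventually (%i. dist (besov_norm chi rho s (h i)) 0 < e) F"
  proof eventually_elim
   case (elim i)
   then show ?case using besov_norm_le[OF elim(2)] besov_norm_nonneg[OF elim(1)] \<open>0 < e\<close> by simp
  qed
 qed
 moreover have "eventually (%i. bb s (h i) (besov_norm chi rho s (h i))) F"
  using ev by eventually_elim (rule bb_besov_norm)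
 ultimately show ?thesis unfolding null_along_def by blast
qed

text \<open>High blocks are uniformly small by the bound in the better space; the remaining finitely
  many blocks involve finitely many coefficients. This turns coefficientwise continuity in time into
  continuity in norm.\<close>

lemma null_along_of_coeff:
 assumes "!!k. ((%i. h i k) \<longlongrightarrow> 0) F" "bdd_along F s h" "s' < s"
 shows "null_along F s' h"
proof (rule null_alongI)
 fix e :: real assume e: "0 < e"
 obtain C where C: "eventually (%i. bb s (h i) C) F" using assms(2) unfolding bdd_along_def by blast
 have "(%n. \<bar>C\<bar> * dy (s - s') n) \<longlonglongrightarrow> 0"
 proof -
  have "2 powr (- (s - s')) < 2 powr 0" using assms(3) by (subst powr_less_cancel_iff) auto
  then have "(%n. (2 powr (- (s - s'))) ^ n) \<longlonglongrightarrow> (0::real)" by (intro LIMSEQ_realpow_zero) auto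
  from tendsto_mult_right_zero[OF this, of "\<bar>C\<bar> * 2 powr (s - s')"] show ?thesis
   by (simp add: dy_power mult.assoc)
 qed
 then have "eventually (%n. \<bar>C\<bar> * dy (s - s') n < e) sequentially" using e by (rule order_tendstoD)
 then obtain n0 where n0: "!!n. n0 \<le> n ==> \<bar>C\<bar> * dy (s - s') n < e" unfolding eventually_sequentially by blast
 let ?S = "%n i. \<Sum>k | wt n k \<noteq> 0. cmod (wt n k) * cmod (h i k)"
 have small: "eventually (%i. ?S n i < e * dy s' n) F" for n
 proof -
  have "((%i. ?S n i) \<longlongrightarrow> (\<Sum>k | wt n k \<noteq> 0. cmod (wt n k) * 0)) F"
   by (intro tendsto_sum tendsto_mult tendsto_const tendsto_norm_zero assms(1))
  then have "((%i. ?S n i) \<longlongrightarrow> 0) F" by (simp only: mult_zero_right sum.neutral_const)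
  then show ?thesis using e by (intro order_tendstoD) auto
 qed
 have "eventually (%i. \<forall>n\<in>{..<n0}. ?S n i < e * dy s' n) F"
  by (intro eventually_ball_finite ballI small) simp
 with C show "eventually (%i. bb s' (h i) e) F"
 proof eventually_elim
  case (elim i)
  show ?case
  proof (rule bbI)
   fix n x
   show "cmod (ev (%k. wt n k * h i k) x) \<le> e * dy s' n"
   proof (cases "n < n0")
    case True
    have "cmod (ev (%k. wt n k * h i k) x) \<le> ?S n i"
     by (subst ev_eq[of "{k. wt n k \<noteq> 0}"])
      (use trig_wt[of n] in \<open>auto intro!: sum_norm_le simp: norm_mult\<close>)
    also have "\<dots> \<le> e * dy s' n" using elim(2) True by (intro less_imp_le) blast
    finally show ?thesis .
   next
    case False
    have "cmod (ev (%k. wt n k * h i k) x) \<le> C * dy s n" by (rule bbD[OF elim(1)])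
    also have "\<dots> \<le> \<bar>C\<bar> * dy s n" by (intro mult_right_mono) auto
    also have "\<dots> = \<bar>C\<bar> * dy (s - s') n * dy s' n" using dy_add[of "s - s'" s' n] by simp
    also have "\<dots> \<le> e * dy s' n" using n0[of n] False by (intro mult_right_mono) auto
    finally show ?thesis .
   qed
  qed
 qed
qed

text \<open>The noise, the linear datum z and the target y of the relaxation are free arguments, so
  that the same expression can be evaluated at the true data and at truncated data.\<close>

definition wick :: "nat => complex => complex => real => (nat => nat => dist) => dist => dist => dist => dist" where
 "wick m \<nu> \<tau> lam \<zeta> z y w k = of_real lam * (y k - w k) +
  (- \<nu> * (\<Sum>i\<le>m + 1. \<Sum>j\<le>m. of_nat ((m + 1) choose i) * of_nat (m choose j) * monom_term i j w (\<zeta> i j) k)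
   + (\<tau> + 1) * (w k + z k))"

lemma wick_Psi: "wick m \<nu> \<tau> lam (%i j. Zc Z Zij (m + 1 - i) (m - j) t) (Z t) y w =
  (%k. of_real lam * (y k - w k) + Psi chi rho m \<nu> \<tau> Z Zij t w k)"
 by (simp add: wick_def Psi_def monom_term_def fun_eq_iff)

abbreviation binc :: "nat => nat => nat => complex" where
 "binc m i j \<equiv> of_nat ((m + 1) choose i) * of_nat (m choose j)"

lemma wick_diff: "wick m \<nu> \<tau> lam \<zeta> z y w k - wick m \<nu> \<tau> lam \<zeta>' z' y' w' k =
 of_real lam * (y k - y' k) + ((- \<nu>) * (\<Sum>i\<le>m + 1. \<Sum>j\<le>m. binc m i j * (monom_term i j w (\<zeta> i j) k - monom_term i j w' (\<zeta>' i j) k))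
  + ((\<tau> + 1) * (z k - z' k) + (\<tau> + 1 - of_real lam) * (w k - w' k)))"
 unfolding wick_def by (simp add: right_diff_distrib sum_subtractf) (simp add: algebra_simps)

lemma null_along_wick:
 assumes "0 < \<alpha>" "\<alpha> < \<beta>" "null_along F \<beta> (%i k. w i k - w' i k)" "bdd_along F \<beta> w'"
  and "!!p q. p \<le> m + 1 ==> q \<le> m ==> null_along F (- \<alpha>) (%i k. \<zeta> i p q k - \<zeta>' i p q k)"
  and "!!p q. p \<le> m + 1 ==> q \<le> m ==> bdd_along F (- \<alpha>) (%i. \<zeta>' i p q)"
  and "null_along F (- \<alpha>) (%i k. z i k - z' i k)" "null_along F (- \<alpha>) (%i k. y i k - y' i k)"
 shows "null_along F (- \<alpha>) (%i k. wick m \<nu> \<tau> lam (\<zeta> i) (z i) (y i) (w i) k - wick m \<nu> \<tau> lam (\<zeta>' i) (z' i) (y' i) (w' i) k)"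
proof -
 have w: "null_along F (- \<alpha>) (%i k. w i k - w' i k)"
  by (rule null_along_exponent[OF assms(3)]) (use assms in auto)
 show ?thesis
  unfolding wick_diff
  by (intro null_along_add null_along_cmult null_along_sum assms w null_along_monom_term[of \<alpha> \<beta>]) auto
qed

lemma trig_wick:
 assumes "trig w" "trig z" "trig y" "!!i j. i \<le> m + 1 ==> j \<le> m ==> trig (\<zeta> i j)"
 shows "trig (wick m \<nu> \<tau> lam \<zeta> z y w)"
  and "ev (wick m \<nu> \<tau> lam \<zeta> z y w) x = of_real lam * (ev y x - ev w x) +
  (- \<nu> * (\<Sum>i\<le>m + 1. \<Sum>j\<le>m. binc m i j * (ev w x ^ i * cnj (ev w x) ^ j * ev (\<zeta> i j) x))
   + (\<tau> + 1) * (ev w x + ev z x))"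
proof -
 have inner: "trig (%k. binc m i j * monom_term i j w (\<zeta> i j) k)" if "i \<in> {..m + 1}" "j \<in> {..m}" for i j
  using that assms by (intro trig_mult2 trig_monom_term) auto
 have t1: "trig (%k. \<Sum>j\<le>m. binc m i j * monom_term i j w (\<zeta> i j) k)" if "i \<in> {..m + 1}" for i
  using that by (intro trig_sum inner) auto
 have t2: "trig (%k. \<Sum>i\<le>m + 1. \<Sum>j\<le>m. binc m i j * monom_term i j w (\<zeta> i j) k)"
  by (intro trig_sum t1) auto
 note t3 = trig_diff[OF assms(3,1)] trig_add[OF assms(1,2)]
 note t4 = trig_mult2[OF t2, of "%_. - \<nu>"] trig_mult2[OF t3(1), of "%_. of_real lam"] trig_mult2[OF t3(2), of "%_. \<tau> + 1"]
 show "trig (wick m \<nu> \<tau> lam \<zeta> z y w)"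
  unfolding wick_def[abs_def] by (intro trig_add t4)
 have s: "ev (%k. \<Sum>i\<le>m + 1. \<Sum>j\<le>m. binc m i j * monom_term i j w (\<zeta> i j) k) x =
   (\<Sum>i\<le>m + 1. \<Sum>j\<le>m. binc m i j * (ev w x ^ i * cnj (ev w x) ^ j * ev (\<zeta> i j) x))"
 proof (subst ev_sum[OF finite_atMost t1], assumption, intro sum.cong refl)
  fix i assume i: "i \<in> {..m + 1}"
  show "ev (%k. \<Sum>j\<le>m. binc m i j * monom_term i j w (\<zeta> i j) k) x =
   (\<Sum>j\<le>m. binc m i j * (ev w x ^ i * cnj (ev w x) ^ j * ev (\<zeta> i j) x))"
  proof (subst ev_sum[OF finite_atMost inner[OF i]], assumption, intro sum.cong refl)
   fix j assume "j \<in> {..m}"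
   then have "trig (\<zeta> i j)" using i assms(4) by auto
   then show "ev (%k. binc m i j * monom_term i j w (\<zeta> i j) k) x = binc m i j * (ev w x ^ i * cnj (ev w x) ^ j * ev (\<zeta> i j) x)"
    using assms(1) by (simp only: ev_cmult trig_monom_term ev_monom_term)
  qed
 qed
 show "ev (wick m \<nu> \<tau> lam \<zeta> z y w) x = of_real lam * (ev y x - ev w x) +
  (- \<nu> * (\<Sum>i\<le>m + 1. \<Sum>j\<le>m. binc m i j * (ev w x ^ i * cnj (ev w x) ^ j * ev (\<zeta> i j) x))
   + (\<tau> + 1) * (ev w x + ev z x))"
  unfolding wick_def[abs_def]
  by (simp only: ev_add[OF t4(2) trig_add[OF t4(1,3)]] ev_add[OF t4(1,3)] ev_cmult[OF t2] ev_cmult[OF t3(1)] ev_cmult[OF t3(2)]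
    ev_diff[OF assms(3,1)] ev_add[OF assms(1,2)] s)
qed

text \<open>Homogeneity: a monomial of degree i + j in w contributes \<sigma> powr (- \<gamma> (i +
  j)) and its noise coefficient supplies the missing 2 m + 1 - i - j factors. The remaining terms
  are less singular and are brought to the same power at the price of powers of T.\<close>

lemma wick_estimates:
 fixes R K T :: real
 assumes ab: "0 < \<alpha>" "\<alpha> < \<beta>" and g: "0 < \<gamma>" and R: "0 < R" and K: "0 \<le> K" and T: "0 < T"
 shows "\<exists>L\<ge>0. \<forall>\<sigma> w w' \<epsilon> \<zeta> z y. 0 < \<sigma> --> \<sigma> \<le> T --> bb \<beta> w (R * \<sigma> powr (- \<gamma>)) --> bb \<beta> w' (R * \<sigma> powr (- \<gamma>)) -->
  bb \<beta> (%k. w k - w' k) (\<epsilon> * \<sigma> powr (- \<gamma>)) --> bb (- \<alpha>) z K --> bb \<beta> y (K * \<sigma> powr (- \<gamma>)) -->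
  (\<forall>i\<le>m + 1. \<forall>j\<le>m. bb (- \<alpha>) (\<zeta> i j) (K * \<sigma> powr (- \<gamma> * (real (m + 1 - i) + real (m - j))))) -->
  bb (- \<alpha>) (wick m \<nu> \<tau> lam \<zeta> z y w) (L * \<sigma> powr (- real (2 * m + 1) * \<gamma>)) \<and>
  bb (- \<alpha>) (%k. wick m \<nu> \<tau> lam \<zeta> z y w k - wick m \<nu> \<tau> lam \<zeta> z y w' k) (L * \<epsilon> * \<sigma> powr (- real (2 * m + 1) * \<gamma>))"
proof -
 let ?E = "2 powr (\<beta> + \<alpha>) :: real"
 let ?Tm = "T powr (2 * m * \<gamma>)" let ?Tm' = "T powr ((2 * m + 1) * \<gamma>)"
 define L1 where "L1 = \<bar>lam\<bar> * (?E * K * ?Tm + ?E * R * ?Tm) + (cmod (- \<nu>) * (\<Sum>i\<le>m + 1. \<Sum>j\<le>m. cmod (binc m i j) * (\<bar>termC \<beta> \<alpha> i j\<bar> * R ^ (i + j) * K)) + cmod (\<tau> + 1) * (?E * R * ?Tm + K * ?Tm'))"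
 define L2 where "L2 = cmod (- \<nu>) * (\<Sum>i\<le>m + 1. \<Sum>j\<le>m. cmod (binc m i j) * (\<bar>termdC \<beta> \<alpha> i j\<bar> * R ^ (i + j) * (1 / R) * K)) + cmod (\<tau> + 1 - of_real lam) * (?E * ?Tm)"
 have L12: "0 \<le> L1" "0 \<le> L2" unfolding L1_def L2_def using R K by (auto intro!: add_nonneg_nonneg mult_nonneg_nonneg sum_nonneg)
 define L where "L = L1 + L2"
 have main: "bb (- \<alpha>) (wick m \<nu> \<tau> lam \<zeta> z y w) (L * \<sigma> powr (- real (2 * m + 1) * \<gamma>)) \<and>
  bb (- \<alpha>) (%k. wick m \<nu> \<tau> lam \<zeta> z y w k - wick m \<nu> \<tau> lam \<zeta> z y w' k) (L * \<epsilon> * \<sigma> powr (- real (2 * m + 1) * \<gamma>))"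
  if s: "0 < \<sigma>" "\<sigma> \<le> T" and w: "bb \<beta> w (R * \<sigma> powr (- \<gamma>))" and w': "bb \<beta> w' (R * \<sigma> powr (- \<gamma>))"
   and d: "bb \<beta> (%k. w k - w' k) (\<epsilon> * \<sigma> powr (- \<gamma>))" and z: "bb (- \<alpha>) z K" and y: "bb \<beta> y (K * \<sigma> powr (- \<gamma>))"
   and \<zeta>: "\<forall>i\<le>m + 1. \<forall>j\<le>m. bb (- \<alpha>) (\<zeta> i j) (K * \<sigma> powr (- \<gamma> * (real (m + 1 - i) + real (m - j))))"
  for \<sigma> w w' \<epsilon> \<zeta> z y
 proof -
  let ?s = "\<sigma> powr (- real (2 * m + 1) * \<gamma>)"
  have eps: "0 \<le> \<epsilon>" using bb_nonneg[OF d] s by (simp add: zero_le_mult_iff)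
  have lin: "bb (- \<alpha>) h (?E * C * ?Tm * ?s)" if "bb \<beta> h (C * \<sigma> powr (- \<gamma>))" "0 \<le> C" for h C
  proof (rule bb_mono[OF bb_le_exponent[OF that(1)]])
   have "\<sigma> powr (- \<gamma>) = \<sigma> powr (2 * m * \<gamma>) * ?s" using s by (simp add: powr_add[symmetric] algebra_simps)
   also have "\<dots> \<le> ?Tm * ?s" using s g by (intro mult_right_mono powr_mono2) auto
   finally have "?E * C * \<sigma> powr (- \<gamma>) \<le> ?E * C * (?Tm * ?s)" using that(2) by (intro mult_left_mono) auto
   then show "2 powr (\<beta> - - \<alpha>) * (C * \<sigma> powr (- \<gamma>)) \<le> ?E * C * ?Tm * ?s" by (simp add: mult.assoc)
  qed (use ab in auto)
  have z': "bb (- \<alpha>) z (K * ?Tm' * ?s)"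
  proof (rule bb_mono[OF z])
   have "1 = \<sigma> powr ((2 * m + 1) * \<gamma>) * ?s" using s by (simp add: powr_add[symmetric] algebra_simps)
   also have "\<dots> \<le> ?Tm' * ?s" using s g by (intro mult_right_mono powr_mono2) auto
   finally have "K * 1 \<le> K * (?Tm' * ?s)" using K by (rule mult_left_mono)
   then show "K \<le> K * ?Tm' * ?s" by simp
  qed
  have pw: "(R * \<sigma> powr (- \<gamma>)) ^ (i + j) * (K * \<sigma> powr (- \<gamma> * (real (m + 1 - i) + real (m - j)))) = R ^ (i + j) * K * ?s"
   if "i \<le> m + 1" "j \<le> m" for i j
  proof -
   have "(\<sigma> powr (- \<gamma>)) ^ (i + j) = \<sigma> powr (- \<gamma> * real (i + j))" using s by (simp add: powr_powr flip: powr_realpow)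
   then have "(\<sigma> powr (- \<gamma>)) ^ (i + j) * \<sigma> powr (- \<gamma> * (real (m + 1 - i) + real (m - j))) = ?s"
    using that by (simp add: of_nat_diff powr_add[symmetric] algebra_simps)
   then show ?thesis by (simp add: power_mult_distrib ac_simps)
  qed
  have term1: "bb (- \<alpha>) (monom_term i j w (\<zeta> i j)) (\<bar>termC \<beta> \<alpha> i j\<bar> * R ^ (i + j) * K * ?s)" if ij: "i \<le> m + 1" "j \<le> m" for i j
  proof (rule bb_mono[OF bb_monom_term[OF ab w]])
   show "bb (- \<alpha>) (\<zeta> i j) (K * \<sigma> powr (- \<gamma> * (real (m + 1 - i) + real (m - j))))" using \<zeta> ij by blast
   have "termC \<beta> \<alpha> i j * (R ^ (i + j) * K * ?s) \<le> \<bar>termC \<beta> \<alpha> i j\<bar> * (R ^ (i + j) * K * ?s)"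
    using R K by (intro mult_right_mono) auto
   then show "termC \<beta> \<alpha> i j * (R * \<sigma> powr (- \<gamma>)) ^ (i + j) * (K * \<sigma> powr (- \<gamma> * (real (m + 1 - i) + real (m - j)))) \<le> \<bar>termC \<beta> \<alpha> i j\<bar> * R ^ (i + j) * K * ?s"
    unfolding mult.assoc[of "termC \<beta> \<alpha> i j"] pw[OF ij] by (simp only: mult.assoc)
  qed
  have term2: "bb (- \<alpha>) (%k. monom_term i j w (\<zeta> i j) k - monom_term i j w' (\<zeta> i j) k) (\<bar>termdC \<beta> \<alpha> i j\<bar> * R ^ (i + j) * (1 / R) * K * (\<epsilon> * ?s))" if ij: "i \<le> m + 1" "j \<le> m" for i j
  \<comment> \<open>The Lipschitz bound measures the distance as a multiple of the common size; here
    this multiple is \<epsilon> / R.\<close>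
  proof (rule bb_mono[OF bb_monom_term_diff[OF ab w w', of "\<epsilon> / R"]])
   show "bb \<beta> (%k. w k - w' k) (R * \<sigma> powr (- \<gamma>) * (\<epsilon> / R))" using d R by (simp add: mult.commute)
   show "bb (- \<alpha>) (\<zeta> i j) (K * \<sigma> powr (- \<gamma> * (real (m + 1 - i) + real (m - j))))" using \<zeta> ij by blast
   have "termdC \<beta> \<alpha> i j * (R * \<sigma> powr (- \<gamma>)) ^ (i + j) * (\<epsilon> / R) * (K * \<sigma> powr (- \<gamma> * (real (m + 1 - i) + real (m - j)))) =
    termdC \<beta> \<alpha> i j * (R ^ (i + j) * K * ?s * (\<epsilon> / R))"
    unfolding pw[OF ij, symmetric] by (simp only: ac_simps)
   also have "\<dots> \<le> \<bar>termdC \<beta> \<alpha> i j\<bar> * (R ^ (i + j) * K * ?s * (\<epsilon> / R))"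
    using R K eps by (intro mult_right_mono) auto
   also have "\<dots> = \<bar>termdC \<beta> \<alpha> i j\<bar> * R ^ (i + j) * (1 / R) * K * (\<epsilon> * ?s)"
    by simp
   finally show "termdC \<beta> \<alpha> i j * (R * \<sigma> powr (- \<gamma>)) ^ (i + j) * (\<epsilon> / R) * (K * \<sigma> powr (- \<gamma> * (real (m + 1 - i) + real (m - j)))) \<le> \<bar>termdC \<beta> \<alpha> i j\<bar> * R ^ (i + j) * (1 / R) * K * (\<epsilon> * ?s)" .
  qed
  have "bb (- \<alpha>) (wick m \<nu> \<tau> lam \<zeta> z y w)
   (cmod (of_real lam) * (?E * K * ?Tm * ?s + ?E * R * ?Tm * ?s) + (cmod (- \<nu>) * (\<Sum>i\<le>m + 1. \<Sum>j\<le>m. cmod (binc m i j) * (\<bar>termC \<beta> \<alpha> i j\<bar> * R ^ (i + j) * K * ?s)) + cmod (\<tau> + 1) * (?E * R * ?Tm * ?s + K * ?Tm' * ?s)))"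
   unfolding wick_def[abs_def]
   by (intro bb_add bb_cmult bb_diff bb_sum term1 lin[OF y K] lin[OF w] z') (use R in auto)
  moreover have "cmod (of_real lam) * (?E * K * ?Tm * ?s + ?E * R * ?Tm * ?s) + (cmod (- \<nu>) * (\<Sum>i\<le>m + 1. \<Sum>j\<le>m. cmod (binc m i j) * (\<bar>termC \<beta> \<alpha> i j\<bar> * R ^ (i + j) * K * ?s)) + cmod (\<tau> + 1) * (?E * R * ?Tm * ?s + K * ?Tm' * ?s)) = L1 * ?s"
   unfolding L1_def norm_of_real distrib_right sum_distrib_right mult.assoc by (simp only: distrib_left mult.assoc)
  ultimately have 1: "bb (- \<alpha>) (wick m \<nu> \<tau> lam \<zeta> z y w) (L1 * ?s)" by (simp only:)
  have d': "bb (- \<alpha>) (%k. w k - w' k) (?E * \<epsilon> * ?Tm * ?s)" by (rule lin[OF d eps])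
  have "(%k. wick m \<nu> \<tau> lam \<zeta> z y w k - wick m \<nu> \<tau> lam \<zeta> z y w' k) =
   (%k. (- \<nu>) * (\<Sum>i\<le>m + 1. \<Sum>j\<le>m. binc m i j * (monom_term i j w (\<zeta> i j) k - monom_term i j w' (\<zeta> i j) k)) + (\<tau> + 1 - of_real lam) * (w k - w' k))"
   unfolding wick_diff by simp
  then have "bb (- \<alpha>) (%k. wick m \<nu> \<tau> lam \<zeta> z y w k - wick m \<nu> \<tau> lam \<zeta> z y w' k)
   (cmod (- \<nu>) * (\<Sum>i\<le>m + 1. \<Sum>j\<le>m. cmod (binc m i j) * (\<bar>termdC \<beta> \<alpha> i j\<bar> * R ^ (i + j) * (1 / R) * K * (\<epsilon> * ?s))) + cmod (\<tau> + 1 - of_real lam) * (?E * \<epsilon> * ?Tm * ?s))"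
   by (simp only:) (intro bb_add bb_cmult bb_sum term2 d'; simp)
  moreover have "cmod (- \<nu>) * (\<Sum>i\<le>m + 1. \<Sum>j\<le>m. cmod (binc m i j) * (\<bar>termdC \<beta> \<alpha> i j\<bar> * R ^ (i + j) * (1 / R) * K * (\<epsilon> * ?s))) + cmod (\<tau> + 1 - of_real lam) * (?E * \<epsilon> * ?Tm * ?s) = L2 * (\<epsilon> * ?s)"
   unfolding L2_def distrib_right sum_distrib_right mult.assoc by (simp only: ac_simps)
  ultimately have 2: "bb (- \<alpha>) (%k. wick m \<nu> \<tau> lam \<zeta> z y w k - wick m \<nu> \<tau> lam \<zeta> z y w' k) (L2 * (\<epsilon> * ?s))" by (simp only:)
  show ?thesis
  proof
   show "bb (- \<alpha>) (wick m \<nu> \<tau> lam \<zeta> z y w) (L * ?s)"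
    by (rule bb_mono[OF 1]) (use L12 in \<open>auto simp: L_def distrib_right\<close>)
   have "L2 * (\<epsilon> * ?s) \<le> L * (\<epsilon> * ?s)" using L12 eps by (intro mult_right_mono) (auto simp: L_def)
   then show "bb (- \<alpha>) (%k. wick m \<nu> \<tau> lam \<zeta> z y w k - wick m \<nu> \<tau> lam \<zeta> z y w' k) (L * \<epsilon> * ?s)"
    using bb_mono[OF 2] by (simp only: mult.assoc)
  qed
 qed
 have "0 \<le> L" using L12 by (simp add: L_def)
 show ?thesis
  by (rule exI[of _ L], rule conjI[OF \<open>0 \<le> L\<close>], intro allI impI, rule main)
qed

text \<open>The weight of the class is used with exponent \<gamma>. One factor \<gamma> of time
  decay is given up, paid by T powr \<gamma>, so that a single formula covers the unit, Z itself and
  all higher Wick powers.\<close>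

lemma Zc_bounds:
 assumes Z: "in_L chi rho m Z Zij" and a: "0 < \<alpha>" "\<alpha> < 1" and g: "0 < \<gamma>" "\<gamma> < 1" and T: "0 < T"
 shows "\<exists>K\<ge>0. \<forall>t. 0 < t --> t \<le> T --> bb (- \<alpha>) (Z t) K \<and>
  (\<forall>p\<le>m + 1. \<forall>q\<le>m. bb (- \<alpha>) (Zc Z Zij p q t) (K * t powr (- \<gamma> * (real p + real q))))"
proof -
 have Zb: "!!t. 0 \<le> t ==> in_besov chi rho (- \<alpha>) (Z t)"
  and Zijb: "!!i j t. (i, j) \<in> Lset m ==> 0 < t ==> in_besov chi rho (- \<alpha>) (Zij i j t)"
  using Z a unfolding in_L_def Ball_def split_paired_All prod.case by auto
 obtain C where C: "\<forall>t\<in>{0..T}. besov_norm chi rho (- \<alpha>) (Z t) \<le> C"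
  "\<forall>(i, j)\<in>Lset m. \<forall>t\<in>{0<..T}. t powr ((real (i + j) - 1) * \<gamma>) * besov_norm chi rho (- \<alpha>) (Zij i j t) \<le> C"
  using Z a g T unfolding in_L_def by (meson greaterThanLessThan_iff)
 have Z1: "bb (- \<alpha>) (Z t) C" if "0 < t" "t \<le> T" for t
  using bb_mono[OF bb_besov_norm[OF Zb]] C(1) that by auto
 have C0: "0 \<le> C" using bb_nonneg[OF Z1[OF T order_refl]] .
 have Z2: "bb (- \<alpha>) (Zij i j t) (C * t powr (- (real (i + j) - 1) * \<gamma>))" if "(i, j) \<in> Lset m" "0 < t" "t \<le> T" for i j t
 proof (rule bb_mono[OF bb_besov_norm[OF Zijb[OF that(1,2)]]])
  have zle: "t powr ((real (i + j) - 1) * \<gamma>) * besov_norm chi rho (- \<alpha>) (Zij i j t) \<le> C"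
   using C(2) that by auto
  show "besov_norm chi rho (- \<alpha>) (Zij i j t) \<le> C * t powr (- (real (i + j) - 1) * \<gamma>)"
  proof -
   have e: "t powr (- (real (i + j) - 1) * \<gamma>) = inverse (t powr ((real (i + j) - 1) * \<gamma>))"
    by (simp only: minus_mult_left[symmetric] powr_minus)
   have "y \<le> C * inverse x" if "0 < x" "x * y \<le> C" for x y :: real
    using that by (simp add: field_simps)
   from this[OF _ zle] that(2) show ?thesis unfolding e by simp
  qed
 qed
 define K where "K = unitC (- \<alpha>) + C + (1 + conjC (- \<alpha>)) * C * T powr \<gamma>"
 have u0: "0 \<le> unitC (- \<alpha>)" using bb_nonneg[OF bb_dunit] .
 have K0: "0 \<le> K" using C0 u0 conjC_nonneg by (simp add: K_def)
 have Kge: "unitC (- \<alpha>) \<le> K" "C \<le> K" "C * T powr \<gamma> \<le> K" "conjC (- \<alpha>) * C * T powr \<gamma> \<le> K"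
  using C0 u0 conjC_nonneg[of "- \<alpha>"] by (auto simp: K_def algebra_simps)
 have shift: "C * t powr (- (n - 1) * \<gamma>) \<le> C * T powr \<gamma> * t powr (- \<gamma> * n)" if "0 < t" "t \<le> T" for t n
 proof -
  have "t powr (- (n - 1) * \<gamma>) = t powr \<gamma> * t powr (- \<gamma> * n)" by (simp add: powr_add[symmetric] algebra_simps)
  also have "\<dots> \<le> T powr \<gamma> * t powr (- \<gamma> * n)" using that g by (intro mult_right_mono powr_mono2) auto
  finally show ?thesis using C0 by (simp add: mult.assoc mult_left_mono)
 qed
 have conjb: "bb (- \<alpha>) (dconj h) (K * X)" if "bb (- \<alpha>) h (C * T powr \<gamma> * X)" "0 \<le> X" for h X
  by (rule bb_mono[OF bb_dconj[OF that(1)]]) (use mult_right_mono[OF Kge(4) that(2)] in \<open>simp add: mult.assoc\<close>)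
 have nonconj: "bb (- \<alpha>) h (K * X)" if "bb (- \<alpha>) h (C * T powr \<gamma> * X)" "0 \<le> X" for h X
  by (rule bb_mono[OF that(1)]) (use mult_right_mono[OF Kge(3) that(2)] in simp)
 have "bb (- \<alpha>) (Zc Z Zij p q t) (K * t powr (- \<gamma> * (real p + real q)))" if t: "0 < t" "t \<le> T" and pq: "p \<le> m + 1" "q \<le> m" for p q t
 proof -
  have Z1': "bb (- \<alpha>) (Z t) (C * T powr \<gamma> * t powr (- \<gamma> * 1))"
   by (rule bb_mono[OF Z1[OF t]]) (use shift[OF t, of 1] t in simp)
  have Z2': "bb (- \<alpha>) (Zij i j t) (C * T powr \<gamma> * t powr (- \<gamma> * (real i + real j)))" if "(i, j) \<in> Lset m" for i j
   by (rule bb_mono[OF Z2[OF that t]]) (use shift[OF t, of "real i + real j"] in simp)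
  consider "p = 0" "q = 0" | "p = 1" "q = 0" | "p = 0" "q = 1" | "1 < p + q" "q \<le> p" | "1 < p + q" "p < q" by linarith
  then show ?thesis
  proof cases
   case 1
   then show ?thesis using bb_mono[OF bb_dunit Kge(1)] t by (simp add: Zc_def)
  next
   case 2
   then show ?thesis using nonconj[OF Z1'] by (simp add: Zc_def)
  next
   case 3
   then show ?thesis using conjb[OF Z1'] by (simp add: Zc_def)
  next
   case 4
   then have "(p, q) \<in> Lset m" using pq by (simp add: Lset_def)
   from nonconj[OF Z2'[OF this]] show ?thesis using 4 by (auto simp: Zc_def)
  next
   case 5
   then have "(q, p) \<in> Lset m" using pq by (simp add: Lset_def)
   from conjb[OF Z2'[OF this]] show ?thesis using 5 by (auto simp: Zc_def add.commute)
  qed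
 qed
 then show ?thesis using K0 Z1 bb_mono[OF _ Kge(2)] by blast
qed

text \<open>\<open>besov_norm\<close> is a supremum of reals and controls the blocks only when the
  set is bounded; membership in the space guarantees that.\<close>

lemma besov_cont_null:
 assumes "besov_cont_on chi rho a S w" "!!t. t \<in> S ==> in_besov chi rho a (w t)" "t \<in> S"
 shows "null_along (at t within S) a (%s k. w s k - w t k)"
proof -
 have "((%s. besov_norm chi rho a (%k. w s k - w t k)) \<longlongrightarrow> 0) (at t within S)"
  using assms unfolding besov_cont_on_def by blast
 moreover have "eventually (%s. bb a (%k. w s k - w t k) (besov_norm chi rho a (%k. w s k - w t k))) (at t within S)"
 proof -
  have "eventually (%s. s \<in> S) (at t within S)" by (auto simp: eventually_at_filter)
  then show ?thesis
  proof eventually_elim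
   case (elim s)
   have "in_besov chi rho a (%k. w s k - w t k)"
    using bb_diff[OF bb_besov_norm[OF assms(2)[OF elim]] bb_besov_norm[OF assms(2)[OF assms(3)]]]
    by (rule bb_imp_in_besov)
   then show ?case by (rule bb_besov_norm)
  qed
 qed
 ultimately show ?thesis unfolding null_along_def by blast
qed

lemma null_along_mono: "null_along F a h ==> F' \<le> F ==> null_along F' a h"
 unfolding null_along_def by (meson tendsto_mono filter_leD)

lemma Zc_cont:
 assumes Z: "in_L chi rho m Z Zij" and a: "0 < \<alpha>" "\<alpha> < 1" and t: "0 < t"
 shows "null_along (at t within {0<..}) (- \<alpha>) (%s k. Z s k - Z t k)"
  and "p \<le> m + 1 ==> q \<le> m ==> null_along (at t within {0<..}) (- \<alpha>) (%s k. Zc Z Zij p q s k - Zc Z Zij p q t k)"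
proof -
 have Zb: "!!t. 0 \<le> t ==> in_besov chi rho (- \<alpha>) (Z t)"
  and Zijb: "!!i j t. (i, j) \<in> Lset m ==> 0 < t ==> in_besov chi rho (- \<alpha>) (Zij i j t)"
  and Zcont: "besov_cont_on chi rho (- \<alpha>) {0..} Z"
  and Zijcont: "!!i j. (i, j) \<in> Lset m ==> besov_cont_on chi rho (- \<alpha>) {0<..} (Zij i j)"
  using Z a unfolding in_L_def Ball_def split_paired_All prod.case by auto
 have "null_along (at t within {0..}) (- \<alpha>) (%s k. Z s k - Z t k)"
  by (rule besov_cont_null[OF Zcont]) (use Zb t in auto)
 then show Z1: "null_along (at t within {0<..}) (- \<alpha>) (%s k. Z s k - Z t k)"
  by (rule null_along_mono) (auto intro: at_le)
 have Z2: "null_along (at t within {0<..}) (- \<alpha>) (%s k. Zij i j s k - Zij i j t k)" if "(i, j) \<in> Lset m" for i j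
  by (rule besov_cont_null[OF Zijcont[OF that]]) (use Zijb that t in auto)
 assume pq: "p \<le> m + 1" "q \<le> m"
 consider "p = 0" "q = 0" | "p = 1" "q = 0" | "p = 0" "q = 1" | "1 < p + q" "q \<le> p" | "1 < p + q" "p < q" by linarith
 then show "null_along (at t within {0<..}) (- \<alpha>) (%s k. Zc Z Zij p q s k - Zc Z Zij p q t k)"
 proof cases
  case 1
  then show ?thesis by (simp add: Zc_def null_along_zero)
 next
  case 2
  then show ?thesis using Z1 by (simp add: Zc_def)
 next
  case 3
  then show ?thesis using null_along_dconj[OF Z1] by (simp add: Zc_def)
 next
  case 4
  then have "(p, q) \<in> Lset m" using pq by (simp add: Lset_def)
  moreover have "Zc Z Zij p q s = Zij p q s" for s using 4 by (auto simp: Zc_def)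
  ultimately show ?thesis using Z2 by (simp only:)
 next
  case 5
  then have "(q, p) \<in> Lset m" using pq by (simp add: Lset_def)
  moreover have "Zc Z Zij p q s = dconj (Zij q p s)" for s using 5 by (auto simp: Zc_def)
  ultimately show ?thesis using null_along_dconj[OF Z2] by (simp only:)
 qed
qed

end

section \<open>Local theory of the mild equation\<close>

lemma abs_integrable_Ioo_bound:
 fixes g :: "real => complex"
 assumes "continuous_on {a<..<t} g" "h integrable_on {a..t}" "!!s. a < s ==> s < t ==> cmod (g s) \<le> h s"
 shows "g absolutely_integrable_on {a..t}"
 unfolding absolutely_integrable_on_Icc_iff_Ioo
proof (rule measurable_bounded_by_integrable_imp_absolutely_integrable)
 show "g \<in> borel_measurable (lebesgue_on {a<..<t})"
  by (rule continuous_imp_measurable_on_sets_lebesgue[OF assms(1)]) simp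
 show "h integrable_on {a<..<t}" using assms(2) by (simp add: integrable_on_Icc_iff_Ioo)
qed (use assms(3) in auto)

lemma integral_Ioo_bound:
 fixes g :: "real => complex"
 assumes "g integrable_on {a..t}" "h integrable_on {a..t}" "!!s. a < s ==> s < t ==> cmod (g s) \<le> h s"
 shows "cmod (integral {a..t} g) \<le> integral {a..t} h"
proof -
 have "integral {a..t} g = integral {a<..<t} g" "integral {a..t} h = integral {a<..<t} h"
  by (simp_all only: integral_open_interval_real)
 moreover have "cmod (integral {a<..<t} g) \<le> integral {a<..<t} h"
  by (rule integral_norm_bound_integral) (use assms in \<open>auto simp: integrable_on_Icc_iff_Ioo\<close>)
 ultimately show ?thesis by simp
qed

lemma has_integral_powr_left:
 fixes a t \<eta> :: real
 assumes "\<eta> < 1" "a \<le> t"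
 shows "((%s. (s - a) powr (- \<eta>)) has_integral (t - a) powr (1 - \<eta>) / (1 - \<eta>)) {a..t}"
proof -
 have "((%s. (s - a) powr (- \<eta>)) has_integral (t - a) powr (1 - \<eta>) / (1 - \<eta>) - (a - a) powr (1 - \<eta>) / (1 - \<eta>)) {a..t}"
 proof (rule fundamental_theorem_of_calculus_interior_strong[where S = "{}" and f = "%s. (s - a) powr (1 - \<eta>) / (1 - \<eta>)"])
  fix s assume "s \<in> {a<..<t} - {}"
  then have "((%s. (s - a) powr (1 - \<eta>) / (1 - \<eta>)) has_real_derivative (s - a) powr (- \<eta>)) (at s)"
   using assms by (auto intro!: derivative_eq_intros)
  then show "((%s. (s - a) powr (1 - \<eta>) / (1 - \<eta>)) has_vector_derivative (s - a) powr (- \<eta>)) (at s)"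
   by (simp add: has_real_derivative_iff_has_vector_derivative)
 qed (use assms in \<open>auto intro!: continuous_intros continuous_on_powr'\<close>)
 then show ?thesis using assms by simp
qed

lemma has_integral_powr_right:
 fixes a t \<eta> :: real
 assumes "\<eta> < 1" "a \<le> t"
 shows "((%s. (t - s) powr (- \<eta>)) has_integral (t - a) powr (1 - \<eta>) / (1 - \<eta>)) {a..t}"
proof -
 have "((%s. (t - s) powr (- \<eta>)) has_integral - ((t - t) powr (1 - \<eta>) / (1 - \<eta>)) - - ((t - a) powr (1 - \<eta>) / (1 - \<eta>))) {a..t}"
 proof (rule fundamental_theorem_of_calculus_interior_strong[where S = "{}" and f = "%s. - ((t - s) powr (1 - \<eta>) / (1 - \<eta>))"])
  fix s assume "s \<in> {a<..<t} - {}"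
  then have "((%s. - ((t - s) powr (1 - \<eta>) / (1 - \<eta>))) has_real_derivative (t - s) powr (- \<eta>)) (at s)"
   using assms by (auto intro!: derivative_eq_intros)
  then show "((%s. - ((t - s) powr (1 - \<eta>) / (1 - \<eta>))) has_vector_derivative (t - s) powr (- \<eta>)) (at s)"
   by (simp add: has_real_derivative_iff_has_vector_derivative)
 qed (use assms in \<open>auto intro!: continuous_intros continuous_on_powr'\<close>)
 then show ?thesis using assms by simp
qed

definition betaC :: "real => real => real" where
 "betaC \<kappa> \<eta> = 2 powr \<kappa> / (1 - \<eta>) + 2 powr \<eta> / (1 - \<kappa>)"

lemma betaC_nonneg: "\<kappa> < 1 ==> \<eta> < 1 ==> 0 \<le> betaC \<kappa> \<eta>"
 by (simp add: betaC_def)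

text \<open>An integrable majorant of the Beta-type kernel: one of the two factors is harmless on each
 half of the interval.\<close>

lemma beta_kernel:
 assumes k: "0 \<le> \<kappa>" "\<kappa> < 1" and e: "0 \<le> \<eta>" "\<eta> < 1" and at: "a < t"
 obtains g where "(g has_integral betaC \<kappa> \<eta> * (t - a) powr (1 - \<kappa> - \<eta>)) {a..t}"
  "!!s. a < s ==> s < t ==> (t - s) powr (- \<kappa>) * (s - a) powr (- \<eta>) \<le> g s"
proof
 define h where "h = (t - a) / 2"
 have h: "0 < h" using at by (simp add: h_def)
 define g where "g s = h powr (- \<kappa>) * (s - a) powr (- \<eta>) + h powr (- \<eta>) * (t - s) powr (- \<kappa>)" for s
 have "(g has_integral h powr (- \<kappa>) * ((t - a) powr (1 - \<eta>) / (1 - \<eta>)) + h powr (- \<eta>) * ((t - a) powr (1 - \<kappa>) / (1 - \<kappa>))) {a..t}"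
  unfolding g_def
  by (intro has_integral_add has_integral_mult_right has_integral_powr_left has_integral_powr_right) (use k e at in auto)
 moreover have "h powr (- \<kappa>) * ((t - a) powr (1 - \<eta>) / (1 - \<eta>)) + h powr (- \<eta>) * ((t - a) powr (1 - \<kappa>) / (1 - \<kappa>)) = betaC \<kappa> \<eta> * (t - a) powr (1 - \<kappa> - \<eta>)"
 proof -
  have hp: "h powr (- x) = 2 powr x * (t - a) powr (- x)" for x
  proof -
   have "((t - a) / 2) powr (- x) = (t - a) powr (- x) / 2 powr (- x)" by (rule powr_divide)
   also have "\<dots> = 2 powr x * (t - a) powr (- x)"
    by (simp only: powr_minus[of 2 x] divide_inverse inverse_inverse_eq mult.commute)
   finally show ?thesis by (simp only: h_def)
  qed
  have "(t - a) powr (- \<kappa>) * (t - a) powr (1 - \<eta>) = (t - a) powr (1 - \<kappa> - \<eta>)"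
   "(t - a) powr (- \<eta>) * (t - a) powr (1 - \<kappa>) = (t - a) powr (1 - \<kappa> - \<eta>)"
   by (simp_all add: powr_add[symmetric] algebra_simps)
  then show ?thesis unfolding hp betaC_def by (simp add: distrib_right mult.assoc)
 qed
 ultimately show "(g has_integral betaC \<kappa> \<eta> * (t - a) powr (1 - \<kappa> - \<eta>)) {a..t}" by simp
 fix s assume s: "a < s" "s < t"
 show "(t - s) powr (- \<kappa>) * (s - a) powr (- \<eta>) \<le> g s"
 proof (cases "s - a \<le> h")
  case True
  then have "h \<le> t - s" by (simp add: h_def)
  then have "(t - s) powr (- \<kappa>) \<le> h powr (- \<kappa>)" using h k by (intro powr_mono2') auto
  then have "(t - s) powr (- \<kappa>) * (s - a) powr (- \<eta>) \<le> h powr (- \<kappa>) * (s - a) powr (- \<eta>)" by (intro mult_right_mono) auto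
  then show ?thesis by (simp add: g_def add_increasing2)
 next
  case False
  then have "(s - a) powr (- \<eta>) \<le> h powr (- \<eta>)" using h e by (intro powr_mono2') auto
  then have "(t - s) powr (- \<kappa>) * (s - a) powr (- \<eta>) \<le> (t - s) powr (- \<kappa>) * h powr (- \<eta>)" by (intro mult_left_mono) auto
  then show ?thesis by (simp add: g_def mult.commute add_increasing)
 qed
qed

lemma Pt_add: "Pt \<mu> s (Pt \<mu> r f) = Pt \<mu> (s + r) f"
 by (simp add: Pt_def fun_eq_iff algebra_simps exp_add)

lemma symA_Re: "0 < \<mu> ==> Re (symA \<mu> k) \<le> 0"
proof -
 assume mu: "0 < \<mu>"
 have "Re (symA \<mu> k) = - \<mu> * (4 * pi\<^sup>2 * ((of_int (fst k))\<^sup>2 + (of_int (snd k))\<^sup>2)) - 1"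
  unfolding symA_def by (simp only: minus_complex.sel times_complex.sel uminus_complex.sel plus_complex.sel Re_complex_of_real Im_complex_of_real imaginary_unit.sel) simp
 also have "\<dots> \<le> 0"
 proof -
  have "0 \<le> \<mu> * (4 * pi\<^sup>2 * ((of_int (fst k))\<^sup>2 + (of_int (snd k))\<^sup>2))"
   using mu by (intro mult_nonneg_nonneg add_nonneg_nonneg) auto
  then show ?thesis by (simp only: mult_minus_left)
 qed
 finally show ?thesis .
qed

lemma norm_exp_symA: "0 < \<mu> ==> 0 \<le> r ==> cmod (exp (of_real r * symA \<mu> k)) \<le> 1"
 using symA_Re[of \<mu> k] by (simp add: mult_nonneg_nonpos)

definition duh :: "real => real => real => (real => dist) => dist" where
 "duh \<mu> a t G k = integral {a..t} (%s. Pt \<mu> (t - s) (G s) k)"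

context littlewood_paley
begin

lemma Pt_abs_integrable:
 assumes mu: "0 < \<mu>" and e: "\<eta> < 1" and at: "a \<le> t"
  and G: "continuous_on {a<..t} (%s. G s k)" "!!s. a < s ==> s \<le> t ==> bb r (G s) (L * (s - a) powr (- \<eta>))"
 shows "(%s. Pt \<mu> (t - s) (G s) k) absolutely_integrable_on {a..t}"
proof (rule abs_integrable_Ioo_bound)
 show "continuous_on {a<..<t} (%s. Pt \<mu> (t - s) (G s) k)"
  unfolding Pt_def by (intro continuous_intros continuous_on_subset[OF G(1)]) auto
 show "(%s. (L * coeffC r k) * (s - a) powr (- \<eta>)) integrable_on {a..t}"
  by (intro integrable_on_mult_right has_integral_integrable[OF has_integral_powr_left] e at)
 fix s assume s: "a < s" "s < t"
 have "cmod (Pt \<mu> (t - s) (G s) k) \<le> 1 * cmod (G s k)"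
  unfolding Pt_def norm_mult using s by (intro mult_right_mono norm_exp_symA mu) auto
 also have "\<dots> \<le> L * (s - a) powr (- \<eta>) * coeffC r k" using bb_coeff[OF G(2), of s k] s by simp
 finally show "cmod (Pt \<mu> (t - s) (G s) k) \<le> L * coeffC r k * (s - a) powr (- \<eta>)" by (simp add: ac_simps)
qed

text \<open>A block is a finite combination of coefficients and so commutes with the coefficientwise
  integral. No integration theory for Banach-valued functions is involved.\<close>

lemma bb_duh:
 assumes mu: "0 < \<mu>" and at: "a < t" and ex: "0 \<le> \<eta>" "\<eta> < 1" "0 \<le> \<kappa>" "\<kappa> < 1"
  and G: "!!k. continuous_on {a<..t} (%s. G s k)" "!!s. a < s ==> s \<le> t ==> bb r (G s) (L * (s - a) powr (- \<eta>))"
  and M: "0 \<le> M" "!!s. a < s ==> s < t ==> bb b (Pt \<mu> (t - s) (G s)) (M * ((t - s) powr (- \<kappa>) * (s - a) powr (- \<eta>)))"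
 shows "bb b (duh \<mu> a t G) (M * (betaC \<kappa> \<eta> * (t - a) powr (1 - \<kappa> - \<eta>)))"
proof (rule bbI)
 fix n x
 obtain g where g: "(g has_integral betaC \<kappa> \<eta> * (t - a) powr (1 - \<kappa> - \<eta>)) {a..t}"
  "!!s. a < s ==> s < t ==> (t - s) powr (- \<kappa>) * (s - a) powr (- \<eta>) \<le> g s"
  using beta_kernel[OF ex(3,4,1,2) at] by blast
 let ?f = "%s. ev (%k. wt n k * Pt \<mu> (t - s) (G s) k) x"
 have int: "(%s. Pt \<mu> (t - s) (G s) k) integrable_on {a..t}" for k
  using Pt_abs_integrable[OF mu ex(2) _ G(1,2)] at by (intro set_lebesgue_integral_eq_integral(1)) auto
 have e: "ev (%k. wt n k * h k) x = (\<Sum>k | wt n k \<noteq> 0. (wt n k * ekx k x) * h k)" for h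
  by (subst ev_eq[of "{k. wt n k \<noteq> 0}"]) (use trig_wt[of n] in \<open>auto simp: ac_simps\<close>)
 have fint: "?f integrable_on {a..t}"
  unfolding e by (intro integrable_sum integrable_on_mult_right int) (use trig_wt[of n] in auto)
 have "ev (%k. wt n k * duh \<mu> a t G k) x = integral {a..t} ?f"
  unfolding e duh_def
  by (subst integral_sum) (use trig_wt[of n] in \<open>auto intro!: integrable_on_mult_right int\<close>)
 then have "cmod (ev (%k. wt n k * duh \<mu> a t G k) x) = cmod (integral {a..t} ?f)" by simp
 also have "\<dots> \<le> integral {a..t} (%s. (M * dy b n) * g s)"
 proof (rule integral_Ioo_bound[OF fint])
  show "(%s. M * dy b n * g s) integrable_on {a..t}"
   using g(1) by (intro integrable_on_mult_right) auto
  fix s assume s: "a < s" "s < t"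
  have "cmod (?f s) \<le> M * ((t - s) powr (- \<kappa>) * (s - a) powr (- \<eta>)) * dy b n" by (rule bbD[OF M(2)[OF s]])
  also have "\<dots> \<le> M * g s * dy b n" using g(2)[OF s] M(1) by (intro mult_right_mono mult_left_mono) auto
  finally show "cmod (?f s) \<le> M * dy b n * g s" by (simp add: ac_simps)
 qed
 also have "\<dots> = (M * dy b n) * (betaC \<kappa> \<eta> * (t - a) powr (1 - \<kappa> - \<eta>))"
  using g(1) by (subst integral_mult_right) (simp add: integral_unique)
 finally show "cmod (ev (%k. wt n k * duh \<mu> a t G k) x) \<le> M * (betaC \<kappa> \<eta> * (t - a) powr (1 - \<kappa> - \<eta>)) * dy b n"
  by (simp add: ac_simps)
qed

lemma duh_split:
 assumes mu: "0 < \<mu>" and e: "\<eta> < 1" and act: "a < c" "c \<le> t"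
  and G: "!!k. continuous_on {a<..t} (%s. G s k)" "!!s. a < s ==> s \<le> t ==> bb r (G s) (L * (s - a) powr (- \<eta>))"
 shows "duh \<mu> a t G k = Pt \<mu> (t - c) (duh \<mu> a c G) k + duh \<mu> c t G k"
proof -
 have int: "(%s. Pt \<mu> (t - s) (G s) k) integrable_on {a..t}"
  using Pt_abs_integrable[OF mu e _ G] act by (intro set_lebesgue_integral_eq_integral(1)) auto
 have "Pt \<mu> (t - c) (duh \<mu> a c G) k = integral {a..c} (%s. exp (of_real (t - c) * symA \<mu> k) * Pt \<mu> (c - s) (G s) k)"
  by (simp add: Pt_def duh_def)
 also have "\<dots> = integral {a..c} (%s. Pt \<mu> (t - s) (G s) k)"
  unfolding Pt_def mult.assoc[symmetric] exp_add[symmetric] by (simp add: algebra_simps)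
 finally show ?thesis
  using Henstock_Kurzweil_Integration.integral_combine[OF _ act(2) int] act by (simp add: duh_def)
qed

text \<open>For a fixed frequency the factor exp (t * \<open>symA\<close>) can be pulled out of the
  integral, even though its inverse is unbounded over all frequencies. What remains is an indefinite
  integral.\<close>

lemma duh_continuous:
 assumes mu: "0 < \<mu>" and e: "\<eta> < 1" and ab: "a \<le> b"
  and G: "continuous_on {a<..b} (%s. G s k)" "!!s. a < s ==> s \<le> b ==> bb r (G s) (L * (s - a) powr (- \<eta>))"
 shows "continuous_on {a<..b} (%t. duh \<mu> a t G k)"
proof -
 let ?g = "%s. exp (- of_real s * symA \<mu> k) * G s k"
 have "(%s. exp (- of_real b * symA \<mu> k) * Pt \<mu> (b - s) (G s) k) integrable_on {a..b}"
  using Pt_abs_integrable[OF mu e ab G]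
  by (intro integrable_on_mult_right set_lebesgue_integral_eq_integral(1)) auto
 moreover have "exp (- of_real b * symA \<mu> k) * Pt \<mu> (b - s) (G s) k = ?g s" for s
  unfolding Pt_def mult.assoc[symmetric] exp_add[symmetric] by (simp add: algebra_simps)
 ultimately have "?g integrable_on {a..b}" by (simp only:)
 then have "continuous_on {a..b} (%t. integral {a..t} ?g)" by (rule indefinite_integral_continuous_1)
 then have c: "continuous_on {a<..b} (%t. integral {a..t} ?g)" by (rule continuous_on_subset) auto
 have "continuous_on {a<..b} (%t. exp (of_real t * symA \<mu> k) * integral {a..t} ?g)"
  by (intro continuous_on_mult c continuous_intros)
 moreover have "exp (of_real t * symA \<mu> k) * integral {a..t} ?g = duh \<mu> a t G k" for t
 proof -
  have "exp (of_real t * symA \<mu> k) * ?g s = Pt \<mu> (t - s) (G s) k" for s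
   unfolding Pt_def mult.assoc[symmetric] exp_add[symmetric] by (simp add: algebra_simps)
  then show ?thesis unfolding duh_def integral_mult_right[symmetric] by (simp only:)
 qed
 ultimately show ?thesis by simp
qed

end

text \<open>The forcing \<open>F\<close> may grow like \<open>\<sigma> powr (- \<eta>)\<close> when the curve grows like \<open>\<sigma> powr (- \<gamma>)\<close>, where
 \<open>\<sigma>\<close> is the time elapsed since some initial time, not necessarily \<open>0\<close>.\<close>

locale mild_problem = littlewood_paley +
 fixes \<mu> \<alpha> \<beta> \<alpha>1 \<gamma> \<eta> :: real and F :: "real => dist => dist"
 assumes mu: "0 < \<mu>" and al: "0 < \<alpha>" and be: "0 < \<beta>" and al1: "0 < \<alpha>1"
  and gam1: "(\<alpha> + \<beta>) / 2 < \<gamma>" and gam2: "(\<alpha>1 + \<beta>) / 2 < \<gamma>" and gam3: "\<gamma> \<le> \<eta>" and eta: "\<eta> < 1"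
  and F_est: "!!T R. 0 < T ==> 0 < R ==> \<exists>L\<ge>0. \<forall>\<sigma> s w w' \<epsilon>. 0 < \<sigma> --> \<sigma> \<le> s --> s \<le> T -->
   bb \<beta> w (R * \<sigma> powr (- \<gamma>)) --> bb \<beta> w' (R * \<sigma> powr (- \<gamma>)) --> bb \<beta> (%k. w k - w' k) (\<epsilon> * \<sigma> powr (- \<gamma>)) -->
   bb (- \<alpha>) (F s w) (L * \<sigma> powr (- \<eta>)) \<and> bb (- \<alpha>) (%k. F s w k - F s w' k) (L * \<epsilon> * \<sigma> powr (- \<eta>))"
  and F_cont: "!!a b R w k. 0 \<le> a ==> (!!t. a < t ==> t \<le> b ==> bb \<beta> (w t) (R * (t - a) powr (- \<gamma>))) ==>
   (!!k. continuous_on {a<..b} (%t. w t k)) ==> continuous_on {a<..b} (%s. F s (w s) k)"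
begin

text \<open>Continuity is required only of the coefficients, which passes easily to limits;
  continuity in norm is recovered afterwards in \<open>Sol_imp_class\<close>.\<close>

definition curve :: "real => real => real => (real => dist) => bool" where
 "curve a b R w \<longleftrightarrow> (\<forall>t. a < t --> t \<le> b --> bb \<beta> (w t) (R * (t - a) powr (- \<gamma>))) \<and>
  (\<forall>k. continuous_on {a<..b} (%t. w t k))"

definition Phi :: "real => dist => (real => dist) => real => dist" where
 "Phi a u w t k = Pt \<mu> (t - a) u k + duh \<mu> a t (%s. F s (w s)) k"

definition Sol :: "real => real => dist => (real => dist) => bool" where
 "Sol a b u w \<longleftrightarrow> (\<exists>R. curve a b R w) \<and> (\<forall>t. a < t --> t \<le> b --> w t = Phi a u w t)"

lemma exps: "0 < \<gamma>" "\<gamma> < 1" "0 < \<eta>" "0 \<le> (\<alpha> + \<beta>) / 2" "(\<alpha> + \<beta>) / 2 < 1" "(\<alpha>1 + \<beta>) / 2 < 1"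
 using gam1 gam2 gam3 eta al be by (simp_all add: field_simps)

lemma curve_mono: "curve a b R w ==> R \<le> R' ==> curve a b R' w"
 unfolding curve_def by (blast intro: bb_mono mult_right_mono powr_ge_zero)

lemma curve_bb: "curve a b R w ==> a < t ==> t \<le> b ==> bb \<beta> (w t) (R * (t - a) powr (- \<gamma>))"
 unfolding curve_def by blast

lemma curve_subset: "curve a b R w ==> b' \<le> b ==> curve a b' R w"
 unfolding curve_def by (auto intro: continuous_on_subset)

lemma curve_restart: "curve a b R w ==> a \<le> c ==> 0 \<le> R ==> curve c b R w"
proof -
 assume w: "curve a b R w" and ac: "a \<le> c" and R: "0 \<le> R"
 have "bb \<beta> (w t) (R * (t - c) powr (- \<gamma>))" if "c < t" "t \<le> b" for t
 proof (rule bb_mono[OF curve_bb[OF w]])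
  show "R * (t - a) powr (- \<gamma>) \<le> R * (t - c) powr (- \<gamma>)"
   using that ac exps R by (intro mult_left_mono powr_mono2') auto
 qed (use that ac in auto)
 moreover have "continuous_on {c<..b} (%t. w t k)" for k
 proof (rule continuous_on_subset)
  show "continuous_on {a<..b} (%t. w t k)" using w unfolding curve_def by blast
 qed (use ac in auto)
 ultimately show ?thesis unfolding curve_def by blast
qed

lemma curve_forcing:
 assumes w: "curve a b R w" and ab: "0 \<le> a" "a < b" and R: "0 < R"
 obtains L where "0 \<le> L" "!!s. a < s ==> s \<le> b ==> bb (- \<alpha>) (F s (w s)) (L * (s - a) powr (- \<eta>))"
  "!!k. continuous_on {a<..b} (%s. F s (w s) k)"
proof -
 obtain L where L: "0 \<le> L" "\<forall>\<sigma> s w w' \<epsilon>. 0 < \<sigma> --> \<sigma> \<le> s --> s \<le> b -->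
   bb \<beta> w (R * \<sigma> powr (- \<gamma>)) --> bb \<beta> w' (R * \<sigma> powr (- \<gamma>)) --> bb \<beta> (%k. w k - w' k) (\<epsilon> * \<sigma> powr (- \<gamma>)) -->
   bb (- \<alpha>) (F s w) (L * \<sigma> powr (- \<eta>)) \<and> bb (- \<alpha>) (%k. F s w k - F s w' k) (L * \<epsilon> * \<sigma> powr (- \<eta>))"
  using F_est[of b R] ab R by auto
 show ?thesis
 proof (rule that[OF L(1)])
  fix s assume s: "a < s" "s \<le> b"
  \<comment> \<open>\<open>F_est\<close> states size and Lipschitz bounds jointly; comparing the
    curve with itself at distance 0 isolates the size bound.\<close>
  have "bb \<beta> (%k. w s k - w s k) (0 * (s - a) powr (- \<gamma>))" by (simp add: bb_zero)
  then show "bb (- \<alpha>) (F s (w s)) (L * (s - a) powr (- \<eta>))"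
   using L(2)[rule_format, of "s - a" s "w s" "w s" 0] s ab curve_bb[OF w s] by auto
 next
  fix k show "continuous_on {a<..b} (%s. F s (w s) k)"
   using w unfolding curve_def by (intro F_cont[OF ab(1), of b w R]) auto
 qed
qed

text \<open>Smoothing by the semigroup, with the target regularity \<open>b\<close> left open: \<open>b = \<beta>\<close> is used for the
 fixed point, a larger \<open>b\<close> for continuity in time.\<close>

lemma Pt_smoothing:
 assumes T: "0 < T" and b: "- r \<le> b" "(r + b) / 2 \<le> 1"
 obtains K where "0 \<le> K" "!!t f C. 0 < t ==> t \<le> T ==> bb (- r) f C ==> bb b (Pt \<mu> t f) (K * C * t powr (- ((r + b) / 2)))"
proof -
 obtain K where K: "0 \<le> K" "\<forall>t f C s b. 0 < t --> t \<le> T --> s \<le> b --> b \<le> s + 2 --> bb s f C -->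
  bb b (Pt \<mu> t f) (K * nearC s * C * t powr (- ((b - s) / 2)))"
  using bb_Pt[OF mu T] by blast
 show ?thesis
 proof (rule that[of "K * nearC (- r)"])
  show "0 \<le> K * nearC (- r)" using K(1) nearC_nonneg by simp
  fix t f C assume "0 < t" "t \<le> T" "bb (- r) f C"
  then show "bb b (Pt \<mu> t f) (K * nearC (- r) * C * t powr (- ((r + b) / 2)))"
   using K(2)[rule_format, of t "- r" b f C] b by (simp add: add.commute)
 qed
qed

lemma Pt_coeff_continuous: "continuous_on S (%t. Pt \<mu> (t - a) u k)"
 unfolding Pt_def by (intro continuous_intros)

text \<open>The hypothesis on X has three uses. With \<Lambda> > 0 it trades the exponential weight
  for a small constant (contraction). With \<Lambda> = 0 and X = 1 it allows \<kappa> to exceed the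
  smoothing exponent on an interval of length 1 (local existence), or to equal it (higher
  regularity).\<close>

lemma Phi_bound:
 assumes T: "0 < T" and b: "- \<alpha> \<le> b" "(\<alpha> + b) / 2 < 1" and \<kappa>: "(\<alpha> + b) / 2 \<le> \<kappa>" "0 \<le> \<kappa>" "\<kappa> < 1"
 obtains K where "0 \<le> K" "!!a t G L \<Lambda> X. a < t ==> t - a \<le> T ==> (!!k. continuous_on {a<..t} (%s. G s k)) ==>
  0 \<le> L ==> 0 \<le> \<Lambda> ==> (!!s. a < s ==> s \<le> t ==> bb (- \<alpha>) (G s) (L * exp (\<Lambda> * (s - a)) * (s - a) powr (- \<eta>))) ==>
  0 \<le> X ==> (!!r. 0 < r ==> r \<le> T ==> exp (- \<Lambda> * r) * r powr (- ((\<alpha> + b) / 2)) \<le> X * r powr (- \<kappa>)) ==>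
  bb b (duh \<mu> a t G) (K * L * X * exp (\<Lambda> * (t - a)) * (t - a) powr (1 - \<kappa> - \<eta>))"
proof -
 obtain K where K: "0 \<le> K" "!!t f C. 0 < t ==> t \<le> T ==> bb (- \<alpha>) f C ==> bb b (Pt \<mu> t f) (K * C * t powr (- ((\<alpha> + b) / 2)))"
  using Pt_smoothing[OF T b(1)] b(2) by auto
 show ?thesis
 proof (rule that[of "K * betaC \<kappa> \<eta>"])
  show "0 \<le> K * betaC \<kappa> \<eta>" using K(1) betaC_nonneg[OF \<kappa>(3) eta] by simp
  fix a t G L \<Lambda> X
  assume at: "a < t" "t - a \<le> T" and Gc: "!!k. continuous_on {a<..t} (%s. G s k)" and L: "0 \<le> L" "0 \<le> (\<Lambda>::real)"
   and G: "!!s. a < s ==> s \<le> t ==> bb (- \<alpha>) (G s) (L * exp (\<Lambda> * (s - a)) * (s - a) powr (- \<eta>))"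
   and X: "0 \<le> X" "!!r. 0 < r ==> r \<le> T ==> exp (- \<Lambda> * r) * r powr (- ((\<alpha> + b) / 2)) \<le> X * r powr (- \<kappa>)"
  let ?E = "exp (\<Lambda> * (t - a))"
  have G': "bb (- \<alpha>) (G s) (L * ?E * (s - a) powr (- \<eta>))" if "a < s" "s \<le> t" for s
   by (rule bb_mono[OF G[OF that]]) (use that L in \<open>auto intro!: mult_right_mono mult_left_mono\<close>)
  have "bb b (Pt \<mu> (t - s) (G s)) (K * L * X * ?E * ((t - s) powr (- \<kappa>) * (s - a) powr (- \<eta>)))" if s: "a < s" "s < t" for s
  proof (rule bb_mono[OF K(2)[OF _ _ G]])
   have "exp (\<Lambda> * (s - a)) = ?E * exp (- \<Lambda> * (t - s))" by (simp add: algebra_simps flip: exp_add)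
   then have "K * (L * exp (\<Lambda> * (s - a)) * (s - a) powr (- \<eta>)) * (t - s) powr (- ((\<alpha> + b) / 2)) =
    K * L * ?E * (s - a) powr (- \<eta>) * (exp (- \<Lambda> * (t - s)) * (t - s) powr (- ((\<alpha> + b) / 2)))" by (simp only: ac_simps)
   also have "\<dots> \<le> K * L * ?E * (s - a) powr (- \<eta>) * (X * (t - s) powr (- \<kappa>))"
    using K(1) L s at by (intro mult_left_mono X(2)) auto
   also have "\<dots> = K * L * X * ?E * ((t - s) powr (- \<kappa>) * (s - a) powr (- \<eta>))" by (simp only: ac_simps)
   finally show "K * (L * exp (\<Lambda> * (s - a)) * (s - a) powr (- \<eta>)) * (t - s) powr (- ((\<alpha> + b) / 2)) \<le> K * L * X * ?E * ((t - s) powr (- \<kappa>) * (s - a) powr (- \<eta>))" .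
  qed (use s at in auto)
  moreover have "0 \<le> K * L * X * ?E" using K(1) L X(1) by simp
  ultimately have "bb b (duh \<mu> a t G) (K * L * X * ?E * (betaC \<kappa> \<eta> * (t - a) powr (1 - \<kappa> - \<eta>)))"
   using exps(3) eta \<kappa> by (intro bb_duh[OF mu at(1) _ _ _ _ Gc G']) auto
  then show "bb b (duh \<mu> a t G) (K * betaC \<kappa> \<eta> * L * X * ?E * (t - a) powr (1 - \<kappa> - \<eta>))" by (simp only: ac_simps)
 qed
qed

lemma Phi_diff: "(%k. Phi a u w t k - Phi a u w' t k) = (%k. duh \<mu> a t (%s. F s (w s)) k - duh \<mu> a t (%s. F s (w' s)) k)"
 by (simp add: Phi_def fun_eq_iff)

lemma duh_diff:
 assumes "a \<le> t"
  and G: "continuous_on {a<..t} (%s. G s k)" "!!s. a < s ==> s \<le> t ==> bb (- \<alpha>) (G s) (L * (s - a) powr (- \<eta>))"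
  and H: "continuous_on {a<..t} (%s. H s k)" "!!s. a < s ==> s \<le> t ==> bb (- \<alpha>) (H s) (L' * (s - a) powr (- \<eta>))"
 shows "duh \<mu> a t (%s k. G s k - H s k) k = duh \<mu> a t G k - duh \<mu> a t H k"
proof -
 have "(%s. Pt \<mu> (t - s) (G s) k) integrable_on {a..t}" "(%s. Pt \<mu> (t - s) (H s) k) integrable_on {a..t}"
  using Pt_abs_integrable[OF mu eta assms(1) G] Pt_abs_integrable[OF mu eta assms(1) H]
  by (auto intro: set_lebesgue_integral_eq_integral(1))
 then show ?thesis unfolding duh_def by (subst integral_diff[symmetric]) (auto simp: Pt_def algebra_simps)
qed

lemma exp_weight:
 assumes "0 < \<iota>" "\<iota> \<le> 1" "0 < \<Lambda>" "0 < (r::real)"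
 shows "exp (- \<Lambda> * r) * r powr (- \<kappa>) \<le> \<Lambda> powr (- \<iota>) * r powr (- (\<kappa> + \<iota>))"
proof -
 have "exp (- \<Lambda> * r) \<le> 1 / (1 + \<Lambda> * r)"
 proof -
  have "1 + \<Lambda> * r \<le> exp (\<Lambda> * r)" by (rule exp_ge_add_one_self)
  then have "inverse (exp (\<Lambda> * r)) \<le> inverse (1 + \<Lambda> * r)" using assms by (intro le_imp_inverse_le) (auto intro: add_pos_pos)
  then show ?thesis by (simp add: exp_minus inverse_eq_divide)
 qed
 also have "\<dots> \<le> (\<Lambda> * r) powr (- \<iota>)" using assms by (intro powr_le_one_plus) auto
 also have "\<dots> = \<Lambda> powr (- \<iota>) * r powr (- \<iota>)" using assms by (simp add: powr_mult)
 finally have "exp (- \<Lambda> * r) * r powr (- \<kappa>) \<le> \<Lambda> powr (- \<iota>) * r powr (- \<iota>) * r powr (- \<kappa>)" by (rule mult_right_mono) simp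
 also have "\<dots> = \<Lambda> powr (- \<iota>) * r powr (- (\<kappa> + \<iota>))" by (simp add: powr_add[symmetric] add.commute mult.assoc)
 finally show ?thesis .
qed

text \<open>With the weight \<open>exp (\<Lambda> (t - a))\<close> the fixed-point map contracts on arbitrarily long intervals;
 this yields both uniqueness and convergence of the Picard iteration.\<close>

definition contracts :: "real => real => real => bool" where
 "contracts T R \<Lambda> \<longleftrightarrow> (\<forall>a t w w' u \<epsilon>. 0 \<le> a --> a < t --> t \<le> T --> curve a t R w --> curve a t R w' --> 0 \<le> \<epsilon> -->
  (\<forall>s. a < s --> s \<le> t --> bb \<beta> (%k. w s k - w' s k) (\<epsilon> * exp (\<Lambda> * (s - a)) * (s - a) powr (- \<gamma>))) -->
  bb \<beta> (%k. Phi a u w t k - Phi a u w' t k) (\<epsilon> / 2 * exp (\<Lambda> * (t - a)) * (t - a) powr (- \<gamma>)))"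

lemma contractsD:
 assumes "contracts T R \<Lambda>" "0 \<le> a" "a < t" "t \<le> T" "curve a t R w" "curve a t R w'" "0 \<le> \<epsilon>"
  "!!s. a < s ==> s \<le> t ==> bb \<beta> (%k. w s k - w' s k) (\<epsilon> * exp (\<Lambda> * (s - a)) * (s - a) powr (- \<gamma>))"
 shows "bb \<beta> (%k. Phi a u w t k - Phi a u w' t k) (\<epsilon> / 2 * exp (\<Lambda> * (t - a)) * (t - a) powr (- \<gamma>))"
 using assms unfolding contracts_def by blast

text \<open>The gap \<iota> between the smoothing exponent (\<alpha> + \<beta>) / 2 and \<gamma> is
  what lets the weight produce a factor \<Lambda> powr (- \<iota>).\<close>

lemma contraction:
 assumes T: "0 < T" and R: "0 < R"
 obtains \<Lambda> where "0 < \<Lambda>" "contracts T R \<Lambda>"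
proof -
 obtain L where L: "0 \<le> L" "\<forall>\<sigma> s w w' \<epsilon>. 0 < \<sigma> --> \<sigma> \<le> s --> s \<le> T -->
   bb \<beta> w (R * \<sigma> powr (- \<gamma>)) --> bb \<beta> w' (R * \<sigma> powr (- \<gamma>)) --> bb \<beta> (%k. w k - w' k) (\<epsilon> * \<sigma> powr (- \<gamma>)) -->
   bb (- \<alpha>) (F s w) (L * \<sigma> powr (- \<eta>)) \<and> bb (- \<alpha>) (%k. F s w k - F s w' k) (L * \<epsilon> * \<sigma> powr (- \<eta>))"
  using F_est[OF T R] by blast
 define \<iota> where "\<iota> = \<gamma> - (\<alpha> + \<beta>) / 2"
 have \<iota>: "0 < \<iota>" "\<iota> \<le> 1" unfolding \<iota>_def using gam1 exps(2) al be by (simp_all add: field_simps)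
 obtain K where K: "0 \<le> K" "!!a t G L \<Lambda> X. a < t ==> t - a \<le> T ==> (!!k. continuous_on {a<..t} (%s. G s k)) ==>
  0 \<le> L ==> 0 \<le> \<Lambda> ==> (!!s. a < s ==> s \<le> t ==> bb (- \<alpha>) (G s) (L * exp (\<Lambda> * (s - a)) * (s - a) powr (- \<eta>))) ==>
  0 \<le> X ==> (!!r. 0 < r ==> r \<le> T ==> exp (- \<Lambda> * r) * r powr (- ((\<alpha> + \<beta>) / 2)) \<le> X * r powr (- \<gamma>)) ==>
  bb \<beta> (duh \<mu> a t G) (K * L * X * exp (\<Lambda> * (t - a)) * (t - a) powr (1 - \<gamma> - \<eta>))"
 proof (rule Phi_bound[OF T, of \<beta> \<gamma>])
 qed (use al be exps gam1 in auto)
 \<comment> \<open>Y exceeds twice the Lipschitz constant of the map without weight, and \<Lambda>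
   is chosen so that the weight divides that constant by Y; the result is below 1/2.\<close>
 define Y where "Y = 2 * K * L * T powr (1 - \<eta>) + 1"
 have Y: "1 \<le> Y" using K(1) L(1) by (simp add: Y_def)
 define \<Lambda> where "\<Lambda> = Y powr (1 / \<iota>)"
 have \<Lambda>: "0 < \<Lambda>" using Y by (simp add: \<Lambda>_def)
 have \<Lambda>Y: "\<Lambda> powr (- \<iota>) = 1 / Y" using \<iota> Y by (simp add: \<Lambda>_def powr_powr powr_minus inverse_eq_divide)
 show ?thesis
 proof (rule that[OF \<Lambda>], unfold contracts_def, intro allI impI)
  fix a t w w' u \<epsilon>
  assume a: "0 \<le> a" "a < t" "t \<le> T" and w: "curve a t R w" and w': "curve a t R w'" and eps: "0 \<le> (\<epsilon>::real)"
   and "\<forall>s. a < s --> s \<le> t --> bb \<beta> (%k. w s k - w' s k) (\<epsilon> * exp (\<Lambda> * (s - a)) * (s - a) powr (- \<gamma>))"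
  note d = this(7)[rule_format]
  obtain L1 where "0 \<le> L1" and L1: "!!s. a < s ==> s \<le> t ==> bb (- \<alpha>) (F s (w s)) (L1 * (s - a) powr (- \<eta>))"
   "!!k. continuous_on {a<..t} (%s. F s (w s) k)"
   by (rule curve_forcing[OF w a(1,2) R]) (rule that)
  obtain L2 where "0 \<le> L2" and L2: "!!s. a < s ==> s \<le> t ==> bb (- \<alpha>) (F s (w' s)) (L2 * (s - a) powr (- \<eta>))"
   "!!k. continuous_on {a<..t} (%s. F s (w' s) k)"
   by (rule curve_forcing[OF w' a(1,2) R]) (rule that)
  let ?G = "%s k. F s (w s) k - F s (w' s) k"
  have "bb (- \<alpha>) (?G s) (L * \<epsilon> * exp (\<Lambda> * (s - a)) * (s - a) powr (- \<eta>))" if s: "a < s" "s \<le> t" for s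
   using L(2)[rule_format, of "s - a" s "w s" "w' s" "\<epsilon> * exp (\<Lambda> * (s - a))"] s a curve_bb[OF w s] curve_bb[OF w' s] d[OF s]
   by (auto simp: mult.assoc)
  moreover have "exp (- \<Lambda> * r) * r powr (- ((\<alpha> + \<beta>) / 2)) \<le> 1 / Y * r powr (- \<gamma>)" if "0 < r" for r
   using exp_weight[OF \<iota> \<Lambda> that, of "(\<alpha> + \<beta>) / 2"] unfolding \<Lambda>Y by (simp add: \<iota>_def)
  ultimately have "bb \<beta> (duh \<mu> a t ?G) (K * (L * \<epsilon>) * (1 / Y) * exp (\<Lambda> * (t - a)) * (t - a) powr (1 - \<gamma> - \<eta>))"
   using a L(1) eps \<Lambda> Y by (intro K(2) continuous_on_diff L1(2) L2(2)) auto
  moreover have "K * (L * \<epsilon>) * (1 / Y) * exp (\<Lambda> * (t - a)) * (t - a) powr (1 - \<gamma> - \<eta>) \<le> \<epsilon> / 2 * exp (\<Lambda> * (t - a)) * (t - a) powr (- \<gamma>)"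
  proof -
   have "(t - a) powr (1 - \<gamma> - \<eta>) = (t - a) powr (1 - \<eta>) * (t - a) powr (- \<gamma>)"
    by (simp add: powr_add[symmetric] algebra_simps)
   also have "\<dots> \<le> T powr (1 - \<eta>) * (t - a) powr (- \<gamma>)"
    using a eta by (intro mult_right_mono powr_mono2) auto
   finally have "K * (L * \<epsilon>) * (1 / Y) * exp (\<Lambda> * (t - a)) * (t - a) powr (1 - \<gamma> - \<eta>) \<le> K * (L * \<epsilon>) * (1 / Y) * exp (\<Lambda> * (t - a)) * (T powr (1 - \<eta>) * (t - a) powr (- \<gamma>))"
    using K(1) L(1) eps Y by (intro mult_left_mono) auto
   also have "\<dots> = (K * L * T powr (1 - \<eta>) / Y) * (\<epsilon> * exp (\<Lambda> * (t - a)) * (t - a) powr (- \<gamma>))" by simp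
   also have "\<dots> \<le> (1 / 2) * (\<epsilon> * exp (\<Lambda> * (t - a)) * (t - a) powr (- \<gamma>))"
   proof (rule mult_right_mono)
    have "K * L * T powr (1 - \<eta>) \<le> 1 / 2 * Y" by (simp add: Y_def)
    then show "K * L * T powr (1 - \<eta>) / Y \<le> 1 / 2" using Y by (simp add: pos_divide_le_eq)
   qed (use eps in simp)
   finally show ?thesis by simp
  qed
  moreover have "duh \<mu> a t ?G = (%k. Phi a u w t k - Phi a u w' t k)"
   unfolding Phi_diff by (rule ext, rule duh_diff[OF _ L1(2) L1(1) L2(2) L2(1)]) (use a(2) in auto)
  ultimately show "bb \<beta> (%k. Phi a u w t k - Phi a u w' t k) (\<epsilon> / 2 * exp (\<Lambda> * (t - a)) * (t - a) powr (- \<gamma>))"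
   by (simp only:) (rule bb_mono)
 qed
qed

text \<open>Both solutions are fixed points in one common ball, so n applications of the contraction
  bound their weighted distance by 2 R / 2 ^ n for every n.\<close>

lemma Sol_unique:
 assumes "0 \<le> a" and w: "Sol a b u w" and w': "Sol a b u w'" and t: "a < t" "t \<le> b"
 shows "w t = w' t"
proof -
 obtain R1 R2 where R12: "curve a b R1 w" "curve a b R2 w'" using w w' unfolding Sol_def by blast
 define R where "R = \<bar>R1\<bar> + \<bar>R2\<bar> + 1"
 have R: "0 < R" "R1 \<le> R" "R2 \<le> R" by (auto simp: R_def)
 have c: "curve a b R w" "curve a b R w'" using curve_mono R12 R by blast+
 have b: "0 < b" using assms by linarith
 obtain \<Lambda> where \<Lambda>: "0 < \<Lambda>" "contracts b R \<Lambda>"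
   using contraction[OF b R(1)] by blast
 have step: "bb \<beta> (%k. w s k - w' s k) (2 * R * (1/2) ^ n * exp (\<Lambda> * (s - a)) * (s - a) powr (- \<gamma>))" if "a < s" "s \<le> b" for n s
  using that
 proof (induction n arbitrary: s)
  case 0
  have "bb \<beta> (%k. w s k - w' s k) (R * (s - a) powr (- \<gamma>) + R * (s - a) powr (- \<gamma>))"
   by (intro bb_diff curve_bb[OF c(1)] curve_bb[OF c(2)] 0)
  then show ?case
  proof (rule bb_mono)
   have "1 \<le> exp (\<Lambda> * (s - a))" using \<Lambda>(1) 0 by simp
   then have "2 * R * (s - a) powr (- \<gamma>) * 1 \<le> 2 * R * (s - a) powr (- \<gamma>) * exp (\<Lambda> * (s - a))"
    using R by (intro mult_left_mono) auto
   then show "R * (s - a) powr (- \<gamma>) + R * (s - a) powr (- \<gamma>) \<le> 2 * R * (1/2) ^ 0 * exp (\<Lambda> * (s - a)) * (s - a) powr (- \<gamma>)"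
    by (simp add: ac_simps)
  qed
 next
  case (Suc n)
  have "bb \<beta> (%k. Phi a u w s k - Phi a u w' s k) (2 * R * (1/2) ^ n / 2 * exp (\<Lambda> * (s - a)) * (s - a) powr (- \<gamma>))"
   by (rule contractsD[OF \<Lambda>(2)]) (use assms(1) Suc curve_subset[OF c(1)] curve_subset[OF c(2)] R in auto)
  moreover have "Phi a u w s = w s" "Phi a u w' s = w' s" using w w' Suc.prems unfolding Sol_def by auto
  ultimately show ?case by simp
 qed
 have "bb \<beta> (%k. w t k - w' t k) 0"
 proof (rule bb_limit[of sequentially "%_ k. w t k - w' t k"])
  show "eventually (%n. bb \<beta> (%k. w t k - w' t k) (2 * R * (1/2) ^ n * exp (\<Lambda> * (t - a)) * (t - a) powr (- \<gamma>))) sequentially"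
   using step[OF t] by simp
  have hl: "(%n. (1/2::real) ^ n) \<longlonglongrightarrow> 0" by (rule LIMSEQ_realpow_zero) auto
  have "(%n. 2 * R * (1/2) ^ n * (exp (\<Lambda> * (t - a)) * (t - a) powr (- \<gamma>))) \<longlonglongrightarrow> 2 * R * 0 * (exp (\<Lambda> * (t - a)) * (t - a) powr (- \<gamma>))"
   by (intro tendsto_mult tendsto_const hl)
  then show "(%n. 2 * R * (1/2) ^ n * exp (\<Lambda> * (t - a)) * (t - a) powr (- \<gamma>)) \<longlonglongrightarrow> 0"
   by (simp only: mult_zero_right mult_zero_left mult.assoc)
 qed auto
 then have "w t k - w' t k = 0" for k by (rule bb_0_imp_zero)
 then show ?thesis by (intro ext) simp
qed

end

section \<open>Local existence by Picard iteration, restarting, gluing and continuation\<close>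

context mild_problem
begin

lemma Phi_continuous:
 assumes "0 \<le> a" "a < b" "0 < R" "curve a b R w"
 shows "continuous_on {a<..b} (%t. Phi a u w t k)"
proof -
 obtain L where "0 \<le> L" and L: "!!s. a < s ==> s \<le> b ==> bb (- \<alpha>) (F s (w s)) (L * (s - a) powr (- \<eta>))"
  "!!k. continuous_on {a<..b} (%s. F s (w s) k)"
  by (rule curve_forcing[OF assms(4,1,2,3)]) (rule that)
 show ?thesis
  unfolding Phi_def
  by (intro continuous_on_add Pt_coeff_continuous duh_continuous[OF mu eta _ L(2,1)]) (use assms in auto)
qed

text \<open>The order of quantifiers is the point: \<delta> and R depend on T and M but neither on
  the starting time nor on the datum, so a bound on a solution yields a fixed step length.\<close>

lemma local_exists:
 assumes T: "0 < T" and M: "0 \<le> M"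
 obtains \<delta> R where "0 < \<delta>" "\<delta> \<le> 1" "!!a u. 0 \<le> a ==> a \<le> T ==> bb (- \<alpha>1) u M ==>
  \<exists>w. curve a (a + \<delta>) R w \<and> Sol a (a + \<delta>) u w"
proof -
 define T' where "T' = T + 1"
 have T': "0 < T'" "T \<le> T'" "1 \<le> T'" using T by (auto simp: T'_def)
 have b1: "- \<alpha>1 \<le> \<beta>" using be al1 by linarith
 have b2: "(\<alpha>1 + \<beta>) / 2 \<le> 1" using exps(6) by simp
 obtain K0 where K0: "0 \<le> K0" "!!t f C. 0 < t ==> t \<le> T' ==> bb (- \<alpha>1) f C ==> bb \<beta> (Pt \<mu> t f) (K0 * C * t powr (- ((\<alpha>1 + \<beta>) / 2)))"
  by (rule Pt_smoothing[OF T'(1) b1 b2]) (rule that)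
 define R0 where "R0 = K0 * M * T' powr (\<gamma> - (\<alpha>1 + \<beta>) / 2)"
 have R0: "0 \<le> R0" using K0(1) M by (simp add: R0_def)
 define R where "R = R0 + 1"
 have R: "0 < R" using R0 by (simp add: R_def)
 have P0: "bb \<beta> (Pt \<mu> t u) (R0 * t powr (- \<gamma>))" if "0 < t" "t \<le> T'" "bb (- \<alpha>1) u M" for t u
 proof (rule bb_mono[OF K0(2)[OF that]])
  have "t powr (- ((\<alpha>1 + \<beta>) / 2)) = t powr (\<gamma> - (\<alpha>1 + \<beta>) / 2) * t powr (- \<gamma>)"
   by (simp add: powr_add[symmetric])
  also have "\<dots> \<le> T' powr (\<gamma> - (\<alpha>1 + \<beta>) / 2) * t powr (- \<gamma>)"
   using that gam2 by (intro mult_right_mono powr_mono2) auto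
  finally show "K0 * M * t powr (- ((\<alpha>1 + \<beta>) / 2)) \<le> R0 * t powr (- \<gamma>)"
   using K0(1) M unfolding R0_def mult.assoc by (intro mult_left_mono) auto
 qed
 obtain L where L: "0 \<le> L" "\<forall>\<sigma> s w w' \<epsilon>. 0 < \<sigma> --> \<sigma> \<le> s --> s \<le> T' -->
   bb \<beta> w (R * \<sigma> powr (- \<gamma>)) --> bb \<beta> w' (R * \<sigma> powr (- \<gamma>)) --> bb \<beta> (%k. w k - w' k) (\<epsilon> * \<sigma> powr (- \<gamma>)) -->
   bb (- \<alpha>) (F s w) (L * \<sigma> powr (- \<eta>)) \<and> bb (- \<alpha>) (%k. F s w k - F s w' k) (L * \<epsilon> * \<sigma> powr (- \<eta>))"
  using F_est[OF T'(1) R] by blast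
 obtain K where K: "0 \<le> K" "!!a t G L \<Lambda> X. a < t ==> t - a \<le> 1 ==> (!!k. continuous_on {a<..t} (%s. G s k)) ==>
  0 \<le> L ==> 0 \<le> \<Lambda> ==> (!!s. a < s ==> s \<le> t ==> bb (- \<alpha>) (G s) (L * exp (\<Lambda> * (s - a)) * (s - a) powr (- \<eta>))) ==>
  0 \<le> X ==> (!!r. 0 < r ==> r \<le> 1 ==> exp (- \<Lambda> * r) * r powr (- ((\<alpha> + \<beta>) / 2)) \<le> X * r powr (- \<gamma>)) ==>
  bb \<beta> (duh \<mu> a t G) (K * L * X * exp (\<Lambda> * (t - a)) * (t - a) powr (1 - \<gamma> - \<eta>))"
 proof (rule Phi_bound[of 1 \<beta> \<gamma>])
 qed (use al be exps gam1 in auto)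
 \<comment> \<open>Chosen so that the Duhamel term contributes at most 1, the amount by which R
   exceeds the bound R0 of the free evolution.\<close>
 define \<delta> where "\<delta> = (1 / (K * L + 1)) powr (1 / (1 - \<eta>))"
 have KL: "1 \<le> K * L + 1" using K(1) L(1) by simp
 have \<delta>: "0 < \<delta>" "\<delta> \<le> 1" using KL eta by (auto simp: \<delta>_def intro!: powr_le1)
 have \<delta>\<eta>: "K * L * \<delta> powr (1 - \<eta>) \<le> 1"
 proof -
  have "\<delta> powr (1 - \<eta>) = 1 / (K * L + 1)" using eta KL by (simp add: \<delta>_def powr_powr)
  then show ?thesis using KL by simp
 qed
 show ?thesis
 proof (rule that[OF \<delta>])
  fix a u assume a: "0 \<le> a" "a \<le> T" and u: "bb (- \<alpha>1) u M"
  define b where "b = a + \<delta>"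
  have b: "a < b" "b \<le> T'" "0 < b" using a \<delta> by (auto simp: b_def T'_def)
  have invariant: "curve a b R (Phi a u w)" if w: "curve a b R w" for w
  proof -
   have "bb \<beta> (Phi a u w t) (R * (t - a) powr (- \<gamma>))" if t: "a < t" "t \<le> b" for t
   proof -
    have wt: "curve a t R w" by (rule curve_subset[OF w t(2)])
    have Fb: "bb (- \<alpha>) (F s (w s)) (L * exp (0 * (s - a)) * (s - a) powr (- \<eta>))" if s: "a < s" "s \<le> t" for s
    proof -
     have "bb \<beta> (%k. w s k - w s k) (0 * (s - a) powr (- \<gamma>))" by (simp add: bb_zero)
     then show ?thesis
      using L(2)[rule_format, of "s - a" s "w s" "w s" 0] s t a b curve_bb[OF wt s] by auto
    qed
    obtain L1 where "0 \<le> L1" "!!s. a < s ==> s \<le> t ==> bb (- \<alpha>) (F s (w s)) (L1 * (s - a) powr (- \<eta>))"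
     and L1: "!!k. continuous_on {a<..t} (%s. F s (w s) k)"
     by (rule curve_forcing[OF wt a(1) t(1) R]) (rule that)
    have "bb \<beta> (duh \<mu> a t (%s. F s (w s))) (K * L * 1 * exp (0 * (t - a)) * (t - a) powr (1 - \<gamma> - \<eta>))"
    proof (rule K(2)[OF t(1) _ L1 L(1) _ Fb])
     show "exp (- 0 * r) * r powr (- ((\<alpha> + \<beta>) / 2)) \<le> 1 * r powr (- \<gamma>)" if "0 < r" "r \<le> 1" for r :: real
      using that gam1 powr_mono'[of "- \<gamma>" "- ((\<alpha> + \<beta>) / 2)" r] by simp
    qed (use t b_def \<delta> in auto)
    moreover have "K * L * (t - a) powr (1 - \<gamma> - \<eta>) \<le> 1 * (t - a) powr (- \<gamma>)"
    proof -
     have "K * L * (t - a) powr (1 - \<eta>) \<le> K * L * \<delta> powr (1 - \<eta>)"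
      using t eta K(1) L(1) b_def by (intro mult_left_mono powr_mono2) auto
     then have "K * L * (t - a) powr (1 - \<eta>) * (t - a) powr (- \<gamma>) \<le> 1 * (t - a) powr (- \<gamma>)"
      using \<delta>\<eta> by (intro mult_right_mono) auto
     then show ?thesis by (simp add: mult.assoc powr_add[symmetric] algebra_simps)
    qed
    ultimately have "bb \<beta> (duh \<mu> a t (%s. F s (w s))) (1 * (t - a) powr (- \<gamma>))"
     by (elim bb_mono) simp
    moreover have "bb \<beta> (Pt \<mu> (t - a) u) (R0 * (t - a) powr (- \<gamma>))"
     by (rule P0) (use t b a u b_def \<delta> T' in auto)
    ultimately have "bb \<beta> (%k. Pt \<mu> (t - a) u k + duh \<mu> a t (%s. F s (w s)) k) (R0 * (t - a) powr (- \<gamma>) + 1 * (t - a) powr (- \<gamma>))"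
     by (intro bb_add)
    then show ?thesis by (simp add: Phi_def[abs_def] R_def distrib_right)
   qed
   moreover have "continuous_on {a<..b} (%t. Phi a u w t k)" for k
    by (rule Phi_continuous[OF a(1) b(1) R w])
   ultimately show ?thesis unfolding curve_def by blast
  qed
  define W where "W n = ((Phi a u) ^^ n) (%t k. 0)" for n
  have W_Suc: "W (Suc n) = Phi a u (W n)" for n by (simp add: W_def)
  have Wc: "curve a b R (W n)" for n
  proof (induction n)
   case 0
   show ?case unfolding curve_def W_def using R by (auto intro!: bb_zero)
  next
   case (Suc n)
   then show ?case unfolding W_Suc by (rule invariant)
  qed
  \<comment> \<open>Convergence of the iteration comes from the exponential weight; the smallness of
    \<delta> serves to keep the iterates in the ball.\<close>
  obtain \<Lambda> where \<Lambda>: "0 < \<Lambda>" "contracts T' R \<Lambda>"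
   using contraction[OF T'(1) R] by blast
  define e where "e t = exp (\<Lambda> * (t - a)) * (t - a) powr (- \<gamma>)" for t
  have e0: "0 \<le> e t" for t by (simp add: e_def)
  have step: "bb \<beta> (%k. W (Suc n) t k - W n t k) (2 * R * (1/2) ^ n * e t)" if "a < t" "t \<le> b" for n t
   using that
  proof (induction n arbitrary: t)
   case 0
   have "bb \<beta> (%k. W (Suc 0) t k - W 0 t k) (R * (t - a) powr (- \<gamma>) + R * (t - a) powr (- \<gamma>))"
    by (intro bb_diff curve_bb[OF Wc] 0)
   then show ?case
   proof (rule bb_mono)
    have "1 \<le> exp (\<Lambda> * (t - a))" using \<Lambda>(1) 0 by simp
    then have "2 * R * (t - a) powr (- \<gamma>) * 1 \<le> 2 * R * (t - a) powr (- \<gamma>) * exp (\<Lambda> * (t - a))"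
     using R by (intro mult_left_mono) auto
    then show "R * (t - a) powr (- \<gamma>) + R * (t - a) powr (- \<gamma>) \<le> 2 * R * (1/2) ^ 0 * e t"
     by (simp add: ac_simps e_def)
   qed
  next
   case (Suc n)
   have "bb \<beta> (%k. Phi a u (W (Suc n)) t k - Phi a u (W n) t k) (2 * R * (1/2) ^ n / 2 * exp (\<Lambda> * (t - a)) * (t - a) powr (- \<gamma>))"
   proof (rule contractsD[OF \<Lambda>(2)])
    show "curve a t R (W (Suc n))" "curve a t R (W n)" by (rule curve_subset[OF Wc Suc.prems(2)])+
    show "bb \<beta> (%k. W (Suc n) s k - W n s k) (2 * R * (1 / 2) ^ n * exp (\<Lambda> * (s - a)) * (s - a) powr - \<gamma>)" if "a < s" "s \<le> t" for s
     using Suc.IH[of s] that Suc.prems by (simp add: e_def mult.assoc)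
   qed (use a b R Suc.prems in auto)
   then show ?case by (simp add: W_Suc e_def mult.assoc)
  qed
  have cauchy: "bb \<beta> (%k. W (n + j) t k - W n t k) (4 * R * (1/2) ^ n * e t)" if t: "a < t" "t \<le> b" for n j t
  proof -
   have "bb \<beta> (%k. \<Sum>i<j. W (Suc (n + i)) t k - W (n + i) t k) (\<Sum>i<j. 2 * R * (1/2) ^ (n + i) * e t)"
    by (intro bb_sum step t) simp
   moreover have "(\<Sum>i<j. W (Suc (n + i)) t k - W (n + i) t k) = W (n + j) t k - W n t k" for k
    using sum_lessThan_telescope[of "%i. W (n + i) t k" j] by simp
   moreover have "(\<Sum>i<j. 2 * R * (1/2) ^ (n + i) * e t) \<le> 4 * R * (1/2) ^ n * e t"
   proof -
    have "(\<Sum>i<j. (1/2::real) ^ i) \<le> 2" using sum_geometric_upper[of "1/2" "{..<j}" 0] by simp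
    then have "2 * R * (1/2) ^ n * e t * (\<Sum>i<j. (1/2) ^ i) \<le> 2 * R * (1/2) ^ n * e t * 2"
     using R e0 by (intro mult_left_mono) auto
    then show ?thesis by (simp add: sum_distrib_left power_add ac_simps)
   qed
   ultimately show ?thesis by (auto intro: bb_mono)
  qed
  have half: "(%n. (1/2::real) ^ n) \<longlonglongrightarrow> 0" by (rule LIMSEQ_realpow_zero) auto
  have Wlim: "convergent (%n. W n t k)" if t: "a < t" "t \<le> b" for t k
  proof (rule Cauchy_convergent, rule metric_CauchyI)
   fix \<epsilon> :: real assume \<epsilon>: "0 < \<epsilon>"
   let ?c = "4 * R * e t * coeffC \<beta> k"
   have "(%n. ?c * (1/2) ^ n) \<longlonglongrightarrow> ?c * 0" by (intro tendsto_mult tendsto_const half)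
   then have "eventually (%n. ?c * (1/2) ^ n < \<epsilon> / 2) sequentially"
    using \<epsilon> by (intro order_tendstoD) auto
   then obtain N where N: "?c * (1/2) ^ N < \<epsilon> / 2" unfolding eventually_sequentially by blast
   have near: "dist (W n t k) (W N t k) < \<epsilon> / 2" if "N \<le> n" for n
   proof -
    have "cmod (W (N + (n - N)) t k - W N t k) \<le> 4 * R * (1/2) ^ N * e t * coeffC \<beta> k"
     by (rule bb_coeff[OF cauchy[OF t]])
    then show ?thesis using N that by (simp add: dist_norm ac_simps)
   qed
   show "\<exists>M. \<forall>m\<ge>M. \<forall>n\<ge>M. dist (W m t k) (W n t k) < \<epsilon>"
    using near by (intro exI[of _ N]) (meson dist_triangle_half_l)
  qed
  define w where "w t k = lim (%n. W n t k)" for t k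
  have Ww: "(%n. W n t k) \<longlonglongrightarrow> w t k" if "a < t" "t \<le> b" for t k
   using Wlim[OF that] by (simp add: w_def convergent_LIMSEQ_iff)
  have err: "bb \<beta> (%k. w t k - W n t k) (4 * R * (1/2) ^ n * e t)" if t: "a < t" "t \<le> b" for t n
  proof (rule bb_limit[of sequentially "%j k. W (n + j) t k - W n t k"])
   show "(%j. W (n + j) t k - W n t k) \<longlonglongrightarrow> w t k - W n t k" for k
    by (intro tendsto_diff tendsto_const) (use LIMSEQ_ignore_initial_segment[OF Ww[OF t], of n] in \<open>simp add: add.commute\<close>)
  qed (use cauchy[OF t] in auto)
  have wc: "curve a b R w"
   unfolding curve_def
  proof (intro conjI allI impI)
   fix t assume t: "a < t" "t \<le> b"
   show "bb \<beta> (w t) (R * (t - a) powr (- \<gamma>))"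
    by (rule bb_limit[OF _ Ww[OF t]]) (use curve_bb[OF Wc t] in auto)
  next
   fix k
   show "continuous_on {a<..b} (%t. w t k)"
    unfolding continuous_on_eq_continuous_within
   proof
    fix t assume t: "t \<in> {a<..b}"
    \<comment> \<open>The convergence is uniform only away from a, where the weight blows
      up.\<close>
    define c where "c = (a + t) / 2"
    have c: "a < c" "c < t" using t by (auto simp: c_def)
    let ?E = "4 * R * (exp (\<Lambda> * (b - a)) * (c - a) powr (- \<gamma>)) * coeffC \<beta> k"
    have ul: "uniform_limit {c..b} (%n t. W n t k) (%t. w t k) sequentially"
    proof (rule uniform_limitI)
     fix \<epsilon> :: real assume "0 < \<epsilon>"
     have "(%n. ?E * (1/2) ^ n) \<longlonglongrightarrow> ?E * 0" by (intro tendsto_mult tendsto_const half)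
     then have "eventually (%n. ?E * (1/2) ^ n < \<epsilon>) sequentially"
      using \<open>0 < \<epsilon>\<close> by (intro order_tendstoD) auto
     then show "eventually (%n. \<forall>x\<in>{c..b}. dist (W n x k) (w x k) < \<epsilon>) sequentially"
     proof eventually_elim
      case (elim n)
      show ?case
      proof
       fix x assume x: "x \<in> {c..b}"
       have "cmod (w x k - W n x k) \<le> 4 * R * (1/2) ^ n * e x * coeffC \<beta> k"
        by (rule bb_coeff[OF err]) (use x c in auto)
       also have "\<dots> \<le> 4 * R * (1/2) ^ n * (exp (\<Lambda> * (b - a)) * (c - a) powr (- \<gamma>)) * coeffC \<beta> k"
        unfolding e_def using x c R \<Lambda>(1) exps coeffC_nonneg
        by (intro mult_right_mono mult_left_mono mult_mono powr_mono2') auto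
       also have "\<dots> = ?E * (1/2) ^ n" by (simp only: ac_simps)
       finally show "dist (W n x k) (w x k) < \<epsilon>" using elim by (simp add: dist_norm norm_minus_commute)
      qed
     qed
    qed
    have "continuous_on {c..b} (%t. w t k)"
    proof (rule uniform_limit_theorem[OF _ ul])
     show "eventually (%n. continuous_on {c..b} (%t. W n t k)) sequentially"
     proof (rule always_eventually, rule allI, rule continuous_on_subset)
      show "continuous_on {a<..b} (%t. W n t k)" for n using Wc[of n] unfolding curve_def by blast
     qed (use c in auto)
    qed simp
    then have "continuous (at t within {c..b}) (%t. w t k)"
     using t c by (simp add: continuous_on_eq_continuous_within)
    moreover have "at t within {c..b} = at t within {a<..b}"
     by (rule at_within_nhd[of t "{c<..}"]) (use c in auto)
    ultimately show "continuous (at t within {a<..b}) (%t. w t k)" by simp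
   qed
  qed
  have "w t = Phi a u w t" if t: "a < t" "t \<le> b" for t
  proof
   fix k
   have "bb \<beta> (%k. Phi a u w t k - Phi a u (W n) t k) (4 * R * (1/2) ^ n / 2 * exp (\<Lambda> * (t - a)) * (t - a) powr (- \<gamma>))" for n
   proof (rule contractsD[OF \<Lambda>(2)])
    show "curve a t R w" "curve a t R (W n)" by (rule curve_subset[OF wc t(2)], rule curve_subset[OF Wc t(2)])
    show "bb \<beta> (%k. w s k - W n s k) (4 * R * (1 / 2) ^ n * exp (\<Lambda> * (s - a)) * (s - a) powr - \<gamma>)" if "a < s" "s \<le> t" for s
     using err[of s n] that t by (simp add: e_def mult.assoc)
   qed (use a b R t in auto)
   then have le: "cmod (Phi a u w t k - W (Suc n) t k) \<le> (2 * R * e t * coeffC \<beta> k) * (1/2) ^ n" for n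
    using bb_coeff[of \<beta> "%k. Phi a u w t k - Phi a u (W n) t k" _ k] unfolding W_Suc e_def by (fastforce simp: ac_simps)
   have "(%n. Phi a u w t k - W (Suc n) t k) \<longlonglongrightarrow> 0"
   proof (rule Lim_null_comparison)
    have "(%n. (2 * R * e t * coeffC \<beta> k) * (1/2) ^ n) \<longlonglongrightarrow> (2 * R * e t * coeffC \<beta> k) * 0"
     by (intro tendsto_mult tendsto_const half)
    then show "(%n. (2 * R * e t * coeffC \<beta> k) * (1/2) ^ n) \<longlonglongrightarrow> 0" by (simp only: mult_zero_right)
   qed (use le in auto)
   moreover have "(%n. Phi a u w t k - W (Suc n) t k) \<longlonglongrightarrow> Phi a u w t k - w t k"
    by (intro tendsto_diff tendsto_const LIMSEQ_Suc Ww t)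
   ultimately have "Phi a u w t k - w t k = 0" using LIMSEQ_unique by blast
   then show "w t k = Phi a u w t k" by simp
  qed
  then have "Sol a b u w" unfolding Sol_def using wc by blast
  then show "\<exists>w. curve a (a + \<delta>) R w \<and> Sol a (a + \<delta>) u w" using wc unfolding b_def by blast
 qed
qed

lemma Sol_subset: "Sol a b u w ==> b' \<le> b ==> Sol a b' u w"
 unfolding Sol_def using curve_subset by (meson order_trans)

lemma Sol_pos_curve: "Sol a b u w ==> \<exists>R>0. curve a b R w"
proof -
 assume "Sol a b u w"
 then obtain R where R: "curve a b R w" unfolding Sol_def by blast
 have "curve a b (\<bar>R\<bar> + 1) w" by (rule curve_mono[OF R]) simp
 then show ?thesis by (intro exI[of _ "\<bar>R\<bar> + 1"]) simp
qed

lemma Phi_restart: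
 assumes "0 \<le> a" "a < c" "c < t" "0 < R" "curve a t R w" "w c = Phi a u w c"
 shows "Phi a u w t = Phi c (w c) w t"
proof -
 have at: "a < t" using assms by simp
 obtain L where "0 \<le> L" and L: "!!s. a < s ==> s \<le> t ==> bb (- \<alpha>) (F s (w s)) (L * (s - a) powr (- \<eta>))"
  "!!k. continuous_on {a<..t} (%s. F s (w s) k)"
  by (rule curve_forcing[OF assms(5,1) at assms(4)]) (rule that)
 have sp: "duh \<mu> a t (%s. F s (w s)) k = Pt \<mu> (t - c) (duh \<mu> a c (%s. F s (w s))) k + duh \<mu> c t (%s. F s (w s)) k" for k
  by (rule duh_split[OF mu eta assms(2) _ L(2,1)]) (use assms in auto)
 have "Pt \<mu> (t - a) u k = Pt \<mu> (t - c) (Pt \<mu> (c - a) u) k" for k by (simp add: Pt_add)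
 moreover have "Pt \<mu> (t - c) (w c) k = Pt \<mu> (t - c) (Pt \<mu> (c - a) u) k + Pt \<mu> (t - c) (duh \<mu> a c (%s. F s (w s))) k" for k
  unfolding assms(6) by (simp add: Pt_def Phi_def distrib_left)
 ultimately show ?thesis unfolding Phi_def by (intro ext) (simp add: sp)
qed

lemma Sol_restart:
 assumes "0 \<le> a" "a < c" "c < b" "Sol a b u w"
 shows "Sol c b (w c) w"
proof -
 obtain R where R: "0 < R" "curve a b R w" using Sol_pos_curve[OF assms(4)] by blast
 have eq: "w t = Phi a u w t" if "a < t" "t \<le> b" for t using assms(4) that unfolding Sol_def by blast
 have "w t = Phi c (w c) w t" if "c < t" "t \<le> b" for t
  using Phi_restart[OF assms(1,2) that(1) R(1) curve_subset[OF R(2) that(2)] eq] eq[of t] that assms by simp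
 moreover have "curve c b R w" by (rule curve_restart[OF R(2)]) (use assms R in auto)
 ultimately show ?thesis unfolding Sol_def by blast
qed

text \<open>The value at the initial time is left free: the integral does not see the
  endpoint.\<close>

lemma Phi_cong: "(!!s. a < s ==> s \<le> t ==> w s = w' s) ==> Phi a u w t = Phi a u w' t"
proof -
 assume eq: "!!s. a < s ==> s \<le> t ==> w s = w' s"
 have "integral {a..t} (%s. Pt \<mu> (t - s) (F s (w s)) k) = integral {a..t} (%s. Pt \<mu> (t - s) (F s (w' s)) k)" for k
 proof -
  have "integral {a<..<t} (%s. Pt \<mu> (t - s) (F s (w s)) k) = integral {a<..<t} (%s. Pt \<mu> (t - s) (F s (w' s)) k)"
   by (rule integral_cong) (simp add: eq)
  then show ?thesis by (simp only: integral_open_interval_real)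
 qed
 then show ?thesis by (simp add: Phi_def duh_def fun_eq_iff)
qed

lemma Sol_cong: "Sol a b u w ==> (!!s. a < s ==> s \<le> b ==> w s = w' s) ==> Sol a b u w'"
proof -
 assume w: "Sol a b u w" and eq: "!!s. a < s ==> s \<le> b ==> w s = w' s"
 obtain R where R: "curve a b R w" using w unfolding Sol_def by blast
 have "curve a b R w'"
  unfolding curve_def
 proof (intro conjI allI impI)
  fix t assume t: "a < t" "t \<le> b"
  show "bb \<beta> (w' t) (R * (t - a) powr (- \<gamma>))" using curve_bb[OF R t] eq[OF t] by simp
 next
  fix k
  have "continuous_on {a<..b} (%t. w t k)" using R unfolding curve_def by blast
  then show "continuous_on {a<..b} (%t. w' t k)" by (rule continuous_on_eq) (simp add: eq)
 qed
 moreover have "w' t = Phi a u w' t" if t: "a < t" "t \<le> b" for t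
 proof -
  have "w t = Phi a u w t" using w t unfolding Sol_def by blast
  also have "\<dots> = Phi a u w' t" by (rule Phi_cong) (use eq t in auto)
  finally show ?thesis using eq[OF t] by simp
 qed
 ultimately show ?thesis unfolding Sol_def by blast
qed

text \<open>The two solutions agree on the overlap (a, c] by uniqueness. The overlap makes {0<..<c}
  and {a<..b} a relatively open cover, from which continuity follows.\<close>

lemma Sol_glue:
 assumes abc: "0 < a" "a < c" "c < b" and w: "Sol 0 c u w" and w': "Sol a b (w a) w'"
 shows "Sol 0 b u (%t. if t \<le> c then w t else w' t)"
proof -
 let ?W = "%t. if t \<le> c then w t else w' t"
 have "w t = w' t" if "a < t" "t \<le> c" for t
  by (rule Sol_unique[OF _ Sol_restart[OF _ abc(1,2) w] Sol_subset[OF w']]) (use abc that in auto)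
 then have W1: "?W t = w' t" if "a < t" for t using that by simp
 have W0: "?W t = w t" if "t \<le> c" for t using that by simp
 obtain R1 where R1: "0 < R1" "curve 0 c R1 w" using Sol_pos_curve[OF w] by blast
 obtain R2 where R2: "0 < R2" "curve a b R2 w'" using Sol_pos_curve[OF w'] by blast
 \<comment> \<open>Past c the distance to a is at least c - a, so the singularity of the second
   piece at a is bounded there; b powr \<gamma> converts that bound to the weight centred at
   0.\<close>
 define R where "R = R1 + R2 * (c - a) powr (- \<gamma>) * b powr \<gamma>"
 have R: "0 < R" "R1 \<le> R" using R1 R2 abc by (auto simp: R_def intro!: add_pos_nonneg)
 have curve: "curve 0 b R ?W"
  unfolding curve_def
 proof (intro conjI allI impI)
  fix t assume t: "0 < t" "t \<le> b"
  show "bb \<beta> (?W t) (R * (t - 0) powr (- \<gamma>))"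
  proof (cases "t \<le> c")
   case True
   then show ?thesis using curve_bb[OF curve_mono[OF R1(2) R(2)] t(1) True] by simp
  next
   case False
   have "bb \<beta> (w' t) (R2 * (t - a) powr (- \<gamma>))" using curve_bb[OF R2(2), of t] False abc t by simp
   then have "bb \<beta> (w' t) (R * t powr (- \<gamma>))"
   proof (rule bb_mono)
    have "(t - a) powr (- \<gamma>) \<le> (c - a) powr (- \<gamma>)" using False abc exps by (intro powr_mono2') auto
    also have "\<dots> = (c - a) powr (- \<gamma>) * (t powr \<gamma> * t powr (- \<gamma>))" using t by (simp add: powr_add[symmetric])
    also have "\<dots> \<le> (c - a) powr (- \<gamma>) * (b powr \<gamma> * t powr (- \<gamma>))"
     using t exps by (intro mult_left_mono mult_right_mono powr_mono2) auto
    finally have "R2 * (t - a) powr (- \<gamma>) \<le> R2 * ((c - a) powr (- \<gamma>) * (b powr \<gamma> * t powr (- \<gamma>)))"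
     using R2(1) by (intro mult_left_mono) auto
    also have "\<dots> \<le> R * t powr (- \<gamma>)" using R1(1) by (simp add: R_def distrib_right mult.assoc)
    finally show "R2 * (t - a) powr (- \<gamma>) \<le> R * t powr (- \<gamma>)" .
   qed
   then show ?thesis using False by simp
  qed
 next
  fix k
  have "continuous_on ({0<..<c} \<union> {a<..b}) (%t. ?W t k)"
  proof (rule continuous_on_Un_local_open)
   have U: "{0<..<c} \<union> {a<..b} = {0<..b}" using abc by auto
   have "{0<..<c} = {0<..b} \<inter> {..<c}" "{a<..b} = {0<..b} \<inter> {a<..}" using abc by auto
   then show "openin (top_of_set ({0<..<c} \<union> {a<..b})) {0<..<c}" "openin (top_of_set ({0<..<c} \<union> {a<..b})) {a<..b}"
    unfolding U by (metis openin_open_Int open_lessThan, metis openin_open_Int open_greaterThan)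
   have "continuous_on {0<..<c} (%t. w t k)"
    using R1(2) unfolding curve_def by (auto intro: continuous_on_subset)
   then show "continuous_on {0<..<c} (%t. ?W t k)" by (rule continuous_on_eq) (simp add: W0)
   have "continuous_on {a<..b} (%t. w' t k)" using R2(2) unfolding curve_def by blast
   then show "continuous_on {a<..b} (%t. ?W t k)" by (rule continuous_on_eq) (simp add: W1)
  qed
  moreover have "{0<..<c} \<union> {a<..b} = {0<..b}" using abc by auto
  ultimately show "continuous_on {0<..b} (%t. ?W t k)" by simp
 qed
 have eq0: "?W t = Phi 0 u ?W t" if t: "0 < t" "t \<le> c" for t
 proof -
  have "w t = Phi 0 u w t" using w t unfolding Sol_def by blast
  also have "\<dots> = Phi 0 u ?W t" by (rule Phi_cong) (use t in auto)
  finally show ?thesis using t by simp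
 qed
 have "?W t = Phi 0 u ?W t" if t: "0 < t" "t \<le> b" for t
 proof (cases "t \<le> c")
  case True
  then show ?thesis using eq0 t by blast
 next
  case False
  have Wa: "?W a = w a" using abc by simp
  have "w' t = Phi a (w a) w' t" using w' t False abc unfolding Sol_def by auto
  also have "\<dots> = Phi a (w a) ?W t" by (rule Phi_cong) (simp add: W1)
  also have "\<dots> = Phi a (?W a) ?W t" by (simp only: Wa)
  also have "\<dots> = Phi 0 u ?W t"
   by (rule Phi_restart[symmetric, OF _ abc(1) _ R(1) curve_subset[OF curve t(2)] eq0]) (use abc False in auto)
  finally show ?thesis using False by simp
 qed
 then show ?thesis unfolding Sol_def using curve by blast
qed

text \<open>The a priori bound on [t0, T] fixes one step length \<delta> for every restart, so
  finitely many steps reach T. The hypothesis is conditioned on the size at a positive time t0,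
  which the first local solution provides.\<close>

lemma global_exists:
 assumes u: "bb (- \<alpha>1) u M0" and T: "0 < T"
  and apriori: "!!t0 A. 0 < t0 ==> \<exists>M. \<forall>b w. t0 < b --> b \<le> T --> Sol 0 b u w --> bb \<beta> (w t0) A -->
   (\<forall>t. t0 \<le> t --> t \<le> b --> bb (- \<alpha>1) (w t) M)"
 shows "\<exists>w. Sol 0 T u w"
proof -
 obtain \<delta>0 R0 where d0: "0 < \<delta>0" "!!a u. 0 \<le> a ==> a \<le> T ==> bb (- \<alpha>1) u M0 ==>
  \<exists>w. curve a (a + \<delta>0) R0 w \<and> Sol a (a + \<delta>0) u w"
  by (rule local_exists[OF T bb_nonneg[OF u]]) (rule that)
 obtain w0 where w0: "curve 0 \<delta>0 R0 w0" "Sol 0 \<delta>0 u w0" using d0(2)[of 0 u] u T by auto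
 define t0 where "t0 = \<delta>0 / 2"
 have t0: "0 < t0" "t0 < \<delta>0" using d0 by (auto simp: t0_def)
 define A where "A = R0 * (t0 - 0) powr (- \<gamma>)"
 have A: "bb \<beta> (w0 t0) A" unfolding A_def by (rule curve_bb[OF w0(1)]) (use t0 in auto)
 obtain M where M: "!!b w t. t0 < b ==> b \<le> T ==> Sol 0 b u w ==> bb \<beta> (w t0) A ==> t0 \<le> t ==> t \<le> b ==> bb (- \<alpha>1) (w t) M"
  using apriori[OF t0(1), of A] by blast
 define M' where "M' = max M 0"
 obtain \<delta> R where d: "0 < \<delta>" "\<delta> \<le> 1" "!!a u. 0 \<le> a ==> a \<le> T ==> bb (- \<alpha>1) u M' ==>
  \<exists>w. curve a (a + \<delta>) R w \<and> Sol a (a + \<delta>) u w"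
  by (rule local_exists[OF T, of M']) (auto simp: M'_def)
 \<comment> \<open>Each step advances by \<delta> / 2 only, because it restarts up to \<delta> / 2
   before the end in order to overlap with the previous piece.\<close>
 have "\<exists>w. Sol 0 (min T (\<delta>0 + real n * (\<delta> / 2))) u w" for n
 proof (induction n)
  case 0
  show ?case using Sol_subset[OF w0(2), of "min T \<delta>0"] by auto
 next
  case (Suc n)
  then obtain w where w: "Sol 0 (min T (\<delta>0 + real n * (\<delta> / 2))) u w" by blast
  define c where "c = min T (\<delta>0 + real n * (\<delta> / 2))"
  show ?case
  proof (cases "c = T")
   case True
   have "real (Suc n) * (\<delta> / 2) = real n * (\<delta> / 2) + \<delta> / 2" by (simp add: algebra_simps add_divide_distrib)
   moreover have "T \<le> \<delta>0 + real n * (\<delta> / 2)" using True by (simp only: c_def min_def split: if_splits)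
   ultimately have "T \<le> \<delta>0 + real (Suc n) * (\<delta> / 2)" using d(1) by linarith
   then have "min T (\<delta>0 + real (Suc n) * (\<delta> / 2)) = c" using True by (simp only: min_absorb1)
   then show ?thesis using w c_def by auto
  next
   case False
   then have c: "c = \<delta>0 + real n * (\<delta> / 2)" "c < T" by (auto simp: c_def min_def split: if_splits)
   then have cge: "\<delta>0 \<le> c" using d(1) by simp
   have wS: "Sol 0 c u w" using w c_def by simp
   define a where "a = max t0 (c - \<delta> / 2)"
   have a: "0 < a" "a < c" "t0 \<le> a" "c - \<delta> / 2 \<le> a" using t0 cge d(1) by (auto simp: a_def)
   \<comment> \<open>By uniqueness every extension passes through the value of the first local
     solution at t0, so the constant M selected from that value applies to it.\<close>
   have "w t0 = w0 t0"
    by (rule Sol_unique[OF _ Sol_subset[OF wS, of t0] Sol_subset[OF w0(2), of t0]]) (use t0 cge in auto)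
   then have "bb (- \<alpha>1) (w a) M"
    using M[of c w a] wS A a c t0 cge by auto
   then have "bb (- \<alpha>1) (w a) M'" by (rule bb_mono) (simp add: M'_def)
   then obtain w' where w': "Sol a (a + \<delta>) (w a) w'" using d(3)[of a "w a"] a c by auto
   have "Sol 0 (a + \<delta>) u (%t. if t \<le> c then w t else w' t)"
    by (rule Sol_glue[OF a(1,2) _ wS w']) (use a d(1) in auto)
   then have "Sol 0 (min T (\<delta>0 + real (Suc n) * (\<delta> / 2))) u (%t. if t \<le> c then w t else w' t)"
   proof (rule Sol_subset)
    have "real (Suc n) * (\<delta> / 2) = real n * (\<delta> / 2) + \<delta> / 2" by (simp add: algebra_simps add_divide_distrib)
    then have "\<delta>0 + real (Suc n) * (\<delta> / 2) \<le> a + \<delta>" using a(4) c(1) d(1) by linarith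
    then show "min T (\<delta>0 + real (Suc n) * (\<delta> / 2)) \<le> a + \<delta>" by (rule min.coboundedI2)
   qed
   then show ?thesis by blast
  qed
 qed
 moreover obtain n where "T < real n * (\<delta> / 2)" using reals_Archimedean3[of "\<delta> / 2"] d(1) by auto
 then have "min T (\<delta>0 + real n * (\<delta> / 2)) = T" using d0(1) by simp
 ultimately show ?thesis by metis
qed

text \<open>The uniqueness of solutions makes the solutions on bounded intervals fit together.\<close>

lemma global_solution:
 assumes "!!T. 0 < T ==> \<exists>w. Sol 0 T u w"
 obtains w where "!!T. 0 < T ==> Sol 0 T u w"
proof -
 obtain S where S: "!!T. 0 < T ==> Sol 0 T u (S T)" using assms by metis
 have "Sol 0 T u (%t. S t t)" if "0 < T" for T
 proof (rule Sol_cong[OF S[OF that]])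
  fix s assume s: "0 < s" "s \<le> T"
  show "S T s = S s s"
   by (rule Sol_unique[OF _ Sol_subset[OF S[OF that] s(2)] S[OF s(1)]]) (use s in auto)
 qed
 then show ?thesis by (rule that)
qed

text \<open>A bound in a space better than C^\<beta> is the compactness needed to upgrade
  coefficientwise continuity in time to continuity in the C^\<beta> norm.\<close>

lemma Sol_higher_regularity:
 assumes w: "Sol 0 T u w" and T: "0 < T" and u: "bb (- \<alpha>1) u M" and b: "\<beta> \<le> b" "(\<alpha> + b) / 2 < 1" "(\<alpha>1 + b) / 2 < 1"
 obtains C p q where "!!t. 0 < t ==> t \<le> T ==> bb b (w t) (C * (t powr p + t powr q))" "0 \<le> C"
proof -
 obtain R where R: "0 < R" "curve 0 T R w" using Sol_pos_curve[OF w] by blast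
 obtain L where L: "0 \<le> L" "!!s. 0 < s ==> s \<le> T ==> bb (- \<alpha>) (F s (w s)) (L * (s - 0) powr (- \<eta>))"
  "!!k. continuous_on {0<..T} (%s. F s (w s) k)"
  by (rule curve_forcing[OF R(2) order_refl T R(1)]) (rule that)
 obtain K0 where K0: "0 \<le> K0" "!!t f C. 0 < t ==> t \<le> T ==> bb (- \<alpha>1) f C ==> bb b (Pt \<mu> t f) (K0 * C * t powr (- ((\<alpha>1 + b) / 2)))"
  by (rule Pt_smoothing[OF T, of \<alpha>1 b]) (use b be al1 in auto)
 let ?\<kappa> = "(\<alpha> + b) / 2"
 obtain K where K: "0 \<le> K" "!!a t G L \<Lambda> X. a < t ==> t - a \<le> T ==> (!!k. continuous_on {a<..t} (%s. G s k)) ==>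
  0 \<le> L ==> 0 \<le> \<Lambda> ==> (!!s. a < s ==> s \<le> t ==> bb (- \<alpha>) (G s) (L * exp (\<Lambda> * (s - a)) * (s - a) powr (- \<eta>))) ==>
  0 \<le> X ==> (!!r. 0 < r ==> r \<le> T ==> exp (- \<Lambda> * r) * r powr (- ((\<alpha> + b) / 2)) \<le> X * r powr (- ?\<kappa>)) ==>
  bb b (duh \<mu> a t G) (K * L * X * exp (\<Lambda> * (t - a)) * (t - a) powr (1 - ?\<kappa> - \<eta>))"
 proof (rule Phi_bound[OF T, of b ?\<kappa>])
 qed (use al be b in auto)
 have M: "0 \<le> M" by (rule bb_nonneg[OF u])
 define C where "C = K0 * M + K * L"
 have C: "0 \<le> C" "K0 * M \<le> C" "K * L \<le> C" using K0(1) K(1) L(1) M by (auto simp: C_def)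
 show ?thesis
 proof (rule that[of C "- ((\<alpha>1 + b) / 2)" "1 - ?\<kappa> - \<eta>"])
  fix t assume t: "0 < t" "t \<le> T"
  have c: "continuous_on {0<..t} (%s. F s (w s) k)" for k by (rule continuous_on_subset[OF L(3)]) (use t in auto)
  have "bb b (duh \<mu> 0 t (%s. F s (w s))) (K * L * 1 * exp (0 * (t - 0)) * (t - 0) powr (1 - ?\<kappa> - \<eta>))"
   by (rule K(2)[OF t(1) _ c L(1)]) (use L(2) t in auto)
  then have 1: "bb b (duh \<mu> 0 t (%s. F s (w s))) (C * t powr (1 - ?\<kappa> - \<eta>))"
   by (rule bb_mono) (use C(3) in \<open>auto intro: mult_right_mono\<close>)
  have 2: "bb b (Pt \<mu> (t - 0) u) (C * t powr (- ((\<alpha>1 + b) / 2)))"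
   by (rule bb_mono[OF K0(2)[OF _ _ u]]) (use t C(2) in \<open>auto intro: mult_right_mono\<close>)
  have "w t = Phi 0 u w t" using w t unfolding Sol_def by blast
  then have "w t = (%k. Pt \<mu> (t - 0) u k + duh \<mu> 0 t (%s. F s (w s)) k)" by (simp add: Phi_def fun_eq_iff)
  then show "bb b (w t) (C * (t powr (- ((\<alpha>1 + b) / 2)) + t powr (1 - ?\<kappa> - \<eta>)))"
   using bb_add[OF 2 1] by (simp only: distrib_left)
 qed (rule C(1))
qed

end

section \<open>Energy calculus\<close>

text \<open>At a zero of h the other factor need only be continuous. This differentiates |V|^r conj
  V at the zeros of V, where |V|^r may fail to be differentiable.\<close>

lemma has_vector_derivative_mult_zero:
 fixes f h :: "real => complex"
 assumes f: "isCont f s" and h: "(h has_vector_derivative h') (at s)" "h s = 0"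
 shows "((%y. f y * h y) has_vector_derivative f s * h') (at s)"
proof -
 have lim: "((%y. norm (h y - h s - (y - s) *\<^sub>R h') / norm (y - s)) \<longlongrightarrow> 0) (at s)"
  using h(1) unfolding has_vector_derivative_def has_derivative_iff_norm by blast
 have "((%y. norm (f y * h y - f s * h s - (y - s) *\<^sub>R (f s * h')) / norm (y - s)) \<longlongrightarrow> 0) (at s)"
 proof (rule Lim_null_comparison)
  have fl: "(f \<longlongrightarrow> f s) (at s)" using f by (simp add: isCont_def)
  have fl0: "((%y. norm (f y - f s)) \<longlongrightarrow> 0) (at s)" using tendsto_norm[OF tendsto_diff[OF fl tendsto_const, of "f s"]] by simp
  have "((%y. norm (f y) * (norm (h y - h s - (y - s) *\<^sub>R h') / norm (y - s)) + norm (f y - f s) * norm h') \<longlongrightarrow> norm (f s) * 0 + 0 * norm h') (at s)"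
   by (intro tendsto_add tendsto_mult tendsto_norm fl lim fl0 tendsto_const)
  then show "((%y. norm (f y) * (norm (h y - h s - (y - s) *\<^sub>R h') / norm (y - s)) + norm (f y - f s) * norm h') \<longlongrightarrow> 0) (at s)"
   by simp
  have "norm (norm (f y * h y - f s * h s - (y - s) *\<^sub>R (f s * h')) / norm (y - s)) \<le> norm (f y) * (norm (h y - h s - (y - s) *\<^sub>R h') / norm (y - s)) + norm (f y - f s) * norm h'" if "y \<noteq> s" for y
  proof -
   have "f y * h y - f s * h s - (y - s) *\<^sub>R (f s * h') = f y * (h y - h s - (y - s) *\<^sub>R h') + (y - s) *\<^sub>R ((f y - f s) * h')"
    using h(2) by (simp add: algebra_simps scaleR_conv_of_real)
   then have "norm (f y * h y - f s * h s - (y - s) *\<^sub>R (f s * h')) \<le> norm (f y) * norm (h y - h s - (y - s) *\<^sub>R h') + norm (y - s) * (norm (f y - f s) * norm h')"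
    by (metis norm_mult norm_scaleR norm_triangle_ineq real_norm_def)
   then have "norm (f y * h y - f s * h s - (y - s) *\<^sub>R (f s * h')) / norm (y - s) \<le> (norm (f y) * norm (h y - h s - (y - s) *\<^sub>R h') + norm (y - s) * (norm (f y - f s) * norm h')) / norm (y - s)"
    by (rule divide_right_mono) simp
   also have "\<dots> = norm (f y) * (norm (h y - h s - (y - s) *\<^sub>R h') / norm (y - s)) + norm (f y - f s) * norm h'"
    using that by (simp add: add_divide_distrib)
   finally show ?thesis by simp
  qed
  then show "\<forall>\<^sub>F y in at s. norm (norm (f y * h y - f s * h s - (y - s) *\<^sub>R (f s * h')) / norm (y - s)) \<le> norm (f y) * (norm (h y - h s - (y - s) *\<^sub>R h') / norm (y - s)) + norm (f y - f s) * norm h'"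
   by (auto simp: eventually_at_filter)
 qed
 then show ?thesis
  unfolding has_vector_derivative_def has_derivative_iff_norm by (auto intro: bounded_linear_scaleR_left)
qed

lemma has_real_derivative_norm_powr:
 fixes V :: "real => complex"
 assumes V: "(V has_vector_derivative V') (at s)" and nz: "V s \<noteq> 0"
 shows "((%y. cmod (V y) powr r) has_real_derivative r * cmod (V s) powr (r - 2) * Re (cnj (V s) * V')) (at s)"
proof -
 have R: "((%y. Re (V y)) has_real_derivative Re V') (at s)" "((%y. Im (V y)) has_real_derivative Im V') (at s)"
  using V by (auto simp: has_real_derivative_iff_has_vector_derivative has_vector_derivative_complex_iff)
 have pos: "0 < (Re (V s))\<^sup>2 + (Im (V s))\<^sup>2" using nz by (metis complex_norm_square complex_eq_0 not_sum_power2_lt_zero linorder_cases)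
 have gen: "((%y. ((X y)\<^sup>2 + (Y y)\<^sup>2) powr (r / 2)) has_real_derivative
  r / 2 * ((X s)\<^sup>2 + (Y s)\<^sup>2) powr (r / 2 - 1) * (2 * X s * X' + 2 * Y s * Y')) (at s)"
  if "(X has_real_derivative X') (at s)" "(Y has_real_derivative Y') (at s)" "0 < (X s)\<^sup>2 + (Y s)\<^sup>2" for X Y X' Y'
  using that by (auto intro!: derivative_eq_intros)
 have "((%y. ((Re (V y))\<^sup>2 + (Im (V y))\<^sup>2) powr (r / 2)) has_real_derivative
  r / 2 * ((Re (V s))\<^sup>2 + (Im (V s))\<^sup>2) powr (r / 2 - 1) * (2 * Re (V s) * Re V' + 2 * Im (V s) * Im V')) (at s)"
  by (rule gen[OF R pos])
 moreover have c: "((Re z)\<^sup>2 + (Im z)\<^sup>2) powr (q / 2) = cmod z powr q" for z q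
 proof (cases "z = 0")
  case False
  have "(Re z)\<^sup>2 + (Im z)\<^sup>2 = cmod z powr 2" using False by (simp add: cmod_power2)
  then show ?thesis by (simp only: powr_powr) simp
 qed simp
 moreover have "r / 2 - 1 = (r - 2) / 2" by (simp add: field_simps)
 moreover have "r / 2 * x * (2 * Re (V s) * Re V' + 2 * Im (V s) * Im V') = r * x * Re (cnj (V s) * V')" for x
  by (simp add: algebra_simps)
 ultimately show ?thesis by (simp only:)
qed

text \<open>One formula covers the zeros of V as well: since \<open>0 powr x = 0\<close> for every
  x, its right-hand side is 0 there, which is the true derivative.\<close>

lemma has_vector_derivative_norm_powr_cnj:
 fixes V :: "real => complex"
 assumes V: "(V has_vector_derivative V') (at s)" and r: "0 < r"
 shows "((%y. of_real (cmod (V y) powr r) * cnj (V y)) has_vector_derivative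
  of_real (cmod (V s) powr r) * cnj V' + of_real (r * cmod (V s) powr (r - 2) * Re (cnj (V s) * V')) * cnj (V s)) (at s)"
proof -
 have cV: "((%y. cnj (V y)) has_vector_derivative cnj V') (at s)"
  by (rule bounded_linear.has_vector_derivative[OF bounded_linear_cnj V])
 have iV: "isCont V s" using V has_vector_derivative_continuous by blast
 show ?thesis
 proof (cases "V s = 0")
  case False
  have "((%y. complex_of_real (cmod (V y) powr r)) has_vector_derivative of_real (r * cmod (V s) powr (r - 2) * Re (cnj (V s) * V'))) (at s)"
   using has_real_derivative_norm_powr[OF V False, of r]
   by (intro has_vector_derivative_of_real) (simp add: has_real_derivative_iff_has_vector_derivative)
  from has_vector_derivative_mult[OF this cV] show ?thesis by (simp add: algebra_simps)
 next
  case True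
  have "isCont (%y. complex_of_real (cmod (V y) powr r)) s"
   unfolding isCont_def
   by (rule tendsto_of_real, rule tendsto_powr2) (use iV r in \<open>auto simp: isCont_def intro!: tendsto_norm\<close>)
  from has_vector_derivative_mult_zero[OF this cV] True r show ?thesis by simp
 qed
qed

lemma norm_powr_pred:
 assumes "(z::complex) \<noteq> 0" shows "cmod z powr (r - 2) * (cmod z)\<^sup>2 = cmod z powr r"
proof -
 have "(cmod z)\<^sup>2 = cmod z powr 2" using assms by simp
 then show ?thesis by (simp only: powr_add[symmetric]) simp
qed

text \<open>|V|^p is the product of |V|^(p - 2) conj V with V, both differentiable even at zeros of
  V.\<close>

lemma has_real_derivative_norm_powr_sum:
 fixes V :: "real => complex"
 assumes V: "(V has_vector_derivative V') (at s)" and p: "2 < p"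
 shows "((%y. cmod (V y) powr p) has_real_derivative p * cmod (V s) powr (p - 2) * Re (cnj (V s) * V')) (at s)"
proof -
 let ?r = "p - 2"
 let ?D = "of_real (cmod (V s) powr ?r) * cnj V' + of_real (?r * cmod (V s) powr (?r - 2) * Re (cnj (V s) * V')) * cnj (V s)"
 have "((%y. (of_real (cmod (V y) powr ?r) * cnj (V y)) * V y) has_vector_derivative
   (of_real (cmod (V s) powr ?r) * cnj (V s)) * V' + ?D * V s) (at s)"
  using p by (intro has_vector_derivative_mult has_vector_derivative_norm_powr_cnj V) auto
 then have "((%y. Re ((of_real (cmod (V y) powr ?r) * cnj (V y)) * V y)) has_vector_derivative
   Re ((of_real (cmod (V s) powr ?r) * cnj (V s)) * V' + ?D * V s)) (at s)"
  by (rule bounded_linear.has_vector_derivative[OF bounded_linear_Re])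
 moreover have "Re ((of_real (cmod z powr ?r) * cnj z) * z) = cmod z powr p" for z
 proof (cases "z = 0")
  case False
  have "(of_real (cmod z powr ?r) * cnj z) * z = of_real (cmod z powr ?r * (cmod z)\<^sup>2)"
   by (simp only: complex_norm_square of_real_mult ac_simps)
  also have "cmod z powr ?r * (cmod z)\<^sup>2 = cmod z powr p" using norm_powr_pred[OF False, of p] .
  finally show ?thesis by simp
 qed (use p in simp)
 moreover have "Re ((of_real (cmod (V s) powr ?r) * cnj (V s)) * V' + ?D * V s) = p * cmod (V s) powr ?r * Re (cnj (V s) * V')"
 proof (cases "V s = 0")
  case False
  let ?A = "Re (cnj (V s) * V')"
  have "?D * V s = of_real (cmod (V s) powr ?r) * cnj (cnj (V s) * V') + of_real (?r * cmod (V s) powr (?r - 2) * ?A) * (cnj (V s) * V s)"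
   by (simp add: algebra_simps)
  also have "cnj (V s) * V s = of_real ((cmod (V s))\<^sup>2)" by (simp only: complex_norm_square mult.commute)
  finally have "?D * V s = of_real (cmod (V s) powr ?r) * cnj (cnj (V s) * V') + of_real (?r * ?A * (cmod (V s) powr (?r - 2) * (cmod (V s))\<^sup>2))"
   by (simp add: ac_simps)
  then have DV: "?D * V s = of_real (cmod (V s) powr ?r) * cnj (cnj (V s) * V') + of_real (?r * ?A * cmod (V s) powr ?r)"
   by (simp only: norm_powr_pred[OF False])
  have "Re ((of_real (cmod (V s) powr ?r) * cnj (V s)) * V') = cmod (V s) powr ?r * ?A"
   by (simp only: mult.assoc) simp
  moreover have "Re (?D * V s) = cmod (V s) powr ?r * ?A + ?r * ?A * cmod (V s) powr ?r"
   unfolding DV by simp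
  ultimately show ?thesis by (simp only: plus_complex.sel) (simp add: algebra_simps)
 qed (use p in simp)
 ultimately show ?thesis by (simp add: has_real_derivative_iff_has_vector_derivative)
qed

text \<open>The matrix of the form has determinant \<Delta> > 0 and trace \<mu> (2 + r). The
  constant c is their quotient, a lower bound for the smaller eigenvalue.\<close>

lemma quadratic_form_coercive:
 fixes \<mu> r :: real
 assumes mu: "0 < \<mu>" and r: "0 \<le> r" "r\<^sup>2 < 4 * \<mu>\<^sup>2 * (1 + r)"
 obtains c where "0 < c" "!!A B. c * (A\<^sup>2 + B\<^sup>2) \<le> \<mu> * (1 + r) * A\<^sup>2 - r * (A * B) + \<mu> * B\<^sup>2"
proof -
 define \<Delta> where "\<Delta> = \<mu>\<^sup>2 * (1 + r) - r\<^sup>2 / 4"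
 define c where "c = \<Delta> / (\<mu> * (2 + r))"
 have \<Delta>: "0 < \<Delta>" using r(2) by (simp add: \<Delta>_def)
 have tr: "0 < \<mu> * (2 + r)" using mu r by simp
 have c: "0 < c" using \<Delta> tr by (simp add: c_def)
 have ct: "c * (\<mu> * (2 + r)) = \<Delta>" using tr by (metis c_def nonzero_divide_eq_eq less_irrefl)
 have X: "0 < \<mu> * (1 + r) - c"
 proof -
  have "c * (\<mu> * (2 + r)) < \<mu> * (1 + r) * (\<mu> * (2 + r))"
  proof -
   have "\<mu>\<^sup>2 * (1 + r) * 1 < \<mu>\<^sup>2 * (1 + r) * (2 + r)" using mu r by (intro mult_strict_left_mono) auto
   moreover have "\<mu>\<^sup>2 * (1 + r) * (2 + r) = \<mu> * (1 + r) * (\<mu> * (2 + r))" by (simp add: power2_eq_square ac_simps)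
   ultimately show ?thesis unfolding ct \<Delta>_def using zero_le_power2[of r] by linarith
  qed
  then show ?thesis using tr by (simp add: mult_less_cancel_right)
 qed
 define X where "X = \<mu> * (1 + r) - c"
 define Y where "Y = \<mu> - c"
 have X0: "0 < X" using X by (simp add: X_def)
 have XY: "r\<^sup>2 \<le> 4 * (X * Y)"
 proof -
  have "X * Y = \<mu>\<^sup>2 * (1 + r) - c * (\<mu> * (2 + r)) + c\<^sup>2" by (simp add: X_def Y_def power2_eq_square algebra_simps)
  then have "X * Y = r\<^sup>2 / 4 + c\<^sup>2" unfolding ct \<Delta>_def by simp
  then show ?thesis by simp
 qed
 show ?thesis
 proof (rule that[OF c])
  fix A B :: real
  have "4 * X * (X * A\<^sup>2 - r * (A * B) + Y * B\<^sup>2) = (2 * X * A - r * B)\<^sup>2 + (4 * (X * Y) - r\<^sup>2) * B\<^sup>2"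
   by (simp add: power2_eq_square algebra_simps)
  also have "0 \<le> \<dots>" using XY by (intro add_nonneg_nonneg mult_nonneg_nonneg) auto
  finally have "0 \<le> X * A\<^sup>2 - r * (A * B) + Y * B\<^sup>2" using X0 by (simp add: zero_le_mult_iff)
  then show "c * (A\<^sup>2 + B\<^sup>2) \<le> \<mu> * (1 + r) * A\<^sup>2 - r * (A * B) + \<mu> * B\<^sup>2"
   by (simp add: X_def Y_def algebra_simps)
 qed
qed

lemma integral_deriv_periodic:
 fixes f :: "real => complex"
 assumes "!!s. (f has_vector_derivative f' s) (at s)" "f (1/2) = f (- 1/2)"
 shows "(f' has_integral 0) {- 1/2..1/2}"
proof -
 have "(f' has_integral f (1/2) - f (- 1/2)) {- 1/2..1/2}"
  by (rule fundamental_theorem_of_calculus) (auto intro: has_vector_derivative_at_within assms)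
 then show ?thesis using assms(2) by simp
qed

text \<open>After one integration by parts, with z = conj V * V1, the integrand is |V|^(r - 2) times
  the quadratic form in Re z and Im z. The mixed term stems from the imaginary unit in front of the
  Laplacian.\<close>

lemma dissipation_1d:
 fixes V V1 V2 :: "real => complex"
 assumes V: "!!s. (V has_vector_derivative V1 s) (at s)" and V1: "!!s. (V1 has_vector_derivative V2 s) (at s)"
  and V2: "continuous_on UNIV V2" and per: "V (1/2) = V (- 1/2)" "V1 (1/2) = V1 (- 1/2)"
  and r: "1 \<le> r" and c: "!!A B. c * (A\<^sup>2 + B\<^sup>2) \<le> \<mu> * (1 + r) * A\<^sup>2 - r * (A * B) + \<mu> * B\<^sup>2"
 shows "integral {- 1/2..1/2} (%s. Re ((\<i> + of_real \<mu>) * (of_real (cmod (V s) powr r) * cnj (V s) * V2 s)))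
  \<le> - c * integral {- 1/2..1/2} (%s. cmod (V s) powr r * (cmod (V1 s))\<^sup>2)"
proof -
 have r0: "0 < r" using r by simp
 have cV: "continuous_on UNIV V" and cV1: "continuous_on UNIV V1"
  using V V1 by (auto simp: continuous_on_eq_continuous_within intro!: has_vector_derivative_continuous[of _ _ _ UNIV])
 let ?N = "%s. of_real (cmod (V s) powr r) * cnj (V s)"
 let ?D = "%s. of_real (cmod (V s) powr r) * cnj (V1 s) + of_real (r * cmod (V s) powr (r - 2) * Re (cnj (V s) * V1 s)) * cnj (V s)"
 have cp: "continuous_on UNIV (%s. cmod (V s) powr r)"
  by (intro continuous_on_powr' continuous_intros cV) (use r0 in auto)
 have "((%s. ?N s * V2 s + ?D s * V1 s) has_integral 0) {- 1/2..1/2}"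
 proof (rule integral_deriv_periodic)
  show "((%s. ?N s * V1 s) has_vector_derivative ?N s * V2 s + ?D s * V1 s) (at s)" for s
   by (intro has_vector_derivative_mult has_vector_derivative_norm_powr_cnj V V1 r0)
 qed (simp only: per)
 then have z: "((%s. (\<i> + of_real \<mu>) * (?N s * V2 s + ?D s * V1 s)) has_integral (\<i> + of_real \<mu>) * 0) {- 1/2..1/2}"
  by (rule has_integral_mult_right)
 have "((%s. Re ((\<i> + of_real \<mu>) * (?N s * V2 s + ?D s * V1 s))) has_integral Re ((\<i> + of_real \<mu>) * 0)) {- 1/2..1/2}"
  using has_integral_linear[OF z bounded_linear_Re] by (simp only: o_def)
 then have z0: "((%s. Re ((\<i> + of_real \<mu>) * (?N s * V2 s)) + Re ((\<i> + of_real \<mu>) * (?D s * V1 s))) has_integral 0) {- 1/2..1/2}"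
  by (simp only: distrib_left plus_complex.sel mult_zero_right zero_complex.sel)
 have cN: "continuous_on {- 1/2..1/2} (%s. Re ((\<i> + of_real \<mu>) * (?N s * V2 s)))"
  by (intro continuous_intros continuous_on_subset[OF cp] continuous_on_subset[OF cV] continuous_on_subset[OF V2]) auto
 have iN: "(%s. Re ((\<i> + of_real \<mu>) * (?N s * V2 s))) integrable_on {- 1/2..1/2}"
  by (rule integrable_continuous_real[OF cN])
 have zD: "((%s. Re ((\<i> + of_real \<mu>) * (?D s * V1 s))) has_integral 0 - integral {- 1/2..1/2} (%s. Re ((\<i> + of_real \<mu>) * (?N s * V2 s)))) {- 1/2..1/2}"
  using has_integral_diff[OF z0 integrable_integral[OF iN]] by simp
 have cE: "continuous_on {- 1/2..1/2} (%s. c * (cmod (V s) powr r * (cmod (V1 s))\<^sup>2))"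
  by (intro continuous_intros continuous_on_subset[OF cp] continuous_on_subset[OF cV1]) auto
 have pw: "c * (cmod (V s) powr r * (cmod (V1 s))\<^sup>2) \<le> Re ((\<i> + of_real \<mu>) * (?D s * V1 s))" for s
 proof (cases "V s = 0")
  case False
  define z where "z = cnj (V s) * V1 s"
  have n1: "(Re z)\<^sup>2 + (Im z)\<^sup>2 = (cmod (V s))\<^sup>2 * (cmod (V1 s))\<^sup>2"
   unfolding cmod_power2[of z, symmetric] by (simp add: z_def norm_mult power_mult_distrib)
  have "?D s * V1 s = of_real (cmod (V s) powr r * (cmod (V1 s))\<^sup>2) + of_real (r * cmod (V s) powr (r - 2) * Re z) * z"
   unfolding of_real_mult of_real_power[symmetric] z_def complex_norm_square by (simp add: algebra_simps)
  also have "cmod (V s) powr r * (cmod (V1 s))\<^sup>2 = cmod (V s) powr (r - 2) * ((Re z)\<^sup>2 + (Im z)\<^sup>2)"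
   unfolding n1 norm_powr_pred[OF False, of r, symmetric] by (simp only: mult.assoc)
  finally have Dz: "?D s * V1 s = of_real (cmod (V s) powr (r - 2)) * (of_real ((Re z)\<^sup>2 + (Im z)\<^sup>2) + of_real (r * Re z) * z)"
   by (simp add: algebra_simps)
  have "Re ((\<i> + of_real \<mu>) * (?D s * V1 s)) = cmod (V s) powr (r - 2) * (\<mu> * (1 + r) * (Re z)\<^sup>2 - r * (Re z * Im z) + \<mu> * (Im z)\<^sup>2)"
   unfolding Dz by (simp add: power2_eq_square algebra_simps)
  moreover have "c * (cmod (V s) powr r * (cmod (V1 s))\<^sup>2) = cmod (V s) powr (r - 2) * (c * ((Re z)\<^sup>2 + (Im z)\<^sup>2))"
   unfolding n1 norm_powr_pred[OF False, of r, symmetric] by (simp only: ac_simps)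
  ultimately show ?thesis by (simp only:) (rule mult_left_mono[OF c powr_ge_zero])
 qed (use r0 in simp)
 have "integral {- 1/2..1/2} (%s. c * (cmod (V s) powr r * (cmod (V1 s))\<^sup>2)) \<le> integral {- 1/2..1/2} (%s. Re ((\<i> + of_real \<mu>) * (?D s * V1 s)))"
  by (rule integral_le[OF integrable_continuous_real[OF cE] has_integral_integrable[OF zD] pw])
 also have "\<dots> = - integral {- 1/2..1/2} (%s. Re ((\<i> + of_real \<mu>) * (?N s * V2 s)))"
  using integral_unique[OF zD] by simp
 finally show ?thesis by simp
qed

lemma ibp_bound_1d:
 fixes S h h' S' :: "real => complex" and E :: "real => real"
 assumes S: "!!s. (S has_vector_derivative S' s) (at s)" and h: "!!s. (h has_vector_derivative h' s) (at s)" "continuous_on UNIV h'"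
  and per: "S (1/2) = S (- 1/2)" "h (1/2) = h (- 1/2)" and E: "continuous_on UNIV E" "!!s. cmod (S' s) \<le> E s"
  and H: "!!s. cmod (h s) \<le> H"
 shows "cmod (integral {- 1/2..1/2} (%s. S s * h' s)) \<le> H * integral {- 1/2..1/2} E"
proof -
 have cS: "continuous_on UNIV S"
  using S by (auto simp: continuous_on_eq_continuous_within intro!: has_vector_derivative_continuous[of _ _ _ UNIV])
 have z: "((%s. S s * h' s + S' s * h s) has_integral 0) {- 1/2..1/2}"
 proof (rule integral_deriv_periodic)
  show "((%s. S s * h s) has_vector_derivative S s * h' s + S' s * h s) (at s)" for s
   by (intro has_vector_derivative_mult S h)
 qed (simp only: per)
 have i: "(%s. S s * h' s) integrable_on {- 1/2..1/2}"
  by (intro integrable_continuous_real continuous_intros continuous_on_subset[OF cS] continuous_on_subset[OF h(2)]) auto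
 have z2: "((%s. S' s * h s) has_integral 0 - integral {- 1/2..1/2} (%s. S s * h' s)) {- 1/2..1/2}"
  using has_integral_diff[OF z integrable_integral[OF i]] by simp
 then have "cmod (integral {- 1/2..1/2} (%s. S s * h' s)) = cmod (integral {- 1/2..1/2} (%s. S' s * h s))"
  by (simp add: integral_unique)
 also have "\<dots> \<le> integral {- 1/2..1/2} (%s. H * E s)"
 proof (rule integral_norm_bound_integral[OF has_integral_integrable[OF z2]])
  show "(%s. H * E s) integrable_on {- 1/2..1/2}"
   by (intro integrable_continuous_real continuous_intros continuous_on_subset[OF E(1)]) auto
  have H0: "0 \<le> H" using H[of 0] by (meson norm_ge_zero order_trans)
  show "cmod (S' s * h s) \<le> H * E s" for s
   unfolding norm_mult mult.commute[of H] using E(2) H H0 by (intro mult_mono) (auto intro: order_trans[OF norm_ge_zero])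
 qed
 also have "\<dots> = H * integral {- 1/2..1/2} E" by simp
 finally show ?thesis .
qed

section \<open>Integration by parts on the torus\<close>

text \<open>The boolean selects the coordinate to be differentiated, so one-dimensional lemmas serve
  both directions without duplication.\<close>

definition slice :: "bool => real => real => real \<times> real" where
 "slice b y s = (if b then (s, y) else (y, s))"

lemma slice_continuous [continuous_intros]:
 "continuous_on A f ==> continuous_on A g ==> continuous_on A (%x. slice b (f x) (g x))"
 by (cases b) (auto simp: slice_def intro: continuous_on_Pair)

lemma tmean_slice:
 assumes "continuous_on UNIV g"
 shows "tmean g = integral {-1/2..1/2} (%y. integral {-1/2..1/2} (%s. g (slice b y s)))"
 using tmean_iterated[OF assms] tmean_iterated_swap[OF assms] by (cases b) (simp_all add: slice_def)

lemma slice_integral_continuous: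
 fixes g :: "real \<times> real => 'a::euclidean_space"
 assumes "continuous_on UNIV g"
 shows "continuous_on S (%y. integral {-1/2..1/2} (%s. g (slice b y s)))"
proof -
 have "continuous_on (S \<times> cbox (-1/2) (1/2)) (%(y, s). g (slice b y s))"
  unfolding split_beta by (intro continuous_on_compose2[OF assms] continuous_intros) auto
 then show ?thesis using integral_continuous_on_param[of S "-1/2" "1/2" "%y s. g (slice b y s)"] by (simp add: cbox_interval)
qed

lemma tmean_slice_mono:
 fixes g h :: "real \<times> real => real"
 assumes c: "continuous_on UNIV g" "continuous_on UNIV h"
  and le: "!!y. integral {-1/2..1/2} (%s. g (slice b y s)) \<le> integral {-1/2..1/2} (%s. h (slice b y s))"
 shows "tmean g \<le> tmean h"
 unfolding tmean_slice[OF c(1), of b] tmean_slice[OF c(2), of b]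
 by (intro integral_le integrable_continuous_real slice_integral_continuous c le)

lemma tmean_slice_norm:
 fixes g :: "real \<times> real => complex" and h :: "real \<times> real => real"
 assumes c: "continuous_on UNIV g" "continuous_on UNIV h"
  and le: "!!y. cmod (integral {-1/2..1/2} (%s. g (slice b y s))) \<le> integral {-1/2..1/2} (%s. h (slice b y s))"
 shows "cmod (tmean g) \<le> tmean h"
 unfolding tmean_slice[OF c(1), of b] tmean_slice[OF c(2), of b]
 by (intro integral_norm_bound_integral integrable_continuous_real slice_integral_continuous c le)

definition crd :: "bool => int \<times> int => int" where "crd b = (if b then fst else snd)"

definition grad :: "bool => dist => dist" where
 "grad b f k = 2 * pi * \<i> * of_int (crd b k) * f k"

lemma trig_grad: "trig f ==> trig (grad b f)"
 unfolding grad_def[abs_def] by (rule trig_mult2)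

lemma ev_grad:
 assumes f: "trig f"
 shows "((%s. ev f (slice b y s)) has_vector_derivative ev (grad b f) (slice b y s)) (at s)"
proof -
 have "((%s. ekx k (slice b y s)) has_vector_derivative 2 * pi * \<i> * of_int (crd b k) * ekx k (slice b y s)) (at s)" for k
 proof -
  let ?c = "2 * pi * \<i> * of_int (crd b k)" and ?d = "2 * pi * \<i> * of_int (crd (\<not> b) k) * of_real y"
  have e: "ekx k (slice b y s) = exp (?c * of_real s + ?d)" for s
   unfolding ekx_def by (cases b) (simp_all add: slice_def crd_def algebra_simps)
  have "((%z. exp (?c * z + ?d)) has_field_derivative exp (?c * of_real s + ?d) * ?c) (at (of_real s))"
   by (auto intro!: derivative_eq_intros)
  from has_vector_derivative_real_field[OF this] show ?thesis unfolding e by (simp only: mult.commute)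
 qed
 then have "((%s. \<Sum>k | f k \<noteq> 0. f k * ekx k (slice b y s)) has_vector_derivative
   (\<Sum>k | f k \<noteq> 0. f k * (2 * pi * \<i> * of_int (crd b k) * ekx k (slice b y s)))) (at s)"
  by (intro has_vector_derivative_sum has_vector_derivative_mult_right)
 moreover have "ev (grad b f) x = (\<Sum>k | f k \<noteq> 0. f k * (2 * pi * \<i> * of_int (crd b k) * ekx k x))" for x
  by (subst ev_eq[OF f]) (auto simp: grad_def intro!: sum.cong)
 ultimately show ?thesis unfolding ev_def[of f] by simp
qed

lemma slice_periodic: "ev f (slice b y (1/2)) = ev f (slice b y (-1/2))"
 using ev_periodic[of f "slice b y (-1/2)" "if b then 1 else 0" "if b then 0 else 1"] by (cases b) (simp_all add: slice_def)

lemma powr_continuous [continuous_intros]: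
 fixes f :: "'a::topological_space => real"
 assumes "continuous_on A f" "!!x. x \<in> A ==> 0 \<le> f x" "0 < r" shows "continuous_on A (%x. f x powr r)"
 using assms by (intro continuous_on_powr') auto

lemma dissipation_2d:
 assumes f: "trig f" and r: "1 \<le> r"
  and c: "!!A B. c * (A\<^sup>2 + B\<^sup>2) \<le> \<mu> * (1 + r) * A\<^sup>2 - r * (A * B) + \<mu> * B\<^sup>2"
 shows "tmean (%x. Re ((\<i> + of_real \<mu>) * (of_real (cmod (ev f x) powr r) * cnj (ev f x) * ev (grad b (grad b f)) x)))
  \<le> - c * tmean (%x. cmod (ev f x) powr r * (cmod (ev (grad b f) x))\<^sup>2)"
proof -
 have r0: "0 < r" using r by simp
 have "tmean (%x. Re ((\<i> + of_real \<mu>) * (of_real (cmod (ev f x) powr r) * cnj (ev f x) * ev (grad b (grad b f)) x)))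
  \<le> tmean (%x. - c * (cmod (ev f x) powr r * (cmod (ev (grad b f) x))\<^sup>2))"
 proof (rule tmean_slice_mono[where b = b])
  fix y
  have "integral {- 1/2..1/2} (%s. Re ((\<i> + of_real \<mu>) * (of_real (cmod (ev f (slice b y s)) powr r) * cnj (ev f (slice b y s)) * ev (grad b (grad b f)) (slice b y s))))
   \<le> - c * integral {- 1/2..1/2} (%s. cmod (ev f (slice b y s)) powr r * (cmod (ev (grad b f) (slice b y s)))\<^sup>2)"
   by (rule dissipation_1d[OF ev_grad[OF f] ev_grad[OF trig_grad[OF f]] _ slice_periodic slice_periodic r c])
    (intro continuous_intros)
  then show "integral {- 1/2..1/2} (%s. Re ((\<i> + of_real \<mu>) * (of_real (cmod (ev f (slice b y s)) powr r) * cnj (ev f (slice b y s)) * ev (grad b (grad b f)) (slice b y s))))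
   \<le> integral {- 1/2..1/2} (%s. - c * (cmod (ev f (slice b y s)) powr r * (cmod (ev (grad b f) (slice b y s)))\<^sup>2))"
   by (simp only: integral_mult_right)
 qed (use r0 in \<open>auto intro!: continuous_intros\<close>)
 then show ?thesis by (simp only: tmean_cmult)
qed

lemma ibp_bound_2d:
 fixes S :: "real \<times> real => complex"
 assumes h: "trig h" "!!x. cmod (ev h x) \<le> H" and S: "continuous_on UNIV S" and E: "continuous_on UNIV E"
  and d: "!!y s. \<exists>d. ((%s. S (slice b y s)) has_vector_derivative d) (at s) \<and> cmod d \<le> E (slice b y s)"
  and per: "!!y. S (slice b y (1/2)) = S (slice b y (-1/2))"
 shows "cmod (tmean (%x. S x * ev (grad b h) x)) \<le> H * tmean E"
proof -
 have "cmod (tmean (%x. S x * ev (grad b h) x)) \<le> tmean (%x. H * E x)"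
 proof (rule tmean_slice_norm[where b = b])
  fix y
  obtain d' where d': "!!s. ((%s. S (slice b y s)) has_vector_derivative d' s) (at s)" "!!s. cmod (d' s) \<le> E (slice b y s)"
   using d[of y] by metis
  have "cmod (integral {-1/2..1/2} (%s. S (slice b y s) * ev (grad b h) (slice b y s))) \<le> H * integral {-1/2..1/2} (%s. E (slice b y s))"
  proof (rule ibp_bound_1d[OF d'(1) ev_grad[OF h(1)] _ per slice_periodic _ d'(2) h(2)])
   show "continuous_on UNIV (%s. ev (grad b h) (slice b y s))" by (intro continuous_intros)
   show "continuous_on UNIV (%s. E (slice b y s))" by (rule continuous_on_compose2[OF E]) (auto intro: continuous_intros)
  qed
  then show "cmod (integral {-1/2..1/2} (%s. S (slice b y s) * ev (grad b h) (slice b y s))) \<le> integral {-1/2..1/2} (%s. H * E (slice b y s))"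
   by (simp only: integral_mult_right)
 qed (intro continuous_intros S E)+
 then show ?thesis by (simp only: tmean_cmult)
qed

text \<open>For an antiderivative \<Phi>, the increment of \<Phi> over a window of length 1 has
  derivative 0 by periodicity and thus does not depend on the window.\<close>

lemma integral_periodic_reflect:
 fixes \<phi> :: "real => real"
 assumes c: "continuous_on UNIV \<phi>" and per: "!!s. \<phi> (s + 1) = \<phi> s"
 shows "integral {-1/2..1/2} (%s. \<phi> (x - s)) = integral {-1/2..1/2} \<phi>"
proof -
 define R where "R = \<bar>x\<bar> + 2"
 obtain \<Phi> where P: "!!t. t \<in> {- R..R} ==> (\<Phi> has_vector_derivative \<phi> t) (at t within {- R..R})"
  using antiderivative_continuous[of "- R" R \<phi>] continuous_on_subset[OF c] by auto
 have P': "(\<Phi> has_real_derivative \<phi> t) (at t)" if "- R < t" "t < R" for t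
  using P[of t] that by (simp add: has_real_derivative_iff_has_vector_derivative at_within_Icc_at)
 define h where "h z = \<Phi> (z + 1/2) - \<Phi> (z - 1/2)" for z
 have "(h has_real_derivative 0) (at z within {- R + 1/2<..<R - 1/2})" if "z \<in> {- R + 1/2<..<R - 1/2}" for z
 proof -
  have "((%z. \<Phi> (z + 1/2)) has_real_derivative \<phi> (z + 1/2)) (at z)" "((%z. \<Phi> (z + - (1/2))) has_real_derivative \<phi> (z + - (1/2))) (at z)"
   using P'[of "z + 1/2"] P'[of "z + - (1/2)"] that unfolding DERIV_shift by auto
  then have "((%z. \<Phi> (z + 1/2) - \<Phi> (z + - (1/2))) has_real_derivative \<phi> (z + 1/2) - \<phi> (z + - (1/2))) (at z)"
   by (rule DERIV_diff)
  moreover have "\<phi> (z + 1/2) = \<phi> (z + - (1/2))" using per[of "z + - (1/2)"] by (simp add: add.commute)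
  ultimately show ?thesis unfolding h_def by (simp add: has_field_derivative_at_within)
 qed
 then obtain k where k: "!!z. z \<in> {- R + 1/2<..<R - 1/2} ==> h z = k"
  using has_field_derivative_zero_constant[of "{- R + 1/2<..<R - 1/2}" h] by auto
 have "h x = k" "h 0 = k" by (rule k, simp only: R_def greaterThanLessThan_iff, linarith)+
 then have hx: "h x = h 0" by simp
 have "((%s. \<phi> (x - s)) has_integral - \<Phi> (x - 1/2) - (- \<Phi> (x - - 1/2))) {-1/2..1/2}"
 proof (rule fundamental_theorem_of_calculus)
  fix s :: real assume s: "s \<in> {-1/2..1/2}"
  then have "- R < x - s" "x - s < R" by (auto simp: R_def)
  from P'[OF this] have "((%s. - \<Phi> (x - s)) has_real_derivative \<phi> (x - s)) (at s)"
   by (auto intro!: derivative_eq_intros DERIV_chain2[of \<Phi>])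
  then show "((%s. - \<Phi> (x - s)) has_vector_derivative \<phi> (x - s)) (at s within {-1/2..1/2})"
   by (simp add: has_real_derivative_iff_has_vector_derivative has_vector_derivative_at_within)
 qed simp
 moreover have "(\<phi> has_integral \<Phi> (1/2) - \<Phi> (- 1/2)) {-1/2..1/2}"
 proof (rule fundamental_theorem_of_calculus)
  fix s :: real assume s: "s \<in> {-1/2..1/2}"
  then have "- R < s" "s < R" by (auto simp: R_def)
  from P'[OF this] show "(\<Phi> has_vector_derivative \<phi> s) (at s within {-1/2..1/2})"
   by (simp add: has_real_derivative_iff_has_vector_derivative has_vector_derivative_at_within)
 qed simp
 ultimately show ?thesis using hx by (auto simp: h_def dest!: integral_unique)
qed

lemma tmean_reflect_translate:
 fixes \<phi> :: "real \<times> real => real"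
 assumes c: "continuous_on UNIV \<phi>" and per: "!!x a b. \<phi> (x + (of_int a, of_int b)) = \<phi> x"
 shows "tmean (%y. \<phi> (x - y)) = tmean \<phi>"
proof -
 have c1: "continuous_on UNIV (%y. \<phi> (x - y))" "continuous_on UNIV (%y. \<phi> (fst x - fst y, snd y))"
  by (intro continuous_on_compose2[OF c] continuous_intros; simp)+
 have 1: "integral {-1/2..1/2} (%s. \<phi> (fst x - a, snd x - s)) = integral {-1/2..1/2} (%s. \<phi> (fst x - a, s))" for a
 proof (rule integral_periodic_reflect[of "%s. \<phi> (fst x - a, s)"])
  show "\<phi> (fst x - a, s + 1) = \<phi> (fst x - a, s)" for s using per[of "(fst x - a, s)" 0 1] by simp
 qed (intro continuous_on_compose2[OF c] continuous_intros, simp)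
 have 2: "integral {-1/2..1/2} (%s. \<phi> (fst x - s, b)) = integral {-1/2..1/2} (%s. \<phi> (s, b))" for b
 proof (rule integral_periodic_reflect[of "%s. \<phi> (s, b)"])
  show "\<phi> (s + 1, b) = \<phi> (s, b)" for s using per[of "(s, b)" 1 0] by simp
 qed (intro continuous_on_compose2[OF c] continuous_intros, simp)
 have xe: "x - (a, s) = (fst x - a, snd x - s)" for a s by (simp add: prod_eq_iff)
 have "tmean (%y. \<phi> (x - y)) = tmean (%y. \<phi> (fst x - fst y, snd y))"
  unfolding tmean_iterated[OF c1(1)] tmean_iterated[OF c1(2)] xe by (simp only: 1 fst_conv snd_conv)
 also have "\<dots> = tmean \<phi>"
  unfolding tmean_iterated_swap[OF c1(2)] tmean_iterated_swap[OF c] by (simp only: 2 fst_conv snd_conv)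
 finally show ?thesis .
qed

section \<open>The truncated nonlinearity\<close>

text \<open>Bounds on logarithmic derivatives are stable under products and need no case distinction at zeros.\<close>

definition logd :: "real => real => real => real => (real => complex) => bool" where
 "logd s a a' c X \<longleftrightarrow> (\<exists>X'. (X has_vector_derivative X') (at s) \<and> cmod X' * a \<le> c * cmod (X s) * a')"

lemma logd_mult:
 assumes a: "0 \<le> a" and X: "logd s a a' c X" and Y: "logd s a a' d Y"
 shows "logd s a a' (c + d) (%s. X s * Y s)"
proof -
 obtain X' where X: "(X has_vector_derivative X') (at s)" "cmod X' * a \<le> c * cmod (X s) * a'"
  using X by (auto simp: logd_def)
 obtain Y' where Y: "(Y has_vector_derivative Y') (at s)" "cmod Y' * a \<le> d * cmod (Y s) * a'"
  using Y by (auto simp: logd_def)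
 have "cmod (X s * Y' + X' * Y s) * a \<le> (cmod (X s) * cmod Y' + cmod X' * cmod (Y s)) * a"
  using a by (intro mult_right_mono) (auto intro: order_trans[OF norm_triangle_ineq] simp: norm_mult)
 also have "\<dots> = cmod (X s) * (cmod Y' * a) + (cmod X' * a) * cmod (Y s)" by (simp add: algebra_simps)
 also have "\<dots> \<le> cmod (X s) * (d * cmod (Y s) * a') + (c * cmod (X s) * a') * cmod (Y s)"
  by (intro add_mono mult_left_mono mult_right_mono X Y) auto
 finally have "cmod (X s * Y' + X' * Y s) * a \<le> (c + d) * cmod (X s * Y s) * a'"
  by (simp add: norm_mult algebra_simps)
 then show ?thesis unfolding logd_def using has_vector_derivative_mult[OF X(1) Y(1)] by blast
qed

lemma logd_power:
 assumes a: "0 \<le> a" and X: "logd s a a' c X" shows "logd s a a' (real n * c) (%s. X s ^ n)"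
proof (induction n)
 case 0
 have "((%s. 1 :: complex) has_vector_derivative 0) (at s)" by (rule has_vector_derivative_const)
 then show ?case unfolding logd_def by (intro exI[of _ 0]) auto
next
 case (Suc n)
 show ?case using logd_mult[OF a X Suc] by (simp add: algebra_simps)
qed

lemma logd_inverse:
 assumes X: "logd s a a' c X" and nz: "X s \<noteq> 0" shows "logd s a a' c (%s. inverse (X s))"
proof -
 obtain X' where X: "(X has_vector_derivative X') (at s)" "cmod X' * a \<le> c * cmod (X s) * a'"
  using X by (auto simp: logd_def)
 have "(inverse has_field_derivative - (inverse (X s) * inverse (X s))) (at (X s))"
  using DERIV_inverse[OF nz] by (simp add: power2_eq_square)
 then have "(inverse \<circ> X has_vector_derivative X' * - (inverse (X s) * inverse (X s))) (at s)"
  by (rule field_vector_diff_chain_at[OF X(1)])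
 moreover have "cmod (X' * - (inverse (X s) * inverse (X s))) * a \<le> c * cmod (inverse (X s)) * a'"
 proof -
  have "cmod (X' * - (inverse (X s) * inverse (X s))) * a = (cmod X' * a) * (inverse (cmod (X s)) * inverse (cmod (X s)))"
   by (simp add: norm_mult norm_inverse)
  also have "\<dots> \<le> (c * cmod (X s) * a') * (inverse (cmod (X s)) * inverse (cmod (X s)))"
   by (intro mult_right_mono X) auto
  also have "\<dots> = c * cmod (inverse (X s)) * a'" using nz by (simp add: norm_inverse norm_divide field_simps)
  finally show ?thesis .
 qed
 ultimately show ?thesis unfolding logd_def o_def by blast
qed

text \<open>The rational factor bounds a monomial of degree at most 2 m by \<Lambda> ^ (2 m). Being
  built from z and conj z by products and an inverse, it is within reach of the
  logarithmic-derivative rules.\<close>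

definition cutf :: "real => nat => real => nat => nat => complex => complex" where
 "cutf r m \<Lambda> i j z = of_real (cmod z powr r) * cnj z * (z ^ i * cnj z ^ j * inverse (1 + z * cnj z / of_real (\<Lambda>\<^sup>2)) ^ m)"

lemma one_plus_norm: "1 + z * cnj z / of_real (\<Lambda>\<^sup>2) = of_real (1 + (cmod z)\<^sup>2 / \<Lambda>\<^sup>2)"
 by (simp only: complex_norm_square[symmetric] of_real_add of_real_divide of_real_1)

lemma one_plus_norm_pos: "0 < 1 + (cmod z)\<^sup>2 / \<Lambda>\<^sup>2"
 by (intro add_pos_nonneg) auto

lemma norm_cutf: "cmod (cutf r m \<Lambda> i j z) = cmod z powr r * cmod z * (cmod z ^ (i + j) / (1 + (cmod z)\<^sup>2 / \<Lambda>\<^sup>2) ^ m)"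
proof -
 have "cmod (inverse (1 + z * cnj z / of_real (\<Lambda>\<^sup>2)) ^ m) = inverse ((1 + (cmod z)\<^sup>2 / \<Lambda>\<^sup>2) ^ m)"
  unfolding one_plus_norm norm_power norm_inverse norm_of_real abs_of_pos[OF one_plus_norm_pos] by (rule power_inverse)
 then show ?thesis unfolding cutf_def norm_mult by (simp add: norm_power power_add divide_inverse)
qed

lemma cut_power_bound:
 assumes L: "1 \<le> \<Lambda>" and n: "n \<le> 2 * m" and a: "0 \<le> (a::real)"
 shows "a ^ n / (1 + a\<^sup>2 / \<Lambda>\<^sup>2) ^ m \<le> \<Lambda> ^ (2 * m)"
proof -
 define y where "y = \<Lambda>\<^sup>2 + a\<^sup>2"
 have y: "1 \<le> y" "0 < y" unfolding y_def using one_le_power[OF L, of 2] zero_le_power2[of a] by linarith+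
 have ay: "a \<le> sqrt y" using real_le_rsqrt[of a y] by (simp add: y_def)
 have "a ^ n \<le> sqrt y ^ n" using ay a by (intro power_mono)
 also have "\<dots> \<le> sqrt y ^ (2 * m)" using y n by (intro power_increasing) auto
 also have "\<dots> = y ^ m" using y by (simp add: power_mult)
 finally have "a ^ n \<le> y ^ m" .
 moreover have "(1 + a\<^sup>2 / \<Lambda>\<^sup>2) ^ m = y ^ m / \<Lambda> ^ (2 * m)"
 proof -
  have "1 + a\<^sup>2 / \<Lambda>\<^sup>2 = y / \<Lambda>\<^sup>2" using L by (simp add: y_def field_simps)
  then show ?thesis by (simp add: power_divide power_mult)
 qed
 ultimately have "a ^ n / (1 + a\<^sup>2 / \<Lambda>\<^sup>2) ^ m \<le> y ^ m / (y ^ m / \<Lambda> ^ (2 * m))"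
  using y L by (simp only:) (intro divide_right_mono, auto)
 then show ?thesis using y by simp
qed

text \<open>The logarithmic derivatives add up: 1 + r from |V|^r conj V, i + j \<le> 2 m from the
  monomial, 2 m from the cutoff. After |V'| \<le> |V'|^2 + 1 the bound consists of the energy
  density and a lower power of |V|.\<close>

lemma cutf_deriv:
 assumes V: "(V has_vector_derivative V') (at s)" and r: "0 < r" and L: "1 \<le> \<Lambda>" and ij: "i + j \<le> 2 * m"
 shows "\<exists>d. ((%s. cutf r m \<Lambda> i j (V s)) has_vector_derivative d) (at s) \<and>
  cmod d \<le> (1 + r + 4 * real m) * \<Lambda> ^ (2 * m) * (cmod (V s) powr r * (cmod V')\<^sup>2 + cmod (V s) powr r)"
proof -
 let ?a = "cmod (V s)" and ?a' = "cmod V'"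
 have cV: "((%y. cnj (V y)) has_vector_derivative cnj V') (at s)"
  by (rule bounded_linear.has_vector_derivative[OF bounded_linear_cnj V])
 have lV: "logd s ?a ?a' 1 V" "logd s ?a ?a' 1 (%s. cnj (V s))"
  unfolding logd_def using V cV by (auto simp: mult.commute)
 have lQ: "logd s ?a ?a' 2 (%s. 1 + V s * cnj (V s) / of_real (\<Lambda>\<^sup>2))"
 proof -
  have "((%s. 1 + V s * cnj (V s) / of_real (\<Lambda>\<^sup>2)) has_vector_derivative 0 + (V s * cnj V' + V' * cnj (V s)) / of_real (\<Lambda>\<^sup>2)) (at s)"
   by (intro has_vector_derivative_add has_vector_derivative_const has_vector_derivative_divide has_vector_derivative_mult V cV)
  moreover have "cmod (0 + (V s * cnj V' + V' * cnj (V s)) / of_real (\<Lambda>\<^sup>2)) * ?a \<le> 2 * cmod (1 + V s * cnj (V s) / of_real (\<Lambda>\<^sup>2)) * ?a'"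
  proof -
   have "cmod (V s * cnj V' + V' * cnj (V s)) \<le> 2 * (?a * ?a')"
    using norm_triangle_ineq[of "V s * cnj V'" "V' * cnj (V s)"] by (simp add: norm_mult mult.commute)
   then have "cmod (V s * cnj V' + V' * cnj (V s)) * (?a / \<Lambda>\<^sup>2) \<le> 2 * (?a * ?a') * (?a / \<Lambda>\<^sup>2)"
    by (intro mult_right_mono) auto
   also have "\<dots> = 2 * (?a\<^sup>2 / \<Lambda>\<^sup>2) * ?a'" by (simp add: power2_eq_square)
   also have "\<dots> \<le> 2 * (1 + ?a\<^sup>2 / \<Lambda>\<^sup>2) * ?a'" by (intro mult_right_mono mult_left_mono) auto
   finally show ?thesis unfolding one_plus_norm norm_of_real abs_of_pos[OF one_plus_norm_pos]
    by (simp add: norm_divide norm_mult norm_power)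
  qed
  ultimately show ?thesis unfolding logd_def by blast
 qed
 have Qnz: "1 + V s * cnj (V s) / of_real (\<Lambda>\<^sup>2) \<noteq> 0"
  unfolding one_plus_norm using one_plus_norm_pos[of "V s" \<Lambda>] by (simp only: of_real_eq_0_iff)
 let ?P' = "of_real (?a powr r) * cnj V' + of_real (r * ?a powr (r - 2) * Re (cnj (V s) * V')) * cnj (V s)"
 have dP: "((%y. of_real (cmod (V y) powr r) * cnj (V y)) has_vector_derivative ?P') (at s)"
  by (rule has_vector_derivative_norm_powr_cnj[OF V r])
 have lP: "logd s ?a ?a' (1 + r) (%s. of_real (cmod (V s) powr r) * cnj (V s))"
 proof (cases "V s = 0")
  case False
  have "cmod ?P' \<le> ?a powr r * ?a' + r * ?a powr (r - 2) * (?a * ?a') * ?a"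
  proof (rule order_trans[OF norm_triangle_ineq add_mono])
   have "\<bar>Re (cnj (V s) * V')\<bar> \<le> ?a * ?a'" using abs_Re_le_cmod[of "cnj (V s) * V'"] by (simp add: norm_mult)
   then show "cmod (of_real (r * ?a powr (r - 2) * Re (cnj (V s) * V')) * cnj (V s)) \<le> r * ?a powr (r - 2) * (?a * ?a') * ?a"
    using r by (simp only: norm_mult norm_of_real abs_mult complex_mod_cnj) (intro mult_right_mono mult_mono; simp)
  qed (simp add: norm_mult)
  also have "r * ?a powr (r - 2) * (?a * ?a') * ?a = r * (?a powr (r - 2) * ?a\<^sup>2) * ?a'" by (simp add: power2_eq_square)
  also have "?a powr (r - 2) * ?a\<^sup>2 = ?a powr r" by (rule norm_powr_pred[OF False])
  finally have "cmod ?P' * ?a \<le> (?a powr r * ?a' + r * ?a powr r * ?a') * ?a" by (rule mult_right_mono) simp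
  then show ?thesis unfolding logd_def using dP by (auto simp: norm_mult algebra_simps)
 qed (use dP r in \<open>auto simp: logd_def\<close>)
 let ?Y = "%s. V s ^ i * cnj (V s) ^ j * inverse (1 + V s * cnj (V s) / of_real (\<Lambda>\<^sup>2)) ^ m"
 have lY: "logd s ?a ?a' (real i * 1 + real j * 1 + real m * 2) ?Y"
  by (intro logd_mult logd_power logd_inverse lV lQ Qnz norm_ge_zero)
 have lF: "logd s ?a ?a' (1 + r + (real i * 1 + real j * 1 + real m * 2)) (%s. cutf r m \<Lambda> i j (V s))"
  unfolding cutf_def by (rule logd_mult[OF norm_ge_zero lP lY])
 have L0: "0 \<le> \<Lambda> ^ (2 * m)" using L by simp
 have nn: "0 \<le> (1 + r + 4 * real m) * \<Lambda> ^ (2 * m)" using r L0 by simp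
 show ?thesis
 proof (cases "V s = 0")
  case True
  obtain Y' where Y': "(?Y has_vector_derivative Y') (at s)" using lY by (auto simp: logd_def)
  have "((%s. cutf r m \<Lambda> i j (V s)) has_vector_derivative of_real (?a powr r) * cnj (V s) * Y' + ?P' * ?Y s) (at s)"
   unfolding cutf_def by (rule has_vector_derivative_mult[OF dP Y'])
  moreover have "of_real (?a powr r) * cnj (V s) * Y' + ?P' * ?Y s = 0" using True r by simp
  ultimately show ?thesis using nn by (intro exI[of _ 0]) (simp add: True r)
 next
  case False
  then have a: "0 < ?a" by simp
  obtain d where d: "((%s. cutf r m \<Lambda> i j (V s)) has_vector_derivative d) (at s)"
   "cmod d * ?a \<le> (1 + r + (real i * 1 + real j * 1 + real m * 2)) * cmod (cutf r m \<Lambda> i j (V s)) * ?a'"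
   using lF by (auto simp: logd_def)
  have "cmod (cutf r m \<Lambda> i j (V s)) \<le> ?a powr r * ?a * \<Lambda> ^ (2 * m)"
   unfolding norm_cutf by (intro mult_left_mono cut_power_bound L ij) auto
  moreover have "1 + r + (real i * 1 + real j * 1 + real m * 2) \<le> 1 + r + 4 * real m" using ij by simp
  ultimately have "(1 + r + (real i * 1 + real j * 1 + real m * 2)) * cmod (cutf r m \<Lambda> i j (V s)) * ?a' \<le>
   (1 + r + 4 * real m) * (?a powr r * ?a * \<Lambda> ^ (2 * m)) * ?a'"
   using r by (intro mult_right_mono mult_mono) auto
  also have "\<dots> = ((1 + r + 4 * real m) * \<Lambda> ^ (2 * m) * (?a powr r * ?a')) * ?a" by (simp add: ac_simps)
  finally have "cmod d * ?a \<le> ((1 + r + 4 * real m) * \<Lambda> ^ (2 * m) * (?a powr r * ?a')) * ?a" using d(2) by linarith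
  then have "cmod d \<le> (1 + r + 4 * real m) * \<Lambda> ^ (2 * m) * (?a powr r * ?a')" using a by (simp only: mult_le_cancel_right_pos)
  also have "?a powr r * ?a' \<le> ?a powr r * (?a'\<^sup>2 + 1)"
  proof (rule mult_left_mono)
   have "2 * ?a' \<le> ?a'\<^sup>2 + 1" using zero_le_power2[of "?a' - 1"] by (simp add: power2_diff)
   then show "?a' \<le> ?a'\<^sup>2 + 1" using norm_ge_zero[of V'] by linarith
  qed simp
  also have "?a powr r * (?a'\<^sup>2 + 1) = ?a powr r * ?a'\<^sup>2 + ?a powr r" by (simp add: algebra_simps)
  finally show ?thesis using d(1) nn by (blast intro: mult_left_mono)
 qed
qed

text \<open>Bernoulli's inequality reduces the power m to m = 1, and t^2 / (1 + t^2) \<le> t at t =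
  |z| / \<Lambda> gains one factor 1 / \<Lambda> for one extra power of |z|. The total power is then
  at most r + 2 + 2 m, exactly that of the good term.\<close>

lemma cutf_remainder:
 assumes r: "0 < r" and L: "1 \<le> \<Lambda>" and ij: "i + j \<le> 2 * m"
 shows "cmod (of_real (cmod z powr r) * cnj z * (z ^ i * cnj z ^ j) - cutf r m \<Lambda> i j z) \<le> real m / \<Lambda> * (1 + cmod z powr (r + 2 + 2 * real m))"
proof -
 let ?a = "cmod z"
 define q where "q = inverse (1 + ?a\<^sup>2 / \<Lambda>\<^sup>2)"
 have q: "0 < q" "q \<le> 1" using one_plus_norm_pos[of z \<Lambda>] by (auto simp: q_def inverse_le_1_iff)
 have "1 + real m * (q - 1) \<le> (1 + (q - 1)) ^ m" using q by (intro Bernoulli_inequality) auto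
 then have 1: "1 - q ^ m \<le> real m * (1 - q)" by (simp add: algebra_simps)
 have "1 - q \<le> ?a / \<Lambda>"
 proof -
  define t where "t = ?a / \<Lambda>"
  have t: "0 \<le> t" using L by (simp add: t_def)
  have q': "q = inverse (1 + t\<^sup>2)" by (simp add: q_def t_def power_divide)
  have "0 < 1 + t\<^sup>2" by (intro add_pos_nonneg) auto
  then have "1 - q = t * (t / (1 + t\<^sup>2))" by (simp add: q' field_simps power2_eq_square)
  also have "\<dots> \<le> t * 1"
  proof (rule mult_left_mono[OF _ t])
   have "2 * t \<le> 1 + t\<^sup>2" using zero_le_power2[of "t - 1"] by (simp add: power2_diff)
   then have "t \<le> 1 + t\<^sup>2" using t by linarith
   then show "t / (1 + t\<^sup>2) \<le> 1" using \<open>0 < 1 + t\<^sup>2\<close> by simp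
  qed
  finally show ?thesis by (simp add: t_def)
 qed
 then have 2: "1 - q ^ m \<le> real m * (?a / \<Lambda>)" using 1 mult_left_mono[of "1 - q" "?a / \<Lambda>" "real m"] by simp
 have "of_real (?a powr r) * cnj z * (z ^ i * cnj z ^ j) - cutf r m \<Lambda> i j z = of_real (?a powr r) * cnj z * (z ^ i * cnj z ^ j) * of_real (1 - q ^ m)"
  unfolding cutf_def one_plus_norm by (simp add: q_def algebra_simps)
 then have "cmod (of_real (?a powr r) * cnj z * (z ^ i * cnj z ^ j) - cutf r m \<Lambda> i j z) = ?a powr r * ?a * ?a ^ (i + j) * (1 - q ^ m)"
  using q by (simp add: norm_mult norm_power power_add power_le_one del: of_real_diff)
 also have "\<dots> \<le> ?a powr r * ?a * ?a ^ (i + j) * (real m * (?a / \<Lambda>))" by (intro mult_left_mono 2) auto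
 also have "\<dots> = real m / \<Lambda> * (?a powr r * ?a * ?a ^ (i + j) * ?a)" by simp
 also have "\<dots> \<le> real m / \<Lambda> * (1 + ?a powr (r + 2 + 2 * real m))"
 proof (rule mult_left_mono)
 show "?a powr r * ?a * ?a ^ (i + j) * ?a \<le> 1 + ?a powr (r + 2 + 2 * real m)"
 proof (cases "?a \<le> 1")
  case True
  have "?a powr r * ?a * ?a ^ (i + j) * ?a \<le> 1 * 1 * 1 * 1"
   using True r by (intro mult_mono power_le_one powr_le1) auto
  then show ?thesis by (simp add: add_increasing2)
 next
  case False
  then have a: "0 < ?a" by linarith
  then have "?a powr r * ?a * ?a ^ (i + j) * ?a = ?a powr (r + 1 + real (i + j) + 1)"
   by (simp only: powr_add powr_realpow powr_one less_imp_le)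
  also have "\<dots> \<le> ?a powr (r + 2 + 2 * real m)" using False ij by (intro powr_mono) auto
  finally show ?thesis by simp
 qed
 qed (use L in simp)
 finally show ?thesis .
qed

section \<open>Duality with negative regularity\<close>

definition energy_density :: "real => dist => real \<times> real => real" where
 "energy_density r f x = cmod (ev f x) powr r * ((cmod (ev (grad True f) x))\<^sup>2 + (cmod (ev (grad False f) x))\<^sup>2)"

lemma energy_density_continuous [continuous_intros]: "0 < r ==> continuous_on UNIV (energy_density r f)"
 unfolding energy_density_def[abs_def] by (intro continuous_intros) auto

lemma energy_density_nonneg: "0 \<le> energy_density r f x"
 by (simp add: energy_density_def)

lemma powr_interpolate:
 fixes q s :: real
 assumes "0 < q" "q < s" "0 < \<epsilon>"
 shows "\<exists>C\<ge>0. \<forall>x\<ge>0. x powr q \<le> \<epsilon> * x powr s + C"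
proof (intro exI[of _ "\<epsilon> powr (- q / (s - q))"] conjI allI impI)
 fix x :: real assume x: "0 \<le> x"
 define y where "y = \<epsilon> powr (- 1 / (s - q))"
 show "x powr q \<le> \<epsilon> * x powr s + \<epsilon> powr (- q / (s - q))"
 proof (cases "x \<le> y")
  case True
  have "x powr q \<le> y powr q" using x True assms by (intro powr_mono2) auto
  also have "\<dots> = \<epsilon> powr (- q / (s - q))" by (simp add: y_def powr_powr)
  finally show ?thesis using assms(3) by (simp add: add_increasing)
 next
  case False
  have y0: "0 \<le> y" by (simp add: y_def)
  then have xp: "0 < x" using False by linarith
  have "y powr (s - q) = \<epsilon> powr (- 1 / (s - q) * (s - q))" by (simp only: y_def powr_powr)
  also have "- 1 / (s - q) * (s - q) = - 1" using assms by simp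
  finally have "1 = \<epsilon> * y powr (s - q)" using assms by (simp add: powr_minus_divide)
  also have "\<dots> \<le> \<epsilon> * x powr (s - q)" using False assms y0 by (intro mult_left_mono powr_mono2) auto
  finally have "1 * x powr q \<le> \<epsilon> * x powr (s - q) * x powr q" by (rule mult_right_mono) simp
  also have "\<dots> = \<epsilon> * x powr s" by (simp add: powr_add[symmetric])
  finally show ?thesis by (simp add: add_increasing2)
 qed
qed simp

definition pairing :: "real => nat => nat => dist => dist => complex" where
 "pairing r i j f g = tmean (%x. of_real (cmod (ev f x) powr r) * cnj (ev f x) * (ev f x ^ i * cnj (ev f x) ^ j) * ev g x)"

lemma cutf_continuous [continuous_intros]:
 assumes "continuous_on A f" "0 < r" shows "continuous_on A (%x. cutf r m \<Lambda> i j (f x))"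
proof -
 have "1 + f x * cnj (f x) / of_real (\<Lambda>\<^sup>2) \<noteq> 0" for x
  unfolding one_plus_norm using one_plus_norm_pos[of "f x" \<Lambda>] by (simp only: of_real_eq_0_iff)
 moreover have "continuous_on A (%x. 1 + f x * cnj (f x) / of_real (\<Lambda>\<^sup>2))"
  unfolding divide_inverse by (intro continuous_intros assms)
 ultimately have c1: "continuous_on A (%x. inverse (1 + f x * cnj (f x) / of_real (\<Lambda>\<^sup>2)) ^ m)"
  by (intro continuous_on_power continuous_on_inverse) simp_all
 have c2: "continuous_on A (%x. of_real (cmod (f x) powr r) * cnj (f x))" "continuous_on A (%x. f x ^ i * cnj (f x) ^ j)"
  using assms(2) by (intro continuous_intros assms(1); simp)+
 show ?thesis unfolding cutf_def by (rule continuous_on_mult[OF c2(1) continuous_on_mult[OF c2(2) c1]])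
qed

context littlewood_paley
begin

text \<open>A function is the divergence of the gradient of its inverse Laplacian. For n > 0 the
  block avoids the frequency 0, so this makes sense.\<close>

lemma grad_decomposition:
 assumes n: "0 < n"
 shows "wt n k * g k = (\<Sum>b\<in>UNIV. grad b (%k. of_int (crd b k) / (2 * pi * \<i> * of_real ((norm (freq k))\<^sup>2)) * (wt n k * g k)) k)"
proof (cases "lp_weight chi rho n k = 0")
 case False
 then have "freq_in n k" by (rule lp_weight_freq_in)
 then have "(2::real) ^ n \<le> 2 ^ (J + 1) * norm (freq k)" using n by (simp add: freq_in_def)
 moreover have "(0::real) < 2 ^ n" by simp
 ultimately have "0 < 2 ^ (J + 1) * norm (freq k)" by linarith
 then have "norm (freq k) \<noteq> 0" by (metis less_irrefl mult_zero_right)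
 then have nz: "complex_of_real ((norm (freq k))\<^sup>2) \<noteq> 0" by simp
 have "(\<Sum>b\<in>UNIV. grad b (%k. of_int (crd b k) / (2 * pi * \<i> * of_real ((norm (freq k))\<^sup>2)) * (wt n k * g k)) k)
  = (of_int (fst k) ^ 2 + of_int (snd k) ^ 2) / of_real ((norm (freq k))\<^sup>2) * (wt n k * g k)"
  by (simp add: UNIV_bool grad_def crd_def power2_eq_square field_simps) (simp only: add_divide_distrib)
 also have "of_int (fst k) ^ 2 + of_int (snd k) ^ 2 = complex_of_real ((norm (freq k))\<^sup>2)"
  unfolding norm_freq_sq by simp
 finally show ?thesis using nz by simp
qed (simp add: grad_def)

text \<open>The potentials have one derivative less than g, hence the gain of 2 ^ (-n); this gain is
  available once the derivative is moved onto the test function.\<close>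

lemma riesz_block:
 "\<exists>H\<ge>0. \<forall>n b g K a x. gap < n --> bb (- a) g K -->
  cmod (ev (%k. of_int (crd b k) / (2 * pi * \<i> * of_real ((norm (freq k))\<^sup>2)) * (wt n k * g k)) x) \<le> H * K * nearC (- a) * dy (- a) n / 2 ^ n"
proof -
 obtain H where H: "0 \<le> H" "\<forall>n p. gap < n --> p = fst \<or> p = snd --> mult_bd (%k. of_real (2 ^ n * of_int (p k) / (norm (freq k))\<^sup>2) * wt n k) H"
  using mult_bd_riesz by (elim exE conjE)
 show ?thesis
 proof (intro exI[of _ H] conjI allI impI H(1))
  fix n b g K a x assume n: "gap < n" and g: "bb (- a) g K"
  let ?a = "%k. complex_of_real (2 ^ n * of_int (crd b k) / (norm (freq k))\<^sup>2) * wt n k"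
  have a: "mult_bd ?a H" by (rule H(2)[rule_format, OF n]) (simp add: crd_def)
  have bd: "cmod (ev (%k. ?a k * g k) x) \<le> H * K * nearC (- a) * dy (- a) n"
   by (rule block_annulus[OF a _ g]) (auto intro: lp_weight_freq_in)
  have "trig ?a" using a by (simp only: mult_bd_def)
  then have ta: "trig (%k. ?a k * g k)" by (rule trig_mult1)
  have "(%k. of_int (crd b k) / (2 * pi * \<i> * of_real ((norm (freq k))\<^sup>2)) * (wt n k * g k)) = (%k. (1 / (2 * pi * \<i> * 2 ^ n)) * (?a k * g k))"
   by (rule ext) (simp add: field_simps)
  then have "cmod (ev (%k. of_int (crd b k) / (2 * pi * \<i> * of_real ((norm (freq k))\<^sup>2)) * (wt n k * g k)) x)
   = cmod (ev (%k. ?a k * g k) x) / (2 * pi * 2 ^ n)"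
   by (simp only: ev_cmult[OF ta]) (simp add: norm_mult norm_divide norm_power)
  also have "\<dots> \<le> cmod (ev (%k. ?a k * g k) x) / 2 ^ n"
   using pi_gt3 by (intro divide_left_mono) auto
  also have "\<dots> \<le> H * K * nearC (- a) * dy (- a) n / 2 ^ n" using bd by (rule divide_right_mono) simp
  finally show "cmod (ev (%k. of_int (crd b k) / (2 * pi * \<i> * of_real ((norm (freq k))\<^sup>2)) * (wt n k * g k)) x) \<le> H * K * nearC (- a) * dy (- a) n / 2 ^ n" .
 qed
qed

text \<open>Accounting of exponents, with \<delta> = 1 / (8 m) and \<Lambda> = 2 ^ (2 \<delta> n),
  so that \<Lambda> ^ (2 m) = 2 ^ (n / 2). The truncated part costs at most 2 ^ (\<delta> n) from
  the roughness of g and 2 ^ (n / 2) from the cutoff against the gain 2 ^ (-n); as \<delta> \<le>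
  1/8 this leaves 2 ^ (- \<delta> n). The remainder has 2 ^ (\<delta> n) / \<Lambda> = 2 ^ (-
  \<delta> n).\<close>

lemma pairing_block:
 assumes r: "0 < r" and m: "1 \<le> m" and a: "0 \<le> a" "a \<le> 1 / (8 * real m)"
 shows "\<exists>C\<ge>0. \<forall>n i j f g K. gap < n --> i + j \<le> 2 * m --> trig f --> bb (- a) g K -->
  cmod (pairing r i j f (%k. wt n k * g k)) \<le> C * K * dy (1 / (8 * real m)) n *
   (1 + tmean (energy_density r f) + tmean (%x. cmod (ev f x) powr (r + 2 + 2 * real m)))"
proof -
 obtain H where H: "0 \<le> H" "\<forall>n b g K a x. gap < n --> bb (- a) g K -->
  cmod (ev (%k. of_int (crd b k) / (2 * pi * \<i> * of_real ((norm (freq k))\<^sup>2)) * (wt n k * g k)) x) \<le> H * K * nearC (- a) * dy (- a) n / 2 ^ n"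
  using riesz_block by (elim exE conjE)
 define \<delta> where "\<delta> = 1 / (8 * real m)"
 define c where "c = 1 + r + 4 * real m"
 have c: "0 \<le> c" using r by (simp add: c_def)
 have nC: "0 \<le> nearC (- a)" by (simp add: nearC_def)
 have d: "0 < \<delta>" "\<delta> \<le> 1/8" using m by (auto simp: \<delta>_def field_simps)
 show ?thesis
 proof (intro exI[of _ "real m + 2 * H * nearC (- a) * c * 2"] conjI allI impI)
  show "0 \<le> real m + 2 * H * nearC (- a) * c * 2" using c H(1) nC by simp
  fix n i j f g K
  assume n: "gap < n" and ij: "i + j \<le> 2 * m" and f: "trig f" and g: "bb (- a) g K"
  let ?E = "tmean (%x. cmod (ev f x) powr (r + 2 + 2 * real m))" and ?D = "tmean (energy_density r f)"
  have K: "0 \<le> K" by (rule bb_nonneg[OF g])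
  have rm: "0 < r + 2 + 2 * real m" using r by simp
  have cE: "continuous_on UNIV (%x. cmod (ev f x) powr (r + 2 + 2 * real m))" using rm by (intro continuous_intros) auto
  have cr: "continuous_on UNIV (%x. cmod (ev f x) powr r)" using r by (intro continuous_intros) auto
  have E0: "0 \<le> ?E" by (rule tmean_nonneg[OF cE]) simp
  have D0: "0 \<le> ?D" by (rule tmean_nonneg) (use r in \<open>auto intro: continuous_intros simp: energy_density_nonneg\<close>)
  define \<Lambda> where "\<Lambda> = 2 powr (2 * \<delta> * real n)"
  have L: "1 \<le> \<Lambda>" using d by (simp add: \<Lambda>_def ge_one_powr_ge_zero)
  have Lm: "\<Lambda> ^ (2 * m) = 2 powr (real n / 2)"
   using m by (simp add: \<Lambda>_def powr_realpow[symmetric] powr_powr \<delta>_def field_simps)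
  let ?h = "%b k. of_int (crd b k) / (2 * pi * \<i> * of_real ((norm (freq k))\<^sup>2)) * (wt n k * g k)"
  have th: "trig (?h b)" for b by (rule trig_mult2[OF trig_wt_mult])
  let ?cut = "%x. cutf r m \<Lambda> i j (ev f x)"
  let ?full = "%x. of_real (cmod (ev f x) powr r) * cnj (ev f x) * (ev f x ^ i * cnj (ev f x) ^ j)"
  have ccut: "continuous_on UNIV ?cut" by (intro continuous_intros r)
  have cfull: "continuous_on UNIV ?full" using r by (intro continuous_intros) auto
  have split: "pairing r i j f (%k. wt n k * g k) = tmean (%x. (?full x - ?cut x) * ev (%k. wt n k * g k) x) + (\<Sum>b\<in>UNIV. tmean (%x. ?cut x * ev (grad b (?h b)) x))"
  proof -
   have "(%k. wt n k * g k) = (%k. \<Sum>b\<in>UNIV. grad b (?h b) k)"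
    by (rule ext, rule grad_decomposition) (use n in simp)
   then have e: "ev (%k. wt n k * g k) x = (\<Sum>b\<in>UNIV. ev (grad b (?h b)) x)" for x
    by (simp only: ev_sum[OF finite trig_grad[OF th]])
   have "(%x. ?full x * ev (%k. wt n k * g k) x) = (%x. (?full x - ?cut x) * ev (%k. wt n k * g k) x + (\<Sum>b\<in>UNIV. ?cut x * ev (grad b (?h b)) x))"
    unfolding sum_distrib_left[symmetric] e[symmetric] by (simp add: algebra_simps)
   then show ?thesis unfolding pairing_def
    by (simp only:) (subst tmean_add, (intro continuous_intros ccut cfull)+, subst tmean_sum, simp, (intro continuous_intros ccut)+, rule refl)
  qed
  have dyb: "dy (- a) n \<le> 2 powr (\<delta> * real n)"
  proof -
   have "a * (real n - 1) \<le> \<delta> * real n" using a d n by (intro mult_mono) (auto simp: \<delta>_def)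
   then show ?thesis by (simp add: dy_def)
  qed
  have dyd: "2 powr (- \<delta> * real n) \<le> dy \<delta> n" using d by (simp add: dy_def algebra_simps)
  have b1: "cmod (tmean (%x. (?full x - ?cut x) * ev (%k. wt n k * g k) x)) \<le> real m * K * dy \<delta> n * (1 + ?E)"
  proof -
   have "cmod (tmean (%x. (?full x - ?cut x) * ev (%k. wt n k * g k) x)) \<le> tmean (%x. cmod ((?full x - ?cut x) * ev (%k. wt n k * g k) x))"
    by (intro tmean_norm continuous_intros ccut cfull)
   also have "\<dots> \<le> tmean (%x. (real m / \<Lambda> * (K * dy (- a) n)) * (1 + cmod (ev f x) powr (r + 2 + 2 * real m)))"
   proof (rule tmean_mono)
    fix x
    have "cmod ((?full x - ?cut x) * ev (%k. wt n k * g k) x) \<le> (real m / \<Lambda> * (1 + cmod (ev f x) powr (r + 2 + 2 * real m))) * (K * dy (- a) n)"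
     unfolding norm_mult[of "?full x - ?cut x"] using L
     by (intro mult_mono cutf_remainder r L ij bbD g) auto
    then show "cmod ((?full x - ?cut x) * ev (%k. wt n k * g k) x) \<le> (real m / \<Lambda> * (K * dy (- a) n)) * (1 + cmod (ev f x) powr (r + 2 + 2 * real m))"
     by (simp only: ac_simps)
   qed (intro continuous_intros ccut cfull cE)+
   also have "\<dots> = (real m / \<Lambda> * (K * dy (- a) n)) * (1 + ?E)"
    by (simp only: tmean_cmult tmean_add[OF continuous_on_const cE] tmean_const)
   also have "\<dots> \<le> (real m * K * dy \<delta> n) * (1 + ?E)"
   proof (rule mult_right_mono)
    have "dy (- a) n / \<Lambda> \<le> 2 powr (\<delta> * real n) / \<Lambda>" using dyb L by (intro divide_right_mono) auto
    also have "\<dots> = 2 powr (- \<delta> * real n)" by (simp add: \<Lambda>_def powr_diff[symmetric] algebra_simps)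
    also have "\<dots> \<le> dy \<delta> n" by (rule dyd)
    finally have "(real m * K) * (dy (- a) n / \<Lambda>) \<le> (real m * K) * dy \<delta> n" using K by (intro mult_left_mono) auto
    then show "real m / \<Lambda> * (K * dy (- a) n) \<le> real m * K * dy \<delta> n" by (simp add: field_simps)
   qed (use E0 in simp)
   finally show ?thesis .
  qed
  have tri: "cmod (X + (Y + Z)) \<le> A + (B + B)" if "cmod X \<le> A" "cmod Y \<le> B" "cmod Z \<le> B" for X Y Z A B
   using that norm_triangle_ineq[of X "Y + Z"] norm_triangle_ineq[of Y Z] by linarith
  have sum_bool: "(\<Sum>b\<in>UNIV. T b) = T False + T True" for T :: "bool => complex"
   by (simp add: UNIV_bool)
  have arith: "X + Y \<le> 2 * (1 + D + E)" if "X \<le> D" "Y \<le> 1 + E" "0 \<le> E" "0 \<le> D" for X Y D E :: real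
   using that by argo
  have rE: "tmean (%x. cmod (ev f x) powr r) \<le> 1 + ?E"
  proof -
   have "tmean (%x. cmod (ev f x) powr r) \<le> tmean (%x. 1 + cmod (ev f x) powr (r + 2 + 2 * real m))"
   proof (rule tmean_mono[OF cr])
    show "continuous_on UNIV (%x. 1 + cmod (ev f x) powr (r + 2 + 2 * real m))" by (intro continuous_intros cE)
    show "cmod (ev f x) powr r \<le> 1 + cmod (ev f x) powr (r + 2 + 2 * real m)" for x
    proof (cases "cmod (ev f x) \<le> 1")
     case True then have "cmod (ev f x) powr r \<le> 1" using r by (intro powr_le1) auto
     then show ?thesis by (simp add: add_increasing2)
    next
     case False then show ?thesis by (simp add: add_increasing powr_mono)
    qed
   qed
   also have "\<dots> = 1 + ?E" by (simp only: tmean_add[OF continuous_on_const cE] tmean_const)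
   finally show ?thesis .
  qed
  have b2: "cmod (tmean (%x. ?cut x * ev (grad b (?h b)) x)) \<le> H * nearC (- a) * c * 2 * K * dy \<delta> n * (1 + ?D + ?E)" for b
  proof -
   let ?S = "%x. c * \<Lambda> ^ (2 * m) * (cmod (ev f x) powr r * (cmod (ev (grad b f) x))\<^sup>2 + cmod (ev f x) powr r)"
   have cb: "continuous_on UNIV (%x. cmod (ev f x) powr r * (cmod (ev (grad b f) x))\<^sup>2)" by (intro continuous_intros cr)
   have "cmod (tmean (%x. ?cut x * ev (grad b (?h b)) x)) \<le> (H * K * nearC (- a) * dy (- a) n / 2 ^ n) * tmean ?S"
   proof (rule ibp_bound_2d[OF th H(2)[rule_format, OF n g] ccut])
    show "continuous_on UNIV ?S" by (intro continuous_intros cr)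
    show "\<exists>d. ((%s. ?cut (slice b y s)) has_vector_derivative d) (at s) \<and> cmod d \<le> ?S (slice b y s)" for y s
     unfolding c_def by (rule cutf_deriv[OF ev_grad[OF f] r L ij])
    show "?cut (slice b y (1/2)) = ?cut (slice b y (-1/2))" for y by (simp only: slice_periodic)
   qed
   also have "tmean ?S = c * \<Lambda> ^ (2 * m) * (tmean (%x. cmod (ev f x) powr r * (cmod (ev (grad b f) x))\<^sup>2) + tmean (%x. cmod (ev f x) powr r))"
    by (simp only: tmean_cmult tmean_add[OF cb cr])
   also have "(H * K * nearC (- a) * dy (- a) n / 2 ^ n) * \<dots> \<le> (H * K * nearC (- a) * dy (- a) n / 2 ^ n) * (c * \<Lambda> ^ (2 * m) * (2 * (1 + ?D + ?E)))"
   proof (intro mult_left_mono)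
    have "tmean (%x. cmod (ev f x) powr r * (cmod (ev (grad b f) x))\<^sup>2) \<le> ?D"
     by (rule tmean_mono[OF cb energy_density_continuous[OF r]]) (cases b; simp add: energy_density_def algebra_simps)
    then show "tmean (%x. cmod (ev f x) powr r * (cmod (ev (grad b f) x))\<^sup>2) + tmean (%x. cmod (ev f x) powr r) \<le> 2 * (1 + ?D + ?E)"
     using rE E0 D0 by (rule arith)
   qed (use c L H(1) K nC in auto)
   also have "\<dots> = (H * K * nearC (- a) * c * 2) * (dy (- a) n / 2 ^ n * \<Lambda> ^ (2 * m)) * (1 + ?D + ?E)" by (simp add: field_simps)
   also have "\<dots> \<le> (H * K * nearC (- a) * c * 2) * dy \<delta> n * (1 + ?D + ?E)"
   proof (intro mult_right_mono mult_left_mono)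
    have "dy (- a) n / 2 ^ n * \<Lambda> ^ (2 * m) \<le> 2 powr (\<delta> * real n) / 2 powr (real n) * 2 powr (real n / 2)"
     unfolding Lm using dyb by (intro mult_right_mono) (auto simp: powr_realpow divide_right_mono)
    also have "\<dots> = 2 powr (\<delta> * real n - real n / 2)" by (simp add: powr_diff[symmetric] powr_add[symmetric])
    also have "\<dots> \<le> 2 powr (- \<delta> * real n)"
    proof -
     have "2 * (\<delta> * real n) \<le> 2 * (1/8 * real n)" using d by (intro mult_left_mono mult_right_mono) auto
     then show ?thesis by simp
    qed
    also have "\<dots> \<le> dy \<delta> n" by (rule dyd)
    finally show "dy (- a) n / 2 ^ n * \<Lambda> ^ (2 * m) \<le> dy \<delta> n" .
   qed (use c H(1) K nC E0 D0 in auto)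
   finally show ?thesis by (simp only: ac_simps)
  qed
  have "cmod (pairing r i j f (%k. wt n k * g k)) \<le> real m * K * dy \<delta> n * (1 + ?E) + (H * nearC (- a) * c * 2 * K * dy \<delta> n * (1 + ?D + ?E) + H * nearC (- a) * c * 2 * K * dy \<delta> n * (1 + ?D + ?E))"
   unfolding split sum_bool by (rule tri[OF b1 b2 b2])
  also have "real m * K * dy \<delta> n * (1 + ?E) \<le> real m * K * dy \<delta> n * (1 + ?D + ?E)"
   using D0 K by (intro mult_left_mono) auto
  finally show "cmod (pairing r i j f (%k. wt n k * g k)) \<le> (real m + 2 * H * nearC (- a) * c * 2) * K * dy (1 / (8 * real m)) n * (1 + ?D + ?E)"
   unfolding \<delta>_def[symmetric] by (simp add: algebra_simps)
 qed
qed

end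

section \<open>Absorption of whole pairings; from L^p to negative regularity\<close>

context littlewood_paley
begin

lemma pairing_sum:
 assumes "finite I" "!!n. n \<in> I ==> trig (g n)" "0 < r"
 shows "pairing r i j f (%k. \<Sum>n\<in>I. g n k) = (\<Sum>n\<in>I. pairing r i j f (g n))"
proof -
 have e: "ev (%k. \<Sum>n\<in>I. g n k) x = (\<Sum>n\<in>I. ev (g n) x)" for x by (rule ev_sum) (use assms in auto)
 show ?thesis unfolding pairing_def e sum_distrib_left
  by (rule tmean_sum[OF assms(1)], intro continuous_intros) (use assms(3) in auto)
qed

lemma pairing_sup:
 assumes r: "0 < r" and ij: "i + j \<le> 2 * m" and B: "!!x. cmod (ev g x) \<le> B"
 shows "cmod (pairing r i j f g) \<le> B * (1 + tmean (%x. cmod (ev f x) powr (r + 1 + 2 * real m)))"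
proof -
 let ?F = "%x. of_real (cmod (ev f x) powr r) * cnj (ev f x) * (ev f x ^ i * cnj (ev f x) ^ j) * ev g x"
 have B0: "0 \<le> B" using B[of 0] by (meson norm_ge_zero order_trans)
 have cF: "continuous_on UNIV ?F" using r by (intro continuous_intros) auto
 have cE: "continuous_on UNIV (%x. cmod (ev f x) powr (r + 1 + 2 * real m))" using r by (intro continuous_intros) auto
 have "cmod (pairing r i j f g) \<le> tmean (%x. cmod (?F x))"
  unfolding pairing_def by (rule tmean_norm[OF cF])
 also have "\<dots> \<le> tmean (%x. B * (1 + cmod (ev f x) powr (r + 1 + 2 * real m)))"
 proof (rule tmean_mono)
  fix x
  let ?a = "cmod (ev f x)"
  have "?a powr r * ?a * ?a ^ (i + j) \<le> 1 + ?a powr (r + 1 + 2 * real m)"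
  proof (cases "?a \<le> 1")
   case True
   have "?a powr r * ?a * ?a ^ (i + j) \<le> 1 * 1 * 1"
    using True r by (intro mult_mono power_le_one powr_le1) auto
   then show ?thesis by (simp add: add_increasing2)
  next
   case False
   then have a: "0 < ?a" by linarith
   then have "?a powr r * ?a * ?a ^ (i + j) = ?a powr (r + 1 + real (i + j))"
    by (simp only: powr_add powr_realpow powr_one less_imp_le)
   also have "\<dots> \<le> ?a powr (r + 1 + 2 * real m)" using False ij by (intro powr_mono) auto
   finally show ?thesis by simp
  qed
  then have "(?a powr r * ?a * ?a ^ (i + j)) * cmod (ev g x) \<le> (1 + ?a powr (r + 1 + 2 * real m)) * B"
   by (intro mult_mono B) auto
  moreover have "cmod (?F x) = (?a powr r * ?a * ?a ^ (i + j)) * cmod (ev g x)"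
   by (simp add: norm_mult norm_power power_add)
  ultimately show "cmod (?F x) \<le> B * (1 + ?a powr (r + 1 + 2 * real m))" by (simp only: mult.commute)
 qed (intro continuous_on_norm continuous_intros cF cE)+
 also have "\<dots> = B * (1 + tmean (%x. cmod (ev f x) powr (r + 1 + 2 * real m)))"
  by (simp only: tmean_cmult tmean_add[OF continuous_on_const cE] tmean_const)
 finally show ?thesis .
qed

lemma low_pass_blocks: "low_pass chi rho M g = (%k. \<Sum>n<M. wt n k * g k)"
 by (rule ext) (simp add: low_pass_def sum_distrib_right)

text \<open>High blocks form a geometric tail and are small by choice of n0. The finitely many low
  blocks are bounded functions, and pairing with them costs only the power r + 1 + 2 m, which is
  absorbed by the larger power r + 2 + 2 m up to a constant.\<close>

lemma pairing_small:
 assumes r: "0 < r" and m: "1 \<le> m" and a: "0 \<le> a" "a \<le> 1 / (8 * real m)" and K: "0 \<le> K" and eps: "0 < \<epsilon>"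
 shows "\<exists>C\<ge>0. \<forall>i j f g. i + j \<le> 2 * m --> trig f --> trig g --> bb (- a) g K -->
  cmod (pairing r i j f g) \<le> \<epsilon> * (tmean (energy_density r f) + tmean (%x. cmod (ev f x) powr (r + 2 + 2 * real m))) + C"
proof -
 define \<delta> where "\<delta> = 1 / (8 * real m)"
 have d: "0 < \<delta>" using m by (simp add: \<delta>_def)
 obtain C0 where C0: "0 \<le> C0" "\<forall>n i j f g K. gap < n --> i + j \<le> 2 * m --> trig f --> bb (- a) g K -->
  cmod (pairing r i j f (%k. wt n k * g k)) \<le> C0 * K * dy \<delta> n *
   (1 + tmean (energy_density r f) + tmean (%x. cmod (ev f x) powr (r + 2 + 2 * real m)))"
  unfolding \<delta>_def using pairing_block[OF r m a] by (elim exE conjE)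
 have G: "0 \<le> geoC \<delta>" using d by (intro geoC_nonneg) simp
 have q: "0 < 2 powr (- \<delta>)" "2 powr (- \<delta>) < (1::real)" using d by (auto simp: powr_less_one)
 define c where "c = C0 * K * geoC \<delta>"
 have c: "0 \<le> c" using C0 K G by (simp add: c_def)
 obtain n1 where n1: "(2 powr (- \<delta>)) ^ n1 < \<epsilon> / 2 / (c + 1)"
  using real_arch_pow_inv[of "\<epsilon> / 2 / (c + 1)" "2 powr (- \<delta>)"] eps c q by auto
 \<comment> \<open>n1 makes the tail smaller than \<epsilon> / 2; adding \<open>gap + 1\<close>
   brings the high blocks into the range of \<open>pairing_block\<close>.\<close>
 define n0 where "n0 = n1 + gap + 1"
 have tail: "c * 2 powr (- \<delta> * real n0) \<le> \<epsilon> / 2"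
 proof -
  have "2 powr (- \<delta> * real n0) = (2 powr (- \<delta>)) ^ n0" using q by (simp add: powr_realpow[symmetric] powr_powr)
  also have "\<dots> \<le> (2 powr (- \<delta>)) ^ n1" using q by (intro power_decreasing) (auto simp: n0_def)
  also have "\<dots> \<le> \<epsilon> / 2 / (c + 1)" using n1 by simp
  finally have "c * 2 powr (- \<delta> * real n0) \<le> c * (\<epsilon> / 2 / (c + 1))" using c by (rule mult_left_mono)
  also have "\<dots> \<le> (c + 1) * (\<epsilon> / 2 / (c + 1))" using c eps by (intro mult_right_mono) auto
  also have "\<dots> = \<epsilon> / 2" using c by (simp add: nonzero_mult_div_cancel_left del: divide_divide_eq_left)
  finally show ?thesis .
 qed
 define S0 where "S0 = (\<Sum>n<n0. K * dy (- a) n)"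
 have S0: "0 \<le> S0" unfolding S0_def using K by (intro sum_nonneg) auto
 obtain C1 where C1: "0 \<le> C1" "\<forall>x\<ge>0. x powr (r + 1 + 2 * real m) \<le> \<epsilon> / 2 / (S0 + 1) * x powr (r + 2 + 2 * real m) + C1"
  using powr_interpolate[of "r + 1 + 2 * real m" "r + 2 + 2 * real m" "\<epsilon> / 2 / (S0 + 1)"] r eps S0 by auto
 show ?thesis
 proof (intro exI[of _ "S0 * (1 + C1) + \<epsilon> / 2"] conjI allI impI)
  show "0 \<le> S0 * (1 + C1) + \<epsilon> / 2" using S0 C1 eps by simp
  fix i j f g assume ij: "i + j \<le> 2 * m" and f: "trig f" and g: "trig g" "bb (- a) g K"
  define E where "E = tmean (%x. cmod (ev f x) powr (r + 2 + 2 * real m))"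
  define D where "D = tmean (energy_density r f)"
  define Q where "Q = tmean (%x. cmod (ev f x) powr (r + 1 + 2 * real m))"
  have cE: "continuous_on UNIV (%x. cmod (ev f x) powr (r + 2 + 2 * real m))" using r by (intro continuous_intros) auto
  have cQ: "continuous_on UNIV (%x. cmod (ev f x) powr (r + 1 + 2 * real m))" using r by (intro continuous_intros) auto
  have E0: "0 \<le> E" unfolding E_def by (rule tmean_nonneg[OF cE]) simp
  have D0: "0 \<le> D" unfolding D_def by (rule tmean_nonneg) (use r in \<open>auto intro: continuous_intros simp: energy_density_nonneg\<close>)
  have Q: "Q \<le> \<epsilon> / 2 / (S0 + 1) * E + C1"
  proof -
   have "Q \<le> tmean (%x. \<epsilon> / 2 / (S0 + 1) * cmod (ev f x) powr (r + 2 + 2 * real m) + C1)"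
    unfolding Q_def
   proof (rule tmean_mono[OF cQ])
    show "continuous_on UNIV (%x. \<epsilon> / 2 / (S0 + 1) * cmod (ev f x) powr (r + 2 + 2 * real m) + C1)"
     by (intro continuous_on_add continuous_on_mult_left cE continuous_on_const)
   qed (use C1(2) in simp)
   also have "\<dots> = \<epsilon> / 2 / (S0 + 1) * E + C1"
    unfolding E_def by (simp only: tmean_cmult tmean_add[OF continuous_on_mult_left[OF cE] continuous_on_const] tmean_const)
   finally show ?thesis .
  qed
  obtain M where M: "low_pass chi rho M g = g"
   using low_pass_trig[OF g(1)] by (auto simp: eventually_sequentially)
  have "pairing r i j f g = (\<Sum>n<M. pairing r i j f (%k. wt n k * g k))"
   by (subst M[symmetric], subst low_pass_blocks, rule pairing_sum[OF _ trig_wt_mult r]) simp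
  then have "cmod (pairing r i j f g) \<le> (\<Sum>n<M. cmod (pairing r i j f (%k. wt n k * g k)))"
   by (simp only: norm_sum)
  also have "\<dots> \<le> (\<Sum>n<M. (if n < n0 then K * dy (- a) n else 0) * (1 + Q) + (if n < n0 then 0 else dy \<delta> n) * (C0 * K * (1 + D + E)))"
  proof (rule sum_mono)
   fix n
   show "cmod (pairing r i j f (%k. wt n k * g k)) \<le> (if n < n0 then K * dy (- a) n else 0) * (1 + Q) + (if n < n0 then 0 else dy \<delta> n) * (C0 * K * (1 + D + E))"
   proof (cases "n < n0")
    case True
    have "cmod (pairing r i j f (%k. wt n k * g k)) \<le> K * dy (- a) n * (1 + Q)"
     unfolding Q_def by (rule pairing_sup[OF r ij]) (rule bbD[OF g(2)])
    then show ?thesis using True by simp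
   next
    case False
    then have "gap < n" by (simp add: n0_def)
    from C0(2)[rule_format, OF this ij f g(2)] False show ?thesis unfolding D_def E_def by (simp add: ac_simps)
   qed
  qed
  also have "\<dots> = (\<Sum>n<M. if n < n0 then K * dy (- a) n else 0) * (1 + Q) + (\<Sum>n<M. if n < n0 then 0 else dy \<delta> n) * (C0 * K * (1 + D + E))"
   by (simp only: sum.distrib sum_distrib_right)
  also have "\<dots> \<le> S0 * (1 + Q) + (geoC \<delta> * 2 powr (- \<delta> * real n0)) * (C0 * K * (1 + D + E))"
  proof (intro add_mono mult_right_mono)
   have "(\<Sum>n<M. if n < n0 then K * dy (- a) n else 0) = (\<Sum>n\<in>{..<M} \<inter> {n. n < n0}. K * dy (- a) n)"
    by (simp add: sum.inter_restrict)
   also have "\<dots> \<le> S0" unfolding S0_def using K by (intro sum_mono2) auto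
   finally show "(\<Sum>n<M. if n < n0 then K * dy (- a) n else 0) \<le> S0" .
   have "(\<Sum>n<M. if n < n0 then 0 else dy \<delta> n) = (\<Sum>n\<in>{..<M} \<inter> {n. \<not> n < n0}. dy \<delta> n)"
    by (subst sum.inter_restrict) (auto intro!: sum.cong)
   also have "\<dots> \<le> geoC \<delta> * 2 powr (\<delta> * real 0) * 2 powr (- \<delta> * real n0)" by (rule sum_dy_tail[OF d]) auto
   finally show "(\<Sum>n<M. if n < n0 then 0 else dy \<delta> n) \<le> geoC \<delta> * 2 powr (- \<delta> * real n0)" by simp
   have "0 \<le> Q" unfolding Q_def by (rule tmean_nonneg[OF cQ]) simp
   then show "0 \<le> 1 + Q" by simp
   show "0 \<le> C0 * K * (1 + D + E)" using C0 K D0 E0 by simp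
  qed
  also have "\<dots> \<le> S0 * (1 + (\<epsilon> / 2 / (S0 + 1) * E + C1)) + \<epsilon> / 2 * (1 + D + E)"
  proof (intro add_mono mult_left_mono Q S0 order_refl)
   have "(geoC \<delta> * 2 powr (- \<delta> * real n0)) * (C0 * K * (1 + D + E)) = (c * 2 powr (- \<delta> * real n0)) * (1 + D + E)"
    by (simp add: c_def ac_simps)
   also have "\<dots> \<le> \<epsilon> / 2 * (1 + D + E)" using tail D0 E0 by (intro mult_right_mono) auto
   finally show "(geoC \<delta> * 2 powr (- \<delta> * real n0)) * (C0 * K * (1 + D + E)) \<le> \<epsilon> / 2 * (1 + D + E)" .
  qed
  also have "S0 * (1 + (\<epsilon> / 2 / (S0 + 1) * E + C1)) = S0 * (\<epsilon> / 2 / (S0 + 1)) * E + S0 * (1 + C1)" by (simp add: algebra_simps)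
  also have "S0 * (\<epsilon> / 2 / (S0 + 1)) * E \<le> (S0 + 1) * (\<epsilon> / 2 / (S0 + 1)) * E"
   using S0 eps E0 by (intro mult_right_mono) auto
  also have "(S0 + 1) * (\<epsilon> / 2 / (S0 + 1)) = \<epsilon> / 2" using S0 by (simp add: nonzero_mult_div_cancel_left del: divide_divide_eq_left)
  also have "\<epsilon> / 2 * E + S0 * (1 + C1) + \<epsilon> / 2 * (1 + D + E) \<le> \<epsilon> * (D + E) + (S0 * (1 + C1) + \<epsilon> / 2)"
   using mult_nonneg_nonneg[OF D0 less_imp_le[OF eps]] by (simp add: algebra_simps add_divide_distrib)
  finally show "cmod (pairing r i j f g) \<le> \<epsilon> * (tmean (energy_density r f) + tmean (%x. cmod (ev f x) powr (r + 2 + 2 * real m))) + (S0 * (1 + C1) + \<epsilon> / 2)"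
   unfolding D_def E_def by simp
 qed
qed

text \<open>Split the convolution at the height A = 2 ^ (2 n / p). Below it the L^1 norm of the
  kernel is used. Above it |f| \<le> A powr (1 - p) * |f|^p together with the sup bound of order 4 ^
  n. The two contributions balance because 4 ^ n * A powr (1 - p) = A.\<close>

lemma bb_of_tmean_powr:
 assumes p: "1 < p"
 shows "\<exists>C\<ge>0. \<forall>f. trig f --> bb (- (2 / p)) f (C * (1 + tmean (%x. cmod (ev f x) powr p)))"
proof -
 define k where "k = ksize (2 ^ J) * wtB"
 have k: "0 \<le> k" using wtB_nonneg by (simp add: k_def ksize_def)
 show ?thesis
 proof (intro exI[of _ "16 * k * 2 powr (2 / p)"] conjI allI impI)
  show "0 \<le> 16 * k * 2 powr (2 / p)" using k by simp
  fix f assume f: "trig f"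
  let ?Y = "tmean (%x. cmod (ev f x) powr p)"
  have cY: "continuous_on UNIV (%x. cmod (ev f x) powr p)" using p by (intro continuous_intros) auto
  show "bb (- (2 / p)) f (16 * k * 2 powr (2 / p) * (1 + ?Y))"
  proof (rule bbI)
   fix n x
   define A :: real where "A = 2 powr (2 * real n / p)"
   have A: "0 < A" by (simp add: A_def)
   have N: "1 \<le> (2::real) ^ n" "0 \<le> (2::real) ^ J" by simp_all
   have supp: "\<bar>of_int (fst l)\<bar> \<le> 2 ^ J * (2::real) ^ n \<and> \<bar>of_int (snd l)\<bar> \<le> 2 ^ J * (2::real) ^ n" if "wt n l \<noteq> 0" for l
   proof -
    have "freq_in n l" using that by (intro lp_weight_freq_in) simp
    then have "norm (freq l) \<le> 2 ^ J * 2 ^ n" by (simp add: freq_in_def power_add)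
    then show ?thesis using abs_coord_le_norm_freq[of l] by (auto intro: order_trans)
   qed
   have sup: "cmod (ev (wt n) y) \<le> k * 4 ^ n" for y
    using kernel_pointwise(2)[OF N symbol_bd_wt supp, of y] by (simp add: k_def ac_simps power2_eq_square flip: power_mult_distrib)
   have L1: "tmean (%y. cmod (ev (wt n) y)) \<le> 16 * k"
    using kernel_L1[OF N symbol_bd_wt supp] by (simp add: k_def)
   have cw: "continuous_on UNIV (%y. A * cmod (ev (wt n) y))" by (intro continuous_intros)
   have ct: "continuous_on UNIV (%y. cmod (ev f (x - y)) powr p)" using p by (intro continuous_intros) auto
   have "cmod (ev (%k. wt n k * f k) x) \<le> tmean (%y. cmod (ev (wt n) y * ev f (x - y)))"
    by (subst ev_multiplier[OF trig_wt f], intro tmean_norm continuous_intros)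
   also have "\<dots> \<le> tmean (%y. A * cmod (ev (wt n) y) + (k * 4 ^ n * A powr (1 - p)) * cmod (ev f (x - y)) powr p)"
   proof (rule tmean_mono)
    show "continuous_on UNIV (%y. A * cmod (ev (wt n) y) + (k * 4 ^ n * A powr (1 - p)) * cmod (ev f (x - y)) powr p)"
     by (intro continuous_on_add continuous_on_mult_left cw ct)
    fix y
    let ?z = "cmod (ev f (x - y))"
    show "cmod (ev (wt n) y * ev f (x - y)) \<le> A * cmod (ev (wt n) y) + (k * 4 ^ n * A powr (1 - p)) * ?z powr p"
    proof (cases "?z \<le> A")
     case True
     then have "cmod (ev (wt n) y) * ?z \<le> cmod (ev (wt n) y) * A" by (intro mult_left_mono) auto
     moreover have "0 \<le> (k * 4 ^ n * A powr (1 - p)) * ?z powr p" using k by simp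
     ultimately show ?thesis unfolding norm_mult by (simp add: mult.commute)
    next
     case False
     then have zp: "0 < ?z" using A by linarith
     have "?z = ?z powr (1 - p) * ?z powr p" using zp by (simp add: powr_add[symmetric])
     also have "\<dots> \<le> A powr (1 - p) * ?z powr p" using False A p by (intro mult_right_mono powr_mono2') auto
     finally have "cmod (ev (wt n) y) * ?z \<le> (k * 4 ^ n) * (A powr (1 - p) * ?z powr p)"
      using k by (intro mult_mono sup) auto
     moreover have "0 \<le> A * cmod (ev (wt n) y)" using A by simp
     ultimately show ?thesis unfolding norm_mult by (simp add: mult.assoc)
    qed
   qed (intro continuous_intros)+
   also have "\<dots> = A * tmean (%y. cmod (ev (wt n) y)) + (k * 4 ^ n * A powr (1 - p)) * tmean (%y. cmod (ev f (x - y)) powr p)"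
    by (simp only: tmean_add[OF cw continuous_on_mult_left[OF ct]] tmean_cmult)
   also have "tmean (%y. cmod (ev f (x - y)) powr p) = ?Y"
    by (rule tmean_reflect_translate[OF cY, of x]) (simp only: ev_periodic)
   also have "k * 4 ^ n * A powr (1 - p) = k * A"
   proof -
    have "(4::real) ^ n = 2 powr (2 * real n)" by (simp add: powr_realpow[symmetric] powr_powr[symmetric])
    moreover have "2 * real n / p * (1 - p) = 2 * real n / p - 2 * real n" using p by (simp add: field_simps)
    ultimately show ?thesis by (simp add: A_def powr_powr powr_add[symmetric])
   qed
   also have "A * tmean (%y. cmod (ev (wt n) y)) + k * A * ?Y \<le> A * (16 * k) + 16 * k * A * ?Y"
   proof (intro add_mono mult_left_mono mult_right_mono L1)
    show "0 \<le> ?Y" by (rule tmean_nonneg[OF cY]) simp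
   qed (use A k in auto)
   also have "\<dots> = 16 * k * A * (1 + ?Y)" by (simp add: algebra_simps)
   also have "A = 2 powr (2 / p) * dy (- (2 / p)) n"
    by (simp add: A_def dy_def powr_add[symmetric] algebra_simps diff_divide_distrib)
   finally show "cmod (ev (%k. wt n k * f k) x) \<le> 16 * k * 2 powr (2 / p) * (1 + ?Y) * dy (- (2 / p)) n"
    by (simp only: ac_simps)
  qed
 qed
qed

end

section \<open>Energy inequality for the truncated equation\<close>

context littlewood_paley
begin

lemma symA_grad: "symA \<mu> k * f k = (\<i> + of_real \<mu>) * (grad True (grad True f) k + grad False (grad False f) k) - f k"
 by (simp add: symA_def grad_def crd_def power2_eq_square algebra_simps)

text \<open>The two second derivatives are treated separately along slices. The zeroth-order part of
  the symbol contributes minus the mean of |f|^(r + 2) and is dropped.\<close>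

lemma energy_dissipation:
 assumes f: "trig f" and r: "1 \<le> r"
  and c: "!!A B. c * (A\<^sup>2 + B\<^sup>2) \<le> \<mu> * (1 + r) * A\<^sup>2 - r * (A * B) + \<mu> * B\<^sup>2"
 shows "Re (tmean (%x. of_real (cmod (ev f x) powr r) * cnj (ev f x) * ev (%k. symA \<mu> k * f k) x)) \<le> - c * tmean (energy_density r f)"
proof -
 have r0: "0 < r" using r by simp
 let ?N = "%x. of_real (cmod (ev f x) powr r) * cnj (ev f x)"
 have cN: "continuous_on UNIV ?N" using r0 by (intro continuous_intros) auto
 have tg: "trig (grad b (grad b f))" for b by (intro trig_grad f)
 have e: "ev (%k. symA \<mu> k * f k) x = (\<i> + of_real \<mu>) * (ev (grad True (grad True f)) x + ev (grad False (grad False f)) x) - ev f x" for x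
  unfolding symA_grad using tg f by (simp only: ev_diff ev_cmult ev_add trig_add trig_mult2)
 let ?L = "%b x. Re ((\<i> + of_real \<mu>) * (?N x * ev (grad b (grad b f)) x))"
 have cL: "continuous_on UNIV (?L b)" for b by (intro continuous_intros cN)
 let ?d = "%b x. cmod (ev f x) powr r * (cmod (ev (grad b f) x))\<^sup>2"
 have cd: "continuous_on UNIV (?d b)" for b using r0 by (intro continuous_intros) auto
 have "Re (tmean (%x. ?N x * ev (%k. symA \<mu> k * f k) x)) = tmean (%x. Re (?N x * ev (%k. symA \<mu> k * f k) x))"
  by (rule tmean_Re[symmetric]) (intro continuous_intros cN)
 also have "\<dots> \<le> tmean (%x. ?L True x + ?L False x)"
 proof (rule tmean_mono)
  fix x
  have "?N x * ev f x = of_real (cmod (ev f x) powr r * (cmod (ev f x))\<^sup>2)"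
   unfolding of_real_mult complex_norm_square by (simp only: ac_simps)
  then have "Re (?N x * ev f x) = cmod (ev f x) powr r * (cmod (ev f x))\<^sup>2" by (simp only: Re_complex_of_real)
  then have "0 \<le> Re (?N x * ev f x)" by simp
  moreover have "?N x * ev (%k. symA \<mu> k * f k) x = (\<i> + of_real \<mu>) * (?N x * ev (grad True (grad True f)) x) + (\<i> + of_real \<mu>) * (?N x * ev (grad False (grad False f)) x) - ?N x * ev f x"
   unfolding e by (simp only: ring_distribs ac_simps)
  ultimately show "Re (?N x * ev (%k. symA \<mu> k * f k) x) \<le> ?L True x + ?L False x"
   by (simp only: minus_complex.sel plus_complex.sel)
 qed (intro continuous_intros cN)+
 also have "\<dots> = tmean (?L True) + tmean (?L False)" by (rule tmean_add[OF cL cL])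
 also have "\<dots> \<le> - c * tmean (?d True) + - c * tmean (?d False)"
  by (intro add_mono dissipation_2d f r c)
 also have "\<dots> = - c * (tmean (?d True) + tmean (?d False))" by (simp only: distrib_left)
 also have "tmean (?d True) + tmean (?d False) = tmean (energy_density r f)"
  unfolding energy_density_def[abs_def] distrib_left by (rule tmean_add[OF cd cd, symmetric])
 finally show ?thesis .
qed

text \<open>The top monomial has coefficient 1 and pairs to exactly - Re \<nu> times the mean of
  |f|^(r + 2 + 2 m); every other index pair has i + j \<le> 2 m and falls under
  \<open>pairing_small\<close>. Terms linear in f are read as pairings with the unit distribution. R
  is a slot for the commutation error of the truncation.\<close>

lemma energy_forcing:
 assumes mu: "0 < \<mu>" and r: "1 \<le> r" "r\<^sup>2 < 4 * \<mu>\<^sup>2 * (1 + r)" and m: "1 \<le> m" and nu: "0 < Re \<nu>"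
  and a: "0 \<le> a" "a \<le> 1 / (8 * real m)" and K0: "0 \<le> K0"
 shows "\<exists>C\<ge>0. \<forall>f z y R \<zeta>. trig f --> trig z --> trig y --> trig R -->
  (\<forall>i\<le>m + 1. \<forall>j\<le>m. trig (\<zeta> i j) \<and> bb (- a) (\<zeta> i j) K0) --> \<zeta> (m + 1) m = dunit -->
  bb (- a) z K0 --> bb (- a) y K0 --> bb (- a) R K0 -->
  Re (tmean (%x. of_real (cmod (ev f x) powr r) * cnj (ev f x) *
   (ev (%k. symA \<mu> k * f k) x + (ev (wick m \<nu> \<tau> lam \<zeta> z y f) x + ev R x)))) \<le> C"
proof -
 have r0: "0 < r" using r by simp
 obtain c where c: "0 < c" "!!A B. c * (A\<^sup>2 + B\<^sup>2) \<le> \<mu> * (1 + r) * A\<^sup>2 - r * (A * B) + \<mu> * B\<^sup>2"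
  by (rule quadratic_form_coercive[OF mu _ r(2)]) (use r in auto)
 define K where "K = max K0 (unitC (- a))"
 have K: "0 \<le> K" using K0 by (simp add: K_def)
 define S where "S = {..m + 1} \<times> {..m} - {(m + 1, m)}"
 have finS: "finite S" by (simp add: S_def)
 \<comment> \<open>The total weight of all pairings to be absorbed: noise monomials, relaxation
   target, linear term, linear noise and, with weight 1, the remainder R. Dividing by it makes
   \<epsilon> small enough to be beaten by the dissipation and by Re \<nu>.\<close>
 define \<Theta> where "\<Theta> = cmod \<nu> * (\<Sum>(i, j)\<in>S. cmod (binc m i j)) + \<bar>lam\<bar> + cmod (\<tau> + 1 - of_real lam) + cmod (\<tau> + 1) + 1"
 have \<Theta>: "0 < \<Theta>" unfolding \<Theta>_def by (intro add_nonneg_pos add_nonneg_nonneg mult_nonneg_nonneg sum_nonneg) auto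
 define \<epsilon> where "\<epsilon> = min c (Re \<nu>) / \<Theta>"
 have eps: "0 < \<epsilon>" using c nu \<Theta> by (simp add: \<epsilon>_def)
 obtain C where C: "0 \<le> C" "\<forall>i j f g. i + j \<le> 2 * m --> trig f --> trig g --> bb (- a) g K -->
  cmod (pairing r i j f g) \<le> \<epsilon> * (tmean (energy_density r f) + tmean (%x. cmod (ev f x) powr (r + 2 + 2 * real m))) + C"
  using pairing_small[OF r0 m a K eps] by (elim exE conjE)
 show ?thesis
 proof (intro exI[of _ "\<Theta> * C"] conjI allI impI)
  show "0 \<le> \<Theta> * C" using \<Theta> C by simp
  fix f z y R \<zeta>
  assume f: "trig f" and z: "trig z" "bb (- a) z K0" and y: "trig y" "bb (- a) y K0" and R: "trig R" "bb (- a) R K0"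
   and \<zeta>: "\<forall>i\<le>m + 1. \<forall>j\<le>m. trig (\<zeta> i j) \<and> bb (- a) (\<zeta> i j) K0" and top: "\<zeta> (m + 1) m = dunit"
  have KK: "bb (- a) g K" if "bb (- a) g K0" for g by (rule bb_mono[OF that]) (simp add: K_def)
  define D where "D = tmean (energy_density r f)"
  define E where "E = tmean (%x. cmod (ev f x) powr (r + 2 + 2 * real m))"
  define B where "B = \<epsilon> * (D + E) + C"
  have D0: "0 \<le> D" unfolding D_def by (rule tmean_nonneg) (use r0 in \<open>auto intro: continuous_intros simp: energy_density_nonneg\<close>)
  have E0: "0 \<le> E" unfolding E_def by (rule tmean_nonneg) (use r0 in \<open>auto intro!: continuous_intros\<close>)
  have B: "cmod (pairing r i j f g) \<le> B" if "i + j \<le> 2 * m" "trig g" "bb (- a) g K" for i j g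
   unfolding B_def D_def E_def using C(2) that f by blast
  have Bz: "cmod (pairing r 0 0 f z) \<le> B" "cmod (pairing r 0 0 f y) \<le> B" "cmod (pairing r 0 0 f R) \<le> B"
   using z y R KK by (auto intro: B)
  have Bu: "cmod (pairing r 1 0 f dunit) \<le> B"
   by (rule B) (use m in \<open>auto intro: trig_dunit bb_mono[OF bb_dunit] simp: K_def\<close>)
  have B\<zeta>: "cmod (pairing r (fst p) (snd p) f (\<zeta> (fst p) (snd p))) \<le> B" if "p \<in> S" for p
   using that \<zeta> KK by (intro B) (auto simp: S_def)
  let ?N = "%x. of_real (cmod (ev f x) powr r) * cnj (ev f x)"
  have cN: "continuous_on UNIV ?N" using r0 by (intro continuous_intros) auto
  let ?P = "%i j g x. ?N x * (ev f x ^ i * cnj (ev f x) ^ j) * ev g x"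
  have cP: "continuous_on UNIV (?P i j g)" for i j g by (intro continuous_intros cN)
  have tw: "trig (\<zeta> i j)" if "i \<le> m + 1" "j \<le> m" for i j using \<zeta> that by blast
  have point: "?N x * (ev (%k. symA \<mu> k * f k) x + (ev (wick m \<nu> \<tau> lam \<zeta> z y f) x + ev R x)) =
   ?N x * ev (%k. symA \<mu> k * f k) x + (of_real lam * ?P 0 0 y x + ((\<tau> + 1 - of_real lam) * ?P 1 0 dunit x +
    ((- \<nu>) * (\<Sum>i\<le>m + 1. \<Sum>j\<le>m. binc m i j * ?P i j (\<zeta> i j) x) + ((\<tau> + 1) * ?P 0 0 z x + ?P 0 0 R x))))" for x
  proof -
   have "?N x * (\<Sum>i\<le>m + 1. \<Sum>j\<le>m. binc m i j * (ev f x ^ i * cnj (ev f x) ^ j * ev (\<zeta> i j) x)) = (\<Sum>i\<le>m + 1. \<Sum>j\<le>m. binc m i j * ?P i j (\<zeta> i j) x)"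
    unfolding sum_distrib_left by (intro sum.cong refl) (simp only: ac_simps)
   then have s: "?N x * ((- \<nu>) * (\<Sum>i\<le>m + 1. \<Sum>j\<le>m. binc m i j * (ev f x ^ i * cnj (ev f x) ^ j * ev (\<zeta> i j) x))) = (- \<nu>) * (\<Sum>i\<le>m + 1. \<Sum>j\<le>m. binc m i j * ?P i j (\<zeta> i j) x)"
    by (simp only: mult.left_commute)
   have dist: "n * (S + ((l * (v - w) + (X + (t + 1) * (w + zz))) + RR)) = n * S + (l * (n * (w ^ 0 * 1) * v) + ((t + 1 - l) * (n * (w ^ 1 * 1) * 1) + (n * X + ((t + 1) * (n * (w ^ 0 * 1) * zz) + n * (w ^ 0 * 1) * RR))))"
    for n S l v w X t zz RR :: complex by (simp add: algebra_simps)
   have ew: "ev (wick m \<nu> \<tau> lam \<zeta> z y f) x = of_real lam * (ev y x - ev f x) +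
    (- \<nu> * (\<Sum>i\<le>m + 1. \<Sum>j\<le>m. binc m i j * (ev f x ^ i * cnj (ev f x) ^ j * ev (\<zeta> i j) x)) + (\<tau> + 1) * (ev f x + ev z x))"
    by (rule trig_wick(2)[OF f z(1) y(1)]) (rule tw)
   show ?thesis
    unfolding ew ev_dunit s[symmetric] power_0[of "cnj (ev f x)"] by (rule dist)
  qed
  have cs: "continuous_on UNIV (%x. \<Sum>i\<le>m + 1. \<Sum>j\<le>m. binc m i j * ?P i j (\<zeta> i j) x)"
   by (intro continuous_on_sum continuous_on_mult_left cP)
  have csj: "continuous_on UNIV (%x. \<Sum>j\<le>m. binc m i j * ?P i j (\<zeta> i j) x)" for i
   by (intro continuous_on_sum continuous_on_mult_left cP)
  have csA: "continuous_on UNIV (%x. ?N x * ev (%k. symA \<mu> k * f k) x)" by (intro continuous_intros cN)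
  have tm_sum: "tmean (%x. \<Sum>i\<le>m + 1. \<Sum>j\<le>m. binc m i j * ?P i j (\<zeta> i j) x) = (\<Sum>i\<le>m + 1. \<Sum>j\<le>m. binc m i j * pairing r i j f (\<zeta> i j))"
  proof -
   have "tmean (%x. \<Sum>j\<le>m. binc m i j * ?P i j (\<zeta> i j) x) = (\<Sum>j\<le>m. binc m i j * pairing r i j f (\<zeta> i j))" for i
    unfolding pairing_def tmean_cmult[symmetric] by (rule tmean_sum) (intro finite_atMost continuous_on_mult_left cP)+
   then show ?thesis by (subst tmean_sum[OF _ csj]) simp_all
  qed
  let ?A = "tmean (%x. ?N x * ev (%k. symA \<mu> k * f k) x)"
  have tot: "tmean (%x. ?N x * (ev (%k. symA \<mu> k * f k) x + (ev (wick m \<nu> \<tau> lam \<zeta> z y f) x + ev R x))) =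
   ?A + (of_real lam * pairing r 0 0 f y + ((\<tau> + 1 - of_real lam) * pairing r 1 0 f dunit +
    ((- \<nu>) * (\<Sum>i\<le>m + 1. \<Sum>j\<le>m. binc m i j * pairing r i j f (\<zeta> i j)) + ((\<tau> + 1) * pairing r 0 0 f z + pairing r 0 0 f R))))"
  proof -
   have add6: "tmean (%x. g1 x + (g2 x + (g3 x + (g4 x + (g5 x + g6 x))))) = tmean g1 + (tmean g2 + (tmean g3 + (tmean g4 + (tmean g5 + tmean g6))))"
    if "continuous_on UNIV g1" "continuous_on UNIV g2" "continuous_on UNIV g3" "continuous_on UNIV g4" "continuous_on UNIV g5" "continuous_on UNIV g6"
    for g1 g2 g3 g4 g5 g6 :: "real \<times> real => complex" using that by (simp add: tmean_add continuous_on_add)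
   show ?thesis unfolding point
    by (subst add6, (intro csA cs continuous_on_mult_left cP)+) (simp only: tmean_cmult tm_sum pairing_def)
  qed
  have split: "(\<Sum>i\<le>m + 1. \<Sum>j\<le>m. binc m i j * pairing r i j f (\<zeta> i j)) = of_real E + (\<Sum>p\<in>S. binc m (fst p) (snd p) * pairing r (fst p) (snd p) f (\<zeta> (fst p) (snd p)))"
  proof -
   have "(\<Sum>i\<le>m + 1. \<Sum>j\<le>m. binc m i j * pairing r i j f (\<zeta> i j)) = (\<Sum>p\<in>{..m + 1} \<times> {..m}. binc m (fst p) (snd p) * pairing r (fst p) (snd p) f (\<zeta> (fst p) (snd p)))"
    unfolding sum.cartesian_product by (rule sum.cong[OF refl]) (simp only: split_beta)
   also have "\<dots> = pairing r (m + 1) m f dunit + (\<Sum>p\<in>S. binc m (fst p) (snd p) * pairing r (fst p) (snd p) f (\<zeta> (fst p) (snd p)))"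
    unfolding S_def by (subst sum.remove[of _ "(m + 1, m)"]) (simp_all add: top[simplified])
   also have "pairing r (m + 1) m f dunit = of_real E"
   proof -
    have "?P (m + 1) m dunit x = of_real (cmod (ev f x) powr (r + 2 + 2 * real m))" for x
    proof (cases "ev f x = 0")
     case False
     have "?P (m + 1) m dunit x = of_real (cmod (ev f x) powr r) * (ev f x * cnj (ev f x)) ^ (m + 1)"
      by (simp add: ev_dunit power_mult_distrib ac_simps)
     also have "\<dots> = of_real (cmod (ev f x) powr r * ((cmod (ev f x))\<^sup>2) ^ (m + 1))"
      by (simp only: complex_norm_square[symmetric] of_real_mult of_real_power)
     also have "((cmod (ev f x))\<^sup>2) ^ (m + 1) = cmod (ev f x) powr (2 + 2 * real m)"
     proof -
      have "((cmod (ev f x))\<^sup>2) ^ (m + 1) = cmod (ev f x) ^ (2 * (m + 1))" by (simp only: power_mult)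
      also have "\<dots> = cmod (ev f x) powr real (2 * (m + 1))" using False by (intro powr_realpow[symmetric]) simp
      finally show ?thesis by (simp only: of_nat_mult of_nat_add of_nat_numeral of_nat_1 distrib_left mult_1_right add.commute)
     qed
     finally show ?thesis by (simp only: powr_add[symmetric] add.assoc)
    qed (use r0 in simp)
    then have "pairing r (m + 1) m f dunit = tmean (%x. complex_of_real (cmod (ev f x) powr (r + 2 + 2 * real m)))"
     unfolding pairing_def by (simp only:)
    also have "\<dots> = of_real E"
    proof -
     have c: "continuous_on UNIV (%x. cmod (ev f x) powr (r + 2 + 2 * real m))" using r0 by (intro continuous_intros) auto
     show ?thesis unfolding E_def tmean_def
      using integral_linear[OF tmean_integrable[OF c] bounded_linear_of_real] by (simp only: o_def)
    qed
    finally show ?thesis .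
   qed
   finally show ?thesis .
  qed
  define Y where "Y = (\<Sum>p\<in>S. binc m (fst p) (snd p) * pairing r (fst p) (snd p) f (\<zeta> (fst p) (snd p)))"
  have Y: "cmod Y \<le> (\<Sum>(i, j)\<in>S. cmod (binc m i j)) * B"
   unfolding Y_def sum_distrib_right split_beta
   by (rule sum_norm_le) (unfold norm_mult, rule mult_left_mono[OF B\<zeta>], auto)
  have RA: "Re ?A \<le> - c * D" unfolding D_def by (rule energy_dissipation[OF f r(1) c(2)])
  have RY: "Re ((- \<nu>) * (of_real E + Y)) = - Re \<nu> * E + Re ((- \<nu>) * Y)" by (simp add: algebra_simps)
  have ReLe: "Re (u * w) \<le> cmod u * b" if "cmod w \<le> b" for u w b
   using complex_Re_le_cmod[of "u * w"] mult_left_mono[OF that norm_ge_zero[of u]] by (simp add: norm_mult)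
  have "Re (tmean (%x. ?N x * (ev (%k. symA \<mu> k * f k) x + (ev (wick m \<nu> \<tau> lam \<zeta> z y f) x + ev R x)))) =
   Re ?A + (Re (of_real lam * pairing r 0 0 f y) + (Re ((\<tau> + 1 - of_real lam) * pairing r 1 0 f dunit) +
    ((- Re \<nu> * E + Re ((- \<nu>) * Y)) + (Re ((\<tau> + 1) * pairing r 0 0 f z) + Re (pairing r 0 0 f R)))))"
   unfolding tot split Y_def[symmetric] plus_complex.sel RY by (rule refl)
  also have "\<dots> \<le> - c * D + (cmod (of_real lam) * B + (cmod (\<tau> + 1 - of_real lam) * B +
    ((- Re \<nu> * E + cmod (- \<nu>) * ((\<Sum>(i, j)\<in>S. cmod (binc m i j)) * B)) + (cmod (\<tau> + 1) * B + B))))"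
   by (intro add_mono RA ReLe Bz Bu Y order_refl order_trans[OF complex_Re_le_cmod])
  also have "\<dots> = - c * D - Re \<nu> * E + \<Theta> * B"
   unfolding \<Theta>_def by (simp add: algebra_simps)
  also have "\<Theta> * B = min c (Re \<nu>) * (D + E) + \<Theta> * C"
   using \<Theta> by (simp add: B_def \<epsilon>_def distrib_left)
  also have "- c * D - Re \<nu> * E + (min c (Re \<nu>) * (D + E) + \<Theta> * C) \<le> \<Theta> * C"
  proof -
   have "min c (Re \<nu>) * D \<le> c * D" "min c (Re \<nu>) * E \<le> Re \<nu> * E" using D0 E0 by (intro mult_right_mono; simp)+
   then show ?thesis by (simp add: distrib_left)
  qed
  finally show "Re (tmean (%x. ?N x * (ev (%k. symA \<mu> k * f k) x + (ev (wick m \<nu> \<tau> lam \<zeta> z y f) x + ev R x)))) \<le> \<Theta> * C" .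
 qed
qed

end

section \<open>The a priori bound\<close>

lemma has_vector_derivative_exp_cmult: "((%s. exp (of_real s * A)) has_vector_derivative A * exp (of_real t * A)) (at t)" for A :: complex
proof -
 have "((%z. exp (z * A)) has_field_derivative A * exp (of_real t * A)) (at (of_real t))"
  by (auto intro!: derivative_eq_intros)
 then show ?thesis by (rule has_vector_derivative_real_field)
qed

text \<open>The frequencies stay in one finite set, so the evaluations are jointly continuous in
  time and space; the mean can be differentiated under the integral and the mean value theorem
  applies.\<close>

lemma tmean_powr_growth:
 fixes h h' :: "real => dist"
 assumes p: "2 < p" and A: "finite A" "!!t k. k \<notin> A ==> h t k = 0" "!!t k. k \<notin> A ==> h' t k = 0"
  and ch: "!!k. continuous_on {a..b} (%t. h t k)" and ch': "!!k. continuous_on {a<..<b} (%t. h' t k)"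
  and d: "!!t k. a < t ==> t < b ==> ((%t. h t k) has_vector_derivative h' t k) (at t)"
  and C: "!!t. a < t ==> t < b ==>
   Re (tmean (%x. of_real (cmod (ev (h t) x) powr (p - 2)) * cnj (ev (h t) x) * ev (h' t) x)) \<le> C"
  and t: "a \<le> t" "t \<le> b"
 shows "tmean (%x. cmod (ev (h t) x) powr p) \<le> tmean (%x. cmod (ev (h a) x) powr p) + p * C * (t - a)"
proof (cases "a = t")
 case False
 then have at: "a < t" using t by simp
 have e: "ev (h t) x = (\<Sum>k\<in>A. h t k * ekx k x)" "ev (h' t) x = (\<Sum>k\<in>A. h' t k * ekx k x)" for t x
  using A by (auto intro!: ev_eq)
 define Y where "Y t = tmean (%x. cmod (ev (h t) x) powr p)" for t
 define Y' where "Y' t = tmean (%x. p * cmod (ev (h t) x) powr (p - 2) * Re (cnj (ev (h t) x) * ev (h' t) x))" for t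
 have cevh: "continuous_on ({a..b} \<times> UNIV) (%y. ev (h (fst y)) (snd y))"
  unfolding e by (intro continuous_intros continuous_on_compose2[OF ch]) auto
 have cevh': "continuous_on ({a<..<b} \<times> UNIV) (%y. ev (h' (fst y)) (snd y))"
  unfolding e by (intro continuous_intros continuous_on_compose2[OF ch']) auto
 have cY: "continuous_on {a..b} Y"
  unfolding Y_def tmean_def
 proof (rule integral_continuous_on_param)
  show "continuous_on ({a..b} \<times> cbox (- 1/2, - 1/2) (1/2, 1/2)) (%(t, x). cmod (ev (h t) x) powr p)"
   unfolding split_beta using p
   by (intro powr_continuous continuous_on_norm continuous_on_subset[OF cevh]) auto
 qed
 have dY: "(Y has_real_derivative Y' s) (at s)" if s: "a < s" "s < b" for s
 proof -
  have "(Y has_real_derivative Y' s) (at s within {a<..<b})"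
   unfolding Y_def Y'_def tmean_def
  proof (rule leibniz_rule_field_derivative)
   show "((%t. cmod (ev (h t) x) powr p) has_real_derivative p * cmod (ev (h t) x) powr (p - 2) * Re (cnj (ev (h t) x) * ev (h' t) x)) (at t within {a<..<b})"
    if "t \<in> {a<..<b}" for t x
   proof -
    have "((%t. ev (h t) x) has_vector_derivative ev (h' t) x) (at t)"
     unfolding e using that by (intro has_vector_derivative_sum has_vector_derivative_mult_left d) auto
    from has_real_derivative_norm_powr_sum[OF this p] show ?thesis by (rule has_field_derivative_at_within)
   qed
   show "(%x. cmod (ev (h t) x) powr p) integrable_on cbox (- 1/2, - 1/2) (1/2, 1/2)" for t
    using p by (intro tmean_integrable continuous_intros) auto
   have c1: "continuous_on ({a<..<b} \<times> cbox (- 1/2, - 1/2) (1/2, 1/2)) (%y. ev (h (fst y)) (snd y))"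
    by (rule continuous_on_subset[OF cevh]) auto
   have c2: "continuous_on ({a<..<b} \<times> cbox (- 1/2, - 1/2) (1/2, 1/2)) (%y. ev (h' (fst y)) (snd y))"
    by (rule continuous_on_subset[OF cevh']) auto
   show "continuous_on ({a<..<b} \<times> cbox (- 1/2, - 1/2) (1/2, 1/2)) (%(t, x). p * cmod (ev (h t) x) powr (p - 2) * Re (cnj (ev (h t) x) * ev (h' t) x))"
    unfolding split_beta using p by (intro continuous_intros c1 c2) auto
  qed (use s in auto)
  then show ?thesis using at_within_open[of s "{a<..<b}"] s by simp
 qed
 have "\<exists>l z. a < z \<and> z < t \<and> (Y has_real_derivative l) (at z) \<and> Y t - Y a = (t - a) * l"
 proof (rule MVT[OF at continuous_on_subset[OF cY]])
  show "{a..t} \<subseteq> {a..b}" using t by simp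
  fix s assume "a < s" "s < t"
  then have "(Y has_real_derivative Y' s) (at s)" using t by (intro dY) linarith+
  then show "Y differentiable (at s)" unfolding real_differentiable_def by (rule exI)
 qed
 then obtain l z where z: "a < z" "z < t" "(Y has_real_derivative l) (at z)" "Y t - Y a = (t - a) * l" by blast
 have zb: "z < b" using z t by simp
 have "l = Y' z" by (rule DERIV_unique[OF z(3) dY[OF z(1) zb]])
 also have "Y' z = p * Re (tmean (%x. of_real (cmod (ev (h z) x) powr (p - 2)) * cnj (ev (h z) x) * ev (h' z) x))"
 proof -
  have "continuous_on UNIV (%x. of_real (cmod (ev (h z) x) powr (p - 2)) * cnj (ev (h z) x) * ev (h' z) x)"
   using p by (intro continuous_intros) auto
  note r = tmean_Re[OF this]
  show ?thesis unfolding r[symmetric] tmean_cmult[symmetric] Y'_def by (simp add: mult.assoc)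
 qed
 also have "\<dots> \<le> p * C" using C[OF z(1) zb] p by (intro mult_left_mono) auto
 finally have "(t - a) * l \<le> (t - a) * (p * C)" using at by (intro mult_left_mono) auto
 then show ?thesis using z(4) unfolding Y_def by (simp add: mult.commute)
qed simp

context littlewood_paley
begin

lemma bdd_along_uniform:
 assumes "!!t. t \<in> S ==> bb s (g t) C" shows "bdd_along (sequentially \<times>\<^sub>F principal S) s (%i. g (snd i))"
proof -
 have "eventually (%t. bb s (g t) C) (principal S)" using assms by (simp add: eventually_principal)
 from eventually_compose_filterlim[OF this filterlim_snd] show ?thesis unfolding bdd_along_def by blast
qed

lemma null_along_low_pass:
 assumes g: "!!t. t \<in> S ==> bb s (g t) C" and s: "s' < s"
 shows "null_along (sequentially \<times>\<^sub>F principal S) s' (%i k. low_pass chi rho (fst i) (g (snd i)) k - g (snd i) k)"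
proof -
 let ?d = "s - s'"
 have q: "0 < 2 powr (- ?d)" "2 powr (- ?d) < (1::real)" using s by (auto simp: powr_less_one)
 have "2 powr (- ?d * real n) = (2 powr (- ?d)) ^ n" for n
  by (simp only: powr_realpow[OF q(1), symmetric] powr_powr)
 then have "(%n. 2 powr (- ?d * real n)) \<longlonglongrightarrow> 0"
  using LIMSEQ_realpow_zero[OF less_imp_le[OF q(1)] q(2)] by (simp only:)
 then have "(%n. tailC ?d * C * 2 powr (- ?d * real n)) \<longlonglongrightarrow> 0" by (rule tendsto_mult_right_zero)
 from filterlim_compose[OF this filterlim_fst]
 have 1: "((%i. tailC ?d * C * 2 powr (- ?d * real (fst i))) \<longlongrightarrow> 0) (sequentially \<times>\<^sub>F principal S)" .
 have "eventually (%t. bb s (g t) C) (principal S)" using g by (simp add: eventually_principal)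
 from eventually_compose_filterlim[OF this filterlim_snd]
 have "eventually (%i. bb s (g (snd i)) C) (sequentially \<times>\<^sub>F principal S)" .
 then have "eventually (%i. bb s' (%k. low_pass chi rho (fst i) (g (snd i)) k - g (snd i) k) (tailC ?d * C * 2 powr (- ?d * real (fst i)))) (sequentially \<times>\<^sub>F principal S)"
  by (rule eventually_mono) (unfold low_pass_eq, rule bb_diff_swap, rule bb_Schi_tail, use s in auto)
 with 1 show ?thesis unfolding null_along_def by blast
qed

end

text \<open>The bound \<open>\<alpha> \<le> 1 / (16 * real m)\<close> leaves 2 \<alpha> within the
  range of the pairing estimate after the loss in the commutator, and
  \<open>4 * \<alpha> < \<beta>\<close> keeps products defined when the solution is measured in
  C^(\<beta> / 2) and the noise in C^(- 2 \<alpha>). \<open>top\<close> makes the leading term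
  exactly coercive.\<close>

locale energy_problem = mild_problem +
 fixes m :: nat and \<nu> \<tau> :: complex and lam :: real and \<zeta> :: "real => nat => nat => dist" and z v :: "real => dist"
 assumes F_eq: "F = (%s w. wick m \<nu> \<tau> lam (\<zeta> s) (z s) (v s) w)" and m: "1 \<le> m" and nu: "0 < Re \<nu>"
  and p: "1 \<le> 2 / \<alpha>1 - 2" "(2 / \<alpha>1 - 2)\<^sup>2 < 4 * \<mu>\<^sup>2 * (1 + (2 / \<alpha>1 - 2))"
  and small: "\<alpha> \<le> 1 / (16 * real m)" "4 * \<alpha> < \<beta>"
  and top: "!!s. \<zeta> s (m + 1) m = dunit"
  and data: "!!t0 T. 0 < t0 ==> t0 \<le> T ==> \<exists>K\<ge>0. \<forall>t. t0 \<le> t --> t \<le> T -->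
   bb (- \<alpha>) (z t) K \<and> bb \<beta> (v t) K \<and> (\<forall>i\<le>m + 1. \<forall>j\<le>m. bb (- \<alpha>) (\<zeta> t i j) K)"
begin

definition approx :: "nat => real => dist => dist" where
 "approx N s w = wick m \<nu> \<tau> lam (%i j. low_pass chi rho N (\<zeta> s i j)) (low_pass chi rho N (z s)) (low_pass chi rho N (v s)) (low_pass chi rho N w)"

lemma Sol_bounds:
 assumes w: "Sol 0 b u w" and t: "0 < t0" "t0 \<le> b"
 obtains B where "!!t. t0 \<le> t ==> t \<le> b ==> bb \<beta> (w t) B" "!!t. t0 \<le> t ==> t \<le> b ==> bb (- \<alpha>) (F t (w t)) B"
  "!!k. continuous_on {t0..b} (%t. w t k)" "!!k. continuous_on {t0..b} (%t. F t (w t) k)"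
proof -
 obtain R where R: "0 < R" "curve 0 b R w" using Sol_pos_curve[OF w] by blast
 have ab: "(0::real) \<le> 0" "0 < b" using t by simp_all
 obtain L where L: "0 \<le> L" "!!s. 0 < s ==> s \<le> b ==> bb (- \<alpha>) (F s (w s)) (L * (s - 0) powr (- \<eta>))"
  "!!k. continuous_on {0<..b} (%s. F s (w s) k)"
  by (rule curve_forcing[OF R(2) ab R(1)]) (rule that)
 define B where "B = max (R * t0 powr (- \<gamma>)) (L * t0 powr (- \<eta>))"
 have mono: "s powr (- e) \<le> t0 powr (- e)" if "t0 \<le> s" "0 < e" for s e using that t by (intro powr_mono2') auto
 show ?thesis
 proof (rule that[of B])
  show "bb \<beta> (w s) B" if "t0 \<le> s" "s \<le> b" for s
  proof (rule bb_mono)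
   show "bb \<beta> (w s) (R * (s - 0) powr (- \<gamma>))" by (rule curve_bb[OF R(2)]) (use that t in auto)
   have "R * s powr (- \<gamma>) \<le> R * t0 powr (- \<gamma>)" using mono[OF that(1) exps(1)] R(1) by simp
   then show "R * (s - 0) powr (- \<gamma>) \<le> B" by (simp add: B_def)
  qed
  show "bb (- \<alpha>) (F s (w s)) B" if "t0 \<le> s" "s \<le> b" for s
  proof (rule bb_mono[OF L(2)])
   show "0 < s" "s \<le> b" using that t by auto
   have "L * s powr (- \<eta>) \<le> L * t0 powr (- \<eta>)" using mono[OF that(1) exps(3)] L(1) by (rule mult_left_mono)
   then show "L * (s - 0) powr (- \<eta>) \<le> B" by (simp add: B_def)
  qed
  show "continuous_on {t0..b} (%t. w t k)" for k
   using R(2) t unfolding curve_def by (auto intro: continuous_on_subset)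
  show "continuous_on {t0..b} (%t. F t (w t) k)" for k
   by (rule continuous_on_subset[OF L(3)]) (use t in auto)
 qed
qed

text \<open>Restarting at t0 > 0 removes the singularity at time 0. For fixed k the integrand is
  then continuous, and the Duhamel formula can be differentiated.\<close>

lemma Sol_ode:
 assumes w: "Sol 0 b u w" and t: "0 < t0" "t0 < t" "t < b"
 shows "((%t. w t k) has_vector_derivative symA \<mu> k * w t k + F t (w t) k) (at t)"
proof -
 let ?A = "symA \<mu> k"
 have t0b: "t0 \<le> b" "t0 < b" using t by auto
 obtain B where cG: "continuous_on {t0..b} (%t. F t (w t) k)" by (rule Sol_bounds[OF w t(1) t0b(1)]) (rule that)
 have S: "Sol t0 b (w t0) w" by (rule Sol_restart[OF _ t(1) t0b(2) w]) simp
 define H where "H s = exp (- (of_real s * ?A)) * F s (w s) k" for s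
 have cH: "continuous_on {t0..b} H" unfolding H_def by (intro continuous_intros cG)
 define I where "I s = integral {t0..s} H" for s
 have ws: "w s k = exp (of_real s * ?A) * (exp (- (of_real t0 * ?A)) * w t0 k + I s)" if "t0 < s" "s \<le> b" for s
 proof -
  have "w s k = Phi t0 (w t0) w s k" using S that unfolding Sol_def by metis
  also have "\<dots> = exp (of_real (s - t0) * ?A) * w t0 k + integral {t0..s} (%\<sigma>. exp (of_real (s - \<sigma>) * ?A) * F \<sigma> (w \<sigma>) k)"
   by (simp add: Phi_def duh_def Pt_def)
  also have "(%\<sigma>. exp (of_real (s - \<sigma>) * ?A) * F \<sigma> (w \<sigma>) k) = (%\<sigma>. exp (of_real s * ?A) * H \<sigma>)"
   by (rule ext) (simp add: H_def exp_add[symmetric] left_diff_distrib mult.assoc[symmetric])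
  also have "integral {t0..s} (%\<sigma>. exp (of_real s * ?A) * H \<sigma>) = exp (of_real s * ?A) * I s"
   unfolding I_def by (rule integral_mult_right)
  also have "exp (of_real (s - t0) * ?A) = exp (of_real s * ?A) * exp (- (of_real t0 * ?A))"
   by (simp add: exp_add[symmetric] left_diff_distrib)
  finally show ?thesis by (simp only: distrib_left mult.assoc)
 qed
 have "(I has_vector_derivative H t) (at t within {t0..b})"
  unfolding I_def by (rule integral_has_vector_derivative[OF cH]) (use t in auto)
 then have dI: "(I has_vector_derivative H t) (at t)" using t by (simp add: at_within_Icc_at)
 have "((%s. exp (of_real s * ?A) * (exp (- (of_real t0 * ?A)) * w t0 k + I s)) has_vector_derivative
  exp (of_real t * ?A) * (0 + H t) + ?A * exp (of_real t * ?A) * (exp (- (of_real t0 * ?A)) * w t0 k + I t)) (at t)"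
  by (intro has_vector_derivative_mult has_vector_derivative_exp_cmult has_vector_derivative_add has_vector_derivative_const dI)
 moreover have "exp (of_real t * ?A) * (0 + H t) + ?A * exp (of_real t * ?A) * (exp (- (of_real t0 * ?A)) * w t0 k + I t) = ?A * w t k + F t (w t) k"
 proof -
  have "exp (of_real t * ?A) * H t = F t (w t) k" by (simp add: H_def mult.assoc[symmetric] exp_add[symmetric])
  moreover have "?A * exp (of_real t * ?A) * (exp (- (of_real t0 * ?A)) * w t0 k + I t) = ?A * w t k"
   unfolding ws[OF t(2) less_imp_le[OF t(3)]] by (simp only: mult.assoc)
  ultimately show ?thesis by simp
 qed
 ultimately have D: "((%s. exp (of_real s * ?A) * (exp (- (of_real t0 * ?A)) * w t0 k + I s)) has_vector_derivative ?A * w t k + F t (w t) k) (at t)"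
  by simp
 show ?thesis
  by (rule has_vector_derivative_transform_within_open[OF D, of "{t0<..<b}"]) (use t ws in auto)
qed

text \<open>Both expressions converge to F t (w t) in C^(- 2 \<alpha>), uniformly on [t0, b]: the
  truncated data converge with the rate gained from lowering each exponent, and the nonlinearity is
  continuous. The product filter with \<open>principal\<close> carries the uniformity in time. The
  threshold 1 fixes a size that does not depend on the solution.\<close>

lemma commutator:
 assumes w: "Sol 0 b u w" and t: "0 < t0" "t0 \<le> b"
 shows "eventually (%N. \<forall>t\<in>{t0..b}. bb (- (2 * \<alpha>)) (%k. low_pass chi rho N (F t (w t)) k - approx N t (w t) k) 1) sequentially"
proof -
 let ?S = "{t0..b}" let ?F = "sequentially \<times>\<^sub>F principal ?S"
 obtain B where B: "!!t. t0 \<le> t ==> t \<le> b ==> bb \<beta> (w t) B" "!!t. t0 \<le> t ==> t \<le> b ==> bb (- \<alpha>) (F t (w t)) B"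
  by (rule Sol_bounds[OF w t]) (rule that)
 obtain K where K: "\<forall>t. t0 \<le> t --> t \<le> b --> bb (- \<alpha>) (z t) K \<and> bb \<beta> (v t) K \<and> (\<forall>i\<le>m + 1. \<forall>j\<le>m. bb (- \<alpha>) (\<zeta> t i j) K)"
  using data[OF t] by blast
 have a2: "- (2 * \<alpha>) < - \<alpha>" "\<beta> / 2 < \<beta>" "0 < 2 * \<alpha>" "2 * \<alpha> < \<beta> / 2" "- (2 * \<alpha>) < \<beta>" using al be small(2) by auto
 have nw: "null_along ?F (\<beta> / 2) (%i k. low_pass chi rho (fst i) (w (snd i)) k - w (snd i) k)"
  by (rule null_along_low_pass[OF _ a2(2), of _ _ B]) (use B in auto)
 have bw: "bdd_along ?F (\<beta> / 2) (%i. w (snd i))"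
  by (rule bdd_along_exponent[OF bdd_along_uniform[of _ \<beta> w B]]) (use B a2 in auto)
 have nz: "null_along ?F (- (2 * \<alpha>)) (%i k. low_pass chi rho (fst i) (\<zeta> (snd i) p q) k - \<zeta> (snd i) p q k)" if "p \<le> m + 1" "q \<le> m" for p q
  by (rule null_along_low_pass[OF _ a2(1), of _ _ K]) (use K that in auto)
 have bz: "bdd_along ?F (- (2 * \<alpha>)) (%i. \<zeta> (snd i) p q)" if "p \<le> m + 1" "q \<le> m" for p q
  by (rule bdd_along_exponent[OF bdd_along_uniform[of _ "- \<alpha>" "%t. \<zeta> t p q" K]]) (use K that a2 in auto)
 have nzz: "null_along ?F (- (2 * \<alpha>)) (%i k. low_pass chi rho (fst i) (z (snd i)) k - z (snd i) k)"
  by (rule null_along_low_pass[OF _ a2(1), of _ _ K]) (use K in auto)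
 have nv: "null_along ?F (- (2 * \<alpha>)) (%i k. low_pass chi rho (fst i) (v (snd i)) k - v (snd i) k)"
  by (rule null_along_low_pass[OF _ a2(5), of _ _ K]) (use K in auto)
 have n1: "null_along ?F (- (2 * \<alpha>)) (%i k. approx (fst i) (snd i) (w (snd i)) k - F (snd i) (w (snd i)) k)"
  unfolding approx_def F_eq by (rule null_along_wick[OF a2(3,4) nw bw nz bz nzz nv])
 have n2: "null_along ?F (- (2 * \<alpha>)) (%i k. low_pass chi rho (fst i) (F (snd i) (w (snd i))) k - F (snd i) (w (snd i)) k)"
  by (rule null_along_low_pass[OF _ a2(1), of _ "%t. F t (w t)" B]) (use B in auto)
 have "null_along ?F (- (2 * \<alpha>)) (%i k. low_pass chi rho (fst i) (F (snd i) (w (snd i))) k - approx (fst i) (snd i) (w (snd i)) k)"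
  using null_along_diff[OF n2 n1] by simp
 then obtain e where e: "(e \<longlongrightarrow> 0) ?F" "eventually (%i. bb (- (2 * \<alpha>)) (%k. low_pass chi rho (fst i) (F (snd i) (w (snd i))) k - approx (fst i) (snd i) (w (snd i)) k) (e i)) ?F"
  by (auto simp: null_along_def)
 have "eventually (%i. e i < 1) ?F" using e(1) by (rule order_tendstoD) simp
 then have "eventually (%i. bb (- (2 * \<alpha>)) (%k. low_pass chi rho (fst i) (F (snd i) (w (snd i))) k - approx (fst i) (snd i) (w (snd i)) k) 1) ?F"
  using e(2) by eventually_elim (rule bb_mono[OF _ less_imp_le])
 then obtain Pf Pg where P: "eventually Pf sequentially" "eventually Pg (principal ?S)"
  "!!x y. Pf x ==> Pg y ==> bb (- (2 * \<alpha>)) (%k. low_pass chi rho x (F y (w y)) k - approx x y (w y) k) 1"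
  unfolding eventually_prod_filter by auto
 show ?thesis using P(1) by (rule eventually_mono) (use P(2,3) in \<open>auto simp: eventually_principal\<close>)
qed

text \<open>M is chosen before b and w. The solution enters only through its size A at t0 and
  through how large the truncation index must be, and the latter disappears in the limit.\<close>

lemma a_priori:
 assumes t0: "0 < t0" and T: "0 < T"
 shows "\<exists>M. \<forall>b w. t0 < b --> b \<le> T --> Sol 0 b u w --> bb \<beta> (w t0) A -->
   (\<forall>t. t0 \<le> t --> t \<le> b --> bb (- \<alpha>1) (w t) M)"
proof (cases "t0 \<le> T")
 case True
 define r where "r = 2 / \<alpha>1 - 2"
 have r: "1 \<le> r" "r\<^sup>2 < 4 * \<mu>\<^sup>2 * (1 + r)" using p by (auto simp: r_def)
 define q where "q = r + 2"
 have q': "q = 2 / \<alpha>1" by (simp add: q_def r_def)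
 have q: "2 < q" "1 < q" "q - 2 = r" "2 / q = \<alpha>1" using r(1) unfolding q_def by simp_all (use q' in \<open>simp add: q_def\<close>)
 obtain K where K: "0 \<le> K" "\<forall>t. t0 \<le> t --> t \<le> T --> bb (- \<alpha>) (z t) K \<and> bb \<beta> (v t) K \<and> (\<forall>i\<le>m + 1. \<forall>j\<le>m. bb (- \<alpha>) (\<zeta> t i j) K)"
  using data[OF t0 True] by blast
 \<comment> \<open>A common bound for all truncated data in regularity
   \<open>- 2 * \<alpha>\<close>; the entry 1 covers the commutator.\<close>
 define K0 where "K0 = max 1 (max (2 powr \<alpha> * (SchiC * K)) (2 powr (\<beta> + 2 * \<alpha>) * (SchiC * K)))"
 have K0: "0 \<le> K0" by (simp add: K0_def)
 have lpa: "bb (- (2 * \<alpha>)) (low_pass chi rho N g) K0" if "bb (- \<alpha>) g K" for N g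
 proof (rule bb_mono)
  show "bb (- (2 * \<alpha>)) (low_pass chi rho N g) (2 powr (- \<alpha> - - (2 * \<alpha>)) * (SchiC * K))"
   by (rule bb_le_exponent[OF bb_low_pass[OF that]]) (use al in simp)
 qed (simp add: K0_def)
 have lpb: "bb (- (2 * \<alpha>)) (low_pass chi rho N g) K0" if "bb \<beta> g K" for N g
 proof (rule bb_mono)
  show "bb (- (2 * \<alpha>)) (low_pass chi rho N g) (2 powr (\<beta> - - (2 * \<alpha>)) * (SchiC * K))"
   by (rule bb_le_exponent[OF bb_low_pass[OF that]]) (use al be in simp)
 qed (simp add: K0_def)
 have a: "0 \<le> 2 * \<alpha>" "2 * \<alpha> \<le> 1 / (8 * real m)" using al small(1) m by (auto simp: field_simps)
 obtain C where C: "0 \<le> C" "\<forall>f z y R \<zeta>. trig f --> trig z --> trig y --> trig R -->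
  (\<forall>i\<le>m + 1. \<forall>j\<le>m. trig (\<zeta> i j) \<and> bb (- (2 * \<alpha>)) (\<zeta> i j) K0) --> \<zeta> (m + 1) m = dunit -->
  bb (- (2 * \<alpha>)) z K0 --> bb (- (2 * \<alpha>)) y K0 --> bb (- (2 * \<alpha>)) R K0 -->
  Re (tmean (%x. of_real (cmod (ev f x) powr r) * cnj (ev f x) *
   (ev (%k. symA \<mu> k * f k) x + (ev (wick m \<nu> \<tau> lam \<zeta> z y f) x + ev R x)))) \<le> C"
  using energy_forcing[OF mu r m nu a K0, where \<tau> = \<tau> and lam = lam] by (elim exE conjE)
 obtain Cp where Cp: "0 \<le> Cp" "\<forall>f. trig f --> bb (- (2 / q)) f (Cp * (1 + tmean (%x. cmod (ev f x) powr q)))"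
  using bb_of_tmean_powr[OF q(2)] by (elim exE conjE)
 define Y0 where "Y0 = (A * geoC \<beta>) powr q + q * C * T"
 show ?thesis
 proof (intro exI[of _ "Cp * (1 + Y0)"] allI impI)
  fix b w t assume b: "t0 < b" "b \<le> T" and w: "Sol 0 b u w" and A: "bb \<beta> (w t0) A" and t: "t0 \<le> t" "t \<le> b"
  have t0b: "t0 \<le> b" using b by simp
  obtain B where cw: "!!k. continuous_on {t0..b} (%t. w t k)" and cG: "!!k. continuous_on {t0..b} (%t. F t (w t) k)"
   by (rule Sol_bounds[OF w t0 t0b]) (rule that)
  \<comment> \<open>The condition \<open>du\<close> holds for large N and keeps the leading
    coefficient equal to the unit after truncation, so the good term survives unchanged.\<close>
  have main: "bb (- \<alpha>1) (low_pass chi rho N (w t)) (Cp * (1 + Y0))"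
   if com: "\<forall>t\<in>{t0..b}. bb (- (2 * \<alpha>)) (%k. low_pass chi rho N (F t (w t)) k - approx N t (w t) k) 1"
    and du: "low_pass chi rho N dunit = dunit" for N
  proof -
   define h where "h t = low_pass chi rho N (w t)" for t
   define h' where "h' t = (%k. symA \<mu> k * h t k + low_pass chi rho N (F t (w t)) k)" for t
   have "tmean (%x. cmod (ev (h t) x) powr q) \<le> tmean (%x. cmod (ev (h t0) x) powr q) + q * C * (t - t0)"
   proof (rule tmean_powr_growth[OF q(1) trig_Schi[of N] _ _ _ _ _ _ t])
    show "h t k = 0" "h' t k = 0" if "k \<notin> {k. Schi N k \<noteq> 0}" for t k
     using that by (auto simp: h_def h'_def low_pass_eq)
    show "continuous_on {t0..b} (%t. h t k)" for k
     unfolding h_def low_pass_eq by (intro continuous_intros cw)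
    show "continuous_on {t0<..<b} (%t. h' t k)" for k
     unfolding h_def h'_def low_pass_eq
     by (intro continuous_intros continuous_on_subset[OF cw] continuous_on_subset[OF cG]) auto
    show "((%t. h t k) has_vector_derivative h' t k) (at t)" if "t0 < t" "t < b" for t k
    proof -
     have "((%t. Schi N k * w t k) has_vector_derivative Schi N k * (symA \<mu> k * w t k + F t (w t) k)) (at t)"
      by (intro has_vector_derivative_mult_right Sol_ode[OF w t0 that])
     then show ?thesis unfolding h_def h'_def low_pass_eq by (simp only: distrib_left mult.left_commute)
    qed
    fix s assume s: "t0 < s" "s < b"
    define R where "R = (%k. low_pass chi rho N (F s (w s)) k - approx N s (w s) k)"
    have dat: "bb (- \<alpha>) (z s) K" "bb \<beta> (v s) K" "!!i j. i \<le> m + 1 ==> j \<le> m ==> bb (- \<alpha>) (\<zeta> s i j) K"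
     using K(2)[rule_format, of s] s b by auto
    have tap: "trig (approx N s (w s))" unfolding approx_def by (intro trig_wick trig_low_pass)
    have tR: "trig R" unfolding R_def by (intro trig_diff trig_low_pass tap)
    have bR: "bb (- (2 * \<alpha>)) R K0"
     unfolding R_def by (rule bb_mono[OF com[rule_format]]) (use s in \<open>auto simp: K0_def\<close>)
    have tS: "trig (%k. symA \<mu> k * h s k)" unfolding h_def by (intro trig_mult2 trig_low_pass)
    have "h' s = (%k. symA \<mu> k * h s k + (approx N s (w s) k + R k))" by (simp add: h'_def R_def)
    then have eh: "ev (h' s) x = ev (%k. symA \<mu> k * h s k) x + (ev (approx N s (w s)) x + ev R x)" for x
     by (simp only: ev_add[OF tS trig_add[OF tap tR]] ev_add[OF tap tR])
    show "Re (tmean (%x. of_real (cmod (ev (h s) x) powr (q - 2)) * cnj (ev (h s) x) * ev (h' s) x)) \<le> C"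
     unfolding q(3) eh approx_def h_def[symmetric]
    proof (rule C(2)[rule_format])
     show "trig (h s)" "trig (low_pass chi rho N (z s))" "trig (low_pass chi rho N (v s))"
      unfolding h_def by (rule trig_low_pass)+
     show "low_pass chi rho N (\<zeta> s (m + 1) m) = dunit" by (simp only: top du)
     show "bb (- (2 * \<alpha>)) (low_pass chi rho N (z s)) K0" by (rule lpa[OF dat(1)])
     show "bb (- (2 * \<alpha>)) (low_pass chi rho N (v s)) K0" by (rule lpb[OF dat(2)])
     show "trig (low_pass chi rho N (\<zeta> s i j)) \<and> bb (- (2 * \<alpha>)) (low_pass chi rho N (\<zeta> s i j)) K0" if "i \<le> m + 1" "j \<le> m" for i j
      using lpa[OF dat(3)[OF that]] trig_low_pass by blast
    qed (rule tR bR)+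
   qed
   \<comment> \<open>The L^q norm at t0 is bounded independently of N by the C^\<beta> bound A,
     since the blocks of a C^\<beta> function are absolutely summable.\<close>
   also have "tmean (%x. cmod (ev (h t0) x) powr q) \<le> tmean (%x. (A * geoC \<beta>) powr q)"
   proof (rule tmean_mono)
    show "cmod (ev (h t0) x) powr q \<le> (A * geoC \<beta>) powr q" for x
     unfolding h_def low_pass_blocks using bb_sup_partial[OF be A] q by (intro powr_mono2) auto
   qed (use q in \<open>auto intro!: continuous_intros\<close>)
   also have "tmean (%x. (A * geoC \<beta>) powr q) + q * C * (t - t0) \<le> Y0"
   proof -
    have "q * C * (t - t0) \<le> q * C * T" using q C(1) t t0 b by (intro mult_left_mono) auto
    then show ?thesis by (simp add: Y0_def)
   qed
   finally have "Cp * (1 + tmean (%x. cmod (ev (h t) x) powr q)) \<le> Cp * (1 + Y0)" using Cp(1) by (intro mult_left_mono) auto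
   moreover have "bb (- \<alpha>1) (h t) (Cp * (1 + tmean (%x. cmod (ev (h t) x) powr q)))"
    using Cp(2)[rule_format, of "h t"] unfolding q(4) h_def using trig_low_pass by blast
   ultimately show ?thesis unfolding h_def using bb_mono by blast
  qed
  have "eventually (%N. bb (- \<alpha>1) (low_pass chi rho N (w t)) (Cp * (1 + Y0))) sequentially"
   using commutator[OF w t0 t0b] low_pass_trig[OF trig_dunit] by eventually_elim (rule main)
  moreover have "(%N. low_pass chi rho N (w t) k) \<longlonglongrightarrow> w t k" for k
  proof (rule tendsto_eventually)
   show "eventually (%N. low_pass chi rho N (w t) k = w t k) sequentially"
    using Schi_eventually_1[of k] by eventually_elim (simp add: low_pass_eq)
  qed
  ultimately show "bb (- \<alpha>1) (w t) (Cp * (1 + Y0))"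
   by (intro bb_limit[of sequentially "%N. low_pass chi rho N (w t)" "w t" "- \<alpha>1" "%_. Cp * (1 + Y0)"]) auto
 qed
qed auto

lemma global_unique_solution:
 assumes u: "bb (- \<alpha>1) u M0"
 obtains w where "!!T. 0 < T ==> Sol 0 T u w"
 by (rule global_solution[OF global_exists[OF u _ a_priori]]) (assumption | rule that)+

end

section \<open>Mild solutions\<close>

context littlewood_paley
begin

lemma sol_class_bound:
 assumes w: "sol_class chi rho \<beta> \<gamma> w" and T: "0 < T"
 obtains C where "0 \<le> C" "!!t. 0 < t ==> t \<le> T ==> bb \<beta> (w t) (C * t powr (- \<gamma>))"
proof -
 obtain C where C: "\<forall>t\<in>{0<..T}. t powr \<gamma> * besov_norm chi rho \<beta> (w t) \<le> C"
  using w T unfolding sol_class_def by blast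
 show ?thesis
 proof (rule that[of "max C 0"])
  fix t assume t: "0 < t" "t \<le> T"
  have "in_besov chi rho \<beta> (w t)" using w t unfolding sol_class_def by blast
  then have b: "bb \<beta> (w t) (besov_norm chi rho \<beta> (w t))" by (rule bb_besov_norm)
  have "t powr (- \<gamma>) * (t powr \<gamma> * besov_norm chi rho \<beta> (w t)) \<le> t powr (- \<gamma>) * max C 0"
   using C t by (intro mult_left_mono) (auto intro: max.coboundedI1)
  then have "besov_norm chi rho \<beta> (w t) \<le> max C 0 * t powr (- \<gamma>)"
   using t by (simp add: powr_add[symmetric] mult.assoc[symmetric] mult.commute)
  with b show "bb \<beta> (w t) (max C 0 * t powr (- \<gamma>))" by (rule bb_mono)
 qed simp
qed

lemma sol_class_null:
 assumes w: "sol_class chi rho \<beta> \<gamma> w" and t: "0 < t"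
 shows "null_along (at t within {0<..}) \<beta> (%s k. w s k - w t k)"
 by (rule besov_cont_null) (use w t in \<open>auto simp: sol_class_def\<close>)

lemma sol_class_coeff_continuous:
 assumes w: "sol_class chi rho \<beta> \<gamma> w"
 shows "continuous_on {0<..} (%t. w t k)"
 unfolding continuous_on_def
proof
 fix t :: real assume "t \<in> {0<..}"
 then have "((%s. w s k - w t k) \<longlongrightarrow> 0) (at t within {0<..})"
  by (intro null_along_coeff[OF sol_class_null[OF w]]) simp
 then show "((%s. w s k) \<longlongrightarrow> w t k) (at t within {0<..})" by (rule LIM_zero_cancel)
qed

lemma bdd_along_near:
 fixes a b t :: real
 assumes h: "!!s. a < s ==> s \<le> b ==> bb \<beta> (w s) (D s)" and D: "!!c. a < c ==> \<exists>B. \<forall>s. c \<le> s --> s \<le> b --> D s \<le> B" and t: "a < t"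
 shows "bdd_along (at t within {a<..b}) \<beta> w"
proof -
 define c where "c = (a + t) / 2"
 have c: "a < c" "c < t" using t by (auto simp: c_def)
 obtain B where B: "\<forall>s. c \<le> s --> s \<le> b --> D s \<le> B" using D[OF c(1)] by blast
 have "eventually (%s. c < s) (at t within {a<..b})" by (rule order_tendstoD(1)[OF tendsto_ident_at c(2)])
 moreover have "eventually (%s. s \<in> {a<..b}) (at t within {a<..b})" by (auto simp: eventually_at_filter)
 ultimately have "eventually (%s. bb \<beta> (w s) B) (at t within {a<..b})"
  by eventually_elim (rule bb_mono[OF h], use B in auto)
 then show ?thesis unfolding bdd_along_def by blast
qed

lemma null_along_increment:
 assumes bd: "bdd_along (at t within S) b w" "bb b (w t) C" and c: "!!k. continuous_on S (%s. w s k)" and t: "t \<in> S" and b: "b' < b"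
 shows "null_along (at t within S) b' (%s k. w s k - w t k)"
proof (rule null_along_of_coeff[OF _ _ b])
 show "((%s. w s k - w t k) \<longlongrightarrow> 0) (at t within S)" for k
  using c[of k] t unfolding continuous_on_def by (intro LIM_zero) auto
 have "bdd_along (at t within S) b (%s k. w s k + - w t k)"
  by (rule bdd_along_add[OF bd(1) bdd_along_const[OF bb_uminus[OF bd(2)]]])
 then show "bdd_along (at t within S) b (%s k. w s k - w t k)" by simp
qed

end

section \<open>From fixed points on intervals to mild solutions and back\<close>

context mild_problem
begin

text \<open>\<open>duh\<close> is a gauge integral, whereas \<open>mild_eq\<close> asks for Lebesgue
  integrability with respect to \<open>lborel\<close>. Absolute integrability together with Borel
  measurability bridges the two.\<close>

lemma Sol_imp_mild:
 assumes w: "!!T. 0 < T ==> Sol 0 T u w" shows "mild_eq \<mu> u F w"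
 unfolding mild_eq_def
proof (intro allI impI)
 fix t :: real and k assume t: "0 < t"
 let ?f = "%s. Pt \<mu> (t - s) (F s (w s)) k"
 obtain R where R: "0 < R" "curve 0 t R w" using Sol_pos_curve[OF w[OF t]] by blast
 obtain L where L: "0 \<le> L" "!!s. 0 < s ==> s \<le> t ==> bb (- \<alpha>) (F s (w s)) (L * (s - 0) powr (- \<eta>))"
  "!!k. continuous_on {0<..t} (%s. F s (w s) k)"
  by (rule curve_forcing[OF R(2) order_refl t R(1)]) (rule that)
 have ai: "?f absolutely_integrable_on {0..t}"
  by (rule Pt_abs_integrable[OF mu eta less_imp_le[OF t] L(3,2)])
 \<comment> \<open>Nothing is known about the integrand at time 0, so measurability is assembled
   from the half-open interval and the single point.\<close>
 have "(%s. indicator {0<..t} s *\<^sub>R ?f s) \<in> borel_measurable borel"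
  unfolding Pt_def by (intro borel_measurable_continuous_on_indicator continuous_intros L(3)) auto
 moreover have "(%s. indicator {0::real} s *\<^sub>R ?f 0) \<in> borel_measurable borel" by measurable
 ultimately have "(%s. indicator {0<..t} s *\<^sub>R ?f s + indicator {0::real} s *\<^sub>R ?f 0) \<in> borel_measurable borel"
  by (rule borel_measurable_add)
 moreover have "(%s. indicator {0<..t} s *\<^sub>R ?f s + indicator {0::real} s *\<^sub>R ?f 0) = (%s. indicator {0..t} s *\<^sub>R ?f s)"
  using t by (intro ext) (auto simp: indicator_def)
 ultimately have "(%s. indicator {0..t} s *\<^sub>R ?f s) \<in> borel_measurable lborel" by simp
 from integrable_completion[OF this] ai have si: "set_integrable lborel {0..t} ?f"
  unfolding set_integrable_def by blast
 have "w t k = Phi 0 u w t k" using w[OF t] t unfolding Sol_def by auto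
 then show "set_integrable lborel {0..t} ?f \<and> w t k = Pt \<mu> t u k + (LINT s:{0..t}|lborel. ?f s)"
  using si set_borel_integral_eq_integral(2)[OF si] by (simp add: Phi_def duh_def)
qed

lemma mild_imp_Sol:
 assumes w: "sol_class chi rho \<beta> \<gamma> w" and mild: "mild_eq \<mu> u F w" and T: "0 < T" shows "Sol 0 T u w"
proof -
 obtain C where C: "0 \<le> C" "!!t. 0 < t ==> t \<le> T ==> bb \<beta> (w t) (C * t powr (- \<gamma>))"
  by (rule sol_class_bound[OF w T]) (rule that)
 have "continuous_on {0<..T} (%t. w t k)" for k
  by (rule continuous_on_subset[OF sol_class_coeff_continuous[OF w]]) auto
 then have "curve 0 T C w" using C unfolding curve_def by simp
 moreover have "w t = Phi 0 u w t" if t: "0 < t" for t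
 proof
  fix k
  let ?f = "%s. Pt \<mu> (t - s) (F s (w s)) k"
  have "set_integrable lborel {0..t} ?f" "w t k = Pt \<mu> t u k + (LINT s:{0..t}|lborel. ?f s)"
   using mild t unfolding mild_eq_def by blast+
  then show "w t k = Phi 0 u w t k"
   using set_borel_integral_eq_integral(2) by (simp add: Phi_def duh_def)
 qed
 ultimately show ?thesis unfolding Sol_def by blast
qed

text \<open>Norm continuity is the nontrivial part: coefficientwise continuity is combined with a
  local bound in a space of higher regularity.\<close>

lemma Sol_imp_class:
 assumes w: "!!T. 0 < T ==> Sol 0 T u w" and u: "bb (- \<alpha>1) u M" shows "sol_class chi rho \<beta> \<gamma> w"
 unfolding sol_class_def
proof (intro conjI allI impI)
 have cv: "\<exists>R>0. curve 0 T R w" if "0 < T" for T by (rule Sol_pos_curve[OF w[OF that]])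
 show ib: "in_besov chi rho \<beta> (w t)" if "0 < t" for t
 proof -
  obtain R where "curve 0 t R w" using cv[OF \<open>0 < t\<close>] by blast
  from curve_bb[OF this \<open>0 < t\<close> order_refl] show ?thesis by (rule bb_imp_in_besov)
 qed
 show "\<exists>C. \<forall>t\<in>{0<..T}. t powr \<gamma> * besov_norm chi rho \<beta> (w t) \<le> C" if T: "0 < T" for T
 proof -
  obtain R where R: "curve 0 T R w" using cv[OF T] by blast
  have "t powr \<gamma> * besov_norm chi rho \<beta> (w t) \<le> R" if "t \<in> {0<..T}" for t
  proof -
   have t: "0 < t" "t \<le> T" using that by auto
   have "besov_norm chi rho \<beta> (w t) \<le> R * (t - 0) powr (- \<gamma>)" by (rule besov_norm_le[OF curve_bb[OF R t]])
   then have "t powr \<gamma> * besov_norm chi rho \<beta> (w t) \<le> t powr \<gamma> * (R * t powr (- \<gamma>))" by (intro mult_left_mono) auto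
   also have "\<dots> = R" using t by (simp add: mult.left_commute powr_add[symmetric])
   finally show ?thesis .
  qed
  then show ?thesis by blast
 qed
 \<comment> \<open>Strictly above \<beta>, while the smoothing exponents remain below \<gamma> + (1
   - \<gamma>) / 2 < 1 and hence integrable.\<close>
 define b where "b = \<beta> + (1 - \<gamma>)"
 have b: "\<beta> < b" "\<beta> \<le> b" "(\<alpha> + b) / 2 < 1" "(\<alpha>1 + b) / 2 < 1"
  using exps gam1 gam2 by (auto simp: b_def field_simps)
 show "besov_cont_on chi rho \<beta> {0<..} w"
  unfolding besov_cont_on_def
 proof
  fix t :: real assume "t \<in> {0<..}"
  then have t: "0 < t" by simp
  define T where "T = t + 1"
  have T: "0 < T" "t < T" using t by (auto simp: T_def)
  obtain C p q where C: "!!s. 0 < s ==> s \<le> T ==> bb b (w s) (C * (s powr p + s powr q))" "0 \<le> C"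
   by (rule Sol_higher_regularity[OF w[OF T(1)] T(1) u b(2-4)]) (rule that)
  have "bdd_along (at t within {0<..T}) b w"
  proof (rule bdd_along_near[OF C(1) _ t])
   fix c :: real assume c: "0 < c"
   have "continuous_on {c..T} (%s. C * (s powr p + s powr q))" using c by (intro continuous_intros) auto
   then have "bounded ((%s. C * (s powr p + s powr q)) ` {c..T})" by (intro compact_imp_bounded compact_continuous_image) auto
   then obtain B where "\<forall>y\<in>(%s. C * (s powr p + s powr q)) ` {c..T}. norm y \<le> B" unfolding bounded_iff by blast
   then have "\<forall>s. c \<le> s --> s \<le> T --> C * (s powr p + s powr q) \<le> B" by (auto dest!: abs_le_D1)
   then show "\<exists>B. \<forall>s. c \<le> s --> s \<le> T --> C * (s powr p + s powr q) \<le> B" by blast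
  qed
  moreover obtain R where "curve 0 T R w" using cv[OF T(1)] by blast
  ultimately have "null_along (at t within {0<..T}) \<beta> (%s k. w s k - w t k)"
   using t T by (intro null_along_increment[OF _ C(1) _ _ b(1)]) (auto simp: curve_def)
  moreover have "at t within {0<..T} = at t within {0<..}"
   by (rule at_within_nhd[of t "{..<T}"]) (use t T in auto)
  ultimately have "null_along (at t within {0<..}) \<beta> (%s k. w s k - w t k)" by simp
  then obtain e where e: "(e \<longlongrightarrow> 0) (at t within {0<..})" "eventually (%s. bb \<beta> (%k. w s k - w t k) (e s)) (at t within {0<..})"
   unfolding null_along_def by blast
  show "((%s. besov_norm chi rho \<beta> (%k. w s k - w t k)) \<longlongrightarrow> 0) (at t within {0<..})"
  proof (rule tendsto_sandwich[OF _ _ tendsto_const e(1)])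
   show "eventually (%s. 0 \<le> besov_norm chi rho \<beta> (%k. w s k - w t k)) (at t within {0<..})"
    using e(2) by eventually_elim (rule besov_norm_nonneg, rule bb_imp_in_besov)
   show "eventually (%s. besov_norm chi rho \<beta> (%k. w s k - w t k) \<le> e s) (at t within {0<..})"
    using e(2) by eventually_elim (rule besov_norm_le)
  qed
 qed
qed

end

section \<open>Verification of the abstract hypotheses for the Wick polynomial\<close>

context littlewood_paley
begin

definition drift :: "nat => complex => complex => real => (real => dist) => (nat => nat => real => dist) => (real => dist) => real => dist => dist" where
 "drift m \<nu> \<tau> lam Z Zij v s w = wick m \<nu> \<tau> lam (%i j. Zc Z Zij (m + 1 - i) (m - j) s) (Z s) (v s) w"

text \<open>The noise and v are singular at time 0, the curve at its own starting time. Since the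
  elapsed time \<sigma> is at most the true time s, every negative power of s is bounded by the same
  power of \<sigma>.\<close>

lemma drift_estimates:
 assumes Z: "in_L chi rho m Z Zij" and v: "sol_class chi rho \<beta> \<gamma> v"
  and a: "0 < \<alpha>" "\<alpha> < \<beta>" "\<alpha> < 1" and g: "0 < \<gamma>" "\<gamma> < 1" and T: "0 < T" and R: "0 < R"
 shows "\<exists>L\<ge>0. \<forall>\<sigma> s w w' \<epsilon>. 0 < \<sigma> --> \<sigma> \<le> s --> s \<le> T -->
   bb \<beta> w (R * \<sigma> powr (- \<gamma>)) --> bb \<beta> w' (R * \<sigma> powr (- \<gamma>)) --> bb \<beta> (%k. w k - w' k) (\<epsilon> * \<sigma> powr (- \<gamma>)) -->
   bb (- \<alpha>) (drift m \<nu> \<tau> lam Z Zij v s w) (L * \<sigma> powr (- (real (2 * m + 1) * \<gamma>))) \<and>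
   bb (- \<alpha>) (%k. drift m \<nu> \<tau> lam Z Zij v s w k - drift m \<nu> \<tau> lam Z Zij v s w' k) (L * \<epsilon> * \<sigma> powr (- (real (2 * m + 1) * \<gamma>)))"
proof -
 obtain Kz where Kz: "0 \<le> Kz" "\<forall>t. 0 < t --> t \<le> T --> bb (- \<alpha>) (Z t) Kz \<and>
  (\<forall>p\<le>m + 1. \<forall>q\<le>m. bb (- \<alpha>) (Zc Z Zij p q t) (Kz * t powr (- \<gamma> * (real p + real q))))"
  using Zc_bounds[OF Z a(1,3) g T] by (elim exE conjE)
 obtain Kv where Kv: "0 \<le> Kv" "!!t. 0 < t ==> t \<le> T ==> bb \<beta> (v t) (Kv * t powr (- \<gamma>))"
  by (rule sol_class_bound[OF v T]) (rule that)
 define K where "K = max Kz Kv"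
 have K: "0 \<le> K" "Kz \<le> K" "Kv \<le> K" using Kz by (auto simp: K_def)
 obtain L where L: "0 \<le> L" "\<forall>\<sigma> w w' \<epsilon> \<zeta> z y. 0 < \<sigma> --> \<sigma> \<le> T --> bb \<beta> w (R * \<sigma> powr (- \<gamma>)) --> bb \<beta> w' (R * \<sigma> powr (- \<gamma>)) -->
  bb \<beta> (%k. w k - w' k) (\<epsilon> * \<sigma> powr (- \<gamma>)) --> bb (- \<alpha>) z K --> bb \<beta> y (K * \<sigma> powr (- \<gamma>)) -->
  (\<forall>i\<le>m + 1. \<forall>j\<le>m. bb (- \<alpha>) (\<zeta> i j) (K * \<sigma> powr (- \<gamma> * (real (m + 1 - i) + real (m - j))))) -->
  bb (- \<alpha>) (wick m \<nu> \<tau> lam \<zeta> z y w) (L * \<sigma> powr (- real (2 * m + 1) * \<gamma>)) \<and>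
  bb (- \<alpha>) (%k. wick m \<nu> \<tau> lam \<zeta> z y w k - wick m \<nu> \<tau> lam \<zeta> z y w' k) (L * \<epsilon> * \<sigma> powr (- real (2 * m + 1) * \<gamma>))"
  using wick_estimates[OF a(1,2) g(1) R K(1) T, where m = m and \<nu> = \<nu> and \<tau> = \<tau> and lam = lam] by (elim exE conjE)
 have e: "- real (2 * m + 1) * \<gamma> = - (real (2 * m + 1) * \<gamma>)" by (rule mult_minus_left)
 show ?thesis
 proof (intro exI[of _ L] conjI[OF L(1)] allI impI)
  fix \<sigma> s w w' \<epsilon> assume s: "0 < \<sigma>" "\<sigma> \<le> s" "s \<le> T"
   and w: "bb \<beta> w (R * \<sigma> powr (- \<gamma>))" "bb \<beta> w' (R * \<sigma> powr (- \<gamma>))" "bb \<beta> (%k. w k - w' k) (\<epsilon> * \<sigma> powr (- \<gamma>))"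
  have s0: "0 < s" using s by linarith
  have le: "C * s powr (- x) \<le> K * \<sigma> powr (- x)" if "0 \<le> C" "C \<le> K" "0 \<le> x" for C x
   using that s by (intro mult_mono powr_mono2') auto
  show "bb (- \<alpha>) (drift m \<nu> \<tau> lam Z Zij v s w) (L * \<sigma> powr (- (real (2 * m + 1) * \<gamma>))) \<and>
   bb (- \<alpha>) (%k. drift m \<nu> \<tau> lam Z Zij v s w k - drift m \<nu> \<tau> lam Z Zij v s w' k) (L * \<epsilon> * \<sigma> powr (- (real (2 * m + 1) * \<gamma>)))"
   unfolding drift_def e[symmetric]
  proof (rule L(2)[rule_format, OF s(1) order_trans[OF s(2,3)] w])
   show "bb (- \<alpha>) (Z s) K" by (rule bb_mono[OF _ K(2)]) (use Kz(2) s0 s in blast)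
   show "bb \<beta> (v s) (K * \<sigma> powr (- \<gamma>))" by (rule bb_mono[OF Kv(2)[OF s0 s(3)] le[OF Kv(1) K(3)]]) (use g in simp)
   show "bb (- \<alpha>) (Zc Z Zij (m + 1 - i) (m - j) s) (K * \<sigma> powr (- \<gamma> * (real (m + 1 - i) + real (m - j))))" if "i \<le> m + 1" "j \<le> m" for i j
   proof (rule bb_mono)
    show "bb (- \<alpha>) (Zc Z Zij (m + 1 - i) (m - j) s) (Kz * s powr (- \<gamma> * (real (m + 1 - i) + real (m - j))))"
     using Kz(2) s0 s(3) by (meson diff_le_self)
    show "Kz * s powr (- \<gamma> * (real (m + 1 - i) + real (m - j))) \<le> K * \<sigma> powr (- \<gamma> * (real (m + 1 - i) + real (m - j)))"
     unfolding mult_minus_left by (rule le[OF Kz(1) K(2)]) (use g in simp)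
   qed
  qed
 qed
qed

text \<open>Coefficientwise continuity of the curve and its bound in C^\<beta> give norm continuity
  in C^(\<beta> / 2). As \<alpha> < \<beta> / 2, this suffices for the products with the
  noise.\<close>

lemma drift_continuous:
 assumes Z: "in_L chi rho m Z Zij" and v: "sol_class chi rho \<beta> \<gamma> v"
  and a: "0 < \<alpha>" "2 * \<alpha> < \<beta>" "\<alpha> < 1" and ab: "0 \<le> a"
  and g: "0 < \<gamma>" and w: "!!t. a < t ==> t \<le> b ==> bb \<beta> (w t) (R * (t - a) powr (- \<gamma>))"
  and c: "!!k. continuous_on {a<..b} (%t. w t k)"
 shows "continuous_on {a<..b} (%s. drift m \<nu> \<tau> lam Z Zij v s (w s) k)"
 unfolding continuous_on_def
proof
 fix t assume t: "t \<in> {a<..b}"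
 then have ta: "a < t" "t \<le> b" "0 < t" using ab by auto
 let ?F = "at t within {a<..b}"
 have sub: "?F \<le> at t within {0<..}" by (rule at_le) (use ab in auto)
 have b: "\<beta> / 2 < \<beta>" "\<alpha> < \<beta> / 2" "- \<alpha> \<le> \<beta>" "\<beta> / 2 \<le> \<beta>" using a by auto
 have g1: "\<gamma> \<ge> 0" using g by simp
 have bw: "bdd_along ?F \<beta> w"
 proof (rule bdd_along_near[OF w _ ta(1)])
  fix c assume "a < c"
  have "R * (s - a) powr (- \<gamma>) \<le> \<bar>R\<bar> * (c - a) powr (- \<gamma>)" if "c \<le> s" for s
   using that \<open>a < c\<close> g1 by (intro mult_mono powr_mono2') auto
  then show "\<exists>B. \<forall>s. c \<le> s --> s \<le> b --> R * (s - a) powr (- \<gamma>) \<le> B" by blast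
 qed
 have wt: "bb \<beta> (w t) (R * (t - a) powr (- \<gamma>))" by (rule w[OF ta(1,2)])
 have n1: "null_along ?F (\<beta> / 2) (%s k. w s k - w t k)"
  by (rule null_along_increment[OF bw wt c t b(1)])
 have b1: "bdd_along ?F (\<beta> / 2) (%_. w t)" by (rule bdd_along_exponent[OF bdd_along_const[OF wt] b(4)])
 have n2: "null_along ?F (- \<alpha>) (%s k. Zc Z Zij (m + 1 - p) (m - q) s k - Zc Z Zij (m + 1 - p) (m - q) t k)" for p q
  by (rule null_along_mono[OF Zc_cont(2)[OF Z a(1,3) ta(3)] sub]) auto
 have b2: "bdd_along ?F (- \<alpha>) (%_. Zc Z Zij (m + 1 - p) (m - q) t)" for p q
 proof -
  obtain Kz where Kz: "\<forall>s. 0 < s --> s \<le> t --> bb (- \<alpha>) (Z s) Kz \<and>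
   (\<forall>p\<le>m + 1. \<forall>q\<le>m. bb (- \<alpha>) (Zc Z Zij p q s) (Kz * s powr (- (1/2) * (real p + real q))))"
   using Zc_bounds[OF Z a(1,3), of "1/2" t] ta(3) by auto
  have "bb (- \<alpha>) (Zc Z Zij (m + 1 - p) (m - q) t) (Kz * t powr (- (1/2) * (real (m + 1 - p) + real (m - q))))"
   using Kz ta(3) by (meson diff_le_self order_refl)
  then show ?thesis by (rule bdd_along_const)
 qed
 have n3: "null_along ?F (- \<alpha>) (%s k. Z s k - Z t k)"
  by (rule null_along_mono[OF Zc_cont(1)[OF Z a(1,3) ta(3)] sub])
 have n4: "null_along ?F (- \<alpha>) (%s k. v s k - v t k)"
  by (rule null_along_exponent[OF null_along_mono[OF sol_class_null[OF v ta(3)] sub] b(3)])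
 have "null_along ?F (- \<alpha>) (%s k. drift m \<nu> \<tau> lam Z Zij v s (w s) k - drift m \<nu> \<tau> lam Z Zij v t (w t) k)"
  unfolding drift_def by (rule null_along_wick[OF a(1) b(2) n1 b1 n2 b2 n3 n4])
 then have "((%s. drift m \<nu> \<tau> lam Z Zij v s (w s) k - drift m \<nu> \<tau> lam Z Zij v t (w t) k) \<longlongrightarrow> 0) ?F"
  by (rule null_along_coeff)
 then show "((%s. drift m \<nu> \<tau> lam Z Zij v s (w s) k) \<longlongrightarrow> drift m \<nu> \<tau> lam Z Zij v t (w t) k) ?F" by (rule LIM_zero_cancel)
qed

lemma drift_data:
 assumes Z: "in_L chi rho m Z Zij" and v: "sol_class chi rho \<beta> \<gamma> v"
  and a: "0 < \<alpha>" "\<alpha> < 1" and g: "0 < \<gamma>" "\<gamma> < 1" and t: "0 < t0" "t0 \<le> T"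
 shows "\<exists>K\<ge>0. \<forall>t. t0 \<le> t --> t \<le> T --> bb (- \<alpha>) (Z t) K \<and> bb \<beta> (v t) K \<and>
  (\<forall>i\<le>m + 1. \<forall>j\<le>m. bb (- \<alpha>) (Zc Z Zij (m + 1 - i) (m - j) t) K)"
proof -
 have T: "0 < T" using t by linarith
 obtain Kz where Kz: "0 \<le> Kz" "\<forall>t. 0 < t --> t \<le> T --> bb (- \<alpha>) (Z t) Kz \<and>
  (\<forall>p\<le>m + 1. \<forall>q\<le>m. bb (- \<alpha>) (Zc Z Zij p q t) (Kz * t powr (- \<gamma> * (real p + real q))))"
  using Zc_bounds[OF Z a g T] by (elim exE conjE)
 obtain Kv where Kv: "0 \<le> Kv" "!!t. 0 < t ==> t \<le> T ==> bb \<beta> (v t) (Kv * t powr (- \<gamma>))"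
  by (rule sol_class_bound[OF v T]) (rule that)
 \<comment> \<open>A base of at most 1 makes powers with larger negative exponents larger, so the
   single value Q dominates all weights that occur.\<close>
 define \<sigma> where "\<sigma> = min t0 1"
 have \<sigma>: "0 < \<sigma>" "\<sigma> \<le> 1" "\<sigma> \<le> t0" using t by (auto simp: \<sigma>_def)
 define Q where "Q = \<sigma> powr (- (\<gamma> * real (2 * m + 1)))"
 have le: "t powr (- (\<gamma> * x)) \<le> Q" if "t0 \<le> t" "0 \<le> x" "x \<le> real (2 * m + 1)" for t x
 proof -
  have "t powr (- (\<gamma> * x)) \<le> \<sigma> powr (- (\<gamma> * x))" using that \<sigma> g by (intro powr_mono2') auto
  also have "\<dots> \<le> Q" unfolding Q_def using that \<sigma> g by (intro powr_mono') (auto intro: mult_left_mono)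
  finally show ?thesis .
 qed
 have Q: "1 \<le> Q" unfolding Q_def using powr_mono'[of "- (\<gamma> * real (2 * m + 1))" 0 \<sigma>] \<sigma> g by simp
 define K where "K = max Kz Kv * Q"
 show ?thesis
 proof (intro exI[of _ K] conjI allI impI)
  show "0 \<le> K" using Kz(1) Q by (simp add: K_def)
  fix s assume s: "t0 \<le> s" "s \<le> T"
  then have s0: "0 < s" using t by linarith
  have "Kz * 1 \<le> K" unfolding K_def using Kz(1) Q by (intro mult_mono) auto
  then show "bb (- \<alpha>) (Z s) K" using Kz(2) s0 s(2) by (auto intro: bb_mono)
  have "s powr (- (\<gamma> * 1)) \<le> Q" by (rule le[OF s(1)]) auto
  then have "Kv * s powr (- \<gamma>) \<le> K" unfolding K_def using Kv(1) Q by (intro mult_mono) auto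
  with Kv(2)[OF s0 s(2)] show "bb \<beta> (v s) K" by (rule bb_mono)
  fix i j assume ij: "i \<le> m + 1" "j \<le> m"
  have "s powr (- (\<gamma> * (real (m + 1 - i) + real (m - j)))) \<le> Q" by (rule le[OF s(1)]) auto
  then have "Kz * s powr (- \<gamma> * (real (m + 1 - i) + real (m - j))) \<le> K"
   unfolding K_def using Kz(1) Q by (intro mult_mono) auto
  moreover have "bb (- \<alpha>) (Zc Z Zij (m + 1 - i) (m - j) s) (Kz * s powr (- \<gamma> * (real (m + 1 - i) + real (m - j))))"
   using Kz(2) s0 s(2) by (meson diff_le_self)
  ultimately show "bb (- \<alpha>) (Zc Z Zij (m + 1 - i) (m - j) s) K" by (blast intro: bb_mono)
 qed
qed

end

text \<open>R = 2 \<mu> (\<mu> + sqrt (1 + \<mu>^2)) is the positive root of R^2 = 4 \<mu>^2 (1 +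
  R), and r^2 / (1 + r) is increasing for r \<ge> 0.\<close>

lemma subcritical_exponent:
 fixes \<mu> r :: real
 assumes mu: "0 < \<mu>" and r: "0 \<le> r" "r < 2 * (\<mu> * (\<mu> + sqrt (1 + \<mu>\<^sup>2)))"
 shows "r\<^sup>2 < 4 * \<mu>\<^sup>2 * (1 + r)"
proof -
 define S where "S = sqrt (1 + \<mu>\<^sup>2)"
 define \<kappa> where "\<kappa> = \<mu> * (\<mu> + S)"
 have S2: "S * S = 1 + \<mu> * \<mu>" unfolding S_def by (simp add: power2_eq_square[symmetric])
 have S0: "0 \<le> S" by (simp add: S_def)
 have k: "0 < \<kappa>" using mu S0 by (simp add: \<kappa>_def add_pos_nonneg)
 have kk: "\<kappa> * \<kappa> = \<mu> * \<mu> * (1 + 2 * \<kappa>)"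
 proof -
  have "\<kappa> * \<kappa> = \<mu> * \<mu> * (\<mu> * \<mu> + 2 * (\<mu> * S) + S * S)" by (simp add: \<kappa>_def algebra_simps)
  then show ?thesis unfolding S2 by (simp add: \<kappa>_def algebra_simps)
 qed
 define R where "R = 2 * \<kappa>"
 have R: "r < R" "0 < R" "R * R = 4 * (\<mu> * \<mu>) * (1 + R)" using r k kk by (auto simp: R_def \<kappa>_def S_def)
 have "r * r * (1 + R) < R * R * (1 + r)"
 proof -
  have "0 < (R - r) * (R + r)" "0 \<le> r * R * (R - r)" using R r by (auto intro: mult_pos_pos)
  then show ?thesis by (simp add: algebra_simps)
 qed
 also have "\<dots> = 4 * (\<mu> * \<mu>) * (1 + r) * (1 + R)" by (simp only: R(3) ac_simps)
 finally have "r * r < 4 * (\<mu> * \<mu>) * (1 + r)" using R(2) by (subst (asm) mult_less_cancel_right_pos) simp_all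
 then show ?thesis by (simp only: power2_eq_square)
qed

theorem mainTheorem11:
  fixes chi rho :: "real \<times> real \<Rightarrow> real"
    and m :: nat and \<nu> \<tau> :: complex
    and \<mu> \<alpha>0 \<beta> \<gamma> lam :: real
    and Z :: "real \<Rightarrow> dist" and Zij :: "nat \<Rightarrow> nat \<Rightarrow> real \<Rightarrow> dist"
    and u0 :: dist and v :: "real \<Rightarrow> dist"
  assumes partition: "dyadic_partition chi rho"
    and m: "1 \<le> m" and nu: "0 < Re \<nu>"
    and mu: "0 < \<mu>" "2 + 2 * \<mu> * (\<mu> + sqrt (1 + \<mu>\<^sup>2)) > 2 * real m + 1"
    and alpha0: "1 / (1 + \<mu> * (\<mu> + sqrt (1 + \<mu>\<^sup>2))) \<le> \<alpha>0" "\<alpha>0 \<le> 2 / (2 * real m + 1)"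
    and beta: "0 < \<beta>"
    and gamma: "(\<alpha>0 + \<beta>) / 2 < \<gamma>" "\<gamma> < 1 / (2 * real m + 1)"
    and lambda: "0 < lam"
    and Z: "in_L chi rho m Z Zij"
    and u0: "in_besov chi rho (- \<alpha>0) u0"
    and v_class: "sol_class chi rho \<beta> \<gamma> v"
    and v_mild: "mild_eq \<mu> u0 (\<lambda>s w. Psi chi rho m \<nu> \<tau> Z Zij s w) v"
  shows "\<forall>u1. in_besov chi rho (- \<alpha>0) u1 \<longrightarrow>
     (\<exists>vt. sol_class chi rho \<beta> \<gamma> vt \<and>
        mild_eq \<mu> u1 (\<lambda>s w k. complex_of_real lam * (v s k - w k) + Psi chi rho m \<nu> \<tau> Z Zij s w k) vt \<and>
        (\<forall>w. sol_class chi rho \<beta> \<gamma> w \<and>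
             mild_eq \<mu> u1 (\<lambda>s w' k. complex_of_real lam * (v s k - w' k) + Psi chi rho m \<nu> \<tau> Z Zij s w' k) w
             \<longrightarrow> (\<forall>t>0. w t = vt t)))"
proof (intro allI impI)
 fix u1 assume u1: "in_besov chi rho (- \<alpha>0) u1"
 obtain J where "littlewood_paley chi rho J" by (rule littlewood_paley_exists[OF partition])
 then interpret littlewood_paley chi rho J .
 define \<kappa> where "\<kappa> = \<mu> * (\<mu> + sqrt (1 + \<mu>\<^sup>2))"
 have k: "0 < \<kappa>" using mu by (simp add: \<kappa>_def add_pos_nonneg)
 have a0: "0 < \<alpha>0" using alpha0(1) k unfolding \<kappa>_def[symmetric] by (smt (verit) divide_pos_pos)
 \<comment> \<open>The condition on \<gamma> says \<alpha>0 < \<theta>: a datum of regularity above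
   - \<theta> evolves freely within the weight t powr (- \<gamma>).\<close>
 define \<theta> where "\<theta> = 2 * \<gamma> - \<beta>"
 have \<theta>: "\<alpha>0 < \<theta>" using gamma(1) by (simp add: \<theta>_def field_simps)
 have gm: "\<gamma> * (2 * real m + 1) < 1" using gamma(2) by (simp add: pos_less_divide_eq)
 have g0: "0 < \<gamma>" using \<theta> a0 beta by (simp add: \<theta>_def)
 have g3: "\<gamma> * 3 < 1"
 proof -
  have "\<gamma> * 3 \<le> \<gamma> * (2 * real m + 1)" using g0 m by (intro mult_left_mono) auto
  then show ?thesis using gm by linarith
 qed
 \<comment> \<open>The midpoint lies strictly above \<alpha>0, which forces r < 2 \<kappa> even in
   the borderline case, and strictly below \<theta>, so that the fixed point accepts data in C^(-
   \<alpha>1).\<close>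
 define \<alpha>1 where "\<alpha>1 = (\<alpha>0 + \<theta>) / 2"
 have a1: "\<alpha>0 < \<alpha>1" "\<alpha>1 < \<theta>" "0 < \<alpha>1" using \<theta> a0 by (auto simp: \<alpha>1_def)
 \<comment> \<open>From \<alpha>1 < \<theta> < 2 \<gamma> < 2/3 follows r \<ge> 1, the range in
   which the energy estimate is available.\<close>
 have a1': "\<alpha>1 * 3 < 2" using a1(2) g3 beta by (simp add: \<theta>_def)
 define r where "r = 2 / \<alpha>1 - 2"
 have r1: "1 \<le> r" using a1' a1(3) by (simp add: r_def field_simps)
 have "1 / (1 + \<kappa>) < \<alpha>1" using alpha0(1) a1(1) by (simp add: \<kappa>_def)
 then have "1 < \<alpha>1 * (1 + \<kappa>)" using k by (simp add: pos_divide_less_eq)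
 then have "r < 2 * \<kappa>" using a1(3) by (simp add: r_def field_simps)
 then have r2: "r\<^sup>2 < 4 * \<mu>\<^sup>2 * (1 + r)" using r1 unfolding \<kappa>_def by (intro subcritical_exponent mu) auto
 \<comment> \<open>The three entries serve the pairing estimate, the commutator and the smoothing
   from - \<alpha> to \<beta>, in this order.\<close>
 define \<alpha> where "\<alpha> = min (1 / (16 * real m)) (min (\<beta> / 8) (\<theta> / 2))"
 have al: "0 < \<alpha>" "\<alpha> \<le> 1 / (16 * real m)" "\<alpha> \<le> \<beta> / 8" "\<alpha> \<le> \<theta> / 2" using m beta \<theta> a0 by (auto simp: \<alpha>_def)
 have al1: "\<alpha> < 1"
 proof -
  have "1 / (16 * real m) < 1" using m by simp
  then show ?thesis using al(2) by linarith
 qed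
 have ab: "\<alpha> < \<beta>" "2 * \<alpha> < \<beta>" "4 * \<alpha> < \<beta>" using al(3) beta by auto
 have th0: "0 < \<theta>" using \<theta> a0 by simp
 define F where "F = drift m \<nu> \<tau> lam Z Zij v"
 \<comment> \<open>The time singularity of a polynomial of degree 2 m + 1 in quantities of size t
   powr (- \<gamma>); the upper bound on \<gamma> makes it integrable.\<close>
 define \<eta> where "\<eta> = real (2 * m + 1) * \<gamma>"
 have F_Psi: "F = (%s w k. complex_of_real lam * (v s k - w k) + Psi chi rho m \<nu> \<tau> Z Zij s w k)"
  unfolding F_def drift_def[abs_def] wick_Psi ..
 interpret energy_problem chi rho J \<mu> \<alpha> \<beta> \<alpha>1 \<gamma> \<eta> F m \<nu> \<tau> lam "%s i j. Zc Z Zij (m + 1 - i) (m - j) s" Z v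
 proof unfold_locales
  show "(\<alpha> + \<beta>) / 2 < \<gamma>" using al(4) th0 by (simp add: \<theta>_def field_simps)
  show "(\<alpha>1 + \<beta>) / 2 < \<gamma>" using a1(2) by (simp add: \<theta>_def field_simps)
  show "\<gamma> \<le> \<eta>" using g0 by (simp add: \<eta>_def)
  show "\<eta> < 1" using gm by (simp add: \<eta>_def mult.commute add.commute)
  show "1 \<le> 2 / \<alpha>1 - 2" "(2 / \<alpha>1 - 2)\<^sup>2 < 4 * \<mu>\<^sup>2 * (1 + (2 / \<alpha>1 - 2))" using r1 r2 unfolding r_def by simp_all
  show "F = (%s w. wick m \<nu> \<tau> lam (%i j. Zc Z Zij (m + 1 - i) (m - j) s) (Z s) (v s) w)"
   unfolding F_def drift_def[abs_def] ..
  show "Zc Z Zij (m + 1 - (m + 1)) (m - m) s = dunit" for s by (simp add: Zc_def)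
  show "\<exists>L\<ge>0. \<forall>\<sigma> s w w' \<epsilon>. 0 < \<sigma> --> \<sigma> \<le> s --> s \<le> T -->
   bb \<beta> w (R * \<sigma> powr (- \<gamma>)) --> bb \<beta> w' (R * \<sigma> powr (- \<gamma>)) --> bb \<beta> (%k. w k - w' k) (\<epsilon> * \<sigma> powr (- \<gamma>)) -->
   bb (- \<alpha>) (F s w) (L * \<sigma> powr (- \<eta>)) \<and> bb (- \<alpha>) (%k. F s w k - F s w' k) (L * \<epsilon> * \<sigma> powr (- \<eta>))" if "0 < T" "0 < R" for T R
   unfolding F_def \<eta>_def by (rule drift_estimates[OF Z v_class al(1) ab(1) al1 g0 _ that]) (use g3 g0 in linarith)
  show "continuous_on {a<..b} (%s. F s (w s) k)"
   if "0 \<le> a" "!!t. a < t ==> t \<le> b ==> bb \<beta> (w t) (R * (t - a) powr (- \<gamma>))" "!!k. continuous_on {a<..b} (%t. w t k)" for a b R w k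
   unfolding F_def by (rule drift_continuous[OF Z v_class al(1) ab(2) al1 that(1) g0 that(2,3)])
  show "\<exists>K\<ge>0. \<forall>t. t0 \<le> t --> t \<le> T --> bb (- \<alpha>) (Z t) K \<and> bb \<beta> (v t) K \<and>
   (\<forall>i\<le>m + 1. \<forall>j\<le>m. bb (- \<alpha>) (Zc Z Zij (m + 1 - i) (m - j) t) K)" if "0 < t0" "t0 \<le> T" for t0 T
   by (rule drift_data[OF Z v_class al(1) al1 g0 _ that]) (use g3 g0 in linarith)
 qed (use mu al beta a1 m nu ab in auto)
 obtain M0 where "bb (- \<alpha>0) u1 M0" using u1 unfolding in_besov_iff by blast
 \<comment> \<open>The datum is viewed in the slightly larger space in which the a priori bound is
   available.\<close>
 then have u: "bb (- \<alpha>1) u1 (2 powr (- \<alpha>0 - - \<alpha>1) * M0)" by (rule bb_le_exponent) (use a1 in simp)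
 obtain vt where vt: "!!T. 0 < T ==> Sol 0 T u1 vt" by (rule global_unique_solution[OF u]) (rule that)
 have uq: "w t = vt t" if w: "sol_class chi rho \<beta> \<gamma> w" "mild_eq \<mu> u1 F w" and t: "0 < t" for w t
  by (rule Sol_unique[OF order_refl mild_imp_Sol[OF w t] vt[OF t] t order_refl])
 have "sol_class chi rho \<beta> \<gamma> vt" "mild_eq \<mu> u1 F vt"
  by (rule Sol_imp_class[OF vt u], assumption) (rule Sol_imp_mild[OF vt])
 then have "\<exists>vt. sol_class chi rho \<beta> \<gamma> vt \<and> mild_eq \<mu> u1 F vt \<and>
   (\<forall>w. sol_class chi rho \<beta> \<gamma> w \<and> mild_eq \<mu> u1 F w --> (\<forall>t>0. w t = vt t))"
  using uq by blast
 then show "\<exists>vt. sol_class chi rho \<beta> \<gamma> vt \<and>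
    mild_eq \<mu> u1 (%s w k. complex_of_real lam * (v s k - w k) + Psi chi rho m \<nu> \<tau> Z Zij s w k) vt \<and>
    (\<forall>w. sol_class chi rho \<beta> \<gamma> w \<and>
      mild_eq \<mu> u1 (%s w' k. complex_of_real lam * (v s k - w' k) + Psi chi rho m \<nu> \<tau> Z Zij s w' k) w
      --> (\<forall>t>0. w t = vt t))"
  by (simp only: F_Psi)
qed

end
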